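(* Let $\Omega$, $\Sigma$, $D_0$, $\mathbb{C}^i$, $\mathbb{C}^e$, the vector field $\mathcal{U}$, $\Phi_t=\mathrm{Id}+t\,\mathcal{U}$ and $D_t=\Phi_t(D_0)$ be as in the context, and for $f,g\in H^{1/2}_{co}(\Sigma)$, $t\in[0,1]$, let $F(t,f,g)=\int_\Omega\mathbb{C}^{D_t}\nabla u_t\cdot\nabla v_t=\langle\Lambda_{D_t}^\Sigma f,g\rangle$, where $u_t,v_t\in H^1(\Omega)$ solve $\mathrm{div}(\mathbb{C}^{D_t}\nabla u_t)=0$, $\mathrm{div}(\mathbb{C}^{D_t}\nabla v_t)=0$ in $\Omega$ with $u_t=f$, $v_t=g$ on $\partial\Omega$. For every $t_0\in[0,1]$ the derivative of $t\mapsto F(t,f,g)$ at $t_0$ exists and $$F'(t_0,f,g)=\int_\Omega\Big\{\big(\mathbb{C}^{D_{t_0}}\nabla u_{t_0}\big)\Big[\mathrm{div}\big(\mathcal{U}\circ\Phi_{t_0}^{-1}\big)I_3-\big(D(\mathcal{U}\circ\Phi_{t_0}^{-1})\big)^T\Big]-\mathbb{C}^{D_{t_0}}\big(\nabla u_{t_0}\,D(\mathcal{U}\circ\Phi_{t_0}^{-1})\big)\Big\}\cdot\nabla v_{t_0}.$$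
   Context: Constants $r_0>0$, $M_0\ge1$, $M_1>1$, $\theta_0\in(0,\pi/2)$ are given. $\Omega\subset\mathbb{R}^3$ is a bounded domain with $\mathrm{diam}(\Omega)\le M_1r_0$; $\Sigma\subset\partial\Omega$ is open and has a point $P_\Sigma$ with $\mathrm{dist}(P_\Sigma,\partial\Omega\setminus\Sigma)\ge r_0$. Lipschitz regularity: a portion $S$ of the boundary of a bounded domain $U\subset\mathbb{R}^3$ is of Lipschitz class with constants $r_0,M_0$ if for every $P\in S$ there is a rigid change of coordinates in which $P=0$ and $U\cap R=\{x\in R: x_3>g(x_1,x_2)\}$, where $R=[-r_0,r_0]^2\times[-2M_0r_0,2M_0r_0]$, $g(0)=0$, $\|g\|_{L^\infty}+r_0\,\mathrm{Lip}(g)\le M_0r_0$ (analogously in the plane). A polyhedron is a closed set $D\subset\mathbb{R}^3$ homeomorphic to a closed ball with $\partial D$ a finite union of faces (closed simply connected plane polygonal regions) with pairwise disjoint relative interiors; edges are nondegenerate segments that are intersections of two faces, vertices are nonempty intersections of two edges. The class $\mathcal{P}$ consists of polyhedra $D\subset\Omega$ such that: $\mathrm{dist}(D,\partial\Omega)\ge r_0$; every dihedral angle at an edge and every internal angle of a face lies in $(\theta_0,\pi-\theta_0)\cup(\pi+\theta_0,2\pi-\theta_0)$; every edge has length $\ge r_0$; $\Omega\setminus D$ has Lipschitz boundary with constants $r_0,M_0$, and each face has Lipschitz boundary with constants $r_0,M_0$ in its plane. Elasticity: $\mathbb{C}^sA=2\mu^s\widehat A+\lambda^s(\mathrm{tr}A)I_3$,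 $\widehat A=\frac12(A+A^T)$, $\mu^s\ge\alpha_0>0$, $2\mu^s+3\lambda^s\ge\gamma_0>0$, $0\le\frac{\lambda^s}{2(\lambda^s+\mu^s)}<\frac12$, $s\in\{i,e\}$, and $(\lambda^i-\lambda^e)^2+(\mu^i-\mu^e)^2\ge\eta_0>0$. $\mathbb{C}^{D}=\mathbb{C}^i\chi_D+\mathbb{C}^e\chi_{\Omega\setminus D}$. Vector field: $D_0,D_1\in\mathcal{P}$ and $d_H=d_H(\partial D_0,\partial D_1)$ (Hausdorff distance) satisfies $d_H\le\delta r_0$ with $\delta$ a sufficiently small constant depending only on $M_0,M_1,\theta_0$, so that $D_0,D_1$ have the same number $N$ of vertices, suitably ordered. $\mathcal{U}\in W^{1,\infty}(\mathbb{R}^3,\mathbb{R}^3)$ is a fixed field such that $\mathcal{U}(V_i^{D_0})=V_i^{D_1}-V_i^{D_0}$ for all $i$; $\mathrm{supp}\,\mathcal{U}\subset\{\mathrm{dist}(x,D_0)\le r_0/4\}$; $\|\mathcal{U}\|_\infty+r_0\|D\mathcal{U}\|_\infty\le\widetilde Cd_H$ with $\widetilde C$ depending only on $\theta_0,M_1$; $d_H\le r_0/(3\widetilde C)$ (so $\|D\mathcal{U}\|_\infty\le\frac13$); each $\Phi_t=\mathrm{Id}+t\,\mathcal{U}$, $t\in[0,1]$, is an invertible bi-Lipschitz map of $\Omega$ onto itself with $\frac12\le\det D\Phi_t\le\frac32$; and $\Phi_1(D_0)=D_1$. Notation: $(\nabla u)_{ij}=\partial u_i/\partial x_j$, $D\mathcal{V}$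 is the Jacobian matrix of $\mathcal{V}$, juxtaposition of matrices is the matrix product, $A\cdot B=\sum_{ij}A_{ij}B_{ij}$. $H^{1/2}_{co}(\Sigma)=\{\varphi\in H^{1/2}(\partial\Omega;\mathbb{R}^3):\mathrm{supp}\,\varphi\subset\Sigma\}$. At $t_0=0,1$ derivatives are one-sided. *)

theory Defs
  imports "HOL-Analysis.Analysis" "HOL-Probability.Essential_Supremum"
begin

section \<open>Smooth functions, weak derivatives and Sobolev spaces\<close>

primrec C_k :: "nat \<Rightarrow> ('a::euclidean_space \<Rightarrow> 'b::real_normed_vector) \<Rightarrow> bool" where
  "C_k 0 f \<longleftrightarrow> continuous_on UNIV f"
| "C_k (Suc k) f \<longleftrightarrow> (\<forall>x. f differentiable (at x)) \<and>
     (\<forall>b\<in>Basis. C_k k (\<lambda>x. frechet_derivative f (at x) b))"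

definition smooth :: "('a::euclidean_space \<Rightarrow> 'b::real_normed_vector) \<Rightarrow> bool" where
  "smooth f \<longleftrightarrow> (\<forall>k. C_k k f)"

definition test_function :: "'a::euclidean_space set \<Rightarrow> ('a \<Rightarrow> 'b::real_normed_vector) \<Rightarrow> bool" where
  "test_function \<Omega> \<phi> \<longleftrightarrow> smooth \<phi> \<and> compact (closure {x. \<phi> x \<noteq> 0}) \<and> closure {x. \<phi> x \<noteq> 0} \<subseteq> \<Omega>"

definition is_weak_gradient ::
    "(real^3) set \<Rightarrow> (real^3 \<Rightarrow> real^3) \<Rightarrow> (real^3 \<Rightarrow> real^3^3) \<Rightarrow> bool" where
  "is_weak_gradient \<Omega> u G \<longleftrightarrow>
     (\<forall>K. compact K \<and> K \<subseteq> \<Omega> \<longrightarrow> integrable (lebesgue_on K) u \<and> integrable (lebesgue_on K) G) \<and>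
     (\<forall>\<phi> :: real^3 \<Rightarrow> real. test_function \<Omega> \<phi> \<longrightarrow>
        (\<forall>i j. (\<integral>x. u x $ i * frechet_derivative \<phi> (at x) (axis j 1) \<partial>lebesgue_on \<Omega>)
             = - (\<integral>x. G x $ i $ j * \<phi> x \<partial>lebesgue_on \<Omega>)))"

text \<open>A representative of the weak gradient, with entry \<open>i j\<close> equal to the \<open>j\<close>-th partial
  derivative of the \<open>i\<close>-th component; it is determined almost everywhere on an open \<open>\<Omega>\<close>
  whenever a weak gradient exists. It serves both as \<open>\<nabla>u\<close> for Sobolev functions and as the
  Jacobian matrix \<open>D\<V>\<close> of Lipschitz fields.\<close>

definition weak_gradient :: "(real^3) set \<Rightarrow> (real^3 \<Rightarrow> real^3) \<Rightarrow> real^3 \<Rightarrow> real^3^3" where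
  "weak_gradient \<Omega> u = (SOME G. is_weak_gradient \<Omega> u G)"

definition square_integrable :: "'a measure \<Rightarrow> ('a \<Rightarrow> 'b::euclidean_space) \<Rightarrow> bool" where
  "square_integrable M u \<longleftrightarrow> u \<in> borel_measurable M \<and> integrable M (\<lambda>x. (norm (u x))\<^sup>2)"

definition H1 :: "(real^3) set \<Rightarrow> (real^3 \<Rightarrow> real^3) set" where
  "H1 \<Omega> = {u. square_integrable (lebesgue_on \<Omega>) u \<and>
     (\<exists>G. is_weak_gradient \<Omega> u G \<and> square_integrable (lebesgue_on \<Omega>) G)}"

definition Linf_norm :: "(real^3) set \<Rightarrow> (real^3 \<Rightarrow> 'b::euclidean_space) \<Rightarrow> ennreal" where
  "Linf_norm \<Omega> f = esssup (lebesgue_on \<Omega>) (\<lambda>x. ennreal (norm (f x)))"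

definition W1inf :: "(real^3) set \<Rightarrow> (real^3 \<Rightarrow> real^3) set" where
  "W1inf \<Omega> = {U. U \<in> borel_measurable (lebesgue_on \<Omega>) \<and> Linf_norm \<Omega> U < \<infinity> \<and>
     (\<exists>G. is_weak_gradient \<Omega> U G \<and> G \<in> borel_measurable (lebesgue_on \<Omega>) \<and> Linf_norm \<Omega> G < \<infinity>)}"


section \<open>Surface measure, boundary values and $H^{1/2}$\<close>

text \<open>Two-dimensional Hausdorff measure. The covering sets are required to be bounded because
  \<^const>\<open>diameter\<close> is a real number, without meaning for unbounded sets.\<close>

definition hausdorff2_outer :: "(real^3) set \<Rightarrow> ennreal" where
  "hausdorff2_outer A = (SUP d\<in>{0<..}.
     INF C\<in>{C :: nat \<Rightarrow> (real^3) set. A \<subseteq> (\<Union>n. C n) \<and> (\<forall>n. bounded (C n) \<and> diameter (C n) \<le> d)}.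
       \<Sum>n. ennreal (pi / 4 * (diameter (C n))\<^sup>2))"

definition surface_measure :: "(real^3) set \<Rightarrow> (real^3) measure" where
  "surface_measure \<Omega> =
     restrict_space (measure_of UNIV (sets borel) hausdorff2_outer) (frontier \<Omega>)"

text \<open>Sobolev--Slobodeckij space with exponent \<open>1/2\<close> on a surface: the kernel is
  \<open>\<bar>x - y\<bar>\<close> to the power \<open>-(2 + 2 * (1/2))\<close>.\<close>

definition H_half :: "(real^3) set \<Rightarrow> (real^3 \<Rightarrow> real^3) set" where
  "H_half \<Omega> = {f. square_integrable (surface_measure \<Omega>) f \<and>
     (\<integral>\<^sup>+x. \<integral>\<^sup>+y. ennreal ((norm (f x - f y))\<^sup>2 / (dist x y)^3)
        \<partial>surface_measure \<Omega> \<partial>surface_measure \<Omega>) < \<infinity>}"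

definition boundary_support :: "(real^3) set \<Rightarrow> (real^3 \<Rightarrow> real^3) \<Rightarrow> (real^3) set" where
  "boundary_support \<Omega> f = {x \<in> frontier \<Omega>.
     \<forall>W. open W \<and> x \<in> W \<longrightarrow> \<not> (AE y in surface_measure \<Omega>. y \<in> W \<longrightarrow> f y = 0)}"

definition H_half_co :: "(real^3) set \<Rightarrow> (real^3) set \<Rightarrow> (real^3 \<Rightarrow> real^3) set" where
  "H_half_co \<Omega> \<Sigma> = {f \<in> H_half \<Omega>. boundary_support \<Omega> f \<subseteq> \<Sigma>}"

text \<open>Trace operator: the continuous extension, from $H^1(\Omega)$ to $L^2(\partial\Omega)$, of the
  restriction to the boundary of functions smooth up to the boundary.\<close>

definition has_trace :: "(real^3) set \<Rightarrow> (real^3 \<Rightarrow> real^3) \<Rightarrow> (real^3 \<Rightarrow> real^3) \<Rightarrow> bool" where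
  "has_trace \<Omega> u f \<longleftrightarrow> u \<in> H1 \<Omega> \<and> square_integrable (surface_measure \<Omega>) f \<and>
     (\<exists>\<phi> :: nat \<Rightarrow> real^3 \<Rightarrow> real^3. (\<forall>k. smooth (\<phi> k)) \<and>
        (\<lambda>k. \<integral>\<^sup>+x. ennreal ((norm (\<phi> k x - u x))\<^sup>2
               + (norm (jacobian (\<phi> k) (at x) - weak_gradient \<Omega> u x))\<^sup>2) \<partial>lebesgue_on \<Omega>)
          \<longlonglongrightarrow> 0 \<and>
        (\<lambda>k. \<integral>\<^sup>+x. ennreal ((norm (\<phi> k x - f x))\<^sup>2) \<partial>surface_measure \<Omega>) \<longlonglongrightarrow> 0)"


section \<open>Elasticity\<close>

definition elasticity_tensor :: "real \<Rightarrow> real \<Rightarrow> real^3^3 \<Rightarrow> real^3^3" where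
  "elasticity_tensor lam \<mu> A =
     (2 * \<mu>) *\<^sub>R ((1/2) *\<^sub>R (A + transpose A)) + (lam * trace A) *\<^sub>R mat 1"

definition lame_admissible :: "real \<Rightarrow> real \<Rightarrow> real \<Rightarrow> real \<Rightarrow> bool" where
  "lame_admissible \<alpha>\<^sub>0 \<gamma>\<^sub>0 lam \<mu> \<longleftrightarrow> \<mu> \<ge> \<alpha>\<^sub>0 \<and> 2 * \<mu> + 3 * lam \<ge> \<gamma>\<^sub>0 \<and>
     0 \<le> lam / (2 * (lam + \<mu>)) \<and> lam / (2 * (lam + \<mu>)) < 1/2"

definition inclusion_tensor ::
    "real \<Rightarrow> real \<Rightarrow> real \<Rightarrow> real \<Rightarrow> (real^3) set \<Rightarrow> real^3 \<Rightarrow> real^3^3 \<Rightarrow> real^3^3" where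
  "inclusion_tensor lam_i mu_i lam_e mu_e D x =
     (if x \<in> D then elasticity_tensor lam_i mu_i else elasticity_tensor lam_e mu_e)"

definition energy_form ::
    "(real^3) set \<Rightarrow> (real^3 \<Rightarrow> real^3^3 \<Rightarrow> real^3^3) \<Rightarrow> (real^3 \<Rightarrow> real^3) \<Rightarrow> (real^3 \<Rightarrow> real^3) \<Rightarrow> real"
  where
  "energy_form \<Omega> C u v =
     (\<integral>x. C x (weak_gradient \<Omega> u x) \<bullet> weak_gradient \<Omega> v x \<partial>lebesgue_on \<Omega>)"

definition dirichlet_solution ::
    "(real^3) set \<Rightarrow> (real^3 \<Rightarrow> real^3^3 \<Rightarrow> real^3^3) \<Rightarrow> (real^3 \<Rightarrow> real^3) \<Rightarrow> (real^3 \<Rightarrow> real^3) \<Rightarrow> bool"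
  where
  "dirichlet_solution \<Omega> C f u \<longleftrightarrow> u \<in> H1 \<Omega> \<and>
     (\<forall>\<phi> :: real^3 \<Rightarrow> real^3. test_function \<Omega> \<phi> \<longrightarrow>
        (\<integral>x. C x (weak_gradient \<Omega> u x) \<bullet> jacobian \<phi> (at x) \<partial>lebesgue_on \<Omega>) = 0) \<and>
     has_trace \<Omega> u f"

text \<open>The pairing \<open>\<langle>\<Lambda> f, g\<rangle>\<close> of the Dirichlet-to-Neumann map, in its weak form: any \<open>v\<close> in
  $H^1(\Omega)$ with trace \<open>g\<close> may be used. The local map on \<open>\<Sigma>\<close> is its restriction to data
  \<open>f\<close>, \<open>g\<close> in \<^term>\<open>H_half_co \<Omega> \<Sigma>\<close>.\<close>

definition DN_pairing ::
    "(real^3) set \<Rightarrow> (real^3 \<Rightarrow> real^3^3 \<Rightarrow> real^3^3) \<Rightarrow> (real^3 \<Rightarrow> real^3) \<Rightarrow> (real^3 \<Rightarrow> real^3) \<Rightarrow> real"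
  where
  "DN_pairing \<Omega> C f g =
     (THE r. \<forall>u v. dirichlet_solution \<Omega> C f u \<and> has_trace \<Omega> v g \<longrightarrow> r = energy_form \<Omega> C u v)"


section \<open>Lipschitz boundaries and polyhedra\<close>

text \<open>The rigid change of coordinates is \<open>x \<mapsto> P + T x\<close>, from local to original coordinates.\<close>

definition lipschitz_portion :: "(real^3) set \<Rightarrow> (real^3) set \<Rightarrow> real \<Rightarrow> real \<Rightarrow> bool" where
  "lipschitz_portion U S r\<^sub>0 M\<^sub>0 \<longleftrightarrow> (\<forall>P\<in>S. \<exists>T (g :: real \<times> real \<Rightarrow> real) m L.
     orthogonal_transformation T \<and> g (0, 0) = 0 \<and>
     (\<forall>s \<in> {-r\<^sub>0..r\<^sub>0} \<times> {-r\<^sub>0..r\<^sub>0}. \<bar>g s\<bar> \<le> m) \<and>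
     L-lipschitz_on ({-r\<^sub>0..r\<^sub>0} \<times> {-r\<^sub>0..r\<^sub>0}) g \<and> m + r\<^sub>0 * L \<le> M\<^sub>0 * r\<^sub>0 \<and>
     (\<forall>x :: real^3. \<bar>x $ 1\<bar> \<le> r\<^sub>0 \<and> \<bar>x $ 2\<bar> \<le> r\<^sub>0 \<and> \<bar>x $ 3\<bar> \<le> 2 * M\<^sub>0 * r\<^sub>0 \<longrightarrow>
        (P + T x \<in> U \<longleftrightarrow> g (x $ 1, x $ 2) < x $ 3)))"

definition lipschitz_boundary :: "(real^3) set \<Rightarrow> real \<Rightarrow> real \<Rightarrow> bool" where
  "lipschitz_boundary U r\<^sub>0 M\<^sub>0 \<longleftrightarrow> lipschitz_portion U (frontier U) r\<^sub>0 M\<^sub>0"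

text \<open>The planar analogue for a closed plane region \<open>F\<close>: the underlying domain is
  \<^term>\<open>rel_interior F\<close>, and \<open>p, q\<close> span the directions of the plane of \<open>F\<close>.\<close>

definition lipschitz_boundary_in_plane :: "(real^3) set \<Rightarrow> real \<Rightarrow> real \<Rightarrow> bool" where
  "lipschitz_boundary_in_plane F r\<^sub>0 M\<^sub>0 \<longleftrightarrow> (\<forall>P\<in>rel_frontier F. \<exists>p q (g :: real \<Rightarrow> real) m L.
     norm p = 1 \<and> norm q = 1 \<and> p \<bullet> q = 0 \<and> P + p \<in> affine hull F \<and> P + q \<in> affine hull F \<and>
     g 0 = 0 \<and> (\<forall>s \<in> {-r\<^sub>0..r\<^sub>0}. \<bar>g s\<bar> \<le> m) \<and>
     L-lipschitz_on {-r\<^sub>0..r\<^sub>0} g \<and> m + r\<^sub>0 * L \<le> M\<^sub>0 * r\<^sub>0 \<and>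
     (\<forall>s t. \<bar>s\<bar> \<le> r\<^sub>0 \<and> \<bar>t\<bar> \<le> 2 * M\<^sub>0 * r\<^sub>0 \<longrightarrow>
        (P + s *\<^sub>R p + t *\<^sub>R q \<in> rel_interior F \<longleftrightarrow> g s < t)))"

definition polygonal_region :: "(real^3) set \<Rightarrow> bool" where
  "polygonal_region F \<longleftrightarrow> compact F \<and> aff_dim F = 2 \<and> F = closure (rel_interior F) \<and>
     connected (rel_interior F) \<and> simply_connected F \<and>
     (\<exists>S. finite S \<and> rel_frontier F = (\<Union>(a, b)\<in>S. closed_segment a b))"

text \<open>Polyhedra need not be convex, in contrast to the library's \<^const>\<open>polyhedron\<close>; the
  decomposition \<open>\<F>\<close> of the boundary into faces is part of the data.\<close>

definition polyhedral_body :: "(real^3) set \<Rightarrow> (real^3) set set \<Rightarrow> bool" where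
  "polyhedral_body D \<F> \<longleftrightarrow> closed D \<and> D homeomorphic (cball 0 1 :: (real^3) set) \<and>
     finite \<F> \<and> (\<forall>F\<in>\<F>. polygonal_region F) \<and> frontier D = \<Union>\<F> \<and>
     (\<forall>F\<in>\<F>. \<forall>G\<in>\<F>. F \<noteq> G \<longrightarrow> rel_interior F \<inter> rel_interior G = {})"

definition poly_edges :: "(real^3) set set \<Rightarrow> (real^3) set set" where
  "poly_edges \<F> = {e. \<exists>F\<in>\<F>. \<exists>G\<in>\<F>. F \<noteq> G \<and> e = F \<inter> G \<and> (\<exists>a b. a \<noteq> b \<and> e = closed_segment a b)}"

definition poly_vertices :: "(real^3) set set \<Rightarrow> (real^3) set" where
  "poly_vertices \<F> = {v. \<exists>e\<in>poly_edges \<F>. \<exists>e'\<in>poly_edges \<F>. e \<noteq> e' \<and> e \<inter> e' = {v}}"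

text \<open>The dihedral angle is measured inside \<open>D\<close>: around each interior point of the edge, \<open>D\<close>
  is a wedge of opening \<open>\<omega>\<close> about the edge, with cross-section spanned by \<open>p, q\<close>.\<close>

definition has_dihedral_angle :: "(real^3) set \<Rightarrow> (real^3) set \<Rightarrow> real \<Rightarrow> bool" where
  "has_dihedral_angle D e \<omega> \<longleftrightarrow> 0 < \<omega> \<and> \<omega> < 2 * pi \<and> (\<exists>a b p q.
     a \<noteq> b \<and> e = closed_segment a b \<and> norm p = 1 \<and> norm q = 1 \<and> p \<bullet> q = 0 \<and>
     p \<bullet> (b - a) = 0 \<and> q \<bullet> (b - a) = 0 \<and>
     (\<forall>x\<in>open_segment a b. \<exists>\<rho>>0. D \<inter> ball x \<rho> = ball x \<rho> \<inter>
        {x + (s * cos \<phi>) *\<^sub>R p + (s * sin \<phi>) *\<^sub>R q + z *\<^sub>R (b - a) | s \<phi> z.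
           0 \<le> s \<and> 0 \<le> \<phi> \<and> \<phi> \<le> \<omega>}))"

text \<open>Internal angles of a plane polygon, at its corners; the value \<open>\<pi>\<close> is excluded since the
  points where \<open>F\<close> is locally a half-disc are not corners.\<close>

definition has_internal_angle :: "(real^3) set \<Rightarrow> real^3 \<Rightarrow> real \<Rightarrow> bool" where
  "has_internal_angle F v \<omega> \<longleftrightarrow> 0 < \<omega> \<and> \<omega> < 2 * pi \<and> \<omega> \<noteq> pi \<and> (\<exists>p q.
     norm p = 1 \<and> norm q = 1 \<and> p \<bullet> q = 0 \<and>
     (\<exists>\<rho>>0. F \<inter> ball v \<rho> = ball v \<rho> \<inter>
        {v + (s * cos \<phi>) *\<^sub>R p + (s * sin \<phi>) *\<^sub>R q | s \<phi>. 0 \<le> s \<and> 0 \<le> \<phi> \<and> \<phi> \<le> \<omega>}))"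

definition admissible_angles :: "real \<Rightarrow> real set" where
  "admissible_angles \<theta>\<^sub>0 = {\<theta>\<^sub>0<..<pi - \<theta>\<^sub>0} \<union> {pi + \<theta>\<^sub>0<..<2 * pi - \<theta>\<^sub>0}"

definition class_P ::
    "(real^3) set \<Rightarrow> real \<Rightarrow> real \<Rightarrow> real \<Rightarrow> (real^3) set \<Rightarrow> (real^3) set set \<Rightarrow> bool" where
  "class_P \<Omega> r\<^sub>0 M\<^sub>0 \<theta>\<^sub>0 D \<F> \<longleftrightarrow> polyhedral_body D \<F> \<and> D \<subseteq> \<Omega> \<and> setdist D (frontier \<Omega>) \<ge> r\<^sub>0 \<and>
     (\<forall>e\<in>poly_edges \<F>. \<exists>\<omega>\<in>admissible_angles \<theta>\<^sub>0. has_dihedral_angle D e \<omega>) \<and>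
     (\<forall>F\<in>\<F>. \<forall>v \<omega>. has_internal_angle F v \<omega> \<longrightarrow> \<omega> \<in> admissible_angles \<theta>\<^sub>0) \<and>
     (\<forall>e\<in>poly_edges \<F>. diameter e \<ge> r\<^sub>0) \<and>
     lipschitz_boundary (\<Omega> - D) r\<^sub>0 M\<^sub>0 \<and>
     (\<forall>F\<in>\<F>. lipschitz_boundary_in_plane F r\<^sub>0 M\<^sub>0)"


section \<open>The domain and the deformation field\<close>

definition domain_setting :: "(real^3) set \<Rightarrow> (real^3) set \<Rightarrow> real \<Rightarrow> real \<Rightarrow> bool" where
  "domain_setting \<Omega> \<Sigma> r\<^sub>0 M\<^sub>1 \<longleftrightarrow> open \<Omega> \<and> connected \<Omega> \<and> \<Omega> \<noteq> {} \<and> bounded \<Omega> \<and>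
     diameter \<Omega> \<le> M\<^sub>1 * r\<^sub>0 \<and> openin (top_of_set (frontier \<Omega>)) \<Sigma> \<and>
     (\<exists>P\<in>\<Sigma>. \<forall>y\<in>frontier \<Omega> - \<Sigma>. r\<^sub>0 \<le> dist P y)"

text \<open>Hausdorff distance, for nonempty bounded sets.\<close>

definition hausdorff_dist :: "'a::metric_space set \<Rightarrow> 'a set \<Rightarrow> real" where
  "hausdorff_dist A B = max (SUP x\<in>A. infdist x B) (SUP y\<in>B. infdist y A)"

definition flow_map :: "(real^3 \<Rightarrow> real^3) \<Rightarrow> real \<Rightarrow> real^3 \<Rightarrow> real^3" where
  "flow_map U t x = x + t *\<^sub>R U x"

text \<open>\<open>V0\<close> and \<open>V1\<close> enumerate the \<open>N\<close> vertices of the two polyhedra in corresponding order. Since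
  \<open>U\<close> is evaluated at points, continuity selects the continuous representative of the
  $W^{1,\infty}$ class.\<close>

definition deformation_field ::
    "(real^3) set \<Rightarrow> real \<Rightarrow> real \<Rightarrow> (real^3) set \<Rightarrow> (real^3) set \<Rightarrow>
     nat \<Rightarrow> (nat \<Rightarrow> real^3) \<Rightarrow> (nat \<Rightarrow> real^3) \<Rightarrow> (real^3 \<Rightarrow> real^3) \<Rightarrow> bool" where
  "deformation_field \<Omega> r\<^sub>0 K D0 D1 N V0 V1 U \<longleftrightarrow>
     (let dH = hausdorff_dist (frontier D0) (frontier D1) in
      U \<in> W1inf UNIV \<and> continuous_on UNIV U \<and>
      (\<forall>i<N. U (V0 i) = V1 i - V0 i) \<and>
      closure {x. U x \<noteq> 0} \<subseteq> {x. infdist x D0 \<le> r\<^sub>0 / 4} \<and>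
      Linf_norm UNIV U + ennreal r\<^sub>0 * Linf_norm UNIV (weak_gradient UNIV U) \<le> ennreal (K * dH) \<and>
      dH \<le> r\<^sub>0 / (3 * K) \<and>
      (\<forall>t\<in>{0..1}. bij_betw (flow_map U t) \<Omega> \<Omega> \<and>
         (\<exists>L. L-lipschitz_on \<Omega> (flow_map U t) \<and> L-lipschitz_on \<Omega> (inv_into \<Omega> (flow_map U t))) \<and>
         (AE x in lebesgue_on \<Omega>. det (weak_gradient \<Omega> (flow_map U t) x) \<in> {1/2..3/2})) \<and>
      flow_map U 1 ` D0 = D1)"

end

theory Submission imports Defs
begin

text \<open>Put \<open>V = U \<circ> \<Phi>\<^sub>t\<inverse>\<close> and \<open>\<Psi> = id + s V\<close>. Pulling back by \<open>\<Psi>\<close>, the energy of \<open>u\<close> at time \<open>t + s\<close> becomes a quadratic form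
\<open>Q s\<close> in the gradient \<open>G s\<close> of \<open>u \<circ> \<Psi>\<close>, over the fixed inclusion at time \<open>t\<close>, with coefficients smooth in \<open>s\<close>. The
difference \<open>G s - G 0\<close> is a gradient with zero trace. Such gradients are handled by duality: they annihilate
every divergence-free \<open>L\<^sup>2\<close> field, which at the boundary is shown by pushing the function into the domain along a cone
of directions. Duality also gives Korn's inequality, so \<open>G s - G 0 = O(s)\<close>, and then by symmetry of \<open>Q\<close> the derivative only sees
the first-order coefficient of \<open>Q\<close>.\<close>

text \<open>The coefficient jumps across a moving surface, so it is never differentiated: the
  inclusion at time t + s is the image under \<Psi> of the one at time t, and pulling back freezes
  the tensor. Starting from time t and not from time 0 makes the Jacobian matrix of U o \<Phi>_t^-1
  appear by itself; |DU| <= 1/3 bounds it by (1/3)(3/2) = 1/2, which keeps 1 + s DV invertible. The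
  main obstacle is the boundary. A trace is known only as a limit of smooth functions in L^2 of the
  two-dimensional Hausdorff measure. That a vanishing trace permits extension by zero is therefore
  shown by comparing the volume of a thin layer along the boundary with the Hausdorff measure of the
  boundary, a covering argument that takes the place of the divergence theorem. Describing
  zero-trace gradients as an annihilator also lets the symmetry of mixed derivatives, and with it
  Korn's inequality, carry over to them by orthogonality alone. Maps that are merely Lipschitz are
  reached by mollifying the field.\<close>

abbreviation (input) "L1 \<equiv> integrable lborel"
abbreviation (input) "L2 \<equiv> square_integrable lborel"
abbreviation (input) "dd f x \<equiv> frechet_derivative f (at x)"
abbreviation (input) borel_fun ("_ Borel" [51] 50) where "f Borel \<equiv> f \<in> borel_measurable borel"
abbreviation (input) nn_lborel (binder "NN " 10) where "nn_lborel f \<equiv> integral\<^sup>N lborel f"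
notation (input) scaleR (infixr "*R" 75) and LIMSEQ (infix "---->" 60)

subsection \<open>Smooth functions and mollifiers\<close>

lemma C_k_SucI:
 assumes "\<And>x. (f has_derivative f' x) (at x)" "\<And>b. b \<in> Basis ==> C_k k (\<lambda>x. f' x b)"
 shows "C_k (Suc k) f"
proof -
 have "f' x = dd f x" for x
  using assms(1) frechet_derivative_at by blast
 then show ?thesis
  using assms by (auto simp: differentiable_def)
qed

lemma C_k_SucD:
 assumes "C_k (Suc k) f"
 shows "(f has_derivative dd f x) (at x)"
  "b \<in> Basis ==> C_k k (\<lambda>x. dd f x b)"
 using assms frechet_derivative_works by auto

lemma C_k_continuous: "C_k k f ==> continuous_on UNIV f"
 by (cases k) (auto intro!: continuous_at_imp_continuous_on differentiable_imp_continuous_within)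

lemma C_k_Suc_imp: "C_k (Suc k) f ==> C_k k f"
proof (induction k arbitrary: f)
 case 0
 then show ?case using C_k_continuous[of "Suc 0" f] by simp
next
 case (Suc k)
 show ?case
  by (rule C_k_SucI[where f' = "\<lambda>x. dd f x"])
    (use C_k_SucD[OF Suc.prems] Suc.IH in auto)
qed

lemma C_k_const: "C_k k (\<lambda>_. c)"
proof (induction k arbitrary: c)
 case (Suc k)
 show ?case
  by (rule C_k_SucI[where f' = "\<lambda>x y. 0"]) (auto intro: Suc)
qed simp

lemma C_k_add: "C_k k f ==> C_k k g ==> C_k k (\<lambda>x. f x + g x)"
proof (induction k arbitrary: f g)
 case 0
 then show ?case by (auto intro: continuous_on_add)
next
 case (Suc k)
 show ?case
  by (rule C_k_SucI[where f' = "\<lambda>x b. dd f x b + dd g x b"])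
    (use C_k_SucD[OF Suc.prems(1)] C_k_SucD[OF Suc.prems(2)] Suc.IH in \<open>auto intro!: has_derivative_add\<close>)
qed

lemma C_k_scaleR:
 fixes f :: "'a::euclidean_space => real" and g :: "'a => 'b::real_normed_vector"
 shows "C_k k f ==> C_k k g ==> C_k k (\<lambda>x. f x *R g x)"
proof (induction k arbitrary: f g)
 case 0
 then show ?case by (auto intro: continuous_on_scaleR)
next
 case (Suc k)
 show ?case
 proof (rule C_k_SucI[where f' = "\<lambda>x b. f x *R dd g x b + dd f x b *R g x"])
  show "((\<lambda>x. f x *R g x) has_derivative (\<lambda>b. f x *R dd g x b + dd f x b *R g x)) (at x)" for x
   using C_k_SucD(1)[OF Suc.prems(1)] C_k_SucD(1)[OF Suc.prems(2)] by (rule has_derivative_scaleR)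
  show "C_k k (\<lambda>x. f x *R dd g x b + dd f x b *R g x)" if "b \<in> Basis" for b
   using C_k_add[OF Suc.IH[OF C_k_Suc_imp[OF Suc.prems(1)] C_k_SucD(2)[OF Suc.prems(2) that]]
     Suc.IH[OF C_k_SucD(2)[OF Suc.prems(1) that] C_k_Suc_imp[OF Suc.prems(2)]]] .
 qed
qed

lemma C_k_bounded_linear: "bounded_linear h ==> C_k k f ==> C_k k (\<lambda>x. h (f x))"
proof (induction k arbitrary: f)
 case 0
 then show ?case by (auto intro: bounded_linear.continuous_on)
next
 case (Suc k)
 show ?case
  by (rule C_k_SucI[where f' = "\<lambda>x b. h (dd f x b)"])
    (rule bounded_linear.has_derivative[OF Suc.prems(1) C_k_SucD(1)[OF Suc.prems(2)]]
     Suc.IH[OF Suc.prems(1) C_k_SucD(2)[OF Suc.prems(2)]], assumption?)+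
qed

lemma C_k_affine: "C_k k f ==> C_k k (\<lambda>x. f (a + c *R x))"
proof (induction k arbitrary: f)
 case 0
 then show ?case by (auto intro!: continuous_on_compose2[of UNIV f] continuous_intros)
next
 case (Suc k)
 show ?case
 proof (rule C_k_SucI[where f' = "\<lambda>x b. c *R dd f (a + c *R x) b"])
  fix x
  let ?D = "dd f (a + c *R x)"
  have "((\<lambda>x. f (a + c *R x)) has_derivative (\<lambda>b. ?D (c *R b))) (at x)"
   by (rule has_derivative_compose[where f="\<lambda>x. a + c *R x", OF _ C_k_SucD(1)[OF Suc.prems]])
     (auto intro!: derivative_eq_intros)
  moreover have "?D (c *R b) = c *R ?D b" for b
   using C_k_SucD(1)[OF Suc.prems] has_derivative_bounded_linear
   by (metis bounded_linear.linear linear_scale)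
  ultimately show "((\<lambda>x. f (a + c *R x)) has_derivative (\<lambda>b. c *R ?D b)) (at x)" by simp
 next
  show "C_k k (\<lambda>x. c *R dd f (a + c *R x) b)" if "b \<in> Basis" for b
   using Suc.IH[OF C_k_SucD(2)[OF Suc.prems that]]
   by (intro C_k_bounded_linear[of "(*\<^sub>R) c"] bounded_linear_scaleR_right)
 qed
qed

lemma C_k_inner:
 fixes f :: "real => 'b::real_normed_vector"
 shows "C_k k f ==> C_k k (\<lambda>x::'a::euclidean_space. f (x \<bullet> v))"
proof (induction k arbitrary: f)
 case 0
 then show ?case by (auto intro!: continuous_on_compose2[of UNIV f] continuous_intros)
next
 case (Suc k)
 show ?case
 proof (rule C_k_SucI[where f' = "\<lambda>x b. (b \<bullet> v) *R dd f (x \<bullet> v) 1"])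
  fix x
  let ?D = "dd f (x \<bullet> v)"
  have "((\<lambda>x. f (x \<bullet> v)) has_derivative (\<lambda>b. ?D (b \<bullet> v))) (at x)"
   by (rule has_derivative_compose[where f="\<lambda>x. x \<bullet> v", OF _ C_k_SucD(1)[OF Suc.prems]])
     (auto intro!: derivative_eq_intros)
  moreover have "?D (b \<bullet> v) = (b \<bullet> v) *R ?D 1" for b
   using C_k_SucD(1)[OF Suc.prems] has_derivative_bounded_linear
   by (metis bounded_linear.linear linear_scale mult.right_neutral real_scaleR_def)
  ultimately show "((\<lambda>x. f (x \<bullet> v)) has_derivative (\<lambda>b. (b \<bullet> v) *R ?D 1)) (at x)" by simp
 next
  show "C_k k (\<lambda>x. (b \<bullet> v) *R dd f (x \<bullet> v) 1)" for b :: 'a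
   using Suc.IH[OF C_k_SucD(2)[OF Suc.prems, of 1]]
   by (intro C_k_bounded_linear[of "(*\<^sub>R) (b \<bullet> v)"] bounded_linear_scaleR_right) auto
 qed
qed

lemma smooth_const: "smooth (\<lambda>_. c)"
 by (simp add: smooth_def C_k_const)

lemma smooth_add: "smooth f ==> smooth g ==> smooth (\<lambda>x. f x + g x)"
 and smooth_bounded_linear: "bounded_linear h ==> smooth f ==> smooth (\<lambda>x. h (f x))"
 and smooth_affine: "smooth f ==> smooth (\<lambda>x. f (a + c *R x))"
 and smooth_continuous: "smooth f ==> continuous_on UNIV f"
 by (auto simp: smooth_def intro: C_k_add C_k_bounded_linear C_k_affine C_k_continuous)

lemma smooth_scaleR: "smooth f ==> smooth g ==> smooth (\<lambda>x. f x *R g x)"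
 by (auto simp: smooth_def intro: C_k_scaleR)

lemma smooth_mult:
 fixes f g :: "'a::euclidean_space => real"
 shows "smooth f ==> smooth g ==> smooth (\<lambda>x. f x * g x)"
 using smooth_scaleR[of f g] by simp

lemma smooth_diff: "smooth f ==> smooth g ==> smooth (\<lambda>x. f x - g x)"
 using smooth_add[OF _ smooth_bounded_linear[OF bounded_linear_minus[OF bounded_linear_ident]], of f g] by simp

lemma smooth_prod:
 fixes f :: "'i => 'a::euclidean_space => real"
 assumes "finite I" "\<And>i. i \<in> I ==> smooth (f i)"
 shows "smooth (\<lambda>x. \<Prod>i\<in>I. f i x)"
 using assms by (induction I rule: finite_induct) (auto intro: smooth_const smooth_mult)

lemma smooth_has_derivative: "smooth f ==> (f has_derivative dd f x) (at x)"
 unfolding smooth_def using C_k_SucD(1) by blast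

lemma smooth_sum:
 assumes "finite I" "\<And>i. i \<in> I ==> smooth (f i)"
 shows "smooth (\<lambda>x. \<Sum>i\<in>I. f i x)"
 using assms by (induction I rule: finite_induct) (auto intro: smooth_const smooth_add)

lemma smooth_deriv: "smooth f ==> smooth (\<lambda>x. dd f x h)"
proof -
 assume f: "smooth f"
 have B: "smooth (\<lambda>x. dd f x b)" if "b \<in> Basis" for b
  using f that unfolding smooth_def using C_k_SucD(2) by blast
 have "dd f x h = (\<Sum>b\<in>Basis. (h \<bullet> b) *R dd f x b)" for x
 proof -
  have lin: "linear (dd f x)"
   using smooth_has_derivative[OF f] has_derivative_linear by blast
  have "dd f x h = dd f x (\<Sum>b\<in>Basis. (h \<bullet> b) *R b)"
   by (simp add: euclidean_representation)
  also have "\<dots> = (\<Sum>b\<in>Basis. (h \<bullet> b) *R dd f x b)"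
   using lin by (simp add: linear_sum linear_scale)
  finally show ?thesis .
 qed
 then show ?thesis
  using B by (auto intro!: smooth_sum smooth_scaleR smooth_const)
qed

text \<open>Smoothness of convolutions is proved through this: the derivative of
  \<open>conv \<eta> f\<close> in a basis direction is the convolution of f with a derivative of
  \<open>\<eta>\<close>, so these functions form a class closed under differentiation.\<close>

lemma smooth_coinduct:
 assumes "f \<in> S"
  and "\<And>f x. f \<in> S ==> f differentiable (at x)"
  and "\<And>f b. f \<in> S ==> b \<in> Basis ==> (\<lambda>x. dd f x b) \<in> S"
 shows "smooth f"
proof -
 have "C_k k f" if "f \<in> S" for k f
  using that
 proof (induction k arbitrary: f)
  case 0
  then show ?case
   using assms(2) by (auto intro!: continuous_at_imp_continuous_on differentiable_imp_continuous_within)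
 qed (use assms(2,3) in auto)
 then show ?thesis using assms(1) by (simp add: smooth_def)
qed

text \<open>The derivatives of exp(-1/x) are combinations of the functions x^-m exp(-1/x). Taking
  this family as the object makes smoothness an induction that is uniform in \<open>m\<close>, as
  differentiation stays in the family.\<close>

definition flat_exp :: "nat => real => real" where
 "flat_exp m x = (if x <= 0 then 0 else inverse x ^ m * exp (- inverse x))"

lemma flat_exp_tendsto: "(flat_exp m \<longlongrightarrow> 0) (at 0)"
proof -
 have "((\<lambda>y. y ^ m / exp y) \<longlongrightarrow> (0::real)) at_top"
  by (rule tendsto_power_div_exp_0)
 then have "((\<lambda>x::real. inverse x ^ m / exp (inverse x)) \<longlongrightarrow> 0) (at_right 0)"
  using filterlim_compose filterlim_inverse_at_top_right by blast
 then have "(flat_exp m \<longlongrightarrow> 0) (at_right 0)"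
  by (rule Lim_transform_eventually)
    (auto simp: flat_exp_def exp_minus eventually_at_filter field_simps)
 moreover have "(flat_exp m \<longlongrightarrow> 0) (at_left 0)"
  by (rule tendsto_eventually) (auto simp: flat_exp_def eventually_at_filter)
 ultimately show ?thesis by (simp add: filterlim_at_split)
qed

lemma flat_exp_deriv:
 "(flat_exp m has_real_derivative - real m * flat_exp (Suc m) x + flat_exp (m + 2) x) (at x)"
proof -
 consider "x < 0" | "x = 0" | "x > 0" by linarith
 then show ?thesis
 proof cases
  case 1
  have "((\<lambda>_. 0) has_real_derivative 0) (at x)" by simp
  then have "(flat_exp m has_real_derivative 0) (at x)"
   by (rule has_field_derivative_transform_within_open[of _ _ _ "{..<0}"])
     (use 1 in \<open>auto simp: flat_exp_def\<close>)
  then show ?thesis using 1 by (simp add: flat_exp_def)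
 next
  case 2
  \<comment> \<open>At 0 the difference quotient of \<open>flat_exp m\<close> is
    \<open>flat_exp (Suc m)\<close>, which tends to 0.\<close>
  have "((\<lambda>y. (flat_exp m y - flat_exp m 0) / (y - 0)) \<longlongrightarrow> 0) (at 0)"
   by (rule Lim_transform_eventually[OF flat_exp_tendsto[of "Suc m"]])
     (auto simp: flat_exp_def eventually_at_filter field_simps)
  then have "(flat_exp m has_real_derivative 0) (at 0)"
   by (simp add: has_field_derivative_iff)
  then show ?thesis using 2 by (simp add: flat_exp_def)
 next
  case 3
  have "((\<lambda>x. inverse x ^ m * exp (- inverse x)) has_real_derivative
    - real m * flat_exp (Suc m) x + flat_exp (m + 2) x) (at x)"
  proof (cases m)
   case 0
   then show ?thesis using 3
    by (auto intro!: derivative_eq_intros simp: flat_exp_def field_simps power2_eq_square)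
  next
   case (Suc k)
   then show ?thesis using 3
    by (auto intro!: derivative_eq_intros simp: flat_exp_def field_simps power2_eq_square)
      (metis Suc_pred neq0_conv power_Suc)
  qed
  then show ?thesis
   by (rule has_field_derivative_transform_within_open[of _ _ _ "{0<..}"])
     (use 3 in \<open>auto simp: flat_exp_def\<close>)
 qed
qed

lemma flat_exp_smooth: "smooth (flat_exp m)"
proof -
 have "C_k k (flat_exp m)" for k
 proof (induction k arbitrary: m)
  case 0
  then show ?case
   using flat_exp_deriv by (auto intro!: continuous_at_imp_continuous_on DERIV_isCont)
 next
  case (Suc k)
  show ?case
  proof (rule C_k_SucI)
   show "(flat_exp m has_derivative (\<lambda>b. b * (- real m * flat_exp (Suc m) x + flat_exp (m + 2) x))) (at x)" for x
    using flat_exp_deriv[of m x] by (simp add: has_field_derivative_def mult_commute_abs)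
   show "C_k k (\<lambda>x. b * (- real m * flat_exp (Suc m) x + flat_exp (m + 2) x))" for b
    using C_k_scaleR[OF C_k_const[of k b] C_k_add[OF C_k_scaleR[OF C_k_const[of k "- real m"] Suc.IH[of "Suc m"]] Suc.IH[of "m+2"]]]
    by simp
  qed
 qed
 then show ?thesis by (simp add: smooth_def)
qed

text \<open>A product of one-variable bumps, positive exactly on the open cube of half side 1. Each
  factor is a smooth function of one linear functional, so that no norm has to be
  differentiated.\<close>

definition bump :: "'a::euclidean_space => real" where
 "bump x = (\<Prod>b\<in>Basis. flat_exp 0 (1 + x \<bullet> b) * flat_exp 0 (1 - x \<bullet> b))"

lemma bump_smooth: "smooth (bump :: 'a::euclidean_space => real)"
proof -
 have 1: "smooth (\<lambda>x::real. flat_exp 0 (1 + x))" "smooth (\<lambda>x::real. flat_exp 0 (1 - x))"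
  using smooth_affine[OF flat_exp_smooth, of 0 1 1] smooth_affine[OF flat_exp_smooth, of 0 1 "-1"] by simp_all
 have "smooth (\<lambda>x::'a. flat_exp 0 (1 + x \<bullet> b) * flat_exp 0 (1 - x \<bullet> b))" for b
  using 1 by (intro smooth_mult) (auto simp: smooth_def intro: C_k_inner)
 then have "smooth (\<lambda>x::'a. \<Prod>b\<in>Basis. flat_exp 0 (1 + x \<bullet> b) * flat_exp 0 (1 - x \<bullet> b))"
  by (intro smooth_prod) auto
 then show ?thesis by (simp add: bump_def[abs_def])
qed

lemma bump_nonneg: "0 <= bump x"
 by (auto simp: bump_def flat_exp_def intro!: prod_nonneg)

lemma bump_nonzero_iff: "bump x \<noteq> 0 \<longleftrightarrow> (\<forall>b\<in>Basis. \<bar>x \<bullet> b\<bar> < 1)"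
proof -
 have "bump x \<noteq> 0 \<longleftrightarrow> (\<forall>b\<in>Basis. 0 < 1 + x \<bullet> b \<and> 0 < 1 - x \<bullet> b)"
  by (auto simp: bump_def flat_exp_def)
 also have "\<dots> \<longleftrightarrow> (\<forall>b\<in>Basis. \<bar>x \<bullet> b\<bar> < 1)"
  by (intro ball_cong refl) (auto simp: abs_if)
 finally show ?thesis .
qed

section \<open>Test functions\<close>

lemma test_functionI:
 assumes "smooth \<phi>" "compact K" "K \<subseteq> \<Omega>" "\<And>x. \<phi> x \<noteq> 0 ==> x \<in> K"
 shows "test_function \<Omega> \<phi>"
proof -
 have "closure {x. \<phi> x \<noteq> 0} \<subseteq> K"
  using assms by (intro closure_minimal compact_imp_closed) auto
 then show ?thesis
  using assms unfolding test_function_def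
  by (meson bounded_subset closed_closure compact_eq_bounded_closed dual_order.trans)
qed

lemma test_functionE:
 assumes "test_function \<Omega> \<phi>"
 obtains K where "compact K" "K \<subseteq> \<Omega>" "\<And>x. x \<notin> K ==> \<phi> x = 0"
  "\<And>x b. x \<notin> K ==> dd \<phi> x b = 0"
proof
 let ?K = "closure {x. \<phi> x \<noteq> 0}"
 show "compact ?K" "?K \<subseteq> \<Omega>" using assms by (auto simp: test_function_def)
 show 0: "\<phi> x = 0" if "x \<notin> ?K" for x
  using that closure_subset[of "{x. \<phi> x \<noteq> 0}"] by auto
 show "dd \<phi> x b = 0" if "x \<notin> ?K" for x b
 proof -
  have "(\<phi> has_derivative (\<lambda>_. 0)) (at x)"
  proof (rule has_derivative_transform_within_open[of "\<lambda>_. 0" _ _ _ "- ?K"])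
   show "open (- ?K)" by (simp add: open_Compl)
   show "x \<in> - ?K" using that by simp
   show "0 = \<phi> y" if "y \<in> - ?K" for y using 0[of y] that by simp
  qed (rule has_derivative_const)
  then show ?thesis using frechet_derivative_at by metis
 qed
qed

lemma test_supp: "test_function \<Omega> \<phi> ==> \<exists>K. compact K \<and> K \<subseteq> \<Omega> \<and> (\<forall>x. x \<notin> K --> \<phi> x = 0)"
 by (erule test_functionE) blast

lemma test_smooth: "test_function \<Omega> \<phi> ==> smooth \<phi>"
 by (simp add: test_function_def)

lemma test_mono: "test_function \<Omega> \<phi> ==> \<Omega> \<subseteq> \<Omega>' ==> test_function \<Omega>' \<phi>"
 by (auto simp: test_function_def)

lemma test_deriv:
 assumes "test_function \<Omega> \<phi>"
 shows "test_function \<Omega> (\<lambda>x. dd \<phi> x b)"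
proof -
 obtain K where K: "compact K" "K \<subseteq> \<Omega>" "\<And>x. x \<notin> K ==> \<phi> x = 0"
   "\<And>x b. x \<notin> K ==> dd \<phi> x b = 0"
  using test_functionE[OF assms(1)] by blast
 show ?thesis
  by (rule test_functionI[OF smooth_deriv[OF test_smooth[OF assms(1)]] K(1,2)])
    (use K(4) in auto)
qed

lemma test_mult:
 fixes \<phi> \<psi> :: "'a::euclidean_space => real"
 assumes "test_function \<Omega> \<phi>" "smooth \<psi>"
 shows "test_function \<Omega> (\<lambda>x. \<phi> x * \<psi> x)" "test_function \<Omega> (\<lambda>x. \<psi> x * \<phi> x)"
proof -
 obtain K where K: "compact K" "K \<subseteq> \<Omega>" "\<And>x. x \<notin> K ==> \<phi> x = 0"
  using test_functionE[OF assms(1)] by metis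
 show "test_function \<Omega> (\<lambda>x. \<phi> x * \<psi> x)"
  by (rule test_functionI[OF _ K(1,2)]) (use K(3) assms test_smooth in \<open>auto intro: smooth_mult\<close>)
 then show "test_function \<Omega> (\<lambda>x. \<psi> x * \<phi> x)" by (simp add: mult.commute)
qed

lemma test_diff:
 assumes "test_function \<Omega> \<phi>" "test_function \<Omega> \<psi>"
 shows "test_function \<Omega> (\<lambda>x. \<phi> x - \<psi> x)"
proof -
 obtain K L where K: "compact K" "K \<subseteq> \<Omega>" "\<And>x. x \<notin> K ==> \<phi> x = 0"
  and L: "compact L" "L \<subseteq> \<Omega>" "\<And>x. x \<notin> L ==> \<psi> x = 0"
  using test_functionE[OF assms(1)] test_functionE[OF assms(2)] by metis
 show ?thesis
 proof (rule test_functionI[of _ "K \<union> L"])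
  show "smooth (\<lambda>x. \<phi> x - \<psi> x)"
   using assms by (intro smooth_diff) (auto dest: test_smooth)
  show "x \<in> K \<union> L" if "\<phi> x - \<psi> x \<noteq> 0" for x
   using that K(3)[of x] L(3)[of x] by (cases "x \<in> K"; cases "x \<in> L") auto
 qed (use K L in auto)
qed

lemma test_shift:
 assumes "test_function UNIV \<phi>" "c \<noteq> 0"
 shows "test_function UNIV (\<lambda>x. \<phi> (a + c *R x))"
proof -
 obtain K where K: "compact K" "\<And>x. x \<notin> K ==> \<phi> x = 0"
  using test_functionE[OF assms(1)] by metis
 have "compact ((\<lambda>x. inverse c *R (x - a)) ` K)"
  by (intro compact_continuous_image continuous_intros K)
 moreover have "x \<in> (\<lambda>x. inverse c *R (x - a)) ` K" if "\<phi> (a + c *R x) \<noteq> 0" for x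
  using that K(2) assms(2) by (intro image_eqI[of _ _ "a + c *R x"]) auto
 ultimately show ?thesis
  using assms by (intro test_functionI[of _ "(\<lambda>x. inverse c *R (x - a)) ` K"] smooth_affine test_smooth[OF assms(1)]) auto
qed

lemma compact_support_bounded:
 fixes f :: "'a::euclidean_space => 'b::euclidean_space"
 assumes "continuous_on UNIV f" "compact K" "\<And>x. x \<notin> K ==> f x = 0"
 obtains B where "B > 0" "\<And>x. norm (f x) <= B"
proof -
 have "bounded (f ` K)"
  using assms by (intro compact_imp_bounded compact_continuous_image) (auto intro: continuous_on_subset)
 then obtain B where "B > 0" "\<And>x. x \<in> K ==> norm (f x) <= B"
  unfolding bounded_pos by auto
 then show ?thesis using that assms(3) by (metis less_eq_real_def norm_zero)
qed

lemma compact_support_integrable: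
 fixes f :: "'a::euclidean_space => 'b::euclidean_space"
 assumes "continuous_on UNIV f" "compact K" "\<And>x. x \<notin> K ==> f x = 0"
 shows "L1 f"
proof -
 have "L1 (\<lambda>x. indicator K x *R f x)"
  using assms by (intro borel_integrable_compact) (auto intro: continuous_on_subset)
 moreover have "(\<lambda>x. indicator K x *R f x) = f"
  using assms(3) by (auto simp: indicator_def)
 ultimately show ?thesis by simp
qed

lemma test_integrable:
 fixes \<phi> :: "'a::euclidean_space => 'b::euclidean_space"
 shows "test_function \<Omega> \<phi> ==> L1 \<phi>"
 by (metis test_functionE compact_support_integrable smooth_continuous test_smooth)

lemma test_bounded:
 fixes \<phi> :: "'a::euclidean_space => 'b::euclidean_space"
 assumes "test_function \<Omega> \<phi>"
 obtains B where "B > 0" "\<And>x. norm (\<phi> x) <= B"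
 by (metis assms test_functionE compact_support_bounded smooth_continuous test_smooth)

lemma smooth_measurable:
 fixes f :: "'a::euclidean_space => 'b::euclidean_space"
 shows "smooth f ==> f Borel"
 by (simp add: borel_measurable_continuous_onI smooth_continuous)

lemma test_lipschitz:
 fixes \<phi> :: "'a::euclidean_space => 'b::euclidean_space"
 assumes "test_function \<Omega> \<phi>"
 obtains B where "B > 0" "\<And>x y. norm (\<phi> x - \<phi> y) <= B * norm (x - y)"
  "\<And>x b. norm (dd \<phi> x b) <= B * norm b"
proof -
 have "\<exists>B>0. \<forall>x. norm (dd \<phi> x b) <= B" if "b \<in> Basis" for b
  using test_bounded[OF test_deriv[OF assms]] by metis
 then obtain C where C: "\<And>b. b \<in> Basis ==> C b > 0"
  "\<And>b x. b \<in> Basis ==> norm (dd \<phi> x b) <= C b"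
  by metis
 define B where "B = (\<Sum>b\<in>(Basis::'a set). C b)"
 have Bpos: "B > 0" unfolding B_def using C(1) by (intro sum_pos) auto
 have der: "(\<phi> has_derivative dd \<phi> x) (at x)" for x
  by (rule smooth_has_derivative[OF test_smooth[OF assms]])
 have bd: "norm (dd \<phi> x h) <= B * norm h" for x h
 proof -
  let ?D = "dd \<phi> x"
  have lin: "linear ?D" using der has_derivative_linear by blast
  have "?D h = ?D (\<Sum>b\<in>Basis. (h \<bullet> b) *R b)" by (simp add: euclidean_representation)
  also have "\<dots> = (\<Sum>b\<in>Basis. (h \<bullet> b) *R ?D b)"
   using lin by (simp add: linear_sum linear_scale)
  also have "norm \<dots> <= (\<Sum>b\<in>Basis. norm h * C b)"
   using C(2) Basis_le_norm[of _ h] by (intro sum_norm_le) (auto intro!: mult_mono)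
  finally show ?thesis by (simp add: B_def sum_distrib_left mult.commute)
 qed
 have "norm (\<phi> x - \<phi> y) <= B * norm (x - y)" for x y
  by (rule differentiable_bound[of UNIV \<phi> "\<lambda>x. dd \<phi> x" B x y])
    (auto simp: der intro!: onorm_bound bd order_less_imp_le[OF Bpos])
 then show ?thesis using that Bpos bd by blast
qed

text \<open>The centre \<open>a\<close> is free: convolution moves supports by vectors of the ball
  around \<open>a\<close>, and near the boundary an off-centre ball is used to move them into the
  domain.\<close>

definition mollifier :: "'a::euclidean_space => real => ('a => real) => bool" where
 "mollifier a r \<eta> \<longleftrightarrow> test_function UNIV \<eta> \<and> (\<forall>x. 0 <= \<eta> x) \<and> (\<forall>x. \<eta> x \<noteq> 0 --> x \<in> ball a r) \<and>
   integral\<^sup>L lborel \<eta> = 1"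

lemma mollifier_exists:
 fixes a :: "'a::euclidean_space"
 assumes "r > 0"
 shows "\<exists>\<eta>. mollifier a r \<eta>"
proof -
 \<comment> \<open>The cube of half side r / DIM lies in the ball of radius r, because a norm is at
   most the sum of the absolute coordinates.\<close>
 define c where "c = real DIM('a) / r"
 have c: "c > 0" using assms by (simp add: c_def)
 define f where "f = (\<lambda>x::'a. bump (- (c *R a) + c *R x))"
 have f_smooth: "smooth f" unfolding f_def by (rule smooth_affine[OF bump_smooth])
 have supp: "x \<in> ball a r" if "f x \<noteq> 0" for x
 proof -
  have "\<bar>(c *R (x - a)) \<bullet> b\<bar> < 1" if "b \<in> Basis" for b
   using \<open>f x \<noteq> 0\<close> that unfolding f_def bump_nonzero_iff by (auto simp: scaleR_diff_right)
  then have "norm (c *R (x - a)) < (\<Sum>b\<in>(Basis::'a set). 1)"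
   by (intro order_le_less_trans[OF norm_le_l1] sum_strict_mono) auto
  then have "c * norm (x - a) < c * r" using c assms by (simp add: c_def)
  then show ?thesis using c by (simp add: dist_norm norm_minus_commute)
 qed
 have test: "test_function UNIV f"
  by (rule test_functionI[OF f_smooth, of "cball a r"]) (use supp in \<open>auto dest: less_imp_le\<close>)
 have nn: "f x >= 0" for x by (simp add: f_def bump_nonneg)
 have int: "L1 f" by (rule test_integrable[OF test])
 have "integral\<^sup>L lborel f \<noteq> 0"
 proof
  assume "integral\<^sup>L lborel f = 0"
  then have ae: "AE x in lborel. f x = 0"
   using int nn integral_nonneg_eq_0_iff_AE[of lborel f] by simp
  have op: "open {x. f x \<noteq> 0}"
   using open_Collect_neq[OF smooth_continuous[OF f_smooth] continuous_on_const[of UNIV 0]] by simp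
  have "f a \<noteq> 0" by (simp add: f_def bump_nonzero_iff)
  then obtain e where e: "e > 0" "ball a e \<subseteq> {x. f x \<noteq> 0}"
   using op open_contains_ball by blast
  have "emeasure lborel {x. f x \<noteq> 0} = 0"
   using ae op by (subst (asm) AE_iff_measurable[OF _ refl]) (auto simp: borel_open)
  then have "emeasure lborel (ball a e) = 0"
   using emeasure_mono[OF e(2), of lborel] op by (simp add: borel_open)
  then have "measure lborel (ball a e) = 0" by (simp add: measure_def)
  then show False using content_ball_pos[OF e(1), of a] by simp
 qed
 moreover have "integral\<^sup>L lborel f >= 0" using nn by simp
 ultimately have pos: "integral\<^sup>L lborel f > 0" by simp
 have "mollifier a r (\<lambda>x. inverse (integral\<^sup>L lborel f) * f x)"
  unfolding mollifier_def
  using test_mult(2)[OF test smooth_const[of "inverse (integral\<^sup>L lborel f)"]] pos nn supp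
  by auto
 then show ?thesis by blast
qed

subsection \<open>Translation and convolution\<close>

lemma distr_lborel_isometric_affine:
 fixes a :: "'a::euclidean_space"
 assumes "\<bar>c\<bar> = 1"
 shows "distr lborel borel (\<lambda>x. a + c *R x) = lborel"
 using lborel_affine[of c a] assms by (auto simp: density_1)

lemma lborel_affine_subst:
 fixes a :: "'a::euclidean_space"
 assumes "\<bar>c\<bar> = 1"
 shows nn_integral_lborel_affine:
   "f Borel ==> (NN x. f (a + c *R x)) = (NN x. f x)"
  and integrable_lborel_affine:
   "g Borel ==> L1 (\<lambda>x. g (a + c *R x)) \<longleftrightarrow> L1 (g :: _ => 'b::{banach,second_countable_topology})"
  and integral_lborel_affine:
   "g Borel ==> (LBINT x. g (a + c *R x)) = (LBINT x. g x)"
proof -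
 have [measurable]: "(\<lambda>x. a + c *R x) \<in> measurable lborel borel" by simp
 note d = distr_lborel_isometric_affine[OF assms, of a]
 show "f Borel ==> (NN x. f (a + c *R x)) = (NN x. f x)"
  by (subst (2) d[symmetric], subst nn_integral_distr) auto
 show "g Borel ==> L1 (\<lambda>x. g (a + c *R x)) \<longleftrightarrow> L1 g"
  by (subst (2) d[symmetric], subst integrable_distr_eq) auto
 show "g Borel ==> (LBINT x. g (a + c *R x)) = (LBINT x. g x)"
  by (subst (2) d[symmetric], subst integral_distr) auto
qed

lemma ennreal_tendsto_0I:
 assumes "\<And>e::real. e > 0 ==> eventually (\<lambda>n. X n <= ennreal e) F"
 shows "(X \<longlongrightarrow> 0) F"
proof (rule order_tendstoI)
 fix a :: ennreal assume "0 < a"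
 obtain e where e: "e > 0" "ennreal e < a"
 proof (cases a)
  case (real r)
  then show ?thesis using that[of "r/2"] \<open>0 < a\<close> by (auto simp: ennreal_less_iff)
 next
  case top
  then show ?thesis using that[of 1] by simp
 qed
 then show "eventually (\<lambda>n. X n < a) F"
  using assms[OF e(1)] by (auto elim: eventually_mono)
qed simp

lemma ennreal_tendsto_0D:
 assumes "(X \<longlongrightarrow> 0) F" "e > 0"
 shows "eventually (\<lambda>n. X n <= ennreal e) F"
 using order_tendstoD(2)[OF assms(1), of "ennreal e"] assms(2) by (auto elim: eventually_mono)

text \<open>Regularity gives a compact K inside A and an open U around A. A translation shorter than
  the distance from K to the complement of U changes the indicator of A at x only if x or x - y lies
  in U - K, a set of measure at most e / 2.\<close>

lemma indicator_translation_L1: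
 fixes A :: "'a::euclidean_space set"
 assumes A: "A \<in> sets borel" "emeasure lborel A < \<infinity>" and e: "e > 0"
 shows "\<exists>d>0. \<forall>y. norm y < d --> (NN x. ennreal \<bar>indicator A (x - y) - indicator A x\<bar>) <= ennreal e"
proof -
 obtain U where U: "open U" "A \<subseteq> U" "emeasure lborel (U - A) < ennreal (e/4)"
  using outer_regular_lborel[OF A(1), of "e/4"] e by auto
 \<comment> \<open>Restricted to A, Lebesgue measure is finite, so inner regularity by compact sets
   applies.\<close>
 define M where "M = density lborel (indicator A :: 'a => ennreal)"
 have emM: "emeasure M B = emeasure lborel (A \<inter> B)" if "B \<in> sets borel" for B
  using A that by (simp add: M_def emeasure_restricted)
 have "emeasure M A = (SUP K \<in> {K. K \<subseteq> A \<and> compact K}. emeasure M K)"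
  by (rule inner_regular) (use A emM[of UNIV] in \<open>auto simp: M_def\<close>)
 then have SUP: "emeasure lborel A = (SUP K \<in> {K. K \<subseteq> A \<and> compact K}. emeasure M K)"
  using A by (simp add: emM)
 have "\<exists>K. K \<subseteq> A \<and> compact K \<and> emeasure lborel A <= emeasure lborel K + ennreal (e/4)"
 proof (cases "emeasure lborel A = 0")
  case True
  then show ?thesis by (intro exI[of _ "{}"]) auto
 next
  case False
  then have "emeasure lborel A - ennreal (e/4) < emeasure lborel A"
   using A(2) e by (intro ennreal_between) (auto simp: ennreal_zero_less_divide less_top zero_less_iff_neq_zero)
  then obtain K where K: "K \<subseteq> A" "compact K" "emeasure lborel A - ennreal (e/4) < emeasure M K"
   unfolding less_SUP_iff[of "emeasure lborel A - ennreal (e/4)", folded SUP] SUP less_SUP_iff by auto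
  moreover have "emeasure M K = emeasure lborel K"
   using K emM[of K] by (simp add: compact_imp_closed borel_closed Int_absorb1)
  ultimately show ?thesis
   by (intro exI[of _ K]) (auto simp: ennreal_minus_le_iff add.commute dest!: less_imp_le)
 qed
 then obtain K where K: "K \<subseteq> A" "compact K" "emeasure lborel A <= emeasure lborel K + ennreal (e/4)" by blast
 have Ks: "K \<in> sets borel" "U \<in> sets borel" using K U by (auto simp: compact_imp_closed borel_closed)
 have Kfin: "emeasure lborel K < \<infinity>" using K A emeasure_mono[OF K(1), of lborel] by (auto simp: le_less_trans)
 have "emeasure lborel (A - K) = emeasure lborel A - emeasure lborel K"
  using K A Ks Kfin by (intro emeasure_Diff) auto
 also have "\<dots> <= ennreal (e/4)"
  using K(3) A(2) by (auto simp: ennreal_minus_le_iff)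
 finally have AK: "emeasure lborel (A - K) <= ennreal (e/4)" .
 have "emeasure lborel (U - K) <= emeasure lborel ((U - A) \<union> (A - K))"
  using A Ks by (intro emeasure_mono) auto
 also have "\<dots> <= emeasure lborel (U - A) + emeasure lborel (A - K)"
  using A Ks by (intro emeasure_subadditive) auto
 also have "\<dots> <= ennreal (e/4) + ennreal (e/4)"
  using U(3) AK by (intro add_mono) auto
 also have "\<dots> = ennreal (e/2)" using e by (simp flip: ennreal_plus)
 finally have UK: "emeasure lborel (U - K) <= ennreal (e/2)" .
 obtain d where d: "d > 0" "\<And>x z. x \<in> K ==> z \<in> - U ==> d <= dist x z"
 proof -
  have "K \<inter> - U = {}" using K U by auto
  then show ?thesis using separate_compact_closed[of K "- U"] K(2) U(1) that by (auto simp: closed_Compl)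
 qed
 have "(NN x. ennreal \<bar>indicator A (x - y) - indicator A x\<bar>) <= ennreal e" if y: "norm y < d" for y
 proof -
  have *: "ennreal \<bar>indicator A (x - y) - indicator A x\<bar> <= indicator (U - K) (- y + 1 *R x) + indicator (U - K) x" for x
  proof -
   have "x - y \<in> U" if "x \<in> K" using d(2)[OF that, of "x - y"] y by (auto simp: dist_norm)
   moreover have "x \<in> U" if "x - y \<in> K" using d(2)[OF that, of x] y by (auto simp: dist_norm)
   ultimately show ?thesis
    using K(1) U(2) by (cases "x \<in> K"; cases "x - y \<in> K"; cases "x \<in> A"; cases "x - y \<in> A")
     (auto simp: indicator_def)
  qed
  have "(NN x. ennreal \<bar>indicator A (x - y) - indicator A x\<bar>)
    <= (NN x. indicator (U - K) (- y + 1 *R x) + indicator (U - K) x)"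
   by (intro nn_integral_mono *)
  also have "\<dots> = (NN x. indicator (U - K) (- y + 1 *R x)) + (NN x. indicator (U - K) x)"
   using Ks by (intro nn_integral_add) auto
  also have "\<dots> = emeasure lborel (U - K) + emeasure lborel (U - K)"
   using Ks by (subst nn_integral_lborel_affine) auto
  also have "\<dots> <= ennreal (e/2) + ennreal (e/2)" using UK by (intro add_mono)
  also have "\<dots> = ennreal e" using e by (simp flip: ennreal_plus)
  finally show ?thesis .
 qed
 then show ?thesis using d(1) by blast
qed

text \<open>Approximation by simple functions. Translation preserves the L1 distance, so the error
  of the approximation enters twice with the same size.\<close>

lemma translation_continuous_L1:
 fixes f :: "'a::euclidean_space => 'b::euclidean_space"
 assumes "L1 f" "e > 0"
 shows "\<exists>d>0. \<forall>y. norm y < d --> (NN x. ennreal (norm (f (x - y) - f x))) <= ennreal e"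
 using assms
proof (induction f arbitrary: e rule: integrable_induct)
 case (base A c)
 obtain d where d: "d > 0" "\<And>y. norm y < d ==>
   (NN x. ennreal \<bar>indicator A (x - y) - indicator A x\<bar>) <= ennreal (e / (norm c + 1))"
  using indicator_translation_L1[of A "e / (norm c + 1)"] base divide_pos_pos[OF base.prems, of "norm c + 1"]
  by (auto simp: add_nonneg_pos)
 have "(NN x. ennreal (norm (indicator A (x - y) *R c - indicator A x *R c))) <= ennreal e"
  if "norm y < d" for y
 proof -
  have [measurable]: "A \<in> sets borel" using base by simp
  have "(NN x. ennreal (norm (indicator A (x - y) *R c - indicator A x *R c)))
    = (NN x. ennreal (norm c) * ennreal \<bar>indicator A (x - y) - indicator A x\<bar>)"
   by (intro nn_integral_cong) (auto simp: indicator_def)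
  also have "\<dots> = ennreal (norm c) * (NN x. ennreal \<bar>indicator A (x - y) - indicator A x\<bar>)"
   by (intro nn_integral_cmult) measurable
  also have "\<dots> <= ennreal (norm c) * ennreal (e / (norm c + 1))"
   by (intro mult_left_mono d that) auto
  also have "\<dots> <= ennreal e"
  proof -
   have p: "0 < norm c + 1" by (simp add: add_nonneg_pos)
   then have "norm c * (e / (norm c + 1)) <= e"
    using base.prems by (simp add: pos_divide_le_eq algebra_simps)
   then show ?thesis
    using base.prems p by (subst ennreal_mult[symmetric]) (auto intro: ennreal_leI)
  qed
  finally show ?thesis .
 qed
 then show ?case using d(1) by blast
next
 case (add f g)
 obtain d1 where d1: "d1 > 0" "\<And>y. norm y < d1 ==> (NN x. ennreal (norm (f (x - y) - f x))) <= ennreal (e/2)"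
  using add.IH(1)[of "e/2"] add.prems by auto
 obtain d2 where d2: "d2 > 0" "\<And>y. norm y < d2 ==> (NN x. ennreal (norm (g (x - y) - g x))) <= ennreal (e/2)"
  using add.IH(2)[of "e/2"] add.prems by auto
 have [measurable]: "f Borel" "g Borel"
  using add.hyps borel_measurable_integrable by (auto simp flip: measurable_lborel1)
 have "(NN x. ennreal (norm (f (x - y) + g (x - y) - (f x + g x)))) <= ennreal e"
  if "norm y < min d1 d2" for y
 proof -
  have "(NN x. ennreal (norm (f (x - y) + g (x - y) - (f x + g x))))
   <= (NN x. ennreal (norm (f (x - y) - f x)) + ennreal (norm (g (x - y) - g x)))"
   by (intro nn_integral_mono) (auto simp flip: ennreal_plus intro!: ennreal_leI norm_diff_triangle_ineq)
  also have "\<dots> = (NN x. ennreal (norm (f (x - y) - f x))) + (NN x. ennreal (norm (g (x - y) - g x)))"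
   by (intro nn_integral_add) measurable
  also have "\<dots> <= ennreal (e/2) + ennreal (e/2)"
   using that by (intro add_mono d1 d2) auto
  also have "\<dots> = ennreal e" using add.prems by (simp flip: ennreal_plus)
  finally show ?thesis .
 qed
 then show ?case using d1(1) d2(1) by (intro exI[of _ "min d1 d2"]) auto
next
 case (lim f s)
 have [measurable]: "f Borel" "\<And>i. s i Borel"
  using lim.hyps borel_measurable_integrable by (auto simp flip: measurable_lborel1)
 have "(\<lambda>i. NN x. norm (f x - s i x)) ----> 0"
  by (rule nn_integral_dominated_convergence_norm[where w="\<lambda>x. 2 * norm (f x)"])
    (use lim.hyps in \<open>auto simp: integrable_iff_bounded nn_integral_cmult ennreal_mult ennreal_mult_less_top\<close>)
 then have "eventually (\<lambda>i. (NN x. norm (f x - s i x)) <= ennreal (e/3)) sequentially"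
  using lim.prems by (intro ennreal_tendsto_0D) auto
 then obtain i where i: "(NN x. norm (f x - s i x)) <= ennreal (e/3)"
  by (auto simp: eventually_sequentially)
 obtain d where d: "d > 0" "\<And>y. norm y < d ==> (NN x. ennreal (norm (s i (x - y) - s i x))) <= ennreal (e/3)"
  using lim.IH(1)[of "e/3" i] lim.prems by auto
 have "(NN x. ennreal (norm (f (x - y) - f x))) <= ennreal e" if "norm y < d" for y
 proof -
  have tr: "norm (f (x - y) - f x) <= norm (f (x - y) - s i (x - y)) + norm (s i (x - y) - s i x) + norm (f x - s i x)" for x
   by (smt (verit) norm_diff_triangle_ineq norm_minus_commute norm_triangle_ineq4 norm_triangle_sub diff_add_cancel norm_triangle_le_diff)
  have "(NN x. ennreal (norm (f (x - y) - f x)))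
   <= (NN x. ennreal (norm (f (-y + 1 *R x) - s i (- y + 1 *R x))) + ennreal (norm (s i (x - y) - s i x)) + ennreal (norm (f x - s i x)))"
   using tr by (intro nn_integral_mono) (auto simp flip: ennreal_plus intro!: ennreal_leI)
  also have "\<dots> = (NN x. ennreal (norm (f (-y + 1 *R x) - s i (-y + 1 *R x))))
    + (NN x. ennreal (norm (s i (x - y) - s i x))) + (NN x. ennreal (norm (f x - s i x)))"
   by (simp add: nn_integral_add)
  also have "\<dots> <= ennreal (e/3) + ennreal (e/3) + ennreal (e/3)"
   using i d(2)[OF that] nn_integral_lborel_affine[of 1 "\<lambda>x. ennreal (norm (f x - s i x))" "- y"]
   by (intro add_mono) auto
  also have "\<dots> = ennreal e" using lim.prems by (simp flip: ennreal_plus)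
  finally show ?thesis .
 qed
 then show ?case using d(1) by blast
qed

text \<open>Truncation at height n reduces this to the L1 case: for the truncated g the squared
  difference is at most \<open>C n\<close> times the difference itself, while f - g is small in L2
  by dominated convergence. The summand 1 in \<open>C n\<close> keeps it positive when it is divided
  by.\<close>

lemma translation_continuous_L2:
 fixes f :: "'a::euclidean_space => 'b::euclidean_space"
 assumes f: "L1 f" and f2: "L1 (\<lambda>x. (norm (f x))\<^sup>2)" and e: "e > 0"
 shows "\<exists>d>0. \<forall>y. norm y < d --> (NN x. ennreal ((norm (f (x - y) - f x))\<^sup>2)) <= ennreal e"
proof -
 have [measurable]: "f Borel"
  using f borel_measurable_integrable by (auto simp flip: measurable_lborel1)
 define C where "C n = 2 * real n + 1" for n
 have C: "C n > 0" for n by (simp add: C_def)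
 define g where "g n x = (if norm (f x) <= real n then f x else 0)" for n x
 have [measurable]: "g n Borel" for n unfolding g_def by measurable
 have "(\<lambda>n. LBINT x. (norm (f x - g n x))\<^sup>2) ----> (\<integral>x. 0 \<partial>(lborel :: 'a measure))"
 proof (rule integral_dominated_convergence[where w="\<lambda>x. (norm (f x))\<^sup>2"])
  show "AE x in lborel. (\<lambda>n. (norm (f x - g n x))\<^sup>2) ----> 0"
  proof (rule AE_I2)
   fix x
   obtain N where "norm (f x) <= real N" using real_arch_simple by blast
   then have "eventually (\<lambda>n. (norm (f x - g n x))\<^sup>2 = 0) sequentially"
    by (auto simp: eventually_sequentially g_def intro!: exI[of _ N])
   then show "(\<lambda>n. (norm (f x - g n x))\<^sup>2) ----> 0" by (rule tendsto_eventually)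
  qed
  show "AE x in lborel. norm ((norm (f x - g n x))\<^sup>2) <= (norm (f x))\<^sup>2" for n
   by (auto simp: g_def)
 qed (use f2 in auto)
 then have "eventually (\<lambda>n. (LBINT x. (norm (f x - g n x))\<^sup>2) < e/9) sequentially"
  using e by (intro order_tendstoD) auto
 then obtain n where n: "(LBINT x. (norm (f x - g n x))\<^sup>2) < e/9" by (auto simp: eventually_sequentially)
 have int2: "L1 (\<lambda>x. (norm (f x - g n x))\<^sup>2)"
  by (rule Bochner_Integration.integrable_bound[OF f2]) (auto simp: g_def)
 have n': "(NN x. ennreal ((norm (f x - g n x))\<^sup>2)) <= ennreal (e/9)"
  using n int2 by (subst nn_integral_eq_integral) (auto intro: ennreal_leI)
 have gint: "L1 (g n)"
  by (rule Bochner_Integration.integrable_bound[OF f]) (auto simp: g_def)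
 obtain d where d: "d > 0" "\<And>y. norm y < d ==> (NN x. ennreal (norm (g n (x - y) - g n x))) <= ennreal (e / (9 * C n))"
  using translation_continuous_L1[OF gint, of "e / (9 * C n)"] e C[of n] by auto
 have "(NN x. ennreal ((norm (f (x - y) - f x))\<^sup>2)) <= ennreal e" if "norm y < d" for y
 proof -
  have tr: "(norm (f (x - y) - f x))\<^sup>2 <= 3 * (norm (f (x - y) - g n (x - y)))\<^sup>2
    + 3 * (C n * norm (g n (x - y) - g n x)) + 3 * (norm (f x - g n x))\<^sup>2" for x
  proof -
   let ?a = "norm (f (x - y) - g n (x - y))" and ?b = "norm (g n (x - y) - g n x)" and ?c = "norm (f x - g n x)"
   have "f (x - y) - f x = (f (x - y) - g n (x - y)) + (g n (x - y) - g n x) - (f x - g n x)" by simp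
   then have "norm (f (x - y) - f x) <= ?a + ?b + ?c"
    by (metis (no_types, opaque_lifting) norm_triangle_ineq4 norm_triangle_ineq order_trans add_right_mono)
   then have "(norm (f (x - y) - f x))\<^sup>2 <= (?a + ?b + ?c)\<^sup>2" by (intro power_mono) auto
   also have "\<dots> <= 3 * ?a\<^sup>2 + 3 * ?b\<^sup>2 + 3 * ?c\<^sup>2"
    using sum_squares_bound[of ?a ?b] sum_squares_bound[of ?a ?c] sum_squares_bound[of ?b ?c]
    by (simp add: power2_eq_square algebra_simps)
   also have "?b\<^sup>2 <= C n * ?b"
   proof -
    have "norm (g n z) <= n" for z by (auto simp: g_def)
    then have "?b <= 2 * real n + 1"
     by (smt (verit) norm_triangle_ineq4)
    then show ?thesis by (auto simp: power2_eq_square C_def intro!: mult_right_mono)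
   qed
   finally show ?thesis by simp
  qed
  have "(NN x. ennreal ((norm (f (x - y) - f x))\<^sup>2))
   <= (NN x. ennreal 3 * ennreal ((norm (f (-y + 1 *R x) - g n (- y + 1 *R x)))\<^sup>2)
     + ennreal (3 * C n) * ennreal (norm (g n (x - y) - g n x)) + ennreal 3 * ennreal ((norm (f x - g n x))\<^sup>2))"
   using tr by (intro nn_integral_mono)
    (auto simp flip: ennreal_plus ennreal_mult simp del: ennreal_numeral intro!: ennreal_leI simp: mult.assoc less_imp_le[OF C])
  also have "\<dots> = ennreal 3 * (NN x. ennreal ((norm (f (-y + 1 *R x) - g n (-y + 1 *R x)))\<^sup>2))
    + ennreal (3 * C n) * (NN x. ennreal (norm (g n (x - y) - g n x)))
    + ennreal 3 * (NN x. ennreal ((norm (f x - g n x))\<^sup>2))"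
   by (simp add: nn_integral_add nn_integral_cmult del: ennreal_numeral)
  also have "\<dots> <= ennreal 3 * ennreal (e/9) + ennreal (3 * C n) * ennreal (e / (9 * C n)) + ennreal 3 * ennreal (e/9)"
   using n' d(2)[OF that] nn_integral_lborel_affine[of 1 "\<lambda>x. ennreal ((norm (f x - g n x))\<^sup>2)" "- y"]
   by (intro add_mono mult_left_mono) auto
  also have "\<dots> = ennreal (3 * (e/9) + 3 * C n * (e / (9 * C n)) + 3 * (e/9))"
   using e C[of n] by (simp flip: ennreal_plus ennreal_mult del: ennreal_numeral)
  also have "3 * (e/9) + 3 * C n * (e / (9 * C n)) + 3 * (e/9) = e"
   using C[of n] by (simp add: field_simps)
  finally show ?thesis .
 qed
 then show ?thesis using d(1) by blast
qed

section \<open>Convolution\<close>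

definition conv :: "('a::euclidean_space => real) => ('a => 'b::euclidean_space) => 'a => 'b" where
 "conv \<eta> f x = (LBINT y. \<eta> (x - y) *R f y)"

lemma test_supp_deriv:
 "test_function \<Omega> \<phi> ==> \<exists>K. compact K \<and> K \<subseteq> \<Omega> \<and>
   (\<forall>x. x \<notin> K --> \<phi> x = 0) \<and> (\<forall>x b. x \<notin> K --> dd \<phi> x b = 0)"
 by (erule test_functionE) blast

lemma integrable_lborel_measurable:
 fixes f :: "'a::euclidean_space => 'b::euclidean_space"
 shows "L1 f ==> f Borel"
 using borel_measurable_integrable by (auto simp flip: measurable_lborel1)

lemma integrable_bounded_scaleR:
 fixes f :: "'a => 'b::euclidean_space"
 assumes "integrable M f" "g \<in> borel_measurable M" "\<And>x. \<bar>g x\<bar> <= B"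
 shows "integrable M (\<lambda>x. g x *R f x)"
proof (rule Bochner_Integration.integrable_bound)
 show "integrable M (\<lambda>x. B *R f x)" using assms(1) by simp
 show "AE x in M. norm (g x *R f x) <= norm (B *R f x)"
  using assms(3) by (auto intro!: AE_I2 mult_right_mono order_trans[OF assms(3) abs_ge_self])
qed (use assms in auto)

lemma test_shift_measurable:
 fixes \<eta> :: "'a::euclidean_space => real"
 assumes "test_function \<Omega> \<eta>"
 shows "(\<lambda>y. \<eta> (x - y)) Borel"
 using smooth_measurable[OF smooth_affine[OF test_smooth[OF assms], of x "-1"]] by simp

lemma conv_integrable:
 fixes f :: "'a::euclidean_space => 'b::euclidean_space"
 assumes \<eta>: "test_function UNIV \<eta>" and f: "L1 f"
 shows "L1 (\<lambda>y. \<eta> (x - y) *R f y)"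
proof -
 obtain B where B: "\<And>x. norm (\<eta> x) <= B" using test_bounded[OF \<eta>] by blast
 then show ?thesis
  using test_shift_measurable[OF \<eta>] by (intro integrable_bounded_scaleR[OF f]) auto
qed

lemma conv_alt:
 fixes f :: "'a::euclidean_space => 'b::euclidean_space"
 assumes \<eta>: "test_function UNIV \<eta>" and f: "L1 f"
 shows "conv \<eta> f x = (LBINT z. \<eta> z *R f (x - z))"
proof -
 have [measurable]: "f Borel" "\<eta> Borel"
  using f \<eta> by (auto intro: integrable_lborel_measurable smooth_measurable test_smooth)
 show ?thesis
  using integral_lborel_affine[of "-1" "\<lambda>y. \<eta> (x - y) *R f y" x] by (simp add: conv_def)
qed

text \<open>Differentiation under the integral. The difference quotients of \<open>\<eta>\<close>
  minus their linear part are bounded by 2 B, with B a Lipschitz constant of \<open>\<eta>\<close>,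
  so the integrable f provides the dominating function.\<close>

lemma conv_has_derivative:
 fixes f :: "'a::euclidean_space => 'b::euclidean_space"
 assumes \<eta>: "test_function UNIV \<eta>" and f: "L1 f"
 shows "(conv \<eta> f has_derivative (\<lambda>h. conv (\<lambda>z. dd \<eta> z h) f x)) (at x)"
proof -
 let ?D = "\<lambda>z. dd \<eta> z"
 obtain B where B: "B > 0" "\<And>x y. norm (\<eta> x - \<eta> y) <= B * norm (x - y)"
   "\<And>x b. norm (?D x b) <= B * norm b"
  using test_lipschitz[OF \<eta>] by blast
 have [measurable]: "f Borel" "(\<lambda>y. \<eta> (x - y)) Borel"
  "(\<lambda>y. ?D (x - y) h) Borel" for x h
  using integrable_lborel_measurable[OF f] test_shift_measurable[OF \<eta>]
   test_shift_measurable[OF test_deriv[OF \<eta>]] by auto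
 have der: "(\<eta> has_derivative ?D z) (at z)" for z
  by (rule smooth_has_derivative[OF test_smooth[OF \<eta>]])
 have linD: "linear (?D z)" for z using der has_derivative_linear by blast
 have intD: "L1 (\<lambda>y. ?D (x - y) h *R f y)" for x h
  by (rule conv_integrable[OF test_deriv[OF \<eta>] f])
 have intE: "L1 (\<lambda>y. \<eta> (x - y) *R f y)" for x
  by (rule conv_integrable[OF \<eta> f])
 have "((\<lambda>y. norm ((conv \<eta> f y - conv \<eta> f x) - conv (\<lambda>z. ?D z (y - x)) f x) / norm (y - x)) \<longlongrightarrow> 0) (at x)"
  unfolding tendsto_at_iff_sequentially comp_def
 proof (intro allI impI)
  fix X :: "nat => 'a" assume X: "\<forall>i. X i \<in> UNIV - {x}" "X ----> x"
  define q where "q n y = (\<eta> (X n - y) - \<eta> (x - y) - ?D (x - y) (X n - x)) / norm (X n - x)" for n y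
  have eq: "(conv \<eta> f (X n) - conv \<eta> f x) - conv (\<lambda>z. ?D z (X n - x)) f x = norm (X n - x) *R (LBINT y. q n y *R f y)" for n
  proof -
   have "norm (X n - x) \<noteq> 0" using X(1) by auto
   then have "norm (X n - x) * q n y = \<eta> (X n - y) - \<eta> (x - y) - ?D (x - y) (X n - x)" for y
    by (simp add: q_def)
   then have "norm (X n - x) *R (q n y *R f y) = \<eta> (X n - y) *R f y - \<eta> (x - y) *R f y - ?D (x - y) (X n - x) *R f y" for y
    by (simp only: scaleR_scaleR scaleR_diff_left)
   then have "norm (X n - x) *R (LBINT y. q n y *R f y) = (LBINT y. \<eta> (X n - y) *R f y - \<eta> (x - y) *R f y - ?D (x - y) (X n - x) *R f y)"
    by (subst integral_scaleR_right[symmetric]) simp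
   also have "\<dots> = conv \<eta> f (X n) - conv \<eta> f x - conv (\<lambda>z. ?D z (X n - x)) f x"
    unfolding conv_def by (subst Bochner_Integration.integral_diff; (intro Bochner_Integration.integrable_diff intE intD)?)+
      (simp add: Bochner_Integration.integral_diff intE intD)
   finally show ?thesis by simp
  qed
  have "(\<lambda>n. LBINT y. q n y *R f y) ----> (\<integral>y. (0::'b) \<partial>(lborel :: 'a measure))"
  proof (rule integral_dominated_convergence[where w="\<lambda>y. 2 * B * norm (f y)"])
   show "AE y in lborel. (\<lambda>n. q n y *R f y) ----> 0"
   proof (rule AE_I2)
    fix y
    have "((\<lambda>z. norm (\<eta> z - \<eta> (x - y) - ?D (x - y) (z - (x - y))) / norm (z - (x - y))) \<longlongrightarrow> 0) (at (x - y))"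
     using der[of "x - y"] unfolding has_derivative_iff_norm by blast
    then have "(\<lambda>n. norm (\<eta> (X n - y) - \<eta> (x - y) - ?D (x - y) (X n - y - (x - y))) / norm (X n - y - (x - y))) ----> 0"
     unfolding tendsto_at_iff_sequentially comp_def
     using X by (elim allE[of _ "\<lambda>n. X n - y"]) (auto intro: tendsto_diff)
    then have "(\<lambda>n. norm (q n y)) ----> 0"
     by (simp add: q_def)
    then have "(\<lambda>n. q n y) ----> 0" by (rule tendsto_norm_zero_cancel)
    then show "(\<lambda>n. q n y *R f y) ----> 0"
     using tendsto_scaleR[of "\<lambda>n. q n y" 0 _ "\<lambda>_. f y" "f y"] by simp
   qed
   show "AE y in lborel. norm (q n y *R f y) <= 2 * B * norm (f y)" for n
   proof (rule AE_I2)
    fix y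
    have "norm (X n - x) > 0" using X(1) by auto
    moreover have "\<bar>\<eta> (X n - y) - \<eta> (x - y) - ?D (x - y) (X n - x)\<bar> <= 2 * B * norm (X n - x)"
     using B(2)[of "X n - y" "x - y"] B(3)[of "x - y" "X n - x"] by auto
    ultimately have "\<bar>q n y\<bar> <= 2 * B" by (simp add: q_def field_simps)
    then show "norm (q n y *R f y) <= 2 * B * norm (f y)" by (auto intro: mult_right_mono)
   qed
   show "(\<lambda>y. q n y *R f y) \<in> borel_measurable lborel" for n unfolding q_def by measurable
  qed (use f in auto)
  then have "(\<lambda>n. norm (LBINT y. q n y *R f y)) ----> 0" by (simp add: tendsto_norm_zero)
  moreover have "norm (X n - x) \<noteq> 0" for n using X(1) by auto
  ultimately show "(\<lambda>n. norm ((conv \<eta> f (X n) - conv \<eta> f x) - conv (\<lambda>z. ?D z (X n - x)) f x) / norm (X n - x)) ----> 0"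
   by (simp add: eq)
 qed
 moreover have "bounded_linear (\<lambda>h. conv (\<lambda>z. ?D z h) f x)"
 proof (rule bounded_linear_intro[where K="B * (LBINT y. norm (f y))"])
  fix h k :: 'a and r :: real
  show "conv (\<lambda>z. ?D z (h + k)) f x = conv (\<lambda>z. ?D z h) f x + conv (\<lambda>z. ?D z k) f x"
   unfolding conv_def by (subst Bochner_Integration.integral_add[symmetric]) (auto simp: intD linear_add[OF linD] scaleR_add_left)
  show "conv (\<lambda>z. ?D z (r *R h)) f x = r *R conv (\<lambda>z. ?D z h) f x"
   unfolding conv_def by (subst integral_scaleR_right[symmetric]) (auto simp: intD linear_scale[OF linD])
  have "norm (conv (\<lambda>z. ?D z h) f x) <= (LBINT y. norm (?D (x - y) h *R f y))"
   unfolding conv_def by (rule integral_norm_bound)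
  also have "\<dots> <= (LBINT y. B * norm h * norm (f y))"
   using f B(3) by (intro integral_mono integrable_norm[OF intD]) (auto intro: mult_right_mono)
  also have "\<dots> = norm h * (B * (LBINT y. norm (f y)))" by simp
  finally show "norm (conv (\<lambda>z. ?D z h) f x) <= norm h * (B * (LBINT y. norm (f y)))" .
 qed
 ultimately show ?thesis by (simp add: has_derivative_iff_norm)
qed

lemma conv_frechet_derivative:
 fixes f :: "'a::euclidean_space => 'b::euclidean_space"
 assumes "test_function UNIV \<eta>" "L1 f"
 shows "dd (conv \<eta> f) x h = conv (\<lambda>z. dd \<eta> z h) f x"
 using frechet_derivative_at[OF conv_has_derivative[OF assms, of x]] by metis

lemma conv_smooth:
 fixes f :: "'a::euclidean_space => 'b::euclidean_space"
 assumes "test_function UNIV \<eta>" "L1 f"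
 shows "smooth (conv \<eta> f)"
proof (rule smooth_coinduct[where S="{conv \<eta> f | \<eta>. test_function UNIV \<eta>}"])
 show "conv \<eta> f \<in> {conv \<eta> f |\<eta>. test_function UNIV \<eta>}" using assms by blast
next
 fix g x assume "g \<in> {conv \<eta> f |\<eta>. test_function UNIV \<eta>}"
 then obtain \<eta>' where "g = conv \<eta>' f" "test_function UNIV \<eta>'" by blast
 then show "g differentiable at x"
  using conv_has_derivative[of \<eta>' f x] assms(2) unfolding differentiable_def by blast
next
 fix g and b :: 'a assume "g \<in> {conv \<eta> f |\<eta>. test_function UNIV \<eta>}"
 then obtain \<eta>' where g: "g = conv \<eta>' f" "test_function UNIV \<eta>'" by blast
 have "(\<lambda>x. dd g x b) = conv (\<lambda>z. frechet_derivative \<eta>' (at z) b) f"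
  using conv_frechet_derivative[OF g(2) assms(2)] g(1) by auto
 then show "(\<lambda>x. dd g x b) \<in> {conv \<eta> f |\<eta>. test_function UNIV \<eta>}"
  using test_deriv[OF g(2)] by blast
qed

lemma conv_support:
 assumes "conv \<eta> f x \<noteq> 0"
 obtains y where "\<eta> (x - y) \<noteq> 0" "f y \<noteq> 0"
proof -
 have "\<exists>y. \<eta> (x - y) *R f y \<noteq> 0"
 proof (rule ccontr)
  assume "\<nexists>y. \<eta> (x - y) *R f y \<noteq> 0"
  then have "(\<lambda>y. \<eta> (x - y) *R f y) = (\<lambda>_. 0)" by auto
  then show False using assms by (simp add: conv_def)
 qed
 then show ?thesis using that by auto
qed

lemma mollifier_D:
 assumes "mollifier a r \<eta>"
 shows "test_function UNIV \<eta>" "0 <= \<eta> x" "\<eta> x \<noteq> 0 ==> x \<in> ball a r" "integral\<^sup>L lborel \<eta> = 1"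
  "L1 \<eta>" "\<eta> Borel" "(NN x. ennreal (\<eta> x)) = 1"
proof -
 show *: "test_function UNIV \<eta>" "0 <= \<eta> x" "\<eta> x \<noteq> 0 ==> x \<in> ball a r" "integral\<^sup>L lborel \<eta> = 1" for x
  using assms by (auto simp: mollifier_def)
 show i: "L1 \<eta>" by (rule test_integrable[OF *(1)])
 show "\<eta> Borel" using i by (rule integrable_lborel_measurable)
 show "(NN x. ennreal (\<eta> x)) = 1"
  using i *(2,4) by (subst nn_integral_eq_integral) auto
qed

lemma conv_minus_eq:
 fixes f :: "'a::euclidean_space => 'b::euclidean_space"
 assumes \<eta>: "mollifier a r \<eta>" and f: "L1 f"
 shows "L1 (\<lambda>z. \<eta> z *R (f (x - z) - c))"
  and "conv \<eta> f x - c = (LBINT z. \<eta> z *R (f (x - z) - c))"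
proof -
 note \<eta>' = mollifier_D[OF \<eta>]
 have [measurable]: "f Borel" "\<eta> Borel"
  using integrable_lborel_measurable[OF f] \<eta>' by auto
 have 1: "L1 (\<lambda>z. \<eta> z *R f (x - z))"
  using conv_integrable[OF \<eta>'(1) f, of x] integrable_lborel_affine[of "-1" "\<lambda>y. \<eta> (x - y) *R f y" x] by simp
 have 2: "L1 (\<lambda>z. \<eta> z *R c)" using \<eta>'(5) by simp
 show "L1 (\<lambda>z. \<eta> z *R (f (x - z) - c))"
  using 1 2 by (simp add: scaleR_diff_right)
 have "(LBINT z. \<eta> z *R (f (x - z) - c)) = (LBINT z. \<eta> z *R f (x - z)) - (LBINT z. \<eta> z *R c)"
  using 1 2 by (simp add: scaleR_diff_right)
 also have "\<dots> = conv \<eta> f x - c"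
  using \<eta>' f by (simp add: conv_alt)
 finally show "conv \<eta> f x - c = (LBINT z. \<eta> z *R (f (x - z) - c))" by simp
qed

text \<open>Expand the nonnegative integral of \<eta> (|g| - m)^2, where m is the \<eta>-mean of
  |g|; the total mass 1 of \<eta> turns the result into a variance.\<close>

lemma jensen_square:
 fixes g :: "'a::euclidean_space => 'b::euclidean_space"
 assumes \<eta>: "mollifier a r \<eta>" and g: "g Borel" "L1 (\<lambda>z. \<eta> z *R g z)"
 shows "ennreal ((norm (LBINT z. \<eta> z *R g z))\<^sup>2) <= (NN z. ennreal (\<eta> z) * ennreal ((norm (g z))\<^sup>2))"
proof (cases "(NN z. ennreal (\<eta> z) * ennreal ((norm (g z))\<^sup>2)) = \<infinity>")
 case False
 note \<eta>' = mollifier_D[OF \<eta>]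
 have [measurable]: "g Borel" "\<eta> Borel" using g \<eta>' by auto
 let ?n = "\<lambda>z. norm (g z)"
 have i2: "L1 (\<lambda>z. \<eta> z * (?n z)\<^sup>2)"
  using False \<eta>'(2) by (intro integrableI_nonneg) (auto simp: ennreal_mult less_top)
 have i1: "L1 (\<lambda>z. \<eta> z * ?n z)"
  using integrable_norm[OF g(2)] \<eta>'(2) by simp
 define m where "m = (LBINT z. \<eta> z * ?n z)"
 have m0: "m >= 0" unfolding m_def using \<eta>'(2) by (intro integral_nonneg_AE) auto
 have "0 <= (LBINT z. \<eta> z * (?n z - m)\<^sup>2)"
  using \<eta>'(2) by (intro integral_nonneg_AE) auto
 also have "\<dots> = (LBINT z. \<eta> z * (?n z)\<^sup>2 - (2 * m) * (\<eta> z * ?n z) + m\<^sup>2 * \<eta> z)"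
  by (intro Bochner_Integration.integral_cong) (auto simp: power2_eq_square algebra_simps)
 also have "\<dots> = (LBINT z. \<eta> z * (?n z)\<^sup>2) - (2 * m) * m + m\<^sup>2"
  using i1 i2 \<eta>'(4,5) by (simp add: m_def)
 finally have "m\<^sup>2 <= (LBINT z. \<eta> z * (?n z)\<^sup>2)" by (simp add: power2_eq_square)
 moreover have "norm (LBINT z. \<eta> z *R g z) <= m"
  using integral_norm_bound[of lborel "\<lambda>z. \<eta> z *R g z"] \<eta>'(2) by (simp add: m_def)
 then have "(norm (LBINT z. \<eta> z *R g z))\<^sup>2 <= m\<^sup>2" by (intro power_mono) auto
 ultimately have "(norm (LBINT z. \<eta> z *R g z))\<^sup>2 <= (LBINT z. \<eta> z * (?n z)\<^sup>2)" by simp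
 then have "ennreal ((norm (LBINT z. \<eta> z *R g z))\<^sup>2) <= ennreal (LBINT z. \<eta> z * (?n z)\<^sup>2)"
  by (rule ennreal_leI)
 also have "\<dots> = (NN z. ennreal (\<eta> z * (?n z)\<^sup>2))"
  using \<eta>'(2) by (subst nn_integral_eq_integral[OF i2]) auto
 also have "\<dots> = (NN z. ennreal (\<eta> z) * ennreal ((?n z)\<^sup>2))"
  using \<eta>'(2) by (simp add: ennreal_mult)
 finally show ?thesis .
qed simp

text \<open>The common core of the L1 and L2 cases. Tonelli's theorem turns the averaged pointwise
  bound \<open>J\<close> into an average of translation errors, and \<open>norm a + r <= d\<close>
  means that only translations shorter than d occur in it.\<close>

lemma mollify_avg:
 fixes f :: "'a::euclidean_space => 'b::euclidean_space" and \<Theta> :: "'b => ennreal"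
 assumes \<eta>: "mollifier a r \<eta>" and d: "norm a + r <= d" and f: "f Borel"
  and [measurable]: "\<Theta> Borel"
  and J: "\<And>x. F x <= (NN z. ennreal (\<eta> z) * \<Theta> (f (x - z) - f x))"
  and T: "\<And>y. norm y < d ==> (NN x. \<Theta> (f (x - y) - f x)) <= e"
 shows "(NN x. F x) <= e"
proof -
 note \<eta>' = mollifier_D[OF \<eta>]
 have [measurable]: "f Borel" "\<eta> Borel" using f \<eta>' by auto
 have "(NN x. F x) <= (NN x. (NN z. ennreal (\<eta> z) * \<Theta> (f (x - z) - f x)))"
  by (intro nn_integral_mono J)
 also have "\<dots> = (NN z. (NN x. ennreal (\<eta> z) * \<Theta> (f (x - z) - f x)))"
  by (rule lborel_pair.Fubini'[symmetric]) measurable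
 also have "\<dots> = (NN z. ennreal (\<eta> z) * (NN x. \<Theta> (f (x - z) - f x)))"
  by (intro nn_integral_cong nn_integral_cmult) measurable
 also have "\<dots> <= (NN z. ennreal (\<eta> z) * e)"
 proof (rule nn_integral_mono)
  fix z
  show "ennreal (\<eta> z) * (NN x. \<Theta> (f (x - z) - f x)) <= ennreal (\<eta> z) * e"
  proof (cases "\<eta> z = 0")
   case False
   then have "dist a z < r" using \<eta>'(3) by auto
   then have "norm z < d" using d norm_triangle_sub[of z a] by (auto simp: dist_norm norm_minus_commute)
   then show ?thesis by (intro mult_left_mono T) auto
  qed simp
 qed
 also have "\<dots> = e" using \<eta>'(7) by (simp add: nn_integral_multc)
 finally show ?thesis .
qed

lemma mollify_L1:
 fixes f :: "'a::euclidean_space => 'b::euclidean_space"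
 assumes f: "L1 f" and e: "e > 0"
 shows "\<exists>d>0. \<forall>a r \<eta>. mollifier a r \<eta> --> norm a + r <= d -->
  (NN x. ennreal (norm (conv \<eta> f x - f x))) <= ennreal e"
proof -
 obtain d where d: "d > 0" "\<And>y. norm y < d ==> (NN x. ennreal (norm (f (x - y) - f x))) <= ennreal e"
  using translation_continuous_L1[OF f e] by blast
 have "(NN x. ennreal (norm (conv \<eta> f x - f x))) <= ennreal e"
  if m: "mollifier a r \<eta>" "norm a + r <= d" for a r \<eta>
 proof (rule mollify_avg[OF m integrable_lborel_measurable[OF f], where \<Theta>="\<lambda>v. ennreal (norm v)"])
  fix x
  have "norm (conv \<eta> f x - f x) <= (LBINT z. norm (\<eta> z *R (f (x - z) - f x)))"
   unfolding conv_minus_eq(2)[OF m(1) f] by (rule integral_norm_bound)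
  then have "ennreal (norm (conv \<eta> f x - f x)) <= ennreal (LBINT z. norm (\<eta> z *R (f (x - z) - f x)))"
   by (rule ennreal_leI)
  also have "\<dots> = (NN z. ennreal (norm (\<eta> z *R (f (x - z) - f x))))"
   by (subst nn_integral_eq_integral[OF integrable_norm[OF conv_minus_eq(1)[OF m(1) f]]]) auto
  also have "\<dots> = (NN z. ennreal (\<eta> z) * ennreal (norm (f (x - z) - f x)))"
   using mollifier_D(2)[OF m(1)] by (simp add: ennreal_mult)
  finally show "ennreal (norm (conv \<eta> f x - f x)) <= (NN z. ennreal (\<eta> z) * ennreal (norm (f (x - z) - f x)))" .
 qed (use d(2) in auto)
 then show ?thesis using d(1) by blast
qed

lemma mollify_L2:
 fixes f :: "'a::euclidean_space => 'b::euclidean_space"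
 assumes f: "L1 f" "L1 (\<lambda>x. (norm (f x))\<^sup>2)" and e: "e > 0"
 shows "\<exists>d>0. \<forall>a r \<eta>. mollifier a r \<eta> --> norm a + r <= d -->
  (NN x. ennreal ((norm (conv \<eta> f x - f x))\<^sup>2)) <= ennreal e"
proof -
 have [measurable]: "f Borel" using integrable_lborel_measurable[OF f(1)] .
 obtain d where d: "d > 0" "\<And>y. norm y < d ==> (NN x. ennreal ((norm (f (x - y) - f x))\<^sup>2)) <= ennreal e"
  using translation_continuous_L2[OF f e] by blast
 have "(NN x. ennreal ((norm (conv \<eta> f x - f x))\<^sup>2)) <= ennreal e"
  if m: "mollifier a r \<eta>" "norm a + r <= d" for a r \<eta>
 proof (rule mollify_avg[OF m, where \<Theta>="\<lambda>v. ennreal ((norm v)\<^sup>2)"])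
  show "ennreal ((norm (conv \<eta> f x - f x))\<^sup>2) <= (NN z. ennreal (\<eta> z) * ennreal ((norm (f (x - z) - f x))\<^sup>2))" for x
   unfolding conv_minus_eq(2)[OF m(1) f(1)]
   by (rule jensen_square[OF m(1) _ conv_minus_eq(1)[OF m(1) f(1)]]) measurable
 qed (use d(2) in auto)
 then show ?thesis using d(1) by blast
qed

lemma conv_measurable:
 fixes f :: "'a::euclidean_space => 'b::euclidean_space"
 shows "test_function UNIV \<eta> ==> L1 f ==> conv \<eta> f Borel"
 by (intro smooth_measurable conv_smooth)

text \<open>Convergence to 0 of \<open>norm (a n) + r n\<close> admits off-centre mollifiers, as
  long as their supports shrink to the origin.\<close>

definition mollifying :: "(nat => 'a::euclidean_space => real) => bool" where
 "mollifying \<eta> \<longleftrightarrow> (\<exists>a r. (\<forall>n. mollifier (a n) (r n) (\<eta> n)) \<and> (\<lambda>n. norm (a n) + r n) ----> 0)"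

lemma mollifying_test: "mollifying \<eta> ==> test_function UNIV (\<eta> n)"
 unfolding mollifying_def using mollifier_D(1) by blast

lemma mollifying_seq:
 assumes "mollifying \<eta>" and "\<exists>d>0. \<forall>a r \<eta>. mollifier a r \<eta> --> norm a + r <= d --> P \<eta>"
 shows "eventually (\<lambda>n. P (\<eta> n)) sequentially"
proof -
 obtain a r where ar: "\<And>n. mollifier (a n) (r n) (\<eta> n)" "(\<lambda>n. norm (a n) + r n) ----> 0"
  using assms(1) unfolding mollifying_def by blast
 obtain d where d: "d > 0" "\<And>a r \<eta>. mollifier a r \<eta> ==> norm a + r <= d ==> P \<eta>"
  using assms(2) by blast
 have "eventually (\<lambda>n. norm (a n) + r n < d) sequentially"
  using ar(2) d(1) by (rule order_tendstoD)
 then show ?thesis by (rule eventually_mono) (rule d(2)[OF ar(1)], simp)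
qed

lemma mollifying_L1:
 fixes f :: "'a::euclidean_space => 'b::euclidean_space"
 assumes "mollifying \<eta>" "L1 f"
 shows "(\<lambda>n. NN x. ennreal (norm (conv (\<eta> n) f x - f x))) ----> 0"
 by (intro ennreal_tendsto_0I mollifying_seq[OF assms(1)] mollify_L1 assms(2))

lemma mollifying_L2:
 fixes f :: "'a::euclidean_space => 'b::euclidean_space"
 assumes "mollifying \<eta>" "L1 f" "L1 (\<lambda>x. (norm (f x))\<^sup>2)"
 shows "(\<lambda>n. NN x. ennreal ((norm (conv (\<eta> n) f x - f x))\<^sup>2)) ----> 0"
 by (intro ennreal_tendsto_0I mollifying_seq[OF assms(1)] mollify_L2 assms(2,3))

lemma mollifying_exists: "\<exists>\<eta> :: nat => 'a::euclidean_space => real.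
  mollifying \<eta> \<and> (\<forall>n. mollifier 0 (inverse (real (Suc n))) (\<eta> n))"
proof -
 have "\<forall>n. \<exists>\<eta> :: 'a => real. mollifier 0 (inverse (real (Suc n))) \<eta>"
  by (intro allI mollifier_exists) auto
 then obtain \<eta> :: "nat => 'a => real" where "\<And>n. mollifier 0 (inverse (real (Suc n))) (\<eta> n)" by metis
 moreover have "(\<lambda>n. norm (0::'a) + inverse (real (Suc n))) ----> 0"
  using LIMSEQ_inverse_real_of_nat by simp
 ultimately have "mollifying \<eta>"
  unfolding mollifying_def by (intro exI[of _ "\<lambda>n. 0"] exI[of _ "\<lambda>n. inverse (real (Suc n))"]) blast
 then show ?thesis using \<open>\<And>n. mollifier 0 (inverse (real (Suc n))) (\<eta> n)\<close> by blast
qed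

lemma nn_integral_tendsto_0_imp:
 assumes "\<And>n. g n \<in> borel_measurable M" "\<And>n x. 0 <= g n x" "(\<lambda>n. \<integral>\<^sup>+x. ennreal (g n x) \<partial>M) ----> 0"
 shows "(\<lambda>n. \<integral>x. g n x \<partial>M) ----> 0"
proof -
 have "(\<lambda>n. enn2real (\<integral>\<^sup>+x. ennreal (g n x) \<partial>M)) ----> enn2real 0"
  by (rule tendsto_enn2real) (use assms(3) in auto)
 then show ?thesis using assms(1,2) by (simp add: integral_eq_nn_integral)
qed

text \<open>Multiplication by a test function \<beta> of \<Omega> makes f integrable, and every
  convolution of \<beta> f vanishes because \<beta> times a reflected translate of a mollifier is
  again a test function of \<Omega>. Shrinking the mollifier gives \<beta> f = 0 almost everywhere,
  and by Lindelof countably many \<beta> suffice.\<close>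

lemma null_of_test_orthogonal:
 fixes f :: "'a::euclidean_space => real"
 assumes f: "f Borel" and op: "open \<Omega>"
  and loc: "\<And>K. compact K ==> K \<subseteq> \<Omega> ==> L1 (\<lambda>x. indicator K x * f x)"
  and orth: "\<And>\<phi>. test_function \<Omega> \<phi> ==> (LBINT x. f x * \<phi> x) = 0"
 shows "AE x in lborel. x \<in> \<Omega> --> f x = 0"
proof -
 have [measurable]: "f Borel" by fact
 have null: "AE x in lborel. \<beta> x * f x = 0" if \<beta>: "test_function \<Omega> \<beta>" for \<beta>
 proof -
  obtain K where K: "compact K" "K \<subseteq> \<Omega>" "\<And>x. x \<notin> K ==> \<beta> x = 0"
   using test_supp[OF \<beta>] by auto
  obtain B where B: "\<And>x. norm (\<beta> x) <= B" using test_bounded[OF \<beta>] by blast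
  have [measurable]: "\<beta> Borel" using \<beta> smooth_measurable test_smooth by blast
  have "L1 (\<lambda>x. \<beta> x *R (indicator K x * f x))"
   using B by (intro integrable_bounded_scaleR[OF loc[OF K(1,2)]]) auto
  also have "(\<lambda>x. \<beta> x *R (indicator K x * f x)) = (\<lambda>x. \<beta> x * f x)"
  proof
   fix x show "\<beta> x *R (indicator K x * f x) = \<beta> x * f x"
    using K(3)[of x] by (cases "x \<in> K") auto
  qed
  finally have i: "L1 (\<lambda>x. \<beta> x * f x)" .
  have z: "conv \<eta> (\<lambda>x. \<beta> x * f x) x = 0" if \<eta>: "test_function UNIV \<eta>" for \<eta> x
  proof -
   have "test_function \<Omega> (\<lambda>y. \<beta> y * \<eta> (x + (-1) *R y))"
    by (intro test_mult \<beta> smooth_affine test_smooth[OF \<eta>])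
   then have "(LBINT y. f y * (\<beta> y * \<eta> (x + (-1) *R y))) = 0" by (rule orth)
   then show ?thesis by (simp add: conv_def mult_ac)
  qed
  obtain \<eta> :: "nat => 'a => real" where \<eta>: "mollifying \<eta>" using mollifying_exists by blast
  have "(\<lambda>n. NN x. ennreal (norm (0 - \<beta> x * f x))) ----> 0"
   using mollifying_L1[OF \<eta> i] z mollifying_test[OF \<eta>] by simp
  then have "(NN x. ennreal (norm (0 - \<beta> x * f x))) = 0"
   by (simp add: LIMSEQ_const_iff)
  then show ?thesis by (subst (asm) nn_integral_0_iff_AE) auto
 qed
 have "\<exists>\<beta>. test_function \<Omega> \<beta> \<and> \<beta> x \<noteq> (0::real)" if x: "x \<in> \<Omega>" for x
 proof -
  obtain r where r: "r > 0" "cball x r \<subseteq> \<Omega>" using op x open_contains_cball by blast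
  have "smooth (\<lambda>y. bump (- ((DIM('a)/r) *R x) + (DIM('a)/r) *R y))" (is "smooth ?b") by (rule smooth_affine[OF bump_smooth])
  moreover have "y \<in> cball x r" if "?b y \<noteq> 0" for y
  proof -
   have "\<bar>((DIM('a)/r) *R (y - x)) \<bullet> b\<bar> < 1" if "b \<in> Basis" for b
    using \<open>?b y \<noteq> 0\<close> that unfolding bump_nonzero_iff by (auto simp: scaleR_diff_right)
   then have "norm ((DIM('a)/r) *R (y - x)) < (\<Sum>b\<in>(Basis::'a set). 1)"
    by (intro order_le_less_trans[OF norm_le_l1] sum_strict_mono) auto
   then have "\<bar>DIM('a)/r\<bar> * norm (y - x) < DIM('a)" by (simp only: norm_scaleR) simp
   then show ?thesis using r(1) by (simp add: dist_norm norm_minus_commute field_simps)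
  qed
  ultimately have "test_function \<Omega> ?b" using r(2) by (intro test_functionI[of _ "cball x r"]) auto
  moreover have "?b x \<noteq> 0" by (simp add: bump_nonzero_iff)
  ultimately show ?thesis by blast
 qed
 then obtain \<beta> where \<beta>: "\<And>x. x \<in> \<Omega> ==> test_function \<Omega> (\<beta> x)" "\<And>x. x \<in> \<Omega> ==> \<beta> x x \<noteq> (0::real)"
  by metis
 have "open {y. \<beta> x y \<noteq> 0}" if "x \<in> \<Omega>" for x
  using open_Collect_neq[OF smooth_continuous[OF test_smooth[OF \<beta>(1)[OF that]]] continuous_on_const[of UNIV 0]] by simp
 then obtain \<F> where F: "\<F> \<subseteq> (\<lambda>x. {y. \<beta> x y \<noteq> 0}) ` \<Omega>" "countable \<F>" "\<Union>\<F> = (\<Union>x\<in>\<Omega>. {y. \<beta> x y \<noteq> 0})"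
  using Lindelof[of "(\<lambda>x. {y. \<beta> x y \<noteq> 0}) ` \<Omega>"] by (metis (no_types, lifting) imageE)
 have "AE x in lborel. \<forall>S\<in>\<F>. x \<in> S --> f x = 0"
 proof (subst AE_ball_countable[OF F(2)], rule ballI)
  fix S assume "S \<in> \<F>"
  then obtain z where "z \<in> \<Omega>" "S = {y. \<beta> z y \<noteq> 0}" using F(1) by blast
  then show "AE x in lborel. x \<in> S --> f x = 0"
   using null[OF \<beta>(1)[of z]] by (auto elim!: eventually_mono)
 qed
 then show ?thesis
 proof (rule eventually_mono)
  fix x assume *: "\<forall>S\<in>\<F>. x \<in> S --> f x = 0"
  show "x \<in> \<Omega> --> f x = 0"
  proof
   assume "x \<in> \<Omega>"
   then have "x \<in> \<Union>\<F>" using F(3) \<beta>(2) by blast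
   then show "f x = 0" using * by blast
  qed
 qed
qed

subsection \<open>Weak gradients of scalar functions\<close>

lemma integrable_norm_mult_L2:
 fixes f :: "'a => 'b::euclidean_space" and g :: "'a => 'c::euclidean_space"
 assumes "square_integrable M f" "square_integrable M g"
 shows "integrable M (\<lambda>x. norm (f x) * norm (g x))"
proof (rule Bochner_Integration.integrable_bound)
 show "integrable M (\<lambda>x. (norm (f x))\<^sup>2 + (norm (g x))\<^sup>2)"
  using assms by (auto simp: square_integrable_def)
 show "(\<lambda>x. norm (f x) * norm (g x)) \<in> borel_measurable M"
  using assms by (auto simp: square_integrable_def)
 have "\<bar>a * b\<bar> <= a\<^sup>2 + b\<^sup>2" for a b :: real
  using sum_squares_bound[of a b] sum_squares_bound[of "-a" b] zero_le_power2[of a] zero_le_power2[of b]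
  by (auto simp: abs_if simp del: zero_le_power2)
 from this[of "norm (f x)" "norm (g x)" for x]
 show "AE x in M. norm (norm (f x) * norm (g x)) <= norm ((norm (f x))\<^sup>2 + (norm (g x))\<^sup>2)"
  by (auto intro!: AE_I2)
qed

lemma L2_Cauchy_Schwarz_norm:
 fixes f :: "'a => 'b::euclidean_space" and g :: "'a => 'c::euclidean_space"
 assumes "square_integrable M f" "square_integrable M g"
 shows "(\<integral>x. norm (f x) * norm (g x) \<partial>M) <= sqrt (\<integral>x. (norm (f x))\<^sup>2 \<partial>M) * sqrt (\<integral>x. (norm (g x))\<^sup>2 \<partial>M)"
proof -
 define A B C where "A = (\<integral>x. (norm (f x))\<^sup>2 \<partial>M)" and "B = (\<integral>x. (norm (g x))\<^sup>2 \<partial>M)"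
  and "C = (\<integral>x. norm (f x) * norm (g x) \<partial>M)"
 have A0: "0 <= A" and B0: "0 <= B" and C0: "0 <= C" by (auto simp: A_def B_def C_def)
 have q: "0 <= A * t\<^sup>2 - 2 * C * t + B" for t
 proof -
  have "0 <= (\<integral>x. (norm (f x) * t - norm (g x))\<^sup>2 \<partial>M)" by simp
  also have "\<dots> = (\<integral>x. t\<^sup>2 * (norm (f x))\<^sup>2 - (2 * t) * (norm (f x) * norm (g x)) + (norm (g x))\<^sup>2 \<partial>M)"
   by (intro Bochner_Integration.integral_cong) (auto simp: power2_eq_square algebra_simps)
  also have "\<dots> = t\<^sup>2 * A - (2 * t) * C + B"
   using assms integrable_norm_mult_L2[OF assms] by (simp add: square_integrable_def A_def B_def C_def)
  finally show ?thesis by (simp add: algebra_simps)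
 qed
 have "C\<^sup>2 <= A * B"
 proof (cases "A = 0")
  case True
  have "C = 0"
  proof (rule ccontr)
   assume "C \<noteq> 0"
   then show False using q[of "(B + 1) / (2 * C)"] True by (simp add: field_simps)
  qed
  then show ?thesis using A0 B0 by simp
 next
  case False
  then have "A > 0" using A0 by simp
  then show ?thesis using q[of "C / A"] by (simp add: field_simps power2_eq_square)
 qed
 then have "C <= sqrt (A * B)" using C0 by (simp add: real_le_rsqrt)
 then show ?thesis by (simp add: A_def B_def C_def real_sqrt_mult)
qed

lemma integrable_inner_L2:
 fixes f g :: "'a => 'b::euclidean_space"
 assumes "square_integrable M f" "square_integrable M g"
 shows "integrable M (\<lambda>x. f x \<bullet> g x)"
 by (rule Bochner_Integration.integrable_bound[OF integrable_norm_mult_L2[OF assms]])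
   (use assms Cauchy_Schwarz_ineq2 in \<open>auto simp: square_integrable_def\<close>)

lemma L2_Cauchy_Schwarz:
 fixes f g :: "'a => 'b::euclidean_space"
 assumes "square_integrable M f" "square_integrable M g"
 shows "\<bar>\<integral>x. f x \<bullet> g x \<partial>M\<bar> <= sqrt (\<integral>x. (norm (f x))\<^sup>2 \<partial>M) * sqrt (\<integral>x. (norm (g x))\<^sup>2 \<partial>M)"
proof -
 have "\<bar>\<integral>x. f x \<bullet> g x \<partial>M\<bar> <= (\<integral>x. \<bar>f x \<bullet> g x\<bar> \<partial>M)" by (rule integral_abs_bound)
 also have "\<dots> <= (\<integral>x. norm (f x) * norm (g x) \<partial>M)"
  using integrable_inner_L2[OF assms] integrable_norm_mult_L2[OF assms]
  by (intro integral_mono) (auto simp: Cauchy_Schwarz_ineq2)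
 also note L2_Cauchy_Schwarz_norm[OF assms]
 finally show ?thesis .
qed

lemma L2_bound:
 fixes f :: "'a => 'b::euclidean_space" and g :: "'a => 'c::euclidean_space"
 assumes "square_integrable M f" "g \<in> borel_measurable M" "AE x in M. norm (g x) <= B * norm (f x)"
 shows "square_integrable M g"
 unfolding square_integrable_def
proof
 show "integrable M (\<lambda>x. (norm (g x))\<^sup>2)"
 proof (rule Bochner_Integration.integrable_bound)
  show "integrable M (\<lambda>x. B\<^sup>2 * (norm (f x))\<^sup>2)" using assms(1) by (simp add: square_integrable_def)
  show "AE x in M. norm ((norm (g x))\<^sup>2) <= norm (B\<^sup>2 * (norm (f x))\<^sup>2)"
   using assms(3) by eventually_elim (auto simp: power_mult_distrib[symmetric] intro: power_mono)
 qed (use assms(2) in auto)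
qed (use assms in auto)

lemma L2_add:
 fixes f g :: "'a => 'b::euclidean_space"
 assumes "square_integrable M f" "square_integrable M g"
 shows "square_integrable M (\<lambda>x. f x + g x)"
 unfolding square_integrable_def
proof
 show "integrable M (\<lambda>x. (norm (f x + g x))\<^sup>2)"
 proof (rule Bochner_Integration.integrable_bound)
  show "integrable M (\<lambda>x. 2 * (norm (f x))\<^sup>2 + 2 * (norm (g x))\<^sup>2)"
   using assms by (simp add: square_integrable_def)
  have "(norm (a + b))\<^sup>2 <= 2 * (norm a)\<^sup>2 + 2 * (norm b)\<^sup>2" for a b :: 'b
  proof -
   have "(norm (a + b))\<^sup>2 <= (norm a + norm b)\<^sup>2" by (intro power_mono norm_triangle_ineq) auto
   then show ?thesis using sum_squares_bound[of "norm a" "norm b"] by (simp add: power2_sum)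
  qed
  then show "AE x in M. norm ((norm (f x + g x))\<^sup>2) <= norm (2 * (norm (f x))\<^sup>2 + 2 * (norm (g x))\<^sup>2)"
   by (auto intro!: AE_I2)
 qed (use assms in \<open>auto simp: square_integrable_def\<close>)
qed (use assms in \<open>auto simp: square_integrable_def\<close>)

lemma L2_scaleR:
 fixes f :: "'a => 'b::euclidean_space"
 shows "square_integrable M f ==> square_integrable M (\<lambda>x. c *R f x)"
 by (rule L2_bound[of M f _ "\<bar>c\<bar>"]) (auto simp: square_integrable_def)

lemma L2_diff:
 fixes f g :: "'a => 'b::euclidean_space"
 assumes "square_integrable M f" "square_integrable M g"
 shows "square_integrable M (\<lambda>x. f x - g x)"
 using L2_add[OF assms(1) L2_scaleR[OF assms(2), of "-1"]] by simp

lemma L2_measurable: "square_integrable M f ==> f \<in> borel_measurable M"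
 by (simp add: square_integrable_def)

lemma test_square_integrable:
 fixes \<phi> :: "'a::euclidean_space => 'b::euclidean_space"
 assumes "test_function \<Omega> \<phi>"
 shows "L2 \<phi>"
proof -
 obtain B where B: "\<And>x. norm (\<phi> x) <= B" using test_bounded[OF assms] by blast
 have [measurable]: "\<phi> Borel" using assms smooth_measurable test_smooth by blast
 have "L1 (\<lambda>x. norm (\<phi> x) *R norm (\<phi> x))"
  using B by (intro integrable_bounded_scaleR integrable_norm test_integrable[OF assms]) auto
 then show ?thesis by (simp add: square_integrable_def power2_eq_square)
qed

lemma L2_bounded_support_integrable:
 fixes f :: "'a::euclidean_space => 'b::euclidean_space"
 assumes "L2 f" "bounded S" "\<And>x. x \<notin> S ==> f x = 0"
 shows "L1 f"
proof -
 obtain R where R: "S \<subseteq> cball 0 R"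
  using assms(2) by (auto simp: bounded_iff subset_eq)
 show ?thesis
 proof (rule Bochner_Integration.integrable_bound)
  show "L1 (\<lambda>x. indicator (cball 0 R) x + (norm (f x))\<^sup>2 :: real)"
   using assms(1) emeasure_bounded_finite[OF bounded_cball, of 0 R]
   by (intro Bochner_Integration.integrable_add integrable_real_indicator) (auto simp: square_integrable_def)
  have "norm (f x) <= indicator (cball 0 R) x + (norm (f x))\<^sup>2" for x
  proof (cases "x \<in> cball 0 R")
   case True
   then show ?thesis using sum_squares_bound[of "norm (f x)" "1/2"] zero_le_power2[of "norm (f x)"]
    by (auto simp: power2_eq_square field_simps)
  next
   case False
   then have "x \<notin> S" using R by auto
   then show ?thesis using assms(3)[of x] by simp
  qed
  then show "AE x in lborel. norm (f x) <= norm (indicator (cball 0 R) x + (norm (f x))\<^sup>2 :: real)"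
   by (auto intro!: AE_I2 simp: order_trans[OF _ abs_ge_self])
 qed (use assms in \<open>auto simp: square_integrable_def\<close>)
qed

lemma L2_inner_tendsto:
 fixes h q :: "'a => 'b::euclidean_space"
 assumes h: "square_integrable M h" and q: "square_integrable M q" and qn: "\<And>n. square_integrable M (qn n)"
  and lim: "(\<lambda>n. \<integral>\<^sup>+x. ennreal ((norm (qn n x - q x))\<^sup>2) \<partial>M) ----> 0"
 shows "(\<lambda>n. \<integral>x. h x \<bullet> qn n x \<partial>M) ----> (\<integral>x. h x \<bullet> q x \<partial>M)"
proof (rule Lim_null[THEN iffD2], rule Lim_null_comparison)
 have d: "square_integrable M (\<lambda>x. qn n x - q x)" for n by (rule L2_diff[OF qn q])
 have "norm ((\<integral>x. h x \<bullet> qn n x \<partial>M) - (\<integral>x. h x \<bullet> q x \<partial>M)) <= sqrt (\<integral>x. (norm (h x))\<^sup>2 \<partial>M) * sqrt (\<integral>x. (norm (qn n x - q x))\<^sup>2 \<partial>M)" for n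
  using L2_Cauchy_Schwarz[OF h d] integrable_inner_L2[OF h qn] integrable_inner_L2[OF h q] by (simp add: inner_diff_right)
 then show "eventually (\<lambda>n. norm ((\<integral>x. h x \<bullet> qn n x \<partial>M) - (\<integral>x. h x \<bullet> q x \<partial>M)) <= sqrt (\<integral>x. (norm (h x))\<^sup>2 \<partial>M) * sqrt (\<integral>x. (norm (qn n x - q x))\<^sup>2 \<partial>M)) sequentially"
  by auto
 have "(\<lambda>n. \<integral>x. (norm (qn n x - q x))\<^sup>2 \<partial>M) ----> 0"
  by (rule nn_integral_tendsto_0_imp[OF _ _ lim]) (use L2_measurable[OF d] in auto)
 then have "(\<lambda>n. sqrt (\<integral>x. (norm (h x))\<^sup>2 \<partial>M) * sqrt (\<integral>x. (norm (qn n x - q x))\<^sup>2 \<partial>M)) ----> sqrt (\<integral>x. (norm (h x))\<^sup>2 \<partial>M) * sqrt 0"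
  by (intro tendsto_intros)
 then show "(\<lambda>n. sqrt (\<integral>x. (norm (h x))\<^sup>2 \<partial>M) * sqrt (\<integral>x. (norm (qn n x - q x))\<^sup>2 \<partial>M)) ----> 0" by simp
qed

lemma directional_difference_bound:
 fixes F :: "'a::euclidean_space => real"
 assumes der: "\<And>x. (F has_derivative F' x) (at x)" and B: "\<And>x. \<bar>F' x h\<bar> <= B" and t: "t >= 0"
 shows "\<bar>F (x + t *R h) - F x\<bar> <= B * t"
proof -
 have d: "((\<lambda>s. F (x + s *R h)) has_derivative (\<lambda>u. u * F' (x + s *R h) h)) (at s within {0..t})" for s
 proof -
  have "((\<lambda>s. F (x + s *R h)) has_derivative (\<lambda>u. F' (x + s *R h) (u *R h))) (at s within {0..t})"
   by (rule has_derivative_compose[where f="\<lambda>s. x + s *R h", OF _ der]) (auto intro!: derivative_eq_intros)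
  moreover have "(\<lambda>u. F' (x + s *R h) (u *R h)) = (\<lambda>u. u * F' (x + s *R h) h)"
   using linear_scale[OF has_derivative_linear[OF der[of "x + s *R h"]]] by auto
  ultimately show ?thesis by simp
 qed
 have "norm (F (x + t *R h) - F (x + 0 *R h)) <= B * norm (t - 0)"
 proof (rule differentiable_bound[of "{0..t}" "\<lambda>s. F (x + s *R h)" "\<lambda>s u. u * F' (x + s *R h) h" B])
  show "onorm (\<lambda>u. u * F' (x + s *R h) h) <= B" for s
  proof (rule onorm_bound)
   show "norm (u * F' (x + s *R h) h) <= B * norm u" for u
    using mult_right_mono[OF B[of "x + s *R h"], of "\<bar>u\<bar>"] by (simp add: abs_mult mult.commute)
  qed (use order_trans[OF abs_ge_zero B] in auto)
 qed (use d t in auto)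
 then show ?thesis using t by simp
qed

lemma directional_difference_tendsto:
 fixes F :: "'a::euclidean_space => real"
 assumes der: "(F has_derivative F') (at x)"
 shows "((\<lambda>t. (F (x + t *R h) - F x) / t) \<longlongrightarrow> F' h) (at 0)"
proof -
 have "((\<lambda>s. F (x + s *R h)) has_derivative (\<lambda>u. F' (u *R h))) (at 0)"
  by (rule has_derivative_compose[where f="\<lambda>s. x + s *R h" and g=F and g'=F']) (use der in \<open>auto intro!: derivative_eq_intros\<close>)
 moreover have "(\<lambda>u. F' (u *R h)) = (*) (F' h)"
  using linear_scale[OF has_derivative_linear[OF der], of _ h] by (auto simp: mult.commute)
 ultimately have "((\<lambda>s. F (x + s *R h)) has_real_derivative F' h) (at 0)"
  by (simp add: has_field_derivative_def)
 then show ?thesis by (simp add: has_field_derivative_iff)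
qed

text \<open>The set A is kept for the sake of A = \<Omega>, where the shift produces the boundary
  term. \<open>T n <= 1\<close> confines all shifted supports to one ball, on which the bound B of
  the derivative dominates.\<close>

lemma difference_quotient_integral_tendsto:
 fixes F :: "'a::euclidean_space => real"
 assumes der: "\<And>x. (F has_derivative F' x) (at x)" and K: "compact K" "\<And>x. x \<notin> K ==> F x = 0"
  and cont: "continuous_on UNIV (\<lambda>x. F' x h)" and A: "A \<in> sets borel"
  and T: "\<And>n. T n > 0" "\<And>n. T n <= 1" "T ----> 0"
 shows "(\<lambda>n. LBINT x. indicator A x * ((F (x + T n *R h) - F x) / T n)) ----> (LBINT x. indicator A x * F' x h)"
  and "L1 (\<lambda>x. F' x h)"
proof -
 have F'0: "F' x h = 0" if "x \<notin> K" for x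
 proof -
  have "(F has_derivative (\<lambda>_. 0)) (at x)"
  proof (rule has_derivative_transform_within_open[of "\<lambda>_. 0" _ _ _ "- K"])
   show "open (- K)" using K(1) by (simp add: compact_imp_closed open_Compl)
  qed (use that K(2) in auto)
  then show ?thesis using der[of x] has_derivative_unique by metis
 qed
 have Fc: "continuous_on UNIV F"
  using der by (auto intro!: continuous_at_imp_continuous_on has_derivative_continuous)
 obtain B where B: "\<And>x. norm (F' x h) <= B"
  using compact_support_bounded[OF cont K(1) F'0] by blast
 show "L1 (\<lambda>x. F' x h)"
  by (rule compact_support_integrable[OF cont K(1) F'0])
 have [measurable]: "F Borel" "(\<lambda>x. F' x h) Borel"
  using Fc cont by (auto intro: borel_measurable_continuous_onI)
 obtain R where R: "K \<subseteq> cball 0 R"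
  using compact_imp_bounded[OF K(1)] by (auto simp: bounded_iff subset_eq)
 let ?C = "cball (0::'a) (R + norm h)"
 show "(\<lambda>n. LBINT x. indicator A x * ((F (x + T n *R h) - F x) / T n)) ----> (LBINT x. indicator A x * F' x h)"
 proof (rule integral_dominated_convergence[where w="\<lambda>x. B * indicator ?C x"])
  have "emeasure lborel ?C < \<infinity>" by (rule emeasure_bounded_finite[OF bounded_cball])
  then show "L1 (\<lambda>x. B * indicator ?C x :: real)" by simp
  show "AE x in lborel. (\<lambda>n. indicator A x * ((F (x + T n *R h) - F x) / T n)) ----> indicator A x * F' x h"
  proof (rule AE_I2)
   fix x
   have "(\<lambda>n. (F (x + T n *R h) - F x) / T n) ----> F' x h"
   proof (rule filterlim_compose[OF directional_difference_tendsto[OF der]])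
    show "filterlim T (at 0) sequentially"
     using T(1,3) by (auto simp: filterlim_at intro!: always_eventually simp: less_imp_neq[THEN not_sym])
   qed
   then show "(\<lambda>n. indicator A x * ((F (x + T n *R h) - F x) / T n)) ----> indicator A x * F' x h"
    by (intro tendsto_intros)
  qed
  show "AE x in lborel. norm (indicator A x * ((F (x + T n *R h) - F x) / T n)) <= B * indicator ?C x" for n
  proof (rule AE_I2)
   fix x
   have B0: "B >= 0" using order_trans[OF norm_ge_zero B] .
   have b: "\<bar>(F (x + T n *R h) - F x) / T n\<bar> <= B"
    using directional_difference_bound[OF der, of h B "T n" x] B T(1)[of n] by (simp add: field_simps less_imp_le)
   show "norm (indicator A x * ((F (x + T n *R h) - F x) / T n)) <= B * indicator ?C x"
   proof (cases "x \<in> ?C")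
    case True
    then show ?thesis using b B0 by (auto simp: indicator_def)
   next
    case False
    then have x: "norm x > R + norm h" by simp
    have "norm (T n *R h) <= norm h" using T(1,2)[of n] by (simp add: mult_left_le_one_le less_imp_le)
    then have "norm (x + T n *R h) > R" using x norm_diff_ineq[of x "T n *R h"] by linarith
    moreover have "norm x > R" using x norm_ge_zero[of h] by linarith
    ultimately have "x \<notin> K" "x + T n *R h \<notin> K" using R by auto
    then show ?thesis using K(2) False by simp
   qed
  qed
 qed (use A in measurable)
qed

text \<open>By translation invariance every difference quotient has integral 0, and this passes to
  the limit.\<close>

lemma integral_deriv_zero:
 fixes F :: "'a::euclidean_space => real"
 assumes der: "\<And>x. (F has_derivative F' x) (at x)" and K: "compact K" "\<And>x. x \<notin> K ==> F x = 0"
  and cont: "continuous_on UNIV (\<lambda>x. F' x h)"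
 shows "(LBINT x. F' x h) = 0"
proof -
 have Fc: "continuous_on UNIV F"
  using der by (auto intro!: continuous_at_imp_continuous_on has_derivative_continuous)
 have Fi: "L1 F" by (rule compact_support_integrable[OF Fc K])
 have Fm: "F Borel" using Fi by (rule integrable_lborel_measurable)
 have "(LBINT x. (F (x + t *R h) - F x) / t) = 0" for t
  using integral_lborel_affine[of 1 F "t *R h"] integrable_lborel_affine[of 1 F "t *R h"] Fi Fm
  by (simp add: add.commute)
 then have z: "(LBINT x. indicator UNIV x * ((F (x + t *R h) - F x) / t)) = 0" for t
  by (simp only: indicator_UNIV mult_1)
 have "(\<lambda>n::nat. 0) ----> (LBINT x. indicator UNIV x * F' x h)"
  using difference_quotient_integral_tendsto(1)[OF der K cont, of UNIV "\<lambda>n. inverse (real (Suc n))", unfolded z]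
   LIMSEQ_inverse_real_of_nat by (simp add: inverse_le_1_iff)
 then show ?thesis by (simp add: LIMSEQ_const_iff)
qed

lemma integral_by_parts_test:
 fixes F \<theta> :: "'a::euclidean_space => real"
 assumes der: "\<And>x. (F has_derivative F' x) (at x)" and cont: "continuous_on UNIV (\<lambda>x. F' x h)"
  and \<theta>: "test_function \<Omega> \<theta>"
 shows "(LBINT x. F x * dd \<theta> x h) = - (LBINT x. F' x h * \<theta> x)"
  "L1 (\<lambda>x. F x * dd \<theta> x h)" "L1 (\<lambda>x. F' x h * \<theta> x)"
proof -
 obtain K where K: "compact K" "\<And>x. x \<notin> K ==> \<theta> x = 0" "\<And>x b. x \<notin> K ==> dd \<theta> x b = 0"
  using test_supp_deriv[OF \<theta>] by auto
 have Fc: "continuous_on UNIV F"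
  using der by (auto intro!: continuous_at_imp_continuous_on has_derivative_continuous)
 note \<theta>c = smooth_continuous[OF test_smooth[OF \<theta>]]
 note \<theta>'c = smooth_continuous[OF smooth_deriv[OF test_smooth[OF \<theta>]]]
 show i1: "L1 (\<lambda>x. F x * dd \<theta> x h)"
  by (rule compact_support_integrable[OF _ K(1)]) (auto intro!: continuous_on_mult Fc \<theta>'c simp: K(3))
 show i2: "L1 (\<lambda>x. F' x h * \<theta> x)"
  by (rule compact_support_integrable[OF _ K(1)]) (auto intro!: continuous_on_mult cont \<theta>c simp: K(2))
 have "(LBINT x. F x * dd \<theta> x h + F' x h * \<theta> x) = 0"
 proof (rule integral_deriv_zero[where F="\<lambda>x. F x * \<theta> x" and F'="\<lambda>x h. F x * dd \<theta> x h + F' x h * \<theta> x", OF _ K(1)])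
  show "((\<lambda>x. F x * \<theta> x) has_derivative (\<lambda>h. F x * dd \<theta> x h + F' x h * \<theta> x)) (at x)" for x
   by (rule has_derivative_mult[OF der smooth_has_derivative[OF test_smooth[OF \<theta>]]])
 qed (auto simp: K(2) intro!: continuous_on_add continuous_on_mult Fc cont \<theta>c \<theta>'c)
 then show "(LBINT x. F x * dd \<theta> x h) = - (LBINT x. F' x h * \<theta> x)"
  using i1 i2 by simp
qed

definition grad :: "(real^3 => real) => real^3 => real^3" where
 "grad \<phi> x = (\<chi> j. dd \<phi> x (axis j 1))"

lemma grad_inner:
 assumes "(\<phi> has_derivative \<phi>') (at x)"
 shows "grad \<phi> x \<bullet> h = \<phi>' h"
proof -
 have eq: "dd \<phi> x = \<phi>'" using frechet_derivative_at[OF assms] by simp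
 have lin: "linear \<phi>'" using assms has_derivative_linear by blast
 have "h = (\<Sum>j\<in>UNIV. (h $ j) *R axis j 1)"
  using basis_expansion[of h] by (simp add: scalar_mult_eq_scaleR)
 then have "\<phi>' h = \<phi>' (\<Sum>j\<in>UNIV. (h $ j) *R axis j 1)" by simp
 also have "\<dots> = (\<Sum>j\<in>UNIV. (h $ j) *R \<phi>' (axis j 1))"
  using lin by (simp only: linear_sum linear_scale)
 also have "\<dots> = grad \<phi> x \<bullet> h"
  by (simp add: grad_def inner_vec_def eq mult.commute)
 finally show ?thesis by simp
qed

lemma grad_smooth_inner: "smooth \<phi> ==> grad \<phi> x \<bullet> h = dd \<phi> x h"
 by (rule grad_inner[OF smooth_has_derivative])

lemma continuous_on_grad: "smooth \<phi> ==> continuous_on UNIV (grad \<phi>)"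
 unfolding grad_def[abs_def] by (intro continuous_on_vec_lambda smooth_continuous smooth_deriv)

lemma grad_test_square_integrable:
 assumes "test_function \<Omega> \<phi>"
 shows "L2 (grad \<phi>)"
proof -
 have [measurable]: "grad \<phi> Borel"
  using continuous_on_grad[OF test_smooth[OF assms]] by (rule borel_measurable_continuous_onI)
 have "(norm (grad \<phi> x))\<^sup>2 = (\<Sum>j\<in>UNIV. (norm (dd \<phi> x (axis j 1)))\<^sup>2)" for x
  by (simp only: power2_norm_eq_inner inner_vec_def grad_def) simp
 then have "L1 (\<lambda>x. (norm (grad \<phi> x))\<^sup>2)"
  using test_square_integrable[OF test_deriv[OF assms]]
  by (simp add: square_integrable_def)
 then show ?thesis by (simp add: square_integrable_def)
qed

text \<open>Only the test functions refer to \<Omega>. The functions themselves live on the whole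
  space and are integrated against \<open>lborel\<close>, so that extension by zero becomes a
  statement about enlarging \<Omega>.\<close>

definition wgrad_on :: "(real^3) set => (real^3 => real) => (real^3 => real^3) => bool" where
 "wgrad_on \<Omega> p q \<longleftrightarrow> L2 p \<and> L2 q \<and>
   (\<forall>\<phi> h. test_function \<Omega> \<phi> -->
    (LBINT x. p x * dd \<phi> x h) = - (LBINT x. (q x \<bullet> h) * \<phi> x))"

text \<open>Bounded support makes p and q integrable as well, which is what convolution
  requires.\<close>

definition wgrad :: "(real^3 => real) => (real^3 => real^3) => bool" where
 "wgrad p q \<longleftrightarrow> wgrad_on UNIV p q \<and> (\<exists>S. bounded S \<and> (\<forall>x. x \<notin> S --> p x = 0 \<and> q x = 0))"

lemma wgradD:
 assumes "wgrad p q"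
 shows "L2 p" "L2 q" "L1 p" "L1 q"
  "p Borel" "q Borel"
  "test_function UNIV \<phi> ==> (LBINT x. p x * dd \<phi> x h) = - (LBINT x. (q x \<bullet> h) * \<phi> x)"
  "\<exists>S. bounded S \<and> (\<forall>x. x \<notin> S --> p x = 0 \<and> q x = 0)"
proof -
 show p: "L2 p" and q: "L2 q"
  and S: "\<exists>S. bounded S \<and> (\<forall>x. x \<notin> S --> p x = 0 \<and> q x = 0)"
  and "test_function UNIV \<phi> ==> (LBINT x. p x * dd \<phi> x h) = - (LBINT x. (q x \<bullet> h) * \<phi> x)"
  using assms unfolding wgrad_def wgrad_on_def by blast+
 show "p Borel" "q Borel"
  using p q by (auto simp: square_integrable_def)
 obtain S where "bounded S" "\<forall>x. x \<notin> S --> p x = 0 \<and> q x = 0" using S by blast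
 then show "L1 p" "L1 q"
  using L2_bounded_support_integrable[OF p, of S] L2_bounded_support_integrable[OF q, of S] by auto
qed

lemma L2_inner_const:
 fixes q :: "'a => 'b::euclidean_space"
 assumes "square_integrable M q"
 shows "square_integrable M (\<lambda>x. q x \<bullet> h)"
proof (rule L2_bound[OF assms, of _ "norm h"])
 show "AE x in M. norm (q x \<bullet> h) <= norm h * norm (q x)"
 proof (rule AE_I2)
  fix x show "norm (q x \<bullet> h) <= norm h * norm (q x)"
   using Cauchy_Schwarz_ineq2[of "q x" h] by (simp add: mult.commute)
 qed
qed (use assms in \<open>auto simp: square_integrable_def\<close>)

lemma wgrad_onI_axis:
 assumes p: "L2 p" and q: "L2 q"
  and ax: "\<And>\<phi> j. test_function \<Omega> \<phi> ==>
    (LBINT x. p x * dd \<phi> x (axis j 1)) = - (LBINT x. q x $ j * \<phi> x)"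
 shows "wgrad_on \<Omega> p q"
 unfolding wgrad_on_def
proof (intro conjI allI impI p q)
 fix \<phi> :: "real^3 => real" and h :: "real^3" assume \<phi>: "test_function \<Omega> \<phi>"
 have i1: "L1 (\<lambda>x. p x * dd \<phi> x b)" for b
  using integrable_inner_L2[OF p test_square_integrable[OF test_deriv[OF \<phi>]]] by simp
 have i2: "L1 (\<lambda>x. q x $ j * \<phi> x)" for j
  using integrable_inner_L2[OF L2_inner_const[OF q, of "axis j 1"] test_square_integrable[OF \<phi>]]
  by (simp add: inner_axis)
 have e: "dd \<phi> x h = (\<Sum>j\<in>UNIV. h $ j * dd \<phi> x (axis j 1))" for x
  using grad_smooth_inner[OF test_smooth[OF \<phi>], of x h] by (simp add: grad_def inner_vec_def mult.commute)
 have "(LBINT x. p x * dd \<phi> x h) = (LBINT x. (\<Sum>j\<in>UNIV. h $ j * (p x * dd \<phi> x (axis j 1))))"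
  by (simp add: e sum_distrib_left mult_ac)
 also have "\<dots> = (\<Sum>j\<in>UNIV. h $ j * (LBINT x. p x * dd \<phi> x (axis j 1)))"
  using i1 by (subst Bochner_Integration.integral_sum) auto
 also have "\<dots> = - (\<Sum>j\<in>UNIV. h $ j * (LBINT x. q x $ j * \<phi> x))"
  by (simp add: ax[OF \<phi>] sum_negf)
 also have "(\<Sum>j\<in>UNIV. h $ j * (LBINT x. q x $ j * \<phi> x)) = (LBINT x. (\<Sum>j\<in>UNIV. h $ j * (q x $ j * \<phi> x)))"
  using i2 by (subst Bochner_Integration.integral_sum) auto
 also have "\<dots> = (LBINT x. (q x \<bullet> h) * \<phi> x)"
  by (simp add: inner_vec_def sum_distrib_left sum_distrib_right mult_ac)
 finally show "(LBINT x. p x * dd \<phi> x h) = - (LBINT x. (q x \<bullet> h) * \<phi> x)" .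
qed

lemma conv_inner:
 fixes q :: "real^3 => real^3"
 assumes "test_function UNIV \<eta>" "L1 q"
 shows "conv \<eta> q x \<bullet> h = conv \<eta> (\<lambda>y. q y \<bullet> h) x"
 using integral_inner_left[OF conv_integrable[OF assms, of x], of h] by (simp add: conv_def)

lemma frechet_derivative_reflect:
 assumes "smooth \<eta>"
 shows "frechet_derivative (\<lambda>y. \<eta> (x - y)) (at y) h = - dd \<eta> (x - y) h"
proof -
 have "((\<lambda>y. \<eta> (x - y)) has_derivative (\<lambda>h. dd \<eta> (x - y) (- h))) (at y)"
  by (rule has_derivative_compose[where f="\<lambda>y. x - y", OF _ smooth_has_derivative[OF assms]]) (auto intro!: derivative_eq_intros)
 then have "frechet_derivative (\<lambda>y. \<eta> (x - y)) (at y) h = dd \<eta> (x - y) (- h)"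
  using frechet_derivative_at by metis
 then show ?thesis
  using linear_neg[OF has_derivative_linear[OF smooth_has_derivative[OF assms]]] by metis
qed

lemma test_reflect: "test_function UNIV \<eta> ==> test_function UNIV (\<lambda>y. \<eta> (x - y))"
 using test_shift[of \<eta> "-1" x] by simp

text \<open>The derivative falls on the mollifier, and y \<mapsto> \<eta>(x - y) is a test function;
  the sign of the reflection cancels that of the integration by parts.\<close>

lemma wgrad_conv:
 assumes W: "wgrad p q" and \<eta>: "test_function UNIV \<eta>"
 shows "dd (conv \<eta> p) x h = conv \<eta> q x \<bullet> h"
proof -
 note W' = wgradD[OF W]
 have "dd (conv \<eta> p) x h = (LBINT y. dd \<eta> (x - y) h * p y)"
  by (simp add: conv_frechet_derivative[OF \<eta> W'(3)] conv_def)
 also have "\<dots> = - (LBINT y. p y * frechet_derivative (\<lambda>y. \<eta> (x - y)) (at y) h)"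
  by (simp add: frechet_derivative_reflect[OF test_smooth[OF \<eta>]] mult.commute)
 also have "\<dots> = (LBINT y. (q y \<bullet> h) * \<eta> (x - y))"
  using W'(7)[OF test_reflect[OF \<eta>]] by simp
 also have "\<dots> = conv \<eta> q x \<bullet> h"
  by (simp add: conv_inner[OF \<eta> W'(4)]) (simp add: conv_def mult.commute)
 finally show ?thesis .
qed

lemma wgrad_conv_grad:
 assumes W: "wgrad p q" and \<eta>: "test_function UNIV \<eta>"
 shows "grad (conv \<eta> p) = conv \<eta> q"
proof
 fix x show "grad (conv \<eta> p) x = conv \<eta> q x"
  unfolding grad_def wgrad_conv[OF assms] by (simp add: vec_eq_iff inner_axis)
qed

lemma conv_square_integrable:
 fixes f :: "'a::euclidean_space => 'b::euclidean_space"
 assumes \<eta>: "test_function UNIV \<eta>" and f: "L1 f" "bounded S" "\<And>x. x \<notin> S ==> f x = 0"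
 shows "L2 (conv \<eta> f)"
proof -
 obtain K where K: "compact K" "\<And>x. x \<notin> K ==> \<eta> x = 0" using test_supp[OF \<eta>] by auto
 have cK: "compact {x + y | x y. x \<in> closure S \<and> y \<in> K}"
  using f(2) K(1) by (intro compact_sums) (auto simp: compact_closure)
 have "test_function UNIV (conv \<eta> f)"
 proof (rule test_functionI[OF conv_smooth[OF \<eta> f(1)] cK])
  fix x assume "conv \<eta> f x \<noteq> 0"
  then obtain y where y: "\<eta> (x - y) \<noteq> 0" "f y \<noteq> 0" by (rule conv_support)
  then have "x - y \<in> K" "y \<in> closure S" using K(2) f(3) closure_subset[of S] by auto
  then show "x \<in> {x + y | x y. x \<in> closure S \<and> y \<in> K}" by (intro CollectI exI[of _ y] exI[of _ "x - y"]) auto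
 qed auto
 then show ?thesis by (rule test_square_integrable)
qed

text \<open>\<zeta> \<phi> is a test function of \<Omega> for every test function \<phi> of the
  whole space. Thus a local gradient yields a global one, to which convolution and change of
  variables apply.\<close>

lemma wgrad_on_cutoff:
 assumes W: "wgrad_on \<Omega> p q" and \<zeta>: "test_function \<Omega> \<zeta>"
 shows "wgrad (\<lambda>x. \<zeta> x * p x) (\<lambda>x. \<zeta> x *R q x + p x *R grad \<zeta> x)"
proof -
 have p: "L2 p" and q: "L2 q"
  and ibp: "\<And>\<phi> h. test_function \<Omega> \<phi> ==> (LBINT x. p x * dd \<phi> x h) = - (LBINT x. (q x \<bullet> h) * \<phi> x)"
  using W by (auto simp: wgrad_on_def)
 have [measurable]: "p Borel" "q Borel"
  using p q by (auto simp: square_integrable_def)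
 have [measurable]: "\<zeta> Borel" "grad \<zeta> Borel"
  using smooth_measurable[OF test_smooth[OF \<zeta>]] grad_test_square_integrable[OF \<zeta>] by (auto simp: square_integrable_def)
 obtain B where B: "\<And>x. norm (\<zeta> x) <= B" using test_bounded[OF \<zeta>] by blast
 obtain K where K: "compact K" "\<And>x. x \<notin> K ==> \<zeta> x = 0" "\<And>x b. x \<notin> K ==> dd \<zeta> x b = 0"
  using test_supp_deriv[OF \<zeta>] by auto
 have gK: "grad \<zeta> x = 0" if "x \<notin> K" for x using K(3)[OF that] by (simp add: grad_def vec_eq_iff)
 obtain B' where B': "\<And>x. norm (grad \<zeta> x) <= B'"
  using compact_support_bounded[OF continuous_on_grad[OF test_smooth[OF \<zeta>]] K(1) gK] by blast
 have q0: "L2 (\<lambda>x. \<zeta> x * p x)"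
  by (rule L2_bound[OF p, of _ B]) (auto simp: abs_mult intro!: AE_I2 mult_right_mono B[unfolded real_norm_def])
 have q1: "L2 (\<lambda>x. \<zeta> x *R q x)"
  by (rule L2_bound[OF q, of _ B]) (auto intro!: AE_I2 mult_right_mono B[unfolded real_norm_def])
 have q2: "L2 (\<lambda>x. p x *R grad \<zeta> x)"
  by (rule L2_bound[OF p, of _ B']) (auto simp: mult.commute[of "\<bar>p _\<bar>"] intro!: AE_I2 mult_right_mono B')
 have "wgrad_on UNIV (\<lambda>x. \<zeta> x * p x) (\<lambda>x. \<zeta> x *R q x + p x *R grad \<zeta> x)"
  unfolding wgrad_on_def
 proof (intro conjI allI impI L2_add q0 q1 q2)
  fix \<phi> :: "real^3 => real" and h :: "real^3" assume \<phi>: "test_function UNIV \<phi>"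
  note s\<phi> = test_smooth[OF \<phi>] and s\<zeta> = test_smooth[OF \<zeta>]
  have t: "test_function \<Omega> (\<lambda>x. \<zeta> x * \<phi> x)" by (rule test_mult(1)[OF \<zeta> s\<phi>])
  have fr: "dd (\<lambda>x. \<zeta> x * \<phi> x) x h = \<zeta> x * dd \<phi> x h + (grad \<zeta> x \<bullet> h) * \<phi> x" for x
   using frechet_derivative_at[OF has_derivative_mult[OF smooth_has_derivative[OF s\<zeta>, of x] smooth_has_derivative[OF s\<phi>, of x]]]
   by (simp add: grad_smooth_inner[OF s\<zeta>] fun_eq_iff)
  have i1: "L1 (\<lambda>x. (\<zeta> x * p x) * dd \<phi> x h)"
   using integrable_inner_L2[OF q0 test_square_integrable[OF test_deriv[OF \<phi>]]] by simp
  have i2: "L1 (\<lambda>x. ((p x *R grad \<zeta> x) \<bullet> h) * \<phi> x)"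
   using integrable_inner_L2[OF L2_inner_const[OF q2] test_square_integrable[OF \<phi>]] by simp
  have i3: "L1 (\<lambda>x. ((\<zeta> x *R q x) \<bullet> h) * \<phi> x)"
   using integrable_inner_L2[OF L2_inner_const[OF q1] test_square_integrable[OF \<phi>]] by simp
  have "(LBINT x. (\<zeta> x * p x) * dd \<phi> x h) + (LBINT x. ((p x *R grad \<zeta> x) \<bullet> h) * \<phi> x)
    = (LBINT x. (\<zeta> x * p x) * dd \<phi> x h + ((p x *R grad \<zeta> x) \<bullet> h) * \<phi> x)"
   by (rule Bochner_Integration.integral_add[OF i1 i2, symmetric])
  also have "\<dots> = (LBINT x. p x * dd (\<lambda>x. \<zeta> x * \<phi> x) x h)"
   unfolding fr by (simp add: algebra_simps)
  also have "\<dots> = - (LBINT x. (q x \<bullet> h) * (\<zeta> x * \<phi> x))" by (rule ibp[OF t])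
  also have "\<dots> = - (LBINT x. ((\<zeta> x *R q x) \<bullet> h) * \<phi> x)" by (simp add: mult_ac)
  finally show "(LBINT x. (\<zeta> x * p x) * dd \<phi> x h) = - (LBINT x. ((\<zeta> x *R q x + p x *R grad \<zeta> x) \<bullet> h) * \<phi> x)"
   using i2 i3 by (simp add: inner_add_left distrib_right)
 qed
 then show ?thesis
  unfolding wgrad_def using compact_imp_bounded[OF K(1)] by (intro conjI exI[of _ K]) (auto simp: K gK)
qed

section \<open>Orthogonality of gradients to divergence-free fields\<close>

definition scalar_divfree :: "(real^3) set => (real^3 => real^3) => bool" where
 "scalar_divfree \<Omega> h \<longleftrightarrow> L2 h \<and> (\<forall>\<phi>. test_function \<Omega> \<phi> --> (LBINT x. h x \<bullet> grad \<phi> x) = 0)"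

text \<open>This isolates the one geometric question, whether the mollified z is supported compactly
  in \<Omega>. For z supported away from the boundary small centred mollifiers do, and at the
  boundary mollifiers that push along a cone.\<close>

lemma divfree_orthogonal_of_conv:
 assumes h: "scalar_divfree \<Omega> h" and z: "wgrad z q"
  and \<eta>: "mollifying \<eta>" and test: "eventually (\<lambda>n. test_function \<Omega> (conv (\<eta> n) z)) sequentially"
 shows "(LBINT x. h x \<bullet> q x) = 0"
proof -
 note W = wgradD[OF z]
 obtain S where S: "bounded S" "\<And>x. x \<notin> S ==> q x = 0" using W(8) by blast
 have lim: "(\<lambda>n. LBINT x. h x \<bullet> conv (\<eta> n) q x) ----> (LBINT x. h x \<bullet> q x)"
  using h W conv_square_integrable[OF mollifying_test[OF \<eta>] W(4) S] mollifying_L2[OF \<eta> W(4)]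
  by (intro L2_inner_tendsto) (auto simp: scalar_divfree_def square_integrable_def)
 have "eventually (\<lambda>n. (LBINT x. h x \<bullet> conv (\<eta> n) q x) = 0) sequentially"
  using test
 proof eventually_elim
  case (elim n)
  then have "(LBINT x. h x \<bullet> grad (conv (\<eta> n) z) x) = 0"
   using h by (simp add: scalar_divfree_def)
  then show ?case by (simp add: wgrad_conv_grad[OF z mollifying_test[OF \<eta>]])
 qed
 then have "(\<lambda>n. LBINT x. h x \<bullet> conv (\<eta> n) q x) ----> 0" by (rule tendsto_eventually)
 then show ?thesis by (rule LIMSEQ_unique[OF lim])
qed

lemma divfree_orthogonal_compact:
 assumes h: "scalar_divfree \<Omega> h" and z: "wgrad z q" and \<Omega>: "open \<Omega>"
  and K: "compact K" "K \<subseteq> \<Omega>" "\<And>x. x \<notin> K ==> z x = 0"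
 shows "(LBINT x. h x \<bullet> q x) = 0"
proof -
 obtain \<eta> :: "nat => real^3 => real" where \<eta>: "mollifying \<eta>" "\<And>n. mollifier 0 (inverse (real (Suc n))) (\<eta> n)"
  using mollifying_exists by blast
 note W = wgradD[OF z]
 have "\<exists>d>0. \<forall>x\<in>K. \<forall>y\<in>- \<Omega>. d <= dist x y"
 proof (rule separate_compact_closed[OF K(1)])
  show "closed (- \<Omega>)" using \<Omega> by (rule closed_Compl)
  show "K \<inter> - \<Omega> = {}" using K(2) by blast
 qed
 then obtain d where d: "d > 0" "\<forall>x\<in>K. \<forall>y\<in>- \<Omega>. d <= dist x y" by blast
 have "eventually (\<lambda>n. inverse (real (Suc n)) < d/2) sequentially"
  using LIMSEQ_inverse_real_of_nat d(1) by (intro order_tendstoD) auto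
 then have "eventually (\<lambda>n. test_function \<Omega> (conv (\<eta> n) z)) sequentially"
 proof eventually_elim
  case (elim n)
  have cK: "compact {x + y | x y. x \<in> K \<and> y \<in> cball 0 (d/2)}" using K(1) by (intro compact_sums) auto
  show ?case
  proof (rule test_functionI[OF conv_smooth[OF mollifying_test[OF \<eta>(1)] W(3)] cK])
   show "{x + y | x y. x \<in> K \<and> y \<in> cball 0 (d/2)} \<subseteq> \<Omega>"
   proof
    fix w assume "w \<in> {x + y | x y. x \<in> K \<and> y \<in> cball 0 (d/2)}"
    then obtain x y where w: "w = x + y" "x \<in> K" "norm y <= d / 2" by auto
    show "w \<in> \<Omega>"
    proof (rule ccontr)
     assume "w \<notin> \<Omega>"
     then have "d <= dist x w" using d(2) w(2) by auto
     then show False using w d(1) by (simp add: dist_norm)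
    qed
   qed
   fix x assume "conv (\<eta> n) z x \<noteq> 0"
   then obtain y where y: "\<eta> n (x - y) \<noteq> 0" "z y \<noteq> 0" by (rule conv_support)
   then have "y \<in> K" "norm (x - y) < d/2" using K(3) mollifier_D(3)[OF \<eta>(2) y(1)] elim by auto
   then show "x \<in> {x + y | x y. x \<in> K \<and> y \<in> cball 0 (d/2)}" by (intro CollectI exI[of _ y] exI[of _ "x - y"]) auto
  qed
 qed
 then show ?thesis by (rule divfree_orthogonal_of_conv[OF h z \<eta>(1)])
qed

section \<open>Two-dimensional Hausdorff measure\<close>

definition hausdorff2_pre :: "real => (real^3) set => ennreal" where
 "hausdorff2_pre d A = (INF C\<in>{C :: nat => (real^3) set. A \<subseteq> (\<Union>n. C n) \<and> (\<forall>n. bounded (C n) \<and> diameter (C n) <= d)}.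
    \<Sum>n. ennreal (pi / 4 * (diameter (C n))\<^sup>2))"

lemma hausdorff2_outer_eq: "hausdorff2_outer A = (SUP d\<in>{0<..}. hausdorff2_pre d A)"
 by (simp add: hausdorff2_outer_def hausdorff2_pre_def)

lemma hausdorff2_pre_le:
 assumes "A \<subseteq> (\<Union>n. C n)" "\<And>n. bounded (C n)" "\<And>n. diameter (C n) <= d"
 shows "hausdorff2_pre d A <= (\<Sum>n. ennreal (pi / 4 * (diameter (C n))\<^sup>2))"
 unfolding hausdorff2_pre_def by (rule INF_lower) (use assms in auto)

lemma hausdorff2_pre_mono:
 assumes "A \<subseteq> B" "d' <= d"
 shows "hausdorff2_pre d A <= hausdorff2_pre d' B"
proof (subst (2) hausdorff2_pre_def, rule INF_greatest, clarify)
 fix C :: "nat => (real^3) set"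
 assume C: "B \<subseteq> (\<Union>n. C n)" "\<forall>n. bounded (C n) \<and> diameter (C n) <= d'"
 show "hausdorff2_pre d A <= (\<Sum>n. ennreal (pi / 4 * (diameter (C n))\<^sup>2))"
 proof (rule hausdorff2_pre_le)
  show "A \<subseteq> (\<Union>n. C n)" using C(1) assms(1) by (rule order_trans[rotated])
  show "bounded (C n)" "diameter (C n) <= d" for n using C(2) assms(2) by (auto intro: order_trans)
 qed
qed

lemma hausdorff2_outer_mono: "A \<subseteq> B ==> hausdorff2_outer A <= hausdorff2_outer B"
 unfolding hausdorff2_outer_eq by (intro SUP_mono' hausdorff2_pre_mono) auto

lemma hausdorff2_pre_le_outer: "d > 0 ==> hausdorff2_pre d A <= hausdorff2_outer A"
 unfolding hausdorff2_outer_eq by (rule SUP_upper) auto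

lemma hausdorff2_outer_empty: "hausdorff2_outer {} = 0"
proof -
 have "hausdorff2_pre d {} <= 0" if "d > 0" for d
  using hausdorff2_pre_le[of "{}" "\<lambda>_. {}" d] that by simp
 then show ?thesis unfolding hausdorff2_outer_eq by (intro antisym SUP_least) auto
qed

lemma hausdorff2_pre_countable_subadditive:
 assumes d: "d > 0"
 shows "hausdorff2_pre d (\<Union>i. A i) <= (\<Sum>i. hausdorff2_pre d (A i))"
proof (rule ennreal_le_epsilon)
 fix e :: real assume fin: "(\<Sum>i. hausdorff2_pre d (A i)) < top" and e: "e > 0"
 have "\<exists>C. A i \<subseteq> (\<Union>n. C n) \<and> (\<forall>n. bounded (C n) \<and> diameter (C n) <= d) \<and>
   (\<Sum>n. ennreal (pi / 4 * (diameter (C n))\<^sup>2)) <= hausdorff2_pre d (A i) + ennreal (e * (1/2) ^ Suc i)" for i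
 proof -
  have f: "hausdorff2_pre d (A i) < top" using fin ennreal_suminf_lessD by blast
  have "hausdorff2_pre d (A i) < hausdorff2_pre d (A i) + ennreal (e * (1/2) ^ Suc i)"
   using f e by (cases "hausdorff2_pre d (A i)") (auto simp: ennreal_less_iff simp flip: ennreal_plus)
  then show ?thesis
   by (subst (asm) (1) hausdorff2_pre_def) (auto simp: INF_less_iff intro: less_imp_le)
 qed
 then obtain C where C: "\<And>i. A i \<subseteq> (\<Union>n. C i n)" "\<And>i n. bounded (C i n)" "\<And>i n. diameter (C i n) <= d"
   "\<And>i. (\<Sum>n. ennreal (pi / 4 * (diameter (C i n))\<^sup>2)) <= hausdorff2_pre d (A i) + ennreal (e * (1/2) ^ Suc i)"
  by metis
 let ?C = "\<lambda>k. case prod_decode k of (i, n) => C i n"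
 have "(\<Union>i. A i) \<subseteq> (\<Union>k. ?C k)"
 proof
  fix x assume "x \<in> (\<Union>i. A i)"
  then obtain i n where "x \<in> C i n" using C(1) by blast
  then show "x \<in> (\<Union>k. ?C k)" by (intro UN_I[of "prod_encode (i, n)"]) auto
 qed
 then have "hausdorff2_pre d (\<Union>i. A i) <= (\<Sum>k. ennreal (pi / 4 * (diameter (?C k))\<^sup>2))"
  by (rule hausdorff2_pre_le) (auto simp: C split: prod.split)
 also have "\<dots> = (\<Sum>k. (\<lambda>(i, n). ennreal (pi / 4 * (diameter (C i n))\<^sup>2)) (prod_decode k))"
  by (intro suminf_cong) (auto split: prod.split)
 also have "\<dots> = (\<Sum>i. \<Sum>n. ennreal (pi / 4 * (diameter (C i n))\<^sup>2))"
  by (rule suminf_ennreal_2dimen) simp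
 also have "\<dots> <= (\<Sum>i. hausdorff2_pre d (A i) + ennreal (e * (1/2) ^ Suc i))"
  by (intro suminf_le C(4) summableI)
 also have "\<dots> = (\<Sum>i. hausdorff2_pre d (A i)) + (\<Sum>i. ennreal (e * (1/2) ^ Suc i))"
  by (intro suminf_add[symmetric] summableI)
 also have "(\<Sum>i. ennreal (e * (1/2) ^ Suc i)) = ennreal e"
 proof (rule suminf_ennreal_eq)
  show "(\<lambda>i. e * (1/2) ^ Suc i) sums e"
   using sums_mult[OF power_half_series, of e] by simp
 qed (use e in auto)
 finally show "hausdorff2_pre d (\<Union>i. A i) <= (\<Sum>i. hausdorff2_pre d (A i)) + ennreal e" .
qed

lemma hausdorff2_subadditive:
 "hausdorff2_outer (\<Union>i. A i) <= (\<Sum>i. hausdorff2_outer (A i))"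
proof (subst hausdorff2_outer_eq, rule SUP_least)
 fix d :: real assume "d \<in> {0<..}"
 then have d: "d > 0" by simp
 show "hausdorff2_pre d (\<Union>i. A i) <= (\<Sum>i. hausdorff2_outer (A i))"
  using hausdorff2_pre_countable_subadditive[OF d, of A]
  by (rule order_trans) (intro suminf_le summableI hausdorff2_pre_le_outer d)
qed

lemma hausdorff2_outer_subadditive: "hausdorff2_outer (A \<union> B) <= hausdorff2_outer A + hausdorff2_outer B"
proof -
 let ?A = "\<lambda>i::nat. if i = 0 then A else if i = 1 then B else {}"
 have "(\<Union>i. ?A i) = A \<union> B" by (auto split: if_splits)
 then have "hausdorff2_outer (A \<union> B) <= (\<Sum>i. hausdorff2_outer (?A i))"
  using hausdorff2_subadditive[of ?A] by simp
 also have "\<dots> = (\<Sum>i\<in>{0,1}. hausdorff2_outer (?A i))"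
  by (rule suminf_finite) (auto simp: hausdorff2_outer_empty)
 finally show ?thesis by simp
qed

lemma hausdorff2_outer_eq_seq:
 assumes \<delta>: "\<delta> > 0"
 shows "hausdorff2_outer A = (SUP n. hausdorff2_pre (\<delta> / real (Suc n)) A)"
  "incseq (\<lambda>n. hausdorff2_pre (\<delta> / real (Suc n)) A)"
proof -
 show "incseq (\<lambda>n. hausdorff2_pre (\<delta> / real (Suc n)) A)"
  using \<delta> by (intro incseq_SucI hausdorff2_pre_mono) (auto simp: field_simps)
 show "hausdorff2_outer A = (SUP n. hausdorff2_pre (\<delta> / real (Suc n)) A)"
 proof (rule antisym)
  show "hausdorff2_outer A <= (SUP n. hausdorff2_pre (\<delta> / real (Suc n)) A)"
   unfolding hausdorff2_outer_eq
  proof (rule SUP_mono)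
   fix d :: real assume "d \<in> {0<..}"
   then obtain n where "\<delta> / d < real n" using reals_Archimedean2 by blast
   then have "\<delta> / real (Suc n) <= d" using \<open>d \<in> {0<..}\<close> \<delta> by (auto simp: field_simps)
   then show "\<exists>n\<in>UNIV. hausdorff2_pre d A <= hausdorff2_pre (\<delta> / real (Suc n)) A"
    by (intro bexI[of _ n] hausdorff2_pre_mono) auto
  qed
  show "(SUP n. hausdorff2_pre (\<delta> / real (Suc n)) A) <= hausdorff2_outer A"
   using \<delta> by (intro SUP_least hausdorff2_pre_le_outer) auto
 qed
qed

text \<open>A covering set of diameter at most d < \<delta> cannot meet both A and B, so each cover
  of the union splits into a cover of A and a cover of B.\<close>

lemma hausdorff2_pre_separated:
 assumes sep: "\<And>a b. a \<in> A ==> b \<in> B ==> \<delta> <= dist a b" and d: "0 < d" "d < \<delta>"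
 shows "hausdorff2_pre d A + hausdorff2_pre d B <= hausdorff2_pre d (A \<union> B)"
proof (subst (3) hausdorff2_pre_def, rule INF_greatest, clarify)
 fix C :: "nat => (real^3) set"
 assume C: "A \<union> B \<subseteq> (\<Union>n. C n)" "\<forall>n. bounded (C n) \<and> diameter (C n) <= d"
 define CA CB where "CA n = (if C n \<inter> A \<noteq> {} then C n else {})" and "CB n = (if C n \<inter> B \<noteq> {} then C n else {})" for n
 have one: "C n \<inter> A = {} \<or> C n \<inter> B = {}" for n
 proof (rule ccontr)
  assume "\<not> ?thesis"
  then obtain a b where ab: "a \<in> C n" "a \<in> A" "b \<in> C n" "b \<in> B" by blast
  then have "dist a b <= diameter (C n)" using C(2) by (auto intro: diameter_bounded_bound)
  then show False using sep[of a b] ab C(2) d by (auto simp: not_le dest!: spec[of _ n])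
 qed
 have "hausdorff2_pre d A + hausdorff2_pre d B <=
   (\<Sum>n. ennreal (pi / 4 * (diameter (CA n))\<^sup>2)) + (\<Sum>n. ennreal (pi / 4 * (diameter (CB n))\<^sup>2))"
 proof (intro add_mono hausdorff2_pre_le)
  show "A \<subseteq> (\<Union>n. CA n)" "B \<subseteq> (\<Union>n. CB n)" using C(1) by (fastforce simp: CA_def CB_def)+
 qed (use C(2) d in \<open>auto simp: CA_def CB_def\<close>)
 also have "\<dots> = (\<Sum>n. ennreal (pi / 4 * (diameter (CA n))\<^sup>2) + ennreal (pi / 4 * (diameter (CB n))\<^sup>2))"
  by (intro suminf_add summableI)
 also have "\<dots> <= (\<Sum>n. ennreal (pi / 4 * (diameter (C n))\<^sup>2))"
  using one by (intro suminf_le summableI) (auto simp: CA_def CB_def)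
 finally show "hausdorff2_pre d A + hausdorff2_pre d B <= (\<Sum>n. ennreal (pi / 4 * (diameter (C n))\<^sup>2))" .
qed

lemma hausdorff2_outer_separated:
 assumes sep: "\<And>a b. a \<in> A ==> b \<in> B ==> \<delta> <= dist a b" and \<delta>: "0 < \<delta>"
 shows "hausdorff2_outer A + hausdorff2_outer B <= hausdorff2_outer (A \<union> B)"
proof -
 have \<delta>2: "\<delta>/2 > 0" using \<delta> by simp
 have "hausdorff2_outer A + hausdorff2_outer B
   = (SUP n. hausdorff2_pre (\<delta> / 2 / real (Suc n)) A + hausdorff2_pre (\<delta> / 2 / real (Suc n)) B)"
  unfolding hausdorff2_outer_eq_seq(1)[OF \<delta>2]
  by (rule ennreal_SUP_add[OF hausdorff2_outer_eq_seq(2)[OF \<delta>2] hausdorff2_outer_eq_seq(2)[OF \<delta>2], symmetric])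
 also have "\<dots> <= hausdorff2_outer (A \<union> B)"
 proof (rule SUP_least)
  fix n
  let ?d = "\<delta> / 2 / real (Suc n)"
  have "0 < ?d" using \<delta> by simp
  moreover have "?d < \<delta>" using \<delta> by (simp add: field_simps add_pos_nonneg)
  ultimately show "hausdorff2_pre ?d A + hausdorff2_pre ?d B <= hausdorff2_outer (A \<union> B)"
   using hausdorff2_pre_separated[OF sep, of A B ?d] hausdorff2_pre_le_outer[of ?d "A \<union> B"] by (meson order_trans)
 qed
 finally show ?thesis .
qed

lemma hausdorff2_outer_separated_sum:
 fixes A :: "nat => (real^3) set"
 assumes sepn: "\<And>n. \<exists>\<delta>>0. \<forall>a\<in>(\<Union>i<n. A i). \<forall>b\<in>A n. \<delta> <= dist a b"
 shows "(\<Sum>i<n. hausdorff2_outer (A i)) <= hausdorff2_outer (\<Union>i<n. A i)"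
proof (induction n)
 case (Suc n)
 obtain \<delta> where \<delta>: "\<delta> > 0" "\<And>a b. a \<in> (\<Union>i<n. A i) ==> b \<in> A n ==> \<delta> <= dist a b"
  using sepn[of n] by blast
 have "(\<Sum>i<Suc n. hausdorff2_outer (A i)) <= hausdorff2_outer (\<Union>i<n. A i) + hausdorff2_outer (A n)"
  using Suc by (simp add: add_right_mono)
 also have "\<dots> <= hausdorff2_outer ((\<Union>i<n. A i) \<union> A n)"
  by (rule hausdorff2_outer_separated[OF \<delta>(2,1)])
 also have "(\<Union>i<n. A i) \<union> A n = (\<Union>i<Suc n. A i)" by (auto simp: lessThan_Suc)
 finally show ?case .
qed simp

text \<open>Caratheodory's argument for metric outer measures. X - F is cut into shells
  \<open>R n\<close> according to the distance from F. Shells of equal parity are separated, so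
  their measures add up to at most that of X; the tails of these convergent series bound the part of
  X - F that is close to F.\<close>

lemma hausdorff2_caratheodory_closed:
 fixes F :: "(real^3) set"
 assumes F: "closed F"
 shows "hausdorff2_outer (X \<inter> F) + hausdorff2_outer (X - F) = hausdorff2_outer X"
proof (rule antisym)
 have "X = (X \<inter> F) \<union> (X - F)" by auto
 then show "hausdorff2_outer X <= hausdorff2_outer (X \<inter> F) + hausdorff2_outer (X - F)"
  using hausdorff2_outer_subadditive[of "X \<inter> F" "X - F"] by simp
 show "hausdorff2_outer (X \<inter> F) + hausdorff2_outer (X - F) <= hausdorff2_outer X"
 proof (cases "hausdorff2_outer X = top \<or> F = {}")
  case True
  then show ?thesis by (auto simp: hausdorff2_outer_empty)
 next
  case False
  then have fin: "hausdorff2_outer X < top" and ne: "F \<noteq> {}" by (auto simp: less_top)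
  define r where "r n = inverse (real (Suc n))" for n
  define Y where "Y n = {x \<in> X. r n <= infdist x F}" for n
  define R where "R n = {x \<in> X. r (Suc n) <= infdist x F \<and> infdist x F < r n}" for n
  have rpos: "r n > 0" for n by (simp add: r_def)
  have rdec: "r (Suc n) < r n" for n by (simp add: r_def field_simps)
  have rdecm: "m <= n ==> r n <= r m" for m n by (simp add: r_def field_simps)
  have infd: "infdist x F <= infdist y F + dist x y" for x y :: "real^3" by (rule infdist_triangle)
  have XY: "hausdorff2_outer (X \<inter> F) + hausdorff2_outer (Y n) <= hausdorff2_outer X" for n
  proof -
   have "hausdorff2_outer (X \<inter> F) + hausdorff2_outer (Y n) <= hausdorff2_outer ((X \<inter> F) \<union> Y n)"
   proof (rule hausdorff2_outer_separated[OF _ rpos[of n]])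
    fix a b assume "a \<in> X \<inter> F" "b \<in> Y n"
    then show "r n <= dist a b" using infdist_le[of a F b] by (auto simp: Y_def dist_commute)
   qed
   also have "\<dots> <= hausdorff2_outer X" by (intro hausdorff2_outer_mono) (auto simp: Y_def)
   finally show ?thesis .
  qed
  \<comment> \<open>Neighbouring shells may touch, hence the step 2 and the parity \<open>c\<close>;
    the gap between shells of equal parity is the width of the shell left out.\<close>
  have far: "\<exists>\<delta>>0. \<forall>a\<in>(\<Union>i<n. R (2 * i + c)). \<forall>b\<in>R (2 * n + c). \<delta> <= dist a b" for n c
  proof (cases n)
   case (Suc k)
   show ?thesis
   proof (intro exI[of _ "r (2 * k + c + 1) - r (2 * n + c)"] conjI ballI)
    show "0 < r (2 * k + c + 1) - r (2 * n + c)"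
     using rdec[of "2 * k + c + 1"] by (simp add: Suc)
    fix a b assume "a \<in> (\<Union>i<n. R (2 * i + c))" "b \<in> R (2 * n + c)"
    then obtain i where i: "i < n" "r (Suc (2 * i + c)) <= infdist a F" and b: "infdist b F < r (2 * n + c)"
     by (auto simp: R_def)
    have "r (2 * k + c + 1) <= r (Suc (2 * i + c))" using i(1) Suc by (intro rdecm) auto
    then show "r (2 * k + c + 1) - r (2 * n + c) <= dist a b"
     using i(2) b infd[of a b] by linarith
   qed
  qed (auto intro: exI[of _ 1])
  have half: "(\<Sum>i. hausdorff2_outer (R (2 * i + c))) <= hausdorff2_outer X" for c
  proof (rule suminf_le_const[OF summableI])
   fix n
   have "(\<Sum>i<n. hausdorff2_outer (R (2 * i + c))) <= hausdorff2_outer (\<Union>i<n. R (2 * i + c))"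
    by (rule hausdorff2_outer_separated_sum[where A="\<lambda>i. R (2 * i + c)"]) (rule far)
   also have "\<dots> <= hausdorff2_outer X" by (intro hausdorff2_outer_mono) (auto simp: R_def)
   finally show "(\<Sum>i<n. hausdorff2_outer (R (2 * i + c))) <= hausdorff2_outer X" .
  qed
  have tail: "(\<lambda>n. \<Sum>i. hausdorff2_outer (R (2 * (i + n) + c))) ----> 0" for c
  proof -
   define f where "f i = hausdorff2_outer (R (2 * i + c))" for i
   have f: "f i < top" for i
    using fin hausdorff2_outer_mono[of "R (2 * i + c)" X] by (auto simp: f_def R_def intro: le_less_trans)
   have "(\<Sum>i. f i) < top" using half[of c] fin unfolding f_def by (rule le_less_trans)
   then have s: "summable (\<lambda>i. enn2real (f i))"
    using f by (intro summable_suminf_not_top) (auto simp: less_top)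
   have "(\<lambda>n. \<Sum>i. enn2real (f (i + n))) ----> 0" using suminf_exist_split2[OF s] .
   then have "(\<lambda>n. ennreal (\<Sum>i. enn2real (f (i + n)))) ----> ennreal 0" by (rule tendsto_ennrealI)
   moreover have "ennreal (\<Sum>i. enn2real (f (i + n))) = (\<Sum>i. f (i + n))" for n
   proof -
    have "ennreal (\<Sum>i. enn2real (f (i + n))) = (\<Sum>i. ennreal (enn2real (f (i + n))))"
     by (rule suminf_ennreal2[symmetric]) (use summable_ignore_initial_segment[OF s, of n] in auto)
    also have "\<dots> = (\<Sum>i. f (i + n))" using f by simp
    finally show ?thesis .
   qed
   ultimately show ?thesis by (simp add: f_def)
  qed
  have cover: "X - F \<subseteq> Y (2 * n) \<union> ((\<Union>i. R (2 * (i + n) + 0)) \<union> (\<Union>i. R (2 * (i + n) + 1)))" for n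
  proof
   fix x assume x: "x \<in> X - F"
   then have pos: "infdist x F > 0"
    using F ne in_closed_iff_infdist_zero[of F x] infdist_nonneg[of x F] by (auto simp: less_le)
   then obtain m where m: "r m < infdist x F" unfolding r_def using reals_Archimedean by blast
   define m0 where "m0 = (LEAST m. r m <= infdist x F)"
   have m0: "r m0 <= infdist x F" unfolding m0_def by (rule LeastI[of _ m]) (use m in auto)
   have least: "infdist x F < r k" if "k < m0" for k
    using not_less_Least[OF that[unfolded m0_def]] by auto
   show "x \<in> Y (2 * n) \<union> ((\<Union>i. R (2 * (i + n) + 0)) \<union> (\<Union>i. R (2 * (i + n) + 1)))"
   proof (cases "m0 <= 2 * n")
    case True
    then show ?thesis using x m0 rdecm[OF True] by (auto simp: Y_def)
   next
    case False
    then have R: "x \<in> R (m0 - 1)" using x m0 least[of "m0 - 1"] by (auto simp: R_def)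
    show ?thesis
    proof (cases "even (m0 - 1)")
     case True
     then obtain j where j: "m0 - 1 = 2 * j" by blast
     then have "j >= n" using False by linarith
     then have "x \<in> R (2 * (j - n + n) + 0)" using R j by simp
     then show ?thesis by blast
    next
     case odd: False
     then obtain j where j: "m0 - 1 = 2 * j + 1" by (rule oddE)
     then have "j >= n" using False by linarith
     then have "x \<in> R (2 * (j - n + n) + 1)" using R j by simp
     then show ?thesis by blast
    qed
   qed
  qed
  let ?t = "\<lambda>n. (\<Sum>i. hausdorff2_outer (R (2 * (i + n) + 0))) + (\<Sum>i. hausdorff2_outer (R (2 * (i + n) + 1)))"
  have le: "hausdorff2_outer (X \<inter> F) + hausdorff2_outer (X - F) <= hausdorff2_outer X + ?t n" for n
  proof -
   have "hausdorff2_outer (X - F) <= hausdorff2_outer (Y (2 * n)) + ?t n"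
    using hausdorff2_outer_mono[OF cover[of n]]
    by (rule order_trans) (intro order_trans[OF hausdorff2_outer_subadditive] add_mono order_refl hausdorff2_subadditive)
   then have "hausdorff2_outer (X \<inter> F) + hausdorff2_outer (X - F) <= hausdorff2_outer (X \<inter> F) + (hausdorff2_outer (Y (2 * n)) + ?t n)"
    by (rule add_left_mono)
   also have "\<dots> <= hausdorff2_outer X + ?t n"
    unfolding add.assoc[symmetric] by (intro add_right_mono) (use XY[of "2 * n"] in \<open>simp add: add.assoc[symmetric] add_right_mono\<close>)
   finally show ?thesis .
  qed
  have "?t ----> 0 + 0" by (intro tendsto_add tail)
  then have "(\<lambda>n. hausdorff2_outer X + ?t n) ----> hausdorff2_outer X + (0 + 0)"
   by (rule tendsto_add[OF tendsto_const])
  then show ?thesis using le by (intro LIMSEQ_le_const[of "\<lambda>n. hausdorff2_outer X + ?t n"]) auto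
 qed
qed

text \<open>\<open>measure_of\<close> assigns 0 to every set unless its argument is a measure on the
  generated sets; this is what lets \<open>surface_measure\<close> carry the Hausdorff
  measure.\<close>

lemma hausdorff2_measure_space: "measure_space UNIV (sets borel) hausdorff2_outer"
proof -
 have oms: "outer_measure_space (Pow UNIV) hausdorff2_outer"
  unfolding outer_measure_space_def positive_def increasing_def countably_subadditive_def
  using hausdorff2_outer_empty hausdorff2_outer_mono hausdorff2_subadditive by auto
 interpret P: sigma_algebra "UNIV :: (real^3) set" "Pow UNIV" by (rule sigma_algebra_Pow)
 let ?L = "lambda_system UNIV (Pow UNIV) hausdorff2_outer"
 have L: "measure_space UNIV ?L hausdorff2_outer" by (rule P.caratheodory_lemma[OF oms])
 then interpret L: sigma_algebra UNIV ?L by (simp add: measure_space_def)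
 have "Collect open \<subseteq> ?L"
 proof
  fix S :: "(real^3) set" assume "S \<in> Collect open"
  then have "closed (- S)" by (simp add: closed_Compl)
  then have "- S \<in> ?L"
   unfolding P.lambda_system_eq using hausdorff2_caratheodory_closed by blast
  then have "UNIV - (- S) \<in> ?L" by (rule L.compl_sets)
  then show "S \<in> ?L" by (simp add: Diff_eq)
 qed
 then have "sets borel \<subseteq> ?L"
  unfolding sets_borel by (intro L.sigma_sets_subset) auto
 then show ?thesis
  using L sets.sigma_algebra_axioms[of "borel :: (real^3) measure"] unfolding measure_space_def
  by (auto simp: positive_def countably_additive_def)
qed

lemma sets_measure_of_hausdorff2: "sets (measure_of UNIV (sets borel) hausdorff2_outer) = sets borel"
 using sets.sigma_sets_eq[of "borel :: (real^3) measure"] by (subst sets_measure_of) auto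

lemma sets_surface_measure: "sets (surface_measure \<Omega>) = sets (restrict_space borel (frontier \<Omega>))"
 unfolding surface_measure_def by (rule sets_restrict_space_cong[OF sets_measure_of_hausdorff2])

lemma emeasure_surface_measure:
 assumes "A \<in> sets borel" "A \<subseteq> frontier \<Omega>"
 shows "emeasure (surface_measure \<Omega>) A = hausdorff2_outer A"
proof -
 note s = sets_measure_of_hausdorff2
 have "emeasure (surface_measure \<Omega>) A = emeasure (measure_of UNIV (sets borel) hausdorff2_outer) A"
  unfolding surface_measure_def
  using assms by (subst emeasure_restrict_space) (auto simp: s space_measure_of_conv borel_closed)
 also have "\<dots> = hausdorff2_outer A"
 proof (rule emeasure_measure_of_sigma)
  show "sigma_algebra UNIV (sets (borel :: (real^3) measure))" using sets.sigma_algebra_axioms[of borel] by simp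
 qed (use hausdorff2_measure_space assms in \<open>auto simp: measure_space_def\<close>)
 finally show ?thesis .
qed

text \<open>The indicator of the r-neighbourhood of K, mollified at radius r / 2. It stays 1 within
  r / 2 of K and vanishes beyond 2 r, and r = d / 3 keeps that below the distance d from K to the
  complement of \<Omega>.\<close>

lemma cutoff_exists:
 fixes K :: "'a::euclidean_space set"
 assumes K: "compact K" "K \<subseteq> \<Omega>" and \<Omega>: "open \<Omega>"
 shows "\<exists>(\<beta> :: 'a => real) U. test_function \<Omega> \<beta> \<and> open U \<and> K \<subseteq> U \<and> (\<forall>x\<in>U. \<beta> x = 1) \<and> (\<forall>x. 0 <= \<beta> x)"
proof -
 have "\<exists>d>0. \<forall>x\<in>K. \<forall>y\<in>- \<Omega>. d <= dist x y"
 proof (rule separate_compact_closed[OF K(1)])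
  show "closed (- \<Omega>)" using \<Omega> by (rule closed_Compl)
  show "K \<inter> - \<Omega> = {}" using K(2) by blast
 qed
 then obtain d where d: "d > 0" "\<forall>x\<in>K. \<forall>y\<in>- \<Omega>. d <= dist x y" by blast
 define r where "r = d / 3"
 have r: "r > 0" using d(1) by (simp add: r_def)
 let ?N = "\<lambda>s. {x + y | x y. x \<in> K \<and> y \<in> cball 0 s}"
 have cN: "compact (?N s)" for s using K(1) by (intro compact_sums) auto
 have NI: "z \<in> ?N s" if "x \<in> K" "dist x z <= s" for x z s
  using that by (intro CollectI exI[of _ x] exI[of _ "z - x"]) (auto simp: dist_norm norm_minus_commute)
 have ND: "\<exists>x\<in>K. dist x z <= s" if z: "z \<in> ?N s" for z s
 proof -
  obtain x y where "z = x + y" "x \<in> K" "norm y <= s" using z by auto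
  then show ?thesis by (intro bexI[of _ x]) (auto simp: dist_norm)
 qed
 obtain \<eta> :: "'a => real" where \<eta>: "mollifier 0 (r/2) \<eta>" using mollifier_exists[of "r/2"] r by auto
 note \<eta>' = mollifier_D[OF \<eta>]
 define f where "f = (indicator (?N r) :: 'a => real)"
 have f: "L1 f"
  unfolding f_def using emeasure_bounded_finite[OF compact_imp_bounded[OF cN[of r]]] compact_imp_closed[OF cN[of r]]
  by (intro integrable_real_indicator) (auto simp: borel_closed)
 define \<beta> where "\<beta> = conv \<eta> f"
 define U where "U = (\<Union>x\<in>K. ball x (r/2))"
 have "test_function \<Omega> \<beta>"
 proof (rule test_functionI[OF _ cN[of "2 * r"]])
  show "smooth \<beta>" unfolding \<beta>_def by (rule conv_smooth[OF \<eta>'(1) f])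
  show "?N (2 * r) \<subseteq> \<Omega>"
  proof
   fix z assume "z \<in> ?N (2 * r)"
   then obtain x where x: "x \<in> K" "dist x z <= 2 * r" using ND by blast
   show "z \<in> \<Omega>"
   proof (rule ccontr)
    assume "z \<notin> \<Omega>"
    then have "d <= dist x z" using d(2) x(1) by auto
    then show False using x(2) d(1) by (simp add: r_def)
   qed
  qed
  fix z assume "\<beta> z \<noteq> 0"
  then obtain y where y: "\<eta> (z - y) \<noteq> 0" "f y \<noteq> 0" unfolding \<beta>_def by (rule conv_support)
  then have "y \<in> ?N r" by (auto simp: f_def indicator_def split: if_splits)
  then obtain x where x: "x \<in> K" "dist x y <= r" using ND by blast
  have "dist y z < r / 2" using \<eta>'(3)[OF y(1)] by (auto simp: dist_norm norm_minus_commute)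
  then have "dist x z <= 2 * r" using x(2) dist_triangle[of x z y] r by linarith
  then show "z \<in> ?N (2 * r)" by (rule NI[OF x(1)])
 qed
 moreover have "\<beta> z = 1" if "z \<in> U" for z
 proof -
  obtain x where x: "x \<in> K" "dist x z < r / 2" using \<open>z \<in> U\<close> by (auto simp: U_def)
  have "\<eta> (z - y) *R f y = \<eta> (z + (-1) *R y)" for y
  proof (cases "\<eta> (z - y) = 0")
   case False
   then have "dist z y < r / 2" using \<eta>'(3) by (auto simp: dist_norm)
   then have "dist x y <= r" using x(2) dist_triangle[of x y z] by linarith
   then have "y \<in> ?N r" by (rule NI[OF x(1)])
   then show ?thesis by (simp add: f_def)
  qed simp
  then have "\<beta> z = (LBINT y. \<eta> (z + (-1) *R y))" unfolding \<beta>_def conv_def by (simp only:)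
  also have "\<dots> = 1" using integral_lborel_affine[of "-1" \<eta> z] \<eta>' by simp
  finally show ?thesis .
 qed
 moreover have "0 <= \<beta> z" for z
  unfolding \<beta>_def conv_def using \<eta>'(2) by (intro integral_nonneg_AE) (auto simp: f_def)
 moreover have "open U" "K \<subseteq> U" using r by (auto simp: U_def)
 ultimately have "test_function \<Omega> \<beta> \<and> open U \<and> K \<subseteq> U \<and> (\<forall>x\<in>U. \<beta> x = 1) \<and> (\<forall>x. 0 <= \<beta> x)" by simp
 then show ?thesis by blast
qed

section \<open>Volume of the layer swept out by a surface\<close>

definition sweep :: "real => real^3 => (real^3) set => (real^3) set" where
 "sweep h d A = {q + t *R d | q t. q \<in> A \<and> 0 <= t \<and> t <= h}"

text \<open>The volume of a ball of radius 2, so that a ball of radius 2 r has volume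
  \<open>cball_const * r ^ 3\<close>.\<close>

definition cball_const :: real where "cball_const = 8 * unit_ball_vol 3"

lemma cball_const_pos: "cball_const > 0" by (simp add: cball_const_def)

text \<open>Along d the swept set is covered by N + 1 balls of radius 2 r whose centres are at most
  r apart. As N is at most h |d| / r + 2, their total volume is at most \<open>cball_const\<close>
  times r^2 (h |d| + 3 r).\<close>

lemma sweep_cover_ball:
 fixes d :: "real^3"
 assumes r: "r > 0" and h: "h >= 0" and C: "bounded C" "diameter C <= r"
 shows "\<exists>T. T \<in> sets borel \<and> sweep h d C \<subseteq> T \<and>
  emeasure lborel T <= ennreal (cball_const * r\<^sup>2 * (h * norm d + 3 * r))"
proof (cases "C = {}")
 case True
 then show ?thesis by (intro exI[of _ "{}"]) (auto simp: sweep_def)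
next
 case False
 then obtain c where c: "c \<in> C" by blast
 define N where "N = nat \<lceil>h * norm d / r\<rceil> + 1"
 have N1: "N >= 1" "real N > 0" by (auto simp: N_def)
 have hr: "0 <= h * norm d / r" using h r by simp
 have Nle: "real N <= h * norm d / r + 2" using hr by (simp add: N_def) linarith
 have Nge: "h * norm d / r <= real N" by (simp add: N_def) linarith
 define T where "T = (\<Union>k\<le>N. cball (c + (real k * h / real N) *R d) (2 * r))"
 have "sweep h d C \<subseteq> T"
 proof
  fix x assume "x \<in> sweep h d C"
  then obtain q t where x: "x = q + t *R d" "q \<in> C" "0 <= t" "t <= h" by (auto simp: sweep_def)
  have qc: "norm (q - c) <= r" using diameter_bounded_bound[OF C(1) x(2) c] C(2) by (simp add: dist_norm)
  show "x \<in> T"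
  proof (cases "h = 0")
   case True
   then have "x \<in> cball (c + (real 0 * h / real N) *R d) (2 * r)"
    using x qc r by (auto simp: dist_norm norm_minus_commute)
   then show ?thesis unfolding T_def by blast
  next
   case False
   then have h0: "h > 0" using h by simp
   define k where "k = nat \<lfloor>t * real N / h\<rfloor>"
   have tn: "0 <= t * real N / h" "t * real N / h <= real N" using x h0 N1 by (auto simp: field_simps)
   have k1: "real k <= t * real N / h" "t * real N / h < real k + 1" using tn(1) by (auto simp: k_def)
   have "k <= N" using k1(1) tn(2) by linarith
   have "real k * h <= t * real N" "t * real N < (real k + 1) * h"
    using k1 h0 by (auto simp: field_simps)
   then have "real k * h / real N <= t" "t < (real k + 1) * h / real N"
    using N1 by (auto simp: pos_divide_le_eq pos_less_divide_eq)
   then have "0 <= t - real k * h / real N" "t - real k * h / real N <= h / real N"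
    by (auto simp: add_divide_distrib distrib_right)
   then have "\<bar>t - real k * h / real N\<bar> * norm d <= h / real N * norm d" by (intro mult_right_mono) auto
   also have "\<dots> <= r" using Nge r N1 by (simp add: field_simps)
   finally have "norm ((t - real k * h / real N) *R d) <= r" by simp
   moreover have eq: "x - (c + (real k * h / real N) *R d) = (q - c) + (t - real k * h / real N) *R d"
    by (simp add: x(1) scaleR_diff_left)
   have "norm (x - (c + (real k * h / real N) *R d)) <= norm (q - c) + norm ((t - real k * h / real N) *R d)"
    unfolding eq by (rule norm_triangle_ineq)
   ultimately have "norm (x - (c + (real k * h / real N) *R d)) <= 2 * r"
    using qc by linarith
   then show ?thesis unfolding T_def using \<open>k <= N\<close> by (auto simp: dist_norm norm_minus_commute)
  qed
 qed
 moreover have "T \<in> sets borel" unfolding T_def by (intro sets.finite_UN borel_closed) auto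
 moreover have "emeasure lborel T <= ennreal (cball_const * r\<^sup>2 * (h * norm d + 3 * r))"
 proof -
  have "emeasure lborel T <= (\<Sum>k\<le>N. emeasure lborel (cball (c + (real k * h / real N) *R d) (2 * r)))"
   unfolding T_def by (rule emeasure_subadditive_finite) auto
  also have "\<dots> = (\<Sum>k\<le>N. ennreal (cball_const * r ^ 3))"
   using r by (intro sum.cong refl) (simp add: emeasure_cball cball_const_def power3_eq_cube mult_ac)
  also have "\<dots> = ennreal (real (Suc N) * (cball_const * r ^ 3))"
   using r cball_const_pos by (simp add: ennreal_of_nat_eq_real_of_nat ennreal_mult)
  also have "\<dots> <= ennreal (cball_const * r\<^sup>2 * (h * norm d + 3 * r))"
  proof (rule ennreal_leI)
   have "real (Suc N) * r <= h * norm d + 3 * r" using Nle r by (simp add: field_simps)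
   then have "cball_const * r\<^sup>2 * (real (Suc N) * r) <= cball_const * r\<^sup>2 * (h * norm d + 3 * r)"
    using cball_const_pos by (intro mult_left_mono) auto
   then show "real (Suc N) * (cball_const * r ^ 3) <= cball_const * r\<^sup>2 * (h * norm d + 3 * r)"
    by (simp add: power2_eq_square power3_eq_cube mult_ac)
  qed
  finally show ?thesis .
 qed
 ultimately show ?thesis by blast
qed

text \<open>Sets of a cover may have diameter 0, while the balls above need a positive radius. A
  radius slightly above the diameter is taken, and \<open>e\<close> pays for the difference.\<close>

lemma sweep_cover:
 fixes d :: "real^3"
 assumes e: "e > 0" and h: "h >= 0" and C: "bounded C"
 shows "\<exists>T. T \<in> sets borel \<and> sweep h d C \<subseteq> T \<and>
  emeasure lborel T <= ennreal (cball_const * (diameter C)\<^sup>2 * (h * norm d + 3 * diameter C) + e)"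
proof -
 let ?f = "\<lambda>r. cball_const * r\<^sup>2 * (h * norm d + 3 * r)"
 have "(?f \<longlongrightarrow> ?f (diameter C)) (at_right (diameter C))"
  by (intro tendsto_intros)
 then have "eventually (\<lambda>r. ?f r < ?f (diameter C) + e) (at_right (diameter C))"
  using e by (intro order_tendstoD) auto
 then obtain b where b: "b > diameter C" "\<And>r. diameter C < r ==> r < b ==> ?f r < ?f (diameter C) + e"
  unfolding eventually_at_right_field by blast
 define r where "r = (diameter C + b) / 2"
 have r: "diameter C < r" "r < b" using b(1) by (auto simp: r_def)
 have "r > 0" using r(1) diameter_ge_0[OF C] by linarith
 then obtain T where T: "T \<in> sets borel" "sweep h d C \<subseteq> T" "emeasure lborel T <= ennreal (?f r)"
  using sweep_cover_ball[OF _ h C less_imp_le[OF r(1)], of d] by blast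
 have "ennreal (?f r) <= ennreal (?f (diameter C) + e)"
  using b(2)[OF r] by (intro ennreal_leI) simp
 then show ?thesis using T by (intro exI[of _ T]) auto
qed

text \<open>The factor 4 / pi undoes the normalisation pi / 4 in the Hausdorff measure.\<close>

definition sweep_const :: real where "sweep_const = cball_const * 4 / pi"

lemma sweep_const_pos: "sweep_const > 0" by (simp add: sweep_const_def cball_const_pos)

lemma sweep_measure_pre:
 fixes d :: "real^3"
 assumes E: "E \<in> sets borel" "E \<subseteq> sweep h d A" and h: "h > 0" and d: "d \<noteq> 0" and \<delta>: "\<delta> > 0"
 shows "emeasure lborel E <= ennreal (sweep_const * (h * norm d + 3 * \<delta>)) * hausdorff2_pre \<delta> A"
proof -
 define c where "c = sweep_const * (h * norm d + 3 * \<delta>)"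
 have c: "c > 0" using h d \<delta> sweep_const_pos by (auto simp: c_def intro!: mult_pos_pos add_pos_pos)
 have cov: "emeasure lborel E <= ennreal c * (\<Sum>n. ennreal (pi / 4 * (diameter (C n))\<^sup>2))"
  if C: "A \<subseteq> (\<Union>n. C n)" "\<forall>n. bounded (C n) \<and> diameter (C n) <= \<delta>" for C :: "nat => (real^3) set"
 proof (rule ennreal_le_epsilon)
  fix e :: real assume e: "e > 0"
  have "\<forall>n. \<exists>T. T \<in> sets borel \<and> sweep h d (C n) \<subseteq> T \<and> emeasure lborel T <=
    ennreal (cball_const * (diameter (C n))\<^sup>2 * (h * norm d + 3 * diameter (C n)) + e * (1/2) ^ Suc n)"
   using e h C(2) by (intro allI sweep_cover) auto
  then obtain T where T: "\<And>n. T n \<in> sets borel" "\<And>n. sweep h d (C n) \<subseteq> T n"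
    "\<And>n. emeasure lborel (T n) <= ennreal (cball_const * (diameter (C n))\<^sup>2 * (h * norm d + 3 * diameter (C n)) + e * (1/2) ^ Suc n)"
   by metis
  have "E \<subseteq> (\<Union>n. T n)"
  proof
   fix x assume "x \<in> E"
   then obtain q t where x: "x = q + t *R d" "q \<in> A" "0 <= t" "t <= h" using E(2) by (auto simp: sweep_def)
   then obtain n where "q \<in> C n" using C(1) by blast
   then have "x \<in> sweep h d (C n)" using x by (auto simp: sweep_def)
   then show "x \<in> (\<Union>n. T n)" using T(2) by blast
  qed
  then have "emeasure lborel E <= emeasure lborel (\<Union>n. T n)"
   using T(1) by (intro emeasure_mono) auto
  also have "\<dots> <= (\<Sum>n. emeasure lborel (T n))"
   using T(1) by (intro emeasure_subadditive_countably) auto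
  also have "\<dots> <= (\<Sum>n. ennreal c * ennreal (pi / 4 * (diameter (C n))\<^sup>2) + ennreal (e * (1/2) ^ Suc n))"
  proof (intro suminf_le summableI)
   fix n
   have D: "0 <= diameter (C n)" "diameter (C n) <= \<delta>" using C(2) diameter_ge_0 by auto
   have "cball_const * (diameter (C n))\<^sup>2 * (h * norm d + 3 * diameter (C n)) <= cball_const * (diameter (C n))\<^sup>2 * (h * norm d + 3 * \<delta>)"
    using D cball_const_pos by (intro mult_left_mono) auto
   also have "\<dots> = c * (pi / 4 * (diameter (C n))\<^sup>2)" by (simp add: c_def sweep_const_def field_simps)
   finally have "emeasure lborel (T n) <= ennreal (c * (pi / 4 * (diameter (C n))\<^sup>2) + e * (1/2) ^ Suc n)"
    using T(3)[of n] by (elim order_trans) (intro ennreal_leI, simp)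
   also have "\<dots> = ennreal c * ennreal (pi / 4 * (diameter (C n))\<^sup>2) + ennreal (e * (1/2) ^ Suc n)"
    using c e D by (subst ennreal_plus) (auto simp: ennreal_mult[of c "pi / 4 * (diameter (C n))\<^sup>2", simplified])
   finally show "emeasure lborel (T n) <= ennreal c * ennreal (pi / 4 * (diameter (C n))\<^sup>2) + ennreal (e * (1/2) ^ Suc n)" .
  qed
  also have "\<dots> = (\<Sum>n. ennreal c * ennreal (pi / 4 * (diameter (C n))\<^sup>2)) + (\<Sum>n. ennreal (e * (1/2) ^ Suc n))"
   by (intro suminf_add[symmetric] summableI)
  also have "(\<Sum>n. ennreal (e * (1/2) ^ Suc n)) = ennreal e"
  proof (rule suminf_ennreal_eq)
   show "(\<lambda>i. e * (1/2) ^ Suc i) sums e" using sums_mult[OF power_half_series, of e] by simp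
  qed (use e in auto)
  also have "(\<Sum>n. ennreal c * ennreal (pi / 4 * (diameter (C n))\<^sup>2)) = ennreal c * (\<Sum>n. ennreal (pi / 4 * (diameter (C n))\<^sup>2))"
   by (rule ennreal_suminf_cmult)
  finally show "emeasure lborel E <= ennreal c * (\<Sum>n. ennreal (pi / 4 * (diameter (C n))\<^sup>2)) + ennreal e" .
 qed
 have inv: "ennreal (inverse c) * (ennreal c * y) = y" for y
  using c by (simp add: mult.assoc[symmetric] ennreal_mult[symmetric])
 \<comment> \<open>Dividing by c first leaves a lower bound for each single cover, which passes to
   the infimum.\<close>
 have "ennreal (inverse c) * emeasure lborel E <= hausdorff2_pre \<delta> A"
  unfolding hausdorff2_pre_def
 proof (rule INF_greatest, clarify)
  fix C :: "nat => (real^3) set"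
  assume "A \<subseteq> (\<Union>n. C n)" "\<forall>n. bounded (C n) \<and> diameter (C n) <= \<delta>"
  then have "emeasure lborel E <= ennreal c * (\<Sum>n. ennreal (pi / 4 * (diameter (C n))\<^sup>2))" by (rule cov)
  then have "ennreal (inverse c) * emeasure lborel E
    <= ennreal (inverse c) * (ennreal c * (\<Sum>n. ennreal (pi / 4 * (diameter (C n))\<^sup>2)))"
   by (rule mult_left_mono) simp
  then show "ennreal (inverse c) * emeasure lborel E <= (\<Sum>n. ennreal (pi / 4 * (diameter (C n))\<^sup>2))"
   unfolding inv .
 qed
 then have "ennreal c * (ennreal (inverse c) * emeasure lborel E) <= ennreal c * hausdorff2_pre \<delta> A"
  by (rule mult_left_mono) simp
 moreover have "ennreal c * (ennreal (inverse c) * emeasure lborel E) = emeasure lborel E"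
  using inv[of "emeasure lborel E"] by (simp add: mult.left_commute)
 ultimately show ?thesis by (simp add: c_def)
qed

text \<open>The summand 3 \<delta> of the preceding bound stems from the thickness of the covering
  sets and disappears as \<delta> tends to 0. What remains is linear in h, so the volume of a layer
  divided by its height is controlled by surface measure.\<close>

lemma sweep_measure:
 fixes d :: "real^3"
 assumes E: "E \<in> sets borel" "E \<subseteq> sweep h d A" and h: "h > 0" and d: "d \<noteq> 0"
 shows "emeasure lborel E <= ennreal (sweep_const * norm d * h) * hausdorff2_outer A"
proof (cases "hausdorff2_outer A")
 case (real a)
 show ?thesis
 proof (rule ennreal_le_epsilon)
  fix e :: real assume e: "e > 0"
  \<comment> \<open>Chosen so that the error \<open>3 * sweep_const * \<delta> * a\<close> is at
    most e; a + 1 replaces a since a may be 0.\<close>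
  define \<delta> where "\<delta> = e / (3 * sweep_const * (a + 1))"
  have \<delta>: "\<delta> > 0" using e real sweep_const_pos by (auto simp: \<delta>_def intro!: divide_pos_pos mult_pos_pos)
  have "3 * sweep_const * \<delta> * a <= e"
  proof -
   have "3 * sweep_const * \<delta> * (a + 1) = e" using real sweep_const_pos by (simp add: \<delta>_def)
   moreover have "3 * sweep_const * \<delta> * a <= 3 * sweep_const * \<delta> * (a + 1)"
    using \<delta> sweep_const_pos by (intro mult_left_mono) auto
   ultimately show ?thesis by simp
  qed
  then have 1: "sweep_const * (h * norm d + 3 * \<delta>) * a <= sweep_const * norm d * h * a + e"
   by (simp add: algebra_simps)
  have "emeasure lborel E <= ennreal (sweep_const * (h * norm d + 3 * \<delta>)) * hausdorff2_pre \<delta> A"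
   by (rule sweep_measure_pre[OF assms \<delta>])
  also have "\<dots> <= ennreal (sweep_const * (h * norm d + 3 * \<delta>)) * ennreal a"
   using hausdorff2_pre_le_outer[OF \<delta>, of A] real by (intro mult_left_mono) auto
  also have "\<dots> = ennreal (sweep_const * (h * norm d + 3 * \<delta>) * a)"
   using h \<delta> real sweep_const_pos by (subst ennreal_mult) auto
  also have "\<dots> <= ennreal (sweep_const * norm d * h * a + e)" by (rule ennreal_leI[OF 1])
  also have "\<dots> = ennreal (sweep_const * norm d * h) * hausdorff2_outer A + ennreal e"
   using h real e sweep_const_pos by (subst ennreal_plus) (auto simp: ennreal_mult)
  finally show "emeasure lborel E <= ennreal (sweep_const * norm d * h) * hausdorff2_outer A + ennreal e" .
 qed
next
 case top
 then show ?thesis using h d sweep_const_pos by (simp add: ennreal_mult_top)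
qed

text \<open>For fixed v at most three indices j contribute, and j >= 2 gives j + 1 <= 3 (j - 1),
  hence a contribution of at most 3 v each. This is the origin of the 9.\<close>

lemma level_overlap:
 assumes \<epsilon>: "\<epsilon> > 0" and v: "v >= 0"
 shows "(\<Sum>j\<in>{2..<J}. (real j + 1) * \<epsilon> * indicator {v. (real j - 1) * \<epsilon> <= v \<and> v < (real j + 2) * \<epsilon>} v) <= 9 * v"
proof -
 let ?S = "{j \<in> {2..<J}. (real j - 1) * \<epsilon> <= v \<and> v < (real j + 2) * \<epsilon>}"
 define n where "n = nat \<lfloor>v / \<epsilon> + 1\<rfloor>"
 have v0: "v / \<epsilon> >= 0" using \<epsilon> v by simp
 have "?S \<subseteq> {n - 2..n}"
 proof
  fix j assume "j \<in> ?S"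
  then have "real j <= v / \<epsilon> + 1" "v / \<epsilon> - 2 < real j" using \<epsilon> by (auto simp: field_simps)
  then show "j \<in> {n - 2..n}" using v0 unfolding n_def by (auto simp: le_nat_iff le_floor_iff) linarith+
 qed
 then have card: "card ?S <= 3" using card_mono[of "{n - 2..n}" ?S] by auto
 have "(\<Sum>j\<in>{2..<J}. (real j + 1) * \<epsilon> * indicator {v. (real j - 1) * \<epsilon> <= v \<and> v < (real j + 2) * \<epsilon>} v)
   = (\<Sum>j\<in>?S. (real j + 1) * \<epsilon>)"
  by (rule sum.mono_neutral_cong_right) auto
 also have "\<dots> <= of_nat (card ?S) * (3 * v)"
 proof (rule sum_bounded_above)
  fix j assume j: "j \<in> ?S"
  have "(real j + 1) * \<epsilon> <= (3 * (real j - 1)) * \<epsilon>" using j \<epsilon> by (intro mult_right_mono) auto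
  also have "\<dots> = 3 * ((real j - 1) * \<epsilon>)" by simp
  also have "\<dots> <= 3 * v" using j by (intro mult_left_mono) auto
  finally show "(real j + 1) * \<epsilon> <= 3 * v" .
 qed
 also have "\<dots> <= 3 * (3 * v)" using card v by (intro mult_right_mono) auto
 finally show ?thesis by simp
qed

text \<open>\<open>sweep_measure\<close> only compares sets, so the layer is sliced by the values of
  f. As f varies by less than \<epsilon> along d, the slice where f lies between j \<epsilon> and (j
  + 1) \<epsilon> is swept out by boundary points where f lies between (j - 1) \<epsilon> and (j +
  2) \<epsilon>. Values up to 2 \<epsilon> go into the error term, so the slices start at j =
  2.\<close>

lemma layer_integral:
 fixes f :: "real^3 => real"
 assumes E: "E \<in> sets borel" "E \<subseteq> sweep h d (frontier \<Omega>)" and h: "h > 0" and d: "d \<noteq> 0" and \<epsilon>: "\<epsilon> > 0"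
  and f: "f Borel" "\<And>x. f x >= 0" "\<And>x. x \<in> E ==> f x <= M"
  and osc: "\<And>q t. q \<in> frontier \<Omega> ==> 0 <= t ==> t <= h ==> \<bar>f (q + t *R d) - f q\<bar> < \<epsilon>"
 shows "(NN x. ennreal (f x) * indicator E x) <= ennreal (2 * \<epsilon>) * emeasure lborel E
   + ennreal (9 * sweep_const * norm d * h) * (\<integral>\<^sup>+x. ennreal (f x) \<partial>surface_measure \<Omega>)"
proof -
 have [measurable]: "f Borel" "E \<in> sets borel" using f E by auto
 have Fr: "frontier \<Omega> \<in> sets borel" by (simp add: borel_closed frontier_closed)
 obtain J where J: "M < real J * \<epsilon>" using reals_Archimedean3[OF \<epsilon>] by blast
 define Ej where "Ej j = {x \<in> E. real j * \<epsilon> <= f x \<and> f x < (real j + 1) * \<epsilon>}" for j :: nat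
 define Aj where "Aj j = {q \<in> frontier \<Omega>. (real j - 1) * \<epsilon> <= f q \<and> f q < (real j + 2) * \<epsilon>}" for j :: nat
 have Ejs [measurable]: "Ej j \<in> sets borel" for j unfolding Ej_def by measurable
 have Ajs: "Aj j \<in> sets borel" for j
 proof -
  have "Aj j = frontier \<Omega> \<inter> {q. (real j - 1) * \<epsilon> <= f q \<and> f q < (real j + 2) * \<epsilon>}" by (auto simp: Aj_def)
  also have "\<dots> \<in> sets borel" using Fr by (intro sets.Int) measurable
  finally show ?thesis .
 qed
 have cov: "Ej j \<subseteq> sweep h d (Aj j)" for j
 proof
  fix x assume x: "x \<in> Ej j"
  then obtain q t where q: "x = q + t *R d" "q \<in> frontier \<Omega>" "0 <= t" "t <= h"
   using E(2) by (auto simp: Ej_def sweep_def)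
  have "\<bar>f x - f q\<bar> < \<epsilon>" using osc[OF q(2-4)] q(1) by simp
  then have "q \<in> Aj j" using x q(2) by (auto simp: Ej_def Aj_def algebra_simps)
  then show "x \<in> sweep h d (Aj j)" using q by (auto simp: sweep_def)
 qed
 have Em: "emeasure lborel (Ej j) <= ennreal (sweep_const * norm d * h) * emeasure (surface_measure \<Omega>) (Aj j)" for j
  using sweep_measure[OF Ejs cov h d, of j] emeasure_surface_measure[OF Ajs[of j], of \<Omega>] by (auto simp: Aj_def)
 have pt: "ennreal (f x) * indicator E x <= ennreal (2 * \<epsilon>) * indicator E x
   + (\<Sum>j\<in>{2..<J}. ennreal ((real j + 1) * \<epsilon>) * indicator (Ej j) x)" for x
 proof (cases "x \<in> E \<and> 2 * \<epsilon> < f x")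
  case True
  define j where "j = nat \<lfloor>f x / \<epsilon>\<rfloor>"
  have q: "f x / \<epsilon> >= 2" using True \<epsilon> by (simp add: field_simps)
  then have j: "real j <= f x / \<epsilon>" "f x / \<epsilon> < real j + 1" "j >= 2" unfolding j_def by linarith+
  have "f x < real J * \<epsilon>" using f(3)[of x] True J by auto
  then have "f x / \<epsilon> < real J" using \<epsilon> by (simp add: field_simps)
  then have jJ: "j \<in> {2..<J}" using j by auto
  have xj: "x \<in> Ej j" using True j \<epsilon> by (auto simp: Ej_def field_simps)
  have "ennreal (f x) * indicator E x <= ennreal ((real j + 1) * \<epsilon>) * indicator (Ej j) x"
   using xj True by (auto simp: Ej_def intro!: ennreal_leI)
  also have "\<dots> <= (\<Sum>j\<in>{2..<J}. ennreal ((real j + 1) * \<epsilon>) * indicator (Ej j) x)"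
   using jJ by (intro member_le_sum) auto
  finally show ?thesis by (simp add: add_increasing)
 next
  case False
  then show ?thesis by (cases "x \<in> E") (auto intro!: add_increasing2 ennreal_leI)
 qed
 have "(NN x. ennreal (f x) * indicator E x) <=
   (NN x. ennreal (2 * \<epsilon>) * indicator E x + (\<Sum>j\<in>{2..<J}. ennreal ((real j + 1) * \<epsilon>) * indicator (Ej j) x))"
  by (intro nn_integral_mono pt)
 also have "\<dots> = ennreal (2 * \<epsilon>) * emeasure lborel E + (\<Sum>j\<in>{2..<J}. ennreal ((real j + 1) * \<epsilon>) * emeasure lborel (Ej j))"
 proof -
  have "(NN x. (\<Sum>j\<in>{2..<J}. ennreal ((real j + 1) * \<epsilon>) * indicator (Ej j) x))
    = (\<Sum>j\<in>{2..<J}. NN x. ennreal ((real j + 1) * \<epsilon>) * indicator (Ej j) x)"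
   by (rule nn_integral_sum) measurable
  also have "\<dots> = (\<Sum>j\<in>{2..<J}. ennreal ((real j + 1) * \<epsilon>) * emeasure lborel (Ej j))"
   by (intro sum.cong refl nn_integral_cmult_indicator) simp
  finally have s: "(NN x. (\<Sum>j\<in>{2..<J}. ennreal ((real j + 1) * \<epsilon>) * indicator (Ej j) x))
    = (\<Sum>j\<in>{2..<J}. ennreal ((real j + 1) * \<epsilon>) * emeasure lborel (Ej j))" .
  have "(NN x. ennreal (2 * \<epsilon>) * indicator E x) = ennreal (2 * \<epsilon>) * emeasure lborel E"
   by (rule nn_integral_cmult_indicator) simp
  with s show ?thesis by (subst nn_integral_add) measurable
 qed
 also have "(\<Sum>j\<in>{2..<J}. ennreal ((real j + 1) * \<epsilon>) * emeasure lborel (Ej j)) <=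
   (\<Sum>j\<in>{2..<J}. ennreal ((real j + 1) * \<epsilon>) * (ennreal (sweep_const * norm d * h) * emeasure (surface_measure \<Omega>) (Aj j)))"
  by (intro sum_mono mult_left_mono Em) auto
 also have "\<dots> = ennreal (sweep_const * norm d * h) * (\<Sum>j\<in>{2..<J}. ennreal ((real j + 1) * \<epsilon>) * emeasure (surface_measure \<Omega>) (Aj j))"
  by (simp add: sum_distrib_left mult_ac)
 also have "(\<Sum>j\<in>{2..<J}. ennreal ((real j + 1) * \<epsilon>) * emeasure (surface_measure \<Omega>) (Aj j))
   = (\<integral>\<^sup>+x. (\<Sum>j\<in>{2..<J}. ennreal ((real j + 1) * \<epsilon>) * indicator (Aj j) x) \<partial>surface_measure \<Omega>)"
 proof -
  have "Aj j \<in> sets (surface_measure \<Omega>)" for j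
   using Ajs[of j] Fr by (auto simp: sets_surface_measure sets_restrict_space_iff Aj_def)
  note Aj = this
  have "(\<integral>\<^sup>+x. (\<Sum>j\<in>{2..<J}. ennreal ((real j + 1) * \<epsilon>) * indicator (Aj j) x) \<partial>surface_measure \<Omega>)
    = (\<Sum>j\<in>{2..<J}. \<integral>\<^sup>+x. ennreal ((real j + 1) * \<epsilon>) * indicator (Aj j) x \<partial>surface_measure \<Omega>)"
   using Aj by (intro nn_integral_sum borel_measurable_times_ennreal borel_measurable_indicator) auto
  also have "\<dots> = (\<Sum>j\<in>{2..<J}. ennreal ((real j + 1) * \<epsilon>) * emeasure (surface_measure \<Omega>) (Aj j))"
   by (intro sum.cong refl nn_integral_cmult_indicator Aj)
  finally show ?thesis by simp
 qed
 also have "\<dots> <= (\<integral>\<^sup>+x. ennreal 9 * ennreal (f x) \<partial>surface_measure \<Omega>)"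
 proof (rule nn_integral_mono)
  fix x assume "x \<in> space (surface_measure \<Omega>)"
  have "(\<Sum>j\<in>{2..<J}. ennreal ((real j + 1) * \<epsilon>) * indicator (Aj j) x)
    <= (\<Sum>j\<in>{2..<J}. ennreal ((real j + 1) * \<epsilon> * indicator {v. (real j - 1) * \<epsilon> <= v \<and> v < (real j + 2) * \<epsilon>} (f x)))"
   by (intro sum_mono) (auto simp: Aj_def indicator_def)
  also have "\<dots> = ennreal (\<Sum>j\<in>{2..<J}. (real j + 1) * \<epsilon> * indicator {v. (real j - 1) * \<epsilon> <= v \<and> v < (real j + 2) * \<epsilon>} (f x))"
   using \<epsilon> by (intro sum_ennreal) auto
  also have "\<dots> <= ennreal (9 * f x)" by (intro ennreal_leI level_overlap \<epsilon> f(2))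
  finally show "(\<Sum>j\<in>{2..<J}. ennreal ((real j + 1) * \<epsilon>) * indicator (Aj j) x) <= ennreal 9 * ennreal (f x)"
   using f(2)[of x] by (simp add: ennreal_mult)
 qed
 also have "\<dots> = ennreal 9 * (\<integral>\<^sup>+x. ennreal (f x) \<partial>surface_measure \<Omega>)"
 proof (rule nn_integral_cmult)
  have "f \<in> borel_measurable (restrict_space borel (frontier \<Omega>))" using f(1) by (rule measurable_restrict_space1)
  then have "f \<in> borel_measurable (surface_measure \<Omega>)"
   using measurable_cong_sets[OF sets_surface_measure[of \<Omega>] refl] by blast
  then show "(\<lambda>x. ennreal (f x)) \<in> borel_measurable (surface_measure \<Omega>)" by measurable
 qed
 finally have *: "(NN x. ennreal (f x) * indicator E x) <= ennreal (2 * \<epsilon>) * emeasure lborel E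
   + ennreal (sweep_const * norm d * h) * (ennreal 9 * (\<integral>\<^sup>+x. ennreal (f x) \<partial>surface_measure \<Omega>))"
  by (simp add: add_left_mono mult_left_mono)
 have "ennreal (sweep_const * norm d * h) * (ennreal 9 * (\<integral>\<^sup>+x. ennreal (f x) \<partial>surface_measure \<Omega>))
   = ennreal (9 * sweep_const * norm d * h) * (\<integral>\<^sup>+x. ennreal (f x) \<partial>surface_measure \<Omega>)"
  unfolding mult.assoc[symmetric] using h sweep_const_pos
  by (subst ennreal_mult[symmetric]) (auto simp: mult_ac)
 with * show ?thesis by simp
qed

subsection \<open>Functions with zero trace\<close>

text \<open>A whole ball of directions is required: it contains the supports of rescaled mollifiers,
  and its directions span the space. \<open>\<kappa> <= norm e\<close> keeps the direction 0 out of
  it.\<close>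

definition inner_cone :: "(real^3) set => real^3 => real => real^3 => real => real => bool" where
 "inner_cone \<Omega> P \<rho> e \<kappa> \<tau> \<longleftrightarrow> 0 < \<rho> \<and> 0 < \<kappa> \<and> 0 < \<tau> \<and> \<kappa> <= norm e \<and>
   (\<forall>x\<in>\<Omega> \<inter> ball P \<rho>. \<forall>d\<in>ball e \<kappa>. \<forall>t. 0 < t \<and> t < \<tau> --> x + t *R d \<in> \<Omega>)"

lemma inner_coneD:
 assumes "inner_cone \<Omega> P \<rho> e \<kappa> \<tau>"
 shows "0 < \<rho>" "0 < \<kappa>" "0 < \<tau>" "\<kappa> <= norm e"
  "x \<in> \<Omega> ==> dist P x < \<rho> ==> dist e d < \<kappa> ==> 0 < t ==> t < \<tau> ==> x + t *R d \<in> \<Omega>"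
 using assms by (auto simp: inner_cone_def)

definition exit_layer :: "(real^3) set => real => real^3 => (real^3) set" where
 "exit_layer \<Omega> h d = {x \<in> \<Omega>. x - h *R d \<notin> \<Omega>}"

lemma exit_layer_sets: "open \<Omega> ==> exit_layer \<Omega> h d \<in> sets borel"
proof -
 assume op: "open \<Omega>"
 have "open ((\<lambda>x. x - h *R d) -` \<Omega>)" by (rule open_vimage[OF op]) (intro continuous_intros)
 moreover have "exit_layer \<Omega> h d = \<Omega> - ((\<lambda>x. x - h *R d) -` \<Omega>)" by (auto simp: exit_layer_def)
 ultimately show ?thesis using op by (auto intro: borel_open)
qed

lemma exit_layer_subset_sweep:
 assumes h: "h > 0"
 shows "exit_layer \<Omega> h d \<subseteq> sweep h d (frontier \<Omega>)"
proof
 fix x assume x: "x \<in> exit_layer \<Omega> h d"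
 let ?S = "closed_segment x (x - h *R d)"
 have "?S \<inter> frontier \<Omega> \<noteq> {}"
  by (rule connected_Int_frontier) (use x in \<open>auto simp: exit_layer_def\<close>)
 then obtain q where q: "q \<in> ?S" "q \<in> frontier \<Omega>" by blast
 then obtain u where u: "0 <= u" "u <= 1" "q = (1 - u) *R x + u *R (x - h *R d)"
  by (auto simp: closed_segment_def)
 then have "x = q + (u * h) *R d" by (simp add: algebra_simps)
 moreover have "0 <= u * h" "u * h <= h" using u h by (auto simp: mult_left_le_one_le)
 ultimately show "x \<in> sweep h d (frontier \<Omega>)" using q(2) by (auto simp: sweep_def)
qed

text \<open>A discrete integration by parts: shifting F amounts to replacing \<Omega> by its
  translate \<Omega> + h d. On the support of F the cone condition puts the translate inside
  \<Omega>, so the two differ there by the exit layer alone.\<close>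

lemma exit_layer_difference:
 assumes \<Omega>: "open \<Omega>" and cone: "inner_cone \<Omega> P \<rho> e \<kappa> \<tau>" and d: "dist e d < \<kappa>"
  and h: "0 < h" "h < \<tau>" "h * norm d < \<rho> / 2"
  and F: "L1 F" "\<And>x. F x \<noteq> 0 ==> dist P x < \<rho> / 2"
 shows "(LBINT x. indicator \<Omega> x * ((F (x + h *R d) - F x) / h))
   = - (LBINT x. indicator (exit_layer \<Omega> h d) x * F x) / h"
proof -
 note c = inner_coneD[OF cone]
 have [measurable]: "F Borel" by (rule integrable_lborel_measurable[OF F(1)])
 have \<Omega>s [measurable]: "\<Omega> \<in> sets borel" using \<Omega> by simp
 have Es [measurable]: "exit_layer \<Omega> h d \<in> sets borel" by (rule exit_layer_sets[OF \<Omega>])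
 have iF: "L1 (\<lambda>x. indicator A x * F x)" if "A \<in> sets borel" for A
  using integrable_mult_indicator[OF _ F(1), of A] that by simp
 have pt: "indicator \<Omega> (y - h *R d) * F y = indicator \<Omega> y * F y - indicator (exit_layer \<Omega> h d) y * F y" for y
 proof (cases "F y = 0")
  case False
  then have y: "dist P y < \<rho> / 2" by (rule F(2))
  have "y \<in> \<Omega>" if yh: "y - h *R d \<in> \<Omega>"
  proof -
   have "dist P (y - h *R d) <= dist P y + norm (h *R d)"
    using dist_triangle[of P "y - h *R d" y] by (simp add: dist_norm)
   then have "dist P (y - h *R d) < \<rho>" using y h by simp
   from c(5)[OF yh this d h(1,2)] show ?thesis by simp
  qed
  then show ?thesis by (auto simp: indicator_def exit_layer_def)
 qed simp
 have 1: "L1 (\<lambda>x. indicator \<Omega> x * F (x + h *R d))"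
  and 2: "(LBINT x. indicator \<Omega> x * F (x + h *R d)) = (LBINT y. indicator \<Omega> (y - h *R d) * F y)"
 proof -
  have "(\<lambda>y. indicator \<Omega> (y - h *R d) * F y) Borel" by measurable
  then show "(LBINT x. indicator \<Omega> x * F (x + h *R d)) = (LBINT y. indicator \<Omega> (y - h *R d) * F y)"
   using integral_lborel_affine[of 1 "\<lambda>y. indicator \<Omega> (y - h *R d) * F y" "h *R d"] by (simp add: add.commute)
  have "L1 (\<lambda>x. F (x + h *R d))"
   using integrable_lborel_affine[of 1 F "h *R d"] F(1) by (simp add: add.commute)
  from integrable_mult_indicator[OF _ this, of \<Omega>]
  show "L1 (\<lambda>x. indicator \<Omega> x * F (x + h *R d))" by simp
 qed
 have "(LBINT x. indicator \<Omega> x * ((F (x + h *R d) - F x) / h))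
   = (LBINT x. (indicator \<Omega> x * F (x + h *R d) - indicator \<Omega> x * F x) / h)"
  by (intro Bochner_Integration.integral_cong refl) (simp add: right_diff_distrib)
 also have "\<dots> = ((LBINT x. indicator \<Omega> x * F (x + h *R d)) - (LBINT x. indicator \<Omega> x * F x)) / h"
  using 1 iF[OF \<Omega>s] by simp
 also have "(LBINT x. indicator \<Omega> x * F (x + h *R d))
   = (LBINT x. indicator \<Omega> x * F x) - (LBINT x. indicator (exit_layer \<Omega> h d) x * F x)"
  unfolding 2 pt using iF[OF \<Omega>s] iF[OF Es] by simp
 finally show ?thesis by simp
qed

text \<open>The limit of these layer averages stands in for the boundary integral of F times the
  normal component of d in the divergence theorem; no normal is ever defined.\<close>

lemma exit_layer_limit:
 assumes \<Omega>: "open \<Omega>" and cone: "inner_cone \<Omega> P \<rho> e \<kappa> \<tau>" and d: "dist e d < \<kappa>"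
  and F: "test_function (ball P (\<rho> / 2)) F" and T: "\<And>n. 0 < T n" "T ----> 0"
 shows "(\<lambda>n. (LBINT x. indicator (exit_layer \<Omega> (T n) d) x * F x) / T n)
  ----> - (LBINT x. indicator \<Omega> x * dd F x d)"
proof -
 note c = inner_coneD[OF cone]
 obtain K where K: "compact K" "K \<subseteq> ball P (\<rho> / 2)" "\<And>x. x \<notin> K ==> F x = 0"
  using test_supp[OF F] by auto
 have FK: "dist P x < \<rho> / 2" if "F x \<noteq> 0" for x using K(2) K(3)[of x] that by (cases "x \<in> K") auto
 note Fs = test_smooth[OF F]
 have "eventually (\<lambda>n. T n < 1) sequentially" using T(2) by (intro order_tendstoD) auto
 \<comment> \<open>The limit of the difference quotients is stated for step sizes at most 1, so the
   first N terms are dropped.\<close>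
 then obtain N where N: "\<And>n. n >= N ==> T n < 1" by (auto simp: eventually_sequentially)
 have "(\<lambda>n. LBINT x. indicator \<Omega> x * ((F (x + T (n + N) *R d) - F x) / T (n + N)))
   ----> (LBINT x. indicator \<Omega> x * dd F x d)"
 proof (rule difference_quotient_integral_tendsto(1)[OF smooth_has_derivative[OF Fs] K(1,3)])
  show "continuous_on UNIV (\<lambda>x. dd F x d)" by (intro smooth_continuous smooth_deriv Fs)
  show "\<Omega> \<in> sets borel" using \<Omega> by simp
  show "(\<lambda>n. T (n + N)) ----> 0" using T(2) by (rule LIMSEQ_ignore_initial_segment)
  show "T (n + N) <= 1" for n using N[of "n + N"] by simp
 qed (use T in auto)
 then have "(\<lambda>n. LBINT x. indicator \<Omega> x * ((F (x + T n *R d) - F x) / T n))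
   ----> (LBINT x. indicator \<Omega> x * dd F x d)"
  by (rule LIMSEQ_offset)
 moreover have "eventually (\<lambda>n. (LBINT x. indicator \<Omega> x * ((F (x + T n *R d) - F x) / T n))
   = - ((LBINT x. indicator (exit_layer \<Omega> (T n) d) x * F x) / T n)) sequentially"
 proof -
  have "(\<lambda>n. T n * norm d) ----> 0 * norm d" using T(2) by (intro tendsto_intros)
  then have "eventually (\<lambda>n. T n * norm d < \<rho> / 2) sequentially" using c(1) by (intro order_tendstoD) auto
  moreover have "eventually (\<lambda>n. T n < \<tau>) sequentially" using T(2) c(3) by (intro order_tendstoD) auto
  ultimately show ?thesis
  proof eventually_elim
   case (elim n)
   show ?case
    using exit_layer_difference[OF \<Omega> cone d T(1) elim(2,1) test_integrable[OF F] FK] by simp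
  qed
 qed
 ultimately have "(\<lambda>n. - ((LBINT x. indicator (exit_layer \<Omega> (T n) d) x * F x) / T n))
   ----> (LBINT x. indicator \<Omega> x * dd F x d)"
  by (rule Lim_transform_eventually)
 from tendsto_minus[OF this] show ?thesis by simp
qed

text \<open>The constant \<open>m\<close> does not depend on \<open>\<phi>\<close>: letting the boundary integral of \<open>\<phi>\<^sup>2\<close> tend to \<open>0\<close> and then
  \<open>a \<rightarrow> \<infinity>\<close> kills the boundary term.\<close>

lemma boundary_estimate:
 assumes \<Omega>: "open \<Omega>" "bounded \<Omega>" and cone: "inner_cone \<Omega> P \<rho> e \<kappa> \<tau>" and d: "dist e d < \<kappa>"
  and \<theta>: "test_function (ball P (\<rho> / 2)) \<theta>"
 shows "\<exists>m\<ge>0. \<exists>B\<ge>0. \<forall>\<phi> s a. smooth \<phi> --> a > 0 --> s >= 0 -->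
   (\<integral>\<^sup>+x. ennreal ((\<phi> x)\<^sup>2) \<partial>surface_measure \<Omega>) <= ennreal s -->
   \<bar>LBINT x. indicator \<Omega> x * dd (\<lambda>x. \<phi> x * \<theta> x) x d\<bar> <= B * (a * (9 * sweep_const * norm d * s) + m / a)"
proof -
 note c = inner_coneD[OF cone]
 have d0: "d \<noteq> 0" using d c(4) by (auto simp: dist_norm)
 obtain K where K: "compact K" "K \<subseteq> ball P (\<rho> / 2)" "\<And>x. x \<notin> K ==> \<theta> x = 0"
  using test_supp[OF \<theta>] by auto
 obtain \<beta> U where \<beta>: "test_function (ball P (\<rho> / 2)) \<beta>" "open U" "K \<subseteq> U" "\<forall>x\<in>U. \<beta> x = (1::real)" "\<forall>x. 0 <= \<beta> x"
  using cutoff_exists[OF K(1,2) open_ball] by blast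
 obtain B where B: "B > 0" "\<And>x. \<bar>\<theta> x\<bar> <= B" using test_bounded[OF \<theta>] by auto
 define T where "T n = inverse (real (Suc n))" for n
 have T: "\<And>n. 0 < T n" "T ----> 0" "\<And>n. T n <= 1"
  using LIMSEQ_inverse_real_of_nat by (auto simp: T_def[abs_def] inverse_le_1_iff)
 define E where "E n = exit_layer \<Omega> (T n) d \<inter> K" for n
 have Es [measurable]: "E n \<in> sets borel" for n
  unfolding E_def using exit_layer_sets[OF \<Omega>(1)] K(1) by (intro sets.Int) (auto intro!: borel_closed compact_imp_closed)
 have Efin: "emeasure lborel (E n) < \<infinity>" for n
  by (rule emeasure_bounded_finite) (use compact_imp_bounded[OF K(1)] in \<open>auto simp: E_def intro: bounded_subset\<close>)
 \<comment> \<open>The volume of the layer over K is bounded without recourse to the surface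
   measure: \<beta> is 1 on K, and its layer averages converge, hence eventually stay below
   M.\<close>
 define M where "M = \<bar>LBINT x. indicator \<Omega> x * dd \<beta> x d\<bar> + 1"
 have M: "M >= 0" by (simp add: M_def)
 have "eventually (\<lambda>n. \<bar>(LBINT x. indicator (exit_layer \<Omega> (T n) d) x * \<beta> x) / T n\<bar> < M) sequentially"
  using tendsto_rabs[OF exit_layer_limit[OF \<Omega>(1) cone d \<beta>(1) T(1,2)]]
  by (intro order_tendstoD) (auto simp: M_def)
 then have meas: "eventually (\<lambda>n. measure lborel (E n) <= M * T n) sequentially"
 proof eventually_elim
  case (elim n)
  have "measure lborel (E n) = (LBINT x. indicator (E n) x)" by simp
  also have "\<dots> <= (LBINT x. indicator (exit_layer \<Omega> (T n) d) x * \<beta> x)"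
  proof (rule integral_mono)
   show "L1 (\<lambda>x. indicator (E n) x :: real)" using Efin by (intro integrable_real_indicator) auto
   show "L1 (\<lambda>x. indicator (exit_layer \<Omega> (T n) d) x * \<beta> x)"
    using integrable_mult_indicator[OF _ test_integrable[OF \<beta>(1)], of "exit_layer \<Omega> (T n) d"] exit_layer_sets[OF \<Omega>(1)] by simp
   show "indicator (E n) x <= indicator (exit_layer \<Omega> (T n) d) x * \<beta> x" for x
    using \<beta>(3-5) by (auto simp: E_def indicator_def)
  qed
  also have "\<dots> <= M * T n" using elim T(1)[of n] by (auto simp: field_simps abs_less_iff)
  finally show ?case .
 qed
 have est: "\<bar>LBINT x. indicator \<Omega> x * dd (\<lambda>x. \<phi> x * \<theta> x) x d\<bar> <= B * (a * (9 * sweep_const * norm d * s) + M / a)"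
  if \<phi>: "smooth \<phi>" and a: "a > 0" and s: "s >= 0" and sig: "(\<integral>\<^sup>+x. ennreal ((\<phi> x)\<^sup>2) \<partial>surface_measure \<Omega>) <= ennreal s" for \<phi> s a
 proof -
  have \<phi>m [measurable]: "\<phi> Borel" by (rule smooth_measurable[OF \<phi>])
  let ?F = "\<lambda>x. \<phi> x * \<theta> x"
  have F: "test_function (ball P (\<rho> / 2)) ?F" by (rule test_mult(2)[OF \<theta> \<phi>])
  define f where "f x = (\<phi> x)\<^sup>2" for x
  have fc: "continuous_on UNIV f" unfolding f_def by (intro continuous_intros smooth_continuous \<phi>)
  have fm [measurable]: "f Borel" unfolding f_def by measurable
  have lim: "(\<lambda>n. \<bar>(LBINT x. indicator (exit_layer \<Omega> (T n) d) x * ?F x) / T n\<bar>)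
    ----> \<bar>LBINT x. indicator \<Omega> x * dd ?F x d\<bar>"
   using tendsto_rabs[OF exit_layer_limit[OF \<Omega>(1) cone d F T(1,2)]] by simp
  have bound: "\<bar>LBINT x. indicator \<Omega> x * dd ?F x d\<bar> <= B * (a * (2 * \<epsilon> * M + 9 * sweep_const * norm d * s) + M / a)"
   if \<epsilon>: "\<epsilon> > 0" for \<epsilon>
  proof -
   obtain R where R: "\<And>x. x \<in> closure \<Omega> ==> norm x <= R"
    using bounded_closure[OF \<Omega>(2)] by (auto simp: bounded_iff)
   let ?C = "cball (0::real^3) (R + norm d)"
   have "uniformly_continuous_on ?C f"
    by (intro compact_uniformly_continuous continuous_on_subset[OF fc]) auto
   then obtain \<delta> where \<delta>: "\<delta> > 0" "\<And>x y. x \<in> ?C ==> y \<in> ?C ==> dist y x < \<delta> ==> dist (f y) (f x) < \<epsilon>"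
    unfolding uniformly_continuous_on_def using \<epsilon> by blast
   obtain Mf where Mf: "\<And>x. x \<in> ?C ==> f x <= Mf"
   proof -
    have "compact (f ` ?C)" by (intro compact_continuous_image continuous_on_subset[OF fc]) auto
    then have "bounded (f ` ?C)" by (rule compact_imp_bounded)
    then have "\<exists>b. \<forall>x\<in>?C. \<bar>f x\<bar> <= b" by (auto simp: bounded_iff)
    then obtain b where "\<forall>x\<in>?C. \<bar>f x\<bar> <= b" by blast
    then show thesis using that[of b] by (auto simp: abs_le_iff)
   qed
   have "(\<lambda>n. T n * norm d) ----> 0 * norm d" using T(2) by (intro tendsto_intros)
   then have "eventually (\<lambda>n. T n * norm d < \<delta>) sequentially" using \<delta>(1) by (intro order_tendstoD) auto
   then have "eventually (\<lambda>n. \<bar>(LBINT x. indicator (exit_layer \<Omega> (T n) d) x * ?F x) / T n\<bar>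
      <= B * (a * (2 * \<epsilon> * M + 9 * sweep_const * norm d * s) + M / a)) sequentially"
    using meas
   proof eventually_elim
    case (elim n)
    have subE: "E n \<subseteq> sweep (T n) d (frontier \<Omega>)"
     using exit_layer_subset_sweep[OF T(1)] by (auto simp: E_def)
    have Tn: "T n * norm d <= norm d" using T(1,3)[of n] by (simp add: mult_left_le_one_le less_imp_le)
    have "(NN x. ennreal (f x) * indicator (E n) x) <= ennreal (2 * \<epsilon>) * emeasure lborel (E n)
      + ennreal (9 * sweep_const * norm d * T n) * (\<integral>\<^sup>+x. ennreal (f x) \<partial>surface_measure \<Omega>)"
    proof (rule layer_integral[OF Es subE T(1) d0 \<epsilon> fm])
     show "f x <= Mf" if "x \<in> E n" for x
     proof (rule Mf)
      have "x \<in> closure \<Omega>" using that closure_subset[of \<Omega>] by (auto simp: E_def exit_layer_def)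
      then show "x \<in> ?C" using R[of x] by (simp add: add_increasing2)
     qed
     fix q t assume q: "q \<in> frontier \<Omega>" "0 <= t" "t <= T n"
     have "norm q <= R" using R[of q] q(1) by (auto simp: frontier_def)
     moreover have "norm (t *R d) <= T n * norm d" using q by (auto intro: mult_right_mono)
     ultimately have "norm q <= R + norm d" "norm (q + t *R d) <= R + norm d" "norm (t *R d) < \<delta>"
      using norm_triangle_ineq[of q "t *R d"] Tn elim(1) norm_ge_zero[of d] by linarith+
     then have "q \<in> ?C" "q + t *R d \<in> ?C" "dist (q + t *R d) q < \<delta>"
      by (simp_all only: mem_cball_0) (simp add: dist_norm)
     then show "\<bar>f (q + t *R d) - f q\<bar> < \<epsilon>"
      using \<delta>(2) unfolding dist_real_def by blast
    qed (auto simp: f_def)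
    also have "\<dots> <= ennreal (2 * \<epsilon>) * ennreal (M * T n) + ennreal (9 * sweep_const * norm d * T n) * ennreal s"
     using elim(2) sig Efin[of n]
     by (intro add_mono mult_left_mono) (auto simp: f_def emeasure_eq_ennreal_measure less_top intro: ennreal_leI)
    also have "\<dots> = ennreal (T n * (2 * \<epsilon> * M + 9 * sweep_const * norm d * s))"
     using \<epsilon> M T(1)[of n] sweep_const_pos s
     by (simp add: ennreal_mult[symmetric] ennreal_plus[symmetric] algebra_simps del: ennreal_plus)
    finally have nn: "(NN x. ennreal (f x) * indicator (E n) x) <= ennreal (T n * (2 * \<epsilon> * M + 9 * sweep_const * norm d * s))" .
    have iE: "L1 (\<lambda>x. indicator (E n) x :: real)" using Efin by (intro integrable_real_indicator) auto
    have nn': "(NN x. ennreal (indicator (E n) x * f x)) = (NN x. ennreal (f x) * indicator (E n) x)"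
     by (intro nn_integral_cong) (auto simp: indicator_def)
    have intf: "L1 (\<lambda>x. indicator (E n) x * f x)"
     using nn unfolding nn'[symmetric] by (intro integrableI_nonneg) (auto simp: f_def le_less_trans)
    have fle: "(LBINT x. indicator (E n) x * f x) <= T n * (2 * \<epsilon> * M + 9 * sweep_const * norm d * s)"
     using nn \<epsilon> M T(1)[of n] sweep_const_pos s unfolding nn'[symmetric]
     by (subst (asm) nn_integral_eq_integral[OF intf]) (auto simp: f_def)
    have pt: "norm (indicator (exit_layer \<Omega> (T n) d) x * ?F x) <= B * (a * (indicator (E n) x * f x) + indicator (E n) x / a)" for x
    proof (cases "x \<in> exit_layer \<Omega> (T n) d \<and> x \<in> K")
     case True
     \<comment> \<open>Young's inequality |\<phi>| <= a \<phi>^2 + 1 / a: only the integral of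
       \<phi>^2 over the boundary is assumed small, and the term 1 / a is integrated against the
       volume of the layer.\<close>
     have "0 <= (a * \<bar>\<phi> x\<bar> - 1)\<^sup>2" by simp
     then have "2 * (a * \<bar>\<phi> x\<bar>) <= a\<^sup>2 * (\<phi> x)\<^sup>2 + 1" by (simp add: power2_diff power_mult_distrib)
     moreover have "a * \<bar>\<phi> x\<bar> >= 0" using a by simp
     moreover have "a * (a * f x + 1 / a) = a\<^sup>2 * (\<phi> x)\<^sup>2 + 1"
      using a by (simp add: f_def power2_eq_square field_simps)
     ultimately have "a * \<bar>\<phi> x\<bar> <= a * (a * f x + 1 / a)" by linarith
     then have le: "\<bar>\<phi> x\<bar> <= a * f x + 1 / a" using a by simp
     have "\<bar>\<phi> x\<bar> * \<bar>\<theta> x\<bar> <= (a * f x + 1 / a) * B"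
      using le B by (intro mult_mono) (auto simp: order_trans[OF abs_ge_zero le])
     then show ?thesis using True by (simp add: E_def abs_mult mult.commute)
    next
     case False
     then show ?thesis using K(3)[of x] a B(1) by (auto simp: E_def)
    qed
    have iF: "L1 (\<lambda>x. indicator (exit_layer \<Omega> (T n) d) x * ?F x)"
     using integrable_mult_indicator[OF _ test_integrable[OF F], of "exit_layer \<Omega> (T n) d"] exit_layer_sets[OF \<Omega>(1)] by simp
    have iR: "L1 (\<lambda>x. B * (a * (indicator (E n) x * f x) + indicator (E n) x / a))"
     using intf iE by simp
    have "\<bar>LBINT x. indicator (exit_layer \<Omega> (T n) d) x * ?F x\<bar>
      <= (LBINT x. norm (indicator (exit_layer \<Omega> (T n) d) x * ?F x))"
     using integral_norm_bound[of lborel "\<lambda>x. indicator (exit_layer \<Omega> (T n) d) x * ?F x"] by simp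
    also have "\<dots> <= (LBINT x. B * (a * (indicator (E n) x * f x) + indicator (E n) x / a))"
     by (rule integral_mono[OF integrable_norm[OF iF] iR pt])
    also have "\<dots> = B * (a * (LBINT x. indicator (E n) x * f x) + measure lborel (E n) / a)"
     using intf iE by simp
    also have "\<dots> <= B * (a * (T n * (2 * \<epsilon> * M + 9 * sweep_const * norm d * s)) + (M * T n) / a)"
     using B(1) a fle elim(2) by (intro mult_left_mono add_mono divide_right_mono) auto
    also have "\<dots> = T n * (B * (a * (2 * \<epsilon> * M + 9 * sweep_const * norm d * s) + M / a))"
     by (simp add: algebra_simps)
    finally have "\<bar>LBINT x. indicator (exit_layer \<Omega> (T n) d) x * ?F x\<bar> <= T n * (B * (a * (2 * \<epsilon> * M + 9 * sweep_const * norm d * s) + M / a))" .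
    then show ?case using T(1)[of n] by (simp add: abs_divide pos_divide_le_eq mult.commute)
   qed
   then show ?thesis by (rule tendsto_upperbound[OF lim]) simp
  qed
  have "((\<lambda>\<epsilon>. B * (a * (2 * \<epsilon> * M + 9 * sweep_const * norm d * s) + M / a)) \<longlongrightarrow> B * (a * (2 * 0 * M + 9 * sweep_const * norm d * s) + M / a)) (at_right 0)"
   by (intro tendsto_intros)
  then have "\<bar>LBINT x. indicator \<Omega> x * dd ?F x d\<bar> <= B * (a * (2 * 0 * M + 9 * sweep_const * norm d * s) + M / a)"
   by (rule tendsto_lowerbound) (auto simp: eventually_at_filter intro!: always_eventually bound)
  then show ?thesis by simp
 qed
 show ?thesis
  using est M B(1) by (intro exI[of _ M] exI[of _ B] conjI allI impI) auto
qed

lemma test_UNIV: "test_function \<Omega> \<phi> ==> test_function UNIV \<phi>"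
 by (rule test_mono) auto

lemma grad_diff:
 assumes "smooth \<phi>" "smooth \<psi>"
 shows "grad (\<lambda>x. \<phi> x - \<psi> x) x = grad \<phi> x - grad \<psi> x"
proof (rule vector_eq_rdot[THEN iffD1, rule_format])
 fix h
 have "((\<lambda>x. \<phi> x - \<psi> x) has_derivative (\<lambda>h. dd \<phi> x h - dd \<psi> x h)) (at x)"
  by (rule has_derivative_diff[OF assms[THEN smooth_has_derivative]])
 then show "grad (\<lambda>x. \<phi> x - \<psi> x) x \<bullet> h = (grad \<phi> x - grad \<psi> x) \<bullet> h"
  by (subst grad_inner) (auto simp: inner_diff_left grad_smooth_inner assms)
qed

lemma grad_const_on_open:
 assumes "open U" "x \<in> U" "\<And>y. y \<in> U ==> \<phi> y = c"
 shows "grad \<phi> x = 0"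
proof -
 have "(\<phi> has_derivative (\<lambda>_. 0)) (at x)"
  by (rule has_derivative_transform_within_open[of "\<lambda>_. c" _ _ _ U]) (use assms in auto)
 then have "dd \<phi> x = (\<lambda>_. 0)" using frechet_derivative_at by metis
 then show ?thesis by (simp add: grad_def vec_eq_iff)
qed

text \<open>Extension by zero across the boundary. The defect \<open>Ed \<theta> d\<close> in the
  integration by parts is a limit of boundary terms and vanishes for each d in the cone. Being
  linear in d, it vanishes for every h, since e and e + s h both lie in the cone for small
  s.\<close>

lemma zero_trace_wgrad_on:
 assumes \<Omega>: "open \<Omega>" "bounded \<Omega>" and cone: "inner_cone \<Omega> P \<rho> e \<kappa> \<tau>"
  and w: "L2 w" and g: "L2 g"
  and \<phi>: "\<And>k. smooth (\<phi> k)"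
  and l1: "(\<lambda>k. NN x. ennreal ((norm (indicator \<Omega> x * \<phi> k x - w x))\<^sup>2)) ----> 0"
  and l2: "(\<lambda>k. NN x. ennreal ((norm (indicator \<Omega> x *R grad (\<phi> k) x - g x))\<^sup>2)) ----> 0"
  and l3: "(\<lambda>k. \<integral>\<^sup>+x. ennreal ((\<phi> k x)\<^sup>2) \<partial>surface_measure \<Omega>) ----> 0"
 shows "wgrad_on (ball P (\<rho> / 2)) w g"
proof -
 note c = inner_coneD[OF cone]
 have \<Omega>s [measurable]: "\<Omega> \<in> sets borel" using \<Omega> by simp
 obtain b where b: "\<And>x. x \<in> closure \<Omega> ==> norm x <= b" using bounded_closure[OF \<Omega>(2)] by (auto simp: bounded_iff)
 have Lsm: "L2 (\<lambda>x. indicator \<Omega> x *R F x)" if F: "continuous_on UNIV F" for F :: "real^3 => 'b::euclidean_space"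
 proof -
  have [measurable]: "F Borel" using F by (rule borel_measurable_continuous_onI)
  have "compact (closure \<Omega>)" using \<Omega>(2) by (simp add: compact_closure)
  then have "bounded (F ` closure \<Omega>)" by (intro compact_imp_bounded compact_continuous_image continuous_on_subset[OF F]) auto
  then obtain B where B: "\<And>x. x \<in> closure \<Omega> ==> norm (F x) <= B" by (auto simp: bounded_iff)
  have i: "L2 (indicator \<Omega> :: real^3 => real)"
   unfolding square_integrable_def using emeasure_bounded_finite[OF \<Omega>(2)]
   by (auto simp: power2_eq_square indicator_def simp flip: indicator_def intro!: integrable_real_indicator)
     (simp add: indicator_inter_arith[symmetric])
  show ?thesis
  proof (rule L2_bound[OF i, of _ B])
   show "AE x in lborel. norm (indicator \<Omega> x *R F x) <= B * norm (indicator \<Omega> x :: real)"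
    using B closure_subset[of \<Omega>] by (auto intro!: AE_I2 simp: indicator_def)
  qed measurable
 qed
 have W: "L2 (\<lambda>x. indicator \<Omega> x * \<phi> k x)" for k
  using Lsm[OF smooth_continuous[OF \<phi>]] by simp
 have G: "L2 (\<lambda>x. indicator \<Omega> x *R grad (\<phi> k) x)" for k
  by (rule Lsm[OF continuous_on_grad[OF \<phi>]])
 define Ed where "Ed \<theta> d = (LBINT x. dd \<theta> x d * w x) + (LBINT x. (\<theta> x *R d) \<bullet> g x)" for \<theta> d
 have zero: "Ed \<theta> d = 0" if \<theta>: "test_function (ball P (\<rho> / 2)) \<theta>" and d: "dist e d < \<kappa>" for \<theta> d
 proof -
  define I where "I k = (LBINT x. indicator \<Omega> x * dd (\<lambda>x. \<phi> k x * \<theta> x) x d)" for k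
  note \<theta>s = test_smooth[OF \<theta>]
  have S1: "L2 (\<lambda>x. dd \<theta> x d)"
   by (rule test_square_integrable[OF test_deriv[OF \<theta>]])
  have S2: "L2 (\<lambda>x. \<theta> x *R d)"
   by (rule L2_bound[OF test_square_integrable[OF \<theta>], of _ "norm d"])
     (use smooth_measurable[OF \<theta>s] in \<open>auto simp: mult.commute\<close>)
  have Ieq: "I k = (LBINT x. dd \<theta> x d * (indicator \<Omega> x * \<phi> k x)) + (LBINT x. (\<theta> x *R d) \<bullet> (indicator \<Omega> x *R grad (\<phi> k) x))" for k
  proof -
   have fr: "dd (\<lambda>x. \<phi> k x * \<theta> x) x d = \<phi> k x * dd \<theta> x d + (grad (\<phi> k) x \<bullet> d) * \<theta> x" for x
    using frechet_derivative_at[OF has_derivative_mult[OF smooth_has_derivative[OF \<phi>[of k], of x] smooth_has_derivative[OF \<theta>s, of x]]]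
    by (simp add: grad_smooth_inner[OF \<phi>] fun_eq_iff)
   have "I k = (LBINT x. dd \<theta> x d * (indicator \<Omega> x * \<phi> k x) + (\<theta> x *R d) \<bullet> (indicator \<Omega> x *R grad (\<phi> k) x))"
    unfolding I_def fr by (intro Bochner_Integration.integral_cong refl) (simp add: algebra_simps inner_commute)
   also have "\<dots> = (LBINT x. dd \<theta> x d * (indicator \<Omega> x * \<phi> k x)) + (LBINT x. (\<theta> x *R d) \<bullet> (indicator \<Omega> x *R grad (\<phi> k) x))"
    using integrable_inner_L2[OF S1 W[of k]] integrable_inner_L2[OF S2 G[of k]] by (intro Bochner_Integration.integral_add) auto
   finally show ?thesis .
  qed
  have lim: "I ----> Ed \<theta> d"
   unfolding Ieq Ed_def
   using L2_inner_tendsto[OF S1 w W l1] L2_inner_tendsto[OF S2 g G l2] by (intro tendsto_add) auto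
  obtain m B where mB: "m >= 0" "B >= 0" and est: "\<And>\<phi> s a. smooth \<phi> ==> a > 0 ==> s >= 0 ==>
    (\<integral>\<^sup>+x. ennreal ((\<phi> x)\<^sup>2) \<partial>surface_measure \<Omega>) <= ennreal s ==>
    \<bar>LBINT x. indicator \<Omega> x * dd (\<lambda>x. \<phi> x * \<theta> x) x d\<bar> <= B * (a * (9 * sweep_const * norm d * s) + m / a)"
   using boundary_estimate[OF \<Omega> cone d \<theta>] by blast
  have bd: "\<bar>Ed \<theta> d\<bar> <= B * (9 * sweep_const * norm d + m) * inverse (real (Suc n))" for n
  proof -
   \<comment> \<open>With a boundary integral of at most 1 / a^2 both terms of the estimate are of
     order 1 / a.\<close>
   let ?a = "real (Suc n)"
   have "eventually (\<lambda>k. (\<integral>\<^sup>+x. ennreal ((\<phi> k x)\<^sup>2) \<partial>surface_measure \<Omega>) <= ennreal (1 / ?a\<^sup>2)) sequentially"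
    by (rule ennreal_tendsto_0D[OF l3]) simp
   then have "eventually (\<lambda>k. \<bar>I k\<bar> <= B * (9 * sweep_const * norm d + m) * inverse ?a) sequentially"
   proof eventually_elim
    case (elim k)
    have "\<bar>I k\<bar> <= B * (?a * (9 * sweep_const * norm d * (1 / ?a\<^sup>2)) + m / ?a)"
     unfolding I_def by (rule est[OF \<phi> _ _ elim]) auto
    also have "\<dots> = B * (9 * sweep_const * norm d + m) * inverse ?a"
     by (simp add: field_simps power2_eq_square del: of_nat_Suc)
    finally show ?case .
   qed
   then show ?thesis by (rule tendsto_upperbound[OF tendsto_rabs[OF lim]]) simp
  qed
  have "(\<lambda>n. B * (9 * sweep_const * norm d + m) * inverse (real (Suc n))) ----> B * (9 * sweep_const * norm d + m) * 0"
   by (intro tendsto_mult tendsto_const LIMSEQ_inverse_real_of_nat)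
  then have "\<bar>Ed \<theta> d\<bar> <= B * (9 * sweep_const * norm d + m) * 0"
   by (rule LIMSEQ_le_const) (use bd in auto)
  then show ?thesis by simp
 qed
 show ?thesis
  unfolding wgrad_on_def
 proof (intro conjI allI impI w g)
  fix \<theta> :: "real^3 => real" and h :: "real^3" assume \<theta>: "test_function (ball P (\<rho> / 2)) \<theta>"
  note \<theta>s = test_smooth[OF \<theta>]
  have lin: "linear (dd \<theta> x)" for x
   using smooth_has_derivative[OF \<theta>s] has_derivative_linear by blast
  have S1: "L2 (\<lambda>x. dd \<theta> x d)" for d
   by (rule test_square_integrable[OF test_deriv[OF \<theta>]])
  have S2: "L2 (\<lambda>x. \<theta> x *R d)" for d :: "real^3"
   by (rule L2_bound[OF test_square_integrable[OF \<theta>], of _ "norm d"])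
     (use smooth_measurable[OF \<theta>s] in \<open>auto simp: mult.commute\<close>)
  have i1: "L1 (\<lambda>x. dd \<theta> x d * w x)" for d
   using integrable_inner_L2[OF S1 w] by simp
  have i2: "L1 (\<lambda>x. \<theta> x * (d \<bullet> g x))" for d
   using integrable_inner_L2[OF S2 g] by simp
  \<comment> \<open>Keeps s |h| below \<kappa>, also for h = 0.\<close>
  define s where "s = \<kappa> / (2 * (norm h + 1))"
  have s: "s > 0" using c(2) by (auto simp: s_def intro!: divide_pos_pos add_nonneg_pos)
  have "s * norm h < \<kappa>"
  proof -
   have "s * norm h <= s * (norm h + 1)" using s by (intro mult_left_mono) auto
   also have "\<dots> = \<kappa> / 2"
   proof -
    have "norm h + 1 \<noteq> 0" using norm_ge_zero[of h] by linarith
    then show ?thesis unfolding s_def by (simp add: divide_simps)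
   qed
   finally show ?thesis using c(2) by simp
  qed
  then have "dist e (e + s *R h) < \<kappa>" using s by (simp add: dist_norm)
  from zero[OF \<theta> this] have 1: "Ed \<theta> (e + s *R h) = 0" .
  have 2: "Ed \<theta> e = 0" using zero[OF \<theta>, of e] c(2) by simp
  have "Ed \<theta> (e + s *R h) = Ed \<theta> e + s * Ed \<theta> h"
   using i1 i2 unfolding Ed_def
   by (simp add: linear_add[OF lin] linear_scale[OF lin] inner_add_left algebra_simps)
  then have "Ed \<theta> h = 0" using 1 2 s by simp
  then show "(LBINT x. w x * dd \<theta> x h) = - (LBINT x. (g x \<bullet> h) * \<theta> x)"
   by (simp add: Ed_def inner_commute mult.commute)
 qed
qed

text \<open>The mollifier has centre \<epsilon> e and radius \<epsilon> \<kappa> / 2. Half of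
  \<kappa> is kept in reserve: a point of the closure of \<Omega> \<inter> K is first replaced by a
  nearby point of \<Omega> \<inter> K itself, and the resulting direction must still lie in the
  cone.\<close>

lemma cone_local_orthogonal:
 assumes \<Omega>: "open \<Omega>" and cone: "inner_cone \<Omega> P \<rho> e \<kappa> \<tau>"
  and w: "wgrad_on (ball P (\<rho> / 2)) w g" and w0: "\<And>x. x \<notin> \<Omega> ==> w x = 0"
  and h: "scalar_divfree \<Omega> h" and \<zeta>: "test_function (ball P (\<rho> / 2)) \<zeta>"
 shows "(LBINT x. h x \<bullet> (\<zeta> x *R g x + w x *R grad \<zeta> x)) = 0"
proof -
 note c = inner_coneD[OF cone]
 have z: "wgrad (\<lambda>x. \<zeta> x * w x) (\<lambda>x. \<zeta> x *R g x + w x *R grad \<zeta> x)" by (rule wgrad_on_cutoff[OF w \<zeta>])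
 obtain K where K: "compact K" "K \<subseteq> ball P (\<rho> / 2)" "\<And>x. x \<notin> K ==> \<zeta> x = 0" using test_supp[OF \<zeta>] by auto
 define \<mu> where "\<mu> = \<tau> / 2"
 have \<mu>: "\<mu> > 0" "\<mu> < \<tau>" using c(3) by (auto simp: \<mu>_def)
 define \<epsilon> where "\<epsilon> n = inverse (real (Suc n)) * \<mu>" for n
 have \<epsilon>: "\<epsilon> n > 0" "\<epsilon> n < \<tau>" for n
 proof -
  show "\<epsilon> n > 0" using \<mu> by (simp add: \<epsilon>_def)
  have "inverse (real (Suc n)) <= 1" by (simp add: inverse_le_1_iff)
  then have "\<epsilon> n <= 1 * \<mu>" using \<mu> unfolding \<epsilon>_def by (intro mult_right_mono) auto
  then show "\<epsilon> n < \<tau>" using \<mu> by simp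
 qed
 have "\<exists>\<eta>. mollifier (\<epsilon> n *R e) (\<epsilon> n * \<kappa> / 2) \<eta>" for n using \<epsilon>(1)[of n] c(2) by (intro mollifier_exists) auto
 then obtain \<eta> where \<eta>: "\<And>n. mollifier (\<epsilon> n *R e) (\<epsilon> n * \<kappa> / 2) (\<eta> n)" by metis
 have "(\<lambda>n. inverse (real (Suc n)) * (\<mu> * (norm e + \<kappa> / 2))) ----> 0 * (\<mu> * (norm e + \<kappa> / 2))"
  by (intro tendsto_mult LIMSEQ_inverse_real_of_nat tendsto_const)
 moreover have "norm (\<epsilon> n *R e) + \<epsilon> n * \<kappa> / 2 = inverse (real (Suc n)) * (\<mu> * (norm e + \<kappa> / 2))" for n
 proof -
  have "norm (\<epsilon> n *R e) + \<epsilon> n * \<kappa> / 2 = \<epsilon> n * (norm e + \<kappa> / 2)" using \<epsilon>(1)[of n] by (simp add: algebra_simps)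
  then show ?thesis by (simp only: \<epsilon>_def mult.assoc)
 qed
 ultimately have limn: "(\<lambda>n. norm (\<epsilon> n *R e) + \<epsilon> n * \<kappa> / 2) ----> 0" by simp
 have mol: "mollifying \<eta>"
  unfolding mollifying_def
  by (rule exI[of _ "\<lambda>n. \<epsilon> n *R e"], rule exI[of _ "\<lambda>n. \<epsilon> n * \<kappa> / 2"], rule conjI[OF allI[OF \<eta>] limn])
 have "test_function \<Omega> (conv (\<eta> n) (\<lambda>x. \<zeta> x * w x))" for n
 proof (rule test_functionI[OF conv_smooth[OF mollifying_test[OF mol] wgradD(3)[OF z]]])
  let ?S = "{x + y | x y. x \<in> closure (\<Omega> \<inter> K) \<and> y \<in> cball (\<epsilon> n *R e) (\<epsilon> n * \<kappa> / 2)}"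
  have "bounded (\<Omega> \<inter> K)" using compact_imp_bounded[OF K(1)] by (rule bounded_subset) auto
  then show "compact ?S" by (intro compact_sums) (auto simp: compact_closure)
  show "?S \<subseteq> \<Omega>"
  proof
   fix v assume "v \<in> ?S"
   then obtain x y where v: "v = x + y" "x \<in> closure (\<Omega> \<inter> K)" "dist (\<epsilon> n *R e) y <= \<epsilon> n * \<kappa> / 2" by auto
   have "\<epsilon> n * \<kappa> / 2 > 0" using \<epsilon>(1)[of n] c(2) by simp
   from closure_approachable[THEN iffD1, OF v(2), rule_format, OF this]
   obtain x' where x': "x' \<in> \<Omega>" "x' \<in> K" "dist x' x < \<epsilon> n * \<kappa> / 2" by blast
   define d where "d = inverse (\<epsilon> n) *R (y + (x - x'))"
   have y: "\<epsilon> n *R d = y + (x - x')" using \<epsilon>(1)[of n] by (simp add: d_def)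
   have "\<epsilon> n * dist e d = norm (\<epsilon> n *R e - \<epsilon> n *R d)"
    using \<epsilon>(1)[of n] by (simp add: dist_norm scaleR_diff_right[symmetric])
   also have "\<dots> = norm ((\<epsilon> n *R e - y) + (x' - x))" unfolding y by (simp add: algebra_simps)
   also have "\<dots> < \<epsilon> n * \<kappa>" using norm_triangle_ineq[of "\<epsilon> n *R e - y" "x' - x"] v(3) x'(3) by (simp add: dist_norm)
   finally have "dist e d < \<kappa>" using \<epsilon>(1)[of n] by simp
   moreover have "dist P x' < \<rho>" using x'(2) K(2) c(1) by auto
   ultimately have "x' + \<epsilon> n *R d \<in> \<Omega>" using c(5)[OF x'(1)] \<epsilon> by blast
   then show "v \<in> \<Omega>" unfolding y v(1) by (simp add: add.commute)
  qed
  fix x assume "conv (\<eta> n) (\<lambda>x. \<zeta> x * w x) x \<noteq> 0"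
  then obtain y where y: "\<eta> n (x - y) \<noteq> 0" "\<zeta> y * w y \<noteq> 0" by (rule conv_support)
  have "y \<in> \<Omega> \<inter> K" using y(2) w0[of y] K(3)[of y] by (cases "y \<in> \<Omega>"; cases "y \<in> K") auto
  moreover have "x - y \<in> ball (\<epsilon> n *R e) (\<epsilon> n * \<kappa> / 2)" using mollifier_D(3)[OF \<eta> y(1)] .
  ultimately show "x \<in> ?S" using closure_subset[of "\<Omega> \<inter> K"]
   by (intro CollectI exI[of _ y] exI[of _ "x - y"]) auto
 qed
 then show ?thesis by (intro divfree_orthogonal_of_conv[OF h z mol]) auto
qed

text \<open>A partition of unity written as a product. Multiplying a cutoff by 1 -
  \<open>\<beta> P\<close> changes \<open>\<Lambda>\<close> by its value at a test function of the
  ball around P, hence by 0. After finitely many factors the product vanishes near every point of S,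
  so \<open>\<Lambda> \<zeta>0\<close> is 0, and \<open>\<zeta>0\<close> is 1 near S.\<close>

lemma localization:
 fixes S :: "(real^3) set"
 assumes S: "compact S" and w: "L2 w" and g: "L2 g" and h: "L2 h"
  and zero: "\<And>x. x \<notin> S ==> w x = 0 \<and> g x = 0"
  and loc: "\<And>P. P \<in> S ==> \<exists>R>0. \<forall>\<zeta>. test_function (ball P R) \<zeta> -->
    (LBINT x. h x \<bullet> (\<zeta> x *R g x + w x *R grad \<zeta> x)) = 0"
 shows "(LBINT x. h x \<bullet> g x) = 0"
proof -
 define \<Lambda> where "\<Lambda> \<zeta> = (LBINT x. h x \<bullet> (\<zeta> x *R g x + w x *R grad \<zeta> x))" for \<zeta>
 have "\<forall>P\<in>S. \<exists>R>0. \<forall>\<zeta>. test_function (ball P R) \<zeta> --> \<Lambda> \<zeta> = 0"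
  using loc unfolding \<Lambda>_def by (rule ballI)
 from bchoice[OF this] obtain R where R': "\<forall>P\<in>S. R P > 0 \<and> (\<forall>\<zeta>. test_function (ball P (R P)) \<zeta> --> \<Lambda> \<zeta> = 0)"
  by (rule exE)
 then have R: "\<And>P. P \<in> S ==> R P > 0"
  "\<And>P \<zeta>. P \<in> S ==> test_function (ball P (R P)) \<zeta> ==> \<Lambda> \<zeta> = 0"
  by simp_all
 have "\<forall>P\<in>S. \<exists>p. test_function (ball P (R P)) (fst p :: real^3 => real) \<and> open (snd p) \<and> P \<in> snd p \<and> (\<forall>x\<in>snd p. fst p x = 1)"
 proof
  fix P assume P: "P \<in> S"
  have "{P} \<subseteq> ball P (R P)" using R(1)[OF P] by simp
  from cutoff_exists[OF _ this open_ball, OF finite_imp_compact[OF finite.intros(2)[OF finite.intros(1)]]]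
  obtain \<beta> :: "real^3 => real" and U where
   "test_function (ball P (R P)) \<beta> \<and> open U \<and> {P} \<subseteq> U \<and> (\<forall>x\<in>U. \<beta> x = 1) \<and> (\<forall>x. 0 <= \<beta> x)" by (elim exE)
  then show "\<exists>p. test_function (ball P (R P)) (fst p :: real^3 => real) \<and> open (snd p) \<and> P \<in> snd p \<and> (\<forall>x\<in>snd p. fst p x = 1)"
   by (intro exI[of _ "(\<beta>, U)"]) simp
 qed
 from bchoice[OF this] obtain q where
  q: "\<forall>P\<in>S. test_function (ball P (R P)) (fst (q P) :: real^3 => real) \<and> open (snd (q P)) \<and> P \<in> snd (q P) \<and> (\<forall>x\<in>snd (q P). fst (q P) x = 1)"
  by (rule exE)
 define \<beta> U where "\<beta> P = fst (q P)" and "U P = snd (q P)" for P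
 have \<beta>: "\<And>P. P \<in> S ==> test_function (ball P (R P)) (\<beta> P)" "\<And>P. P \<in> S ==> open (U P)"
  "\<And>P. P \<in> S ==> P \<in> U P" "\<And>P x. P \<in> S ==> x \<in> U P ==> \<beta> P x = 1"
  using q unfolding \<beta>_def U_def by blast+
 obtain F where F: "F \<subseteq> S" "finite F" "S \<subseteq> (\<Union>P\<in>F. U P)"
  by (rule compactE_image[OF S, of S U]) (use \<beta> in auto)
 have int: "L1 (\<lambda>x. h x \<bullet> (\<zeta> x *R g x + w x *R grad \<zeta> x))" if \<zeta>: "test_function UNIV \<zeta>" for \<zeta>
 proof (rule integrable_inner_L2[OF h L2_add])
  note \<zeta>s = test_smooth[OF \<zeta>]
  have [measurable]: "\<zeta> Borel" "w Borel" "g Borel" "grad \<zeta> Borel"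
   using smooth_measurable[OF \<zeta>s] w g grad_test_square_integrable[OF \<zeta>] by (auto simp: square_integrable_def)
  obtain B where B: "\<And>x. norm (\<zeta> x) <= B" using test_bounded[OF \<zeta>] by blast
  show "L2 (\<lambda>x. \<zeta> x *R g x)"
   by (rule L2_bound[OF g, of _ B]) (use B in \<open>auto intro!: AE_I2 mult_right_mono\<close>)
  obtain K where K: "compact K" "\<And>x. x \<notin> K ==> \<zeta> x = 0" "\<And>x b. x \<notin> K ==> dd \<zeta> x b = 0"
   using test_supp_deriv[OF \<zeta>] by auto
  have gK: "grad \<zeta> x = 0" if "x \<notin> K" for x using K(3)[OF that] by (simp add: grad_def vec_eq_iff)
  obtain B' where B': "\<And>x. norm (grad \<zeta> x) <= B'"
   using compact_support_bounded[OF continuous_on_grad[OF \<zeta>s] K(1) gK] by blast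
  show "L2 (\<lambda>x. w x *R grad \<zeta> x)"
   by (rule L2_bound[OF w, of _ B']) (auto simp: mult.commute[of "\<bar>w _\<bar>"] intro!: AE_I2 mult_right_mono B')
 qed
 obtain \<zeta>0 V where \<zeta>0: "test_function UNIV \<zeta>0" "open V" "S \<subseteq> V" "\<forall>x\<in>V. \<zeta>0 x = (1::real)"
  using cutoff_exists[OF S subset_UNIV open_UNIV] by blast
 have prod: "test_function UNIV (\<lambda>x. \<zeta>0 x * (\<Prod>P\<in>F'. (1 - \<beta> P x))) \<and> \<Lambda> (\<lambda>x. \<zeta>0 x * (\<Prod>P\<in>F'. (1 - \<beta> P x))) = \<Lambda> \<zeta>0"
  if "F' \<subseteq> S" "finite F'" for F'
  using that(2,1)
 proof (induction F' rule: finite_induct)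
  case empty
  then show ?case using \<zeta>0(1) by simp
 next
  case (insert P F')
  let ?p = "\<lambda>x. \<zeta>0 x * (\<Prod>P\<in>F'. (1 - \<beta> P x))"
  have P: "P \<in> S" and p: "test_function UNIV ?p" and eq: "\<Lambda> ?p = \<Lambda> \<zeta>0" using insert by auto
  have t: "test_function (ball P (R P)) (\<lambda>x. \<beta> P x * ?p x)"
   by (rule test_mult(1)[OF \<beta>(1)[OF P] test_smooth[OF p]])
  then have \<Lambda>0: "\<Lambda> (\<lambda>x. \<beta> P x * ?p x) = 0" by (rule R(2)[OF P])
  have tU: "test_function UNIV (\<lambda>x. \<beta> P x * ?p x)" by (rule test_UNIV[OF t])
  have e: "(\<lambda>x. \<zeta>0 x * (\<Prod>P\<in>insert P F'. (1 - \<beta> P x))) = (\<lambda>x. ?p x - \<beta> P x * ?p x)"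
   using insert.hyps by (auto simp: algebra_simps)
  have "\<Lambda> (\<lambda>x. ?p x - \<beta> P x * ?p x) = \<Lambda> ?p - \<Lambda> (\<lambda>x. \<beta> P x * ?p x)"
   unfolding \<Lambda>_def grad_diff[OF test_smooth[OF p] test_smooth[OF tU]]
   by (subst Bochner_Integration.integral_diff[OF int[OF p] int[OF tU], symmetric])
     (intro Bochner_Integration.integral_cong refl, simp add: algebra_simps inner_diff_right inner_add_right)
  then show ?case unfolding e using \<Lambda>0 eq test_diff[OF p tU] by simp
 qed
 let ?p = "\<lambda>x. \<zeta>0 x * (\<Prod>P\<in>F. (1 - \<beta> P x))"
 have "\<Lambda> ?p = 0"
 proof -
  have "h x \<bullet> (?p x *R g x + w x *R grad ?p x) = 0" for x
  proof (cases "x \<in> S")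
   case True
   then obtain P where P: "P \<in> F" "x \<in> U P" using F(3) by blast
   have z: "?p y = 0" if "y \<in> U P" for y
   proof -
    have "1 - \<beta> P y = 0" using \<beta>(4)[of P y] P F(1) that by auto
    then have "(\<Prod>P\<in>F. (1 - \<beta> P y)) = 0" using P(1) F(2) by (intro prod_zero) auto
    then show ?thesis by simp
   qed
   have "grad ?p x = 0" using P F(1) \<beta>(2) by (intro grad_const_on_open[of "U P" x ?p 0] z) auto
   then show ?thesis using z[OF P(2)] by simp
  qed (use zero in auto)
  then show ?thesis by (simp add: \<Lambda>_def)
 qed
 then have "\<Lambda> \<zeta>0 = 0" using prod[OF F(1,2)] by simp
 moreover have "h x \<bullet> (\<zeta>0 x *R g x + w x *R grad \<zeta>0 x) = h x \<bullet> g x" for x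
 proof (cases "x \<in> S")
  case True
  then have "grad \<zeta>0 x = 0" "\<zeta>0 x = 1" using grad_const_on_open[of V x \<zeta>0 1] \<zeta>0 by auto
  then show ?thesis by simp
 qed (use zero in auto)
 ultimately show ?thesis by (simp add: \<Lambda>_def)
qed

theorem zero_trace_orthogonal:
 assumes \<Omega>: "open \<Omega>" "bounded \<Omega>" and cone: "\<And>P. P \<in> closure \<Omega> ==> \<exists>\<rho> e \<kappa> \<tau>. inner_cone \<Omega> P \<rho> e \<kappa> \<tau>"
  and w: "L2 w" and g: "L2 g"
  and zero: "\<And>x. x \<notin> \<Omega> ==> w x = 0 \<and> g x = 0"
  and \<phi>: "\<And>k. smooth (\<phi> k)"
  and l1: "(\<lambda>k. NN x. ennreal ((norm (indicator \<Omega> x * \<phi> k x - w x))\<^sup>2)) ----> 0"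
  and l2: "(\<lambda>k. NN x. ennreal ((norm (indicator \<Omega> x *R grad (\<phi> k) x - g x))\<^sup>2)) ----> 0"
  and l3: "(\<lambda>k. \<integral>\<^sup>+x. ennreal ((\<phi> k x)\<^sup>2) \<partial>surface_measure \<Omega>) ----> 0"
  and h: "scalar_divfree \<Omega> h"
 shows "(LBINT x. h x \<bullet> g x) = 0"
proof (rule localization[of "closure \<Omega>", OF _ w g])
 show "compact (closure \<Omega>)" using \<Omega>(2) by (simp add: compact_closure)
 show "L2 h" using h by (simp add: scalar_divfree_def)
 show "w x = 0 \<and> g x = 0" if "x \<notin> closure \<Omega>" for x using zero that closure_subset by blast
 fix P assume "P \<in> closure \<Omega>"
 then obtain \<rho> e \<kappa> \<tau> where c: "inner_cone \<Omega> P \<rho> e \<kappa> \<tau>" using cone by blast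
 show "\<exists>R>0. \<forall>\<zeta>. test_function (ball P R) \<zeta> --> (LBINT x. h x \<bullet> (\<zeta> x *R g x + w x *R grad \<zeta> x)) = 0"
  using cone_local_orthogonal[OF \<Omega>(1) c zero_trace_wgrad_on[OF \<Omega> c w g \<phi> l1 l2 l3] _ h] zero inner_coneD(1)[OF c]
  by (intro exI[of _ "\<rho> / 2"]) auto
qed

section \<open>Inner cones at interior points and at Lipschitz boundary points\<close>

lemma inner_cone_interior:
 assumes "open \<Omega>" "P \<in> \<Omega>"
 shows "\<exists>\<rho> e \<kappa> \<tau>. inner_cone \<Omega> P \<rho> e \<kappa> \<tau>"
proof -
 obtain r where r: "r > 0" "ball P r \<subseteq> \<Omega>" using assms open_contains_ball by blast
 have "x + t *R d \<in> \<Omega>" if "dist P x < r / 2" "dist (axis 1 1 :: real^3) d < 1" "0 < t" "t < r / 4" for x d t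
 proof -
  have "norm d < 2" using that(2) norm_triangle_sub[of d "axis 1 1 :: real^3"] by (simp add: dist_norm norm_minus_commute)
  then have "t * norm d < r / 4 * 2" using that(3,4) by (intro mult_strict_mono) auto
  then have "norm (t *R d) < r / 2" using that(3) by simp
  then have "dist P (x + t *R d) < r" using that(1) dist_triangle[of P "x + t *R d" x] by (simp add: dist_norm)
  then show ?thesis using r(2) by auto
 qed
 then have "inner_cone \<Omega> P (r / 2) (axis 1 1) 1 (r / 4)" using r(1) by (auto simp: inner_cone_def)
 then show ?thesis by blast
qed

text \<open>In the chart a step t b, with b within \<kappa> of the third axis, rises by at least t
  (1 - \<kappa>), while the graph rises by at most 2 L \<kappa> t; \<kappa> = 1 / (2 (L + 1)) makes
  the former larger. The radii \<open>r\<^sub>0 / 4\<close> and \<open>r\<^sub>0 / 8\<close> keep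
  the step inside the chart, and D is too far from P to contain the starting point.\<close>

lemma inner_cone_lipschitz:
 assumes lip: "lipschitz_portion (\<Omega> - D) S r\<^sub>0 M\<^sub>0" and P: "P \<in> S" and r0: "r\<^sub>0 > 0" and M0: "M\<^sub>0 >= 1"
  and D: "\<And>x. x \<in> D ==> r\<^sub>0 <= dist P x"
 shows "\<exists>\<rho> e \<kappa> \<tau>. inner_cone \<Omega> P \<rho> e \<kappa> \<tau>"
proof -
 obtain T g m L where T: "orthogonal_transformation T"
  and L: "L-lipschitz_on ({-r\<^sub>0..r\<^sub>0} \<times> {-r\<^sub>0..r\<^sub>0}) (g :: real \<times> real => real)"
  and U: "\<And>x :: real^3. \<bar>x $ 1\<bar> <= r\<^sub>0 ==> \<bar>x $ 2\<bar> <= r\<^sub>0 ==> \<bar>x $ 3\<bar> <= 2 * M\<^sub>0 * r\<^sub>0 ==>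
    (P + T x \<in> \<Omega> - D \<longleftrightarrow> g (x $ 1, x $ 2) < x $ 3)"
  using lip P unfolding lipschitz_portion_def by blast
 have L0: "L >= 0" using L by (rule lipschitz_on_nonneg)
 have lin: "linear T" using T by (simp add: orthogonal_transformation_def)
 have surj: "\<exists>x. T x = y" for y using orthogonal_transformation_surj[OF T] by (metis surjD)
 have nT: "norm (T x) = norm x" for x by (rule orthogonal_transformation_norm[OF T])
 define \<kappa> where "\<kappa> = 1 / (2 * (L + 1))"
 have \<kappa>: "\<kappa> > 0" "\<kappa> <= 1/2" "2 * L * \<kappa> < 1 - \<kappa>"
  using L0 by (auto simp: \<kappa>_def field_simps)
 let ?e = "axis 3 1 :: real^3"
 have "x + t *R d \<in> \<Omega>" if x: "x \<in> \<Omega>" "dist P x < r\<^sub>0 / 4" and d: "dist (T ?e) d < \<kappa>" and t: "0 < t" "t < r\<^sub>0 / 8" for x d t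
 proof -
  obtain y where y: "T y = x - P" using surj by blast
  obtain b where b: "T b = d" using surj by blast
  have ny: "norm y < r\<^sub>0 / 4" using x(2) nT[of y] y by (simp add: dist_norm norm_minus_commute)
  have nb: "norm (b - ?e) < \<kappa>" using d nT[of "b - ?e"] b by (simp add: linear_diff[OF lin] dist_norm norm_minus_commute)
  have bc: "\<bar>b $ 1\<bar> < \<kappa>" "\<bar>b $ 2\<bar> < \<kappa>" "\<bar>b $ 3 - 1\<bar> < \<kappa>"
   using component_le_norm_cart[of "b - ?e" 1] component_le_norm_cart[of "b - ?e" 2] component_le_norm_cart[of "b - ?e" 3] nb
   by (auto simp: axis_def)
  have yc: "\<bar>y $ i\<bar> < r\<^sub>0 / 4" for i using component_le_norm_cart[of y i] ny by linarith
  have tb: "\<bar>t * b $ 1\<bar> <= r\<^sub>0 / 8" "\<bar>t * b $ 2\<bar> <= r\<^sub>0 / 8" "\<bar>t * b $ 3\<bar> <= r\<^sub>0 / 4"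
  proof -
   have bb: "\<bar>b $ 1\<bar> <= 1" "\<bar>b $ 2\<bar> <= 1" "\<bar>b $ 3\<bar> <= 2" using bc \<kappa> by (auto simp: abs_le_iff abs_less_iff)
   have "t * \<bar>b $ 1\<bar> <= r\<^sub>0 / 8 * 1" by (rule mult_mono) (use t bb r0 in auto)
   moreover have "t * \<bar>b $ 2\<bar> <= r\<^sub>0 / 8 * 1" by (rule mult_mono) (use t bb r0 in auto)
   moreover have "t * \<bar>b $ 3\<bar> <= r\<^sub>0 / 8 * 2" by (rule mult_mono) (use t bb r0 in auto)
   ultimately have "t * \<bar>b $ 1\<bar> <= r\<^sub>0 / 8 * 1" "t * \<bar>b $ 2\<bar> <= r\<^sub>0 / 8 * 1" "t * \<bar>b $ 3\<bar> <= r\<^sub>0 / 8 * 2" by auto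
   then show "\<bar>t * b $ 1\<bar> <= r\<^sub>0 / 8" "\<bar>t * b $ 2\<bar> <= r\<^sub>0 / 8" "\<bar>t * b $ 3\<bar> <= r\<^sub>0 / 4"
    using t by (simp_all only: abs_mult abs_of_pos)
  qed
  have Mr: "r\<^sub>0 <= M\<^sub>0 * r\<^sub>0" using M0 r0 by simp
  have in1: "\<bar>y $ 1\<bar> <= r\<^sub>0" "\<bar>y $ 2\<bar> <= r\<^sub>0" "\<bar>y $ 3\<bar> <= 2 * M\<^sub>0 * r\<^sub>0" using yc[of 1] yc[of 2] yc[of 3] r0 Mr by linarith+
  let ?z = "y + t *R b"
  have in2: "\<bar>?z $ 1\<bar> <= r\<^sub>0" "\<bar>?z $ 2\<bar> <= r\<^sub>0" "\<bar>?z $ 3\<bar> <= 2 * M\<^sub>0 * r\<^sub>0"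
   using yc[of 1] yc[of 2] yc[of 3] r0 Mr tb
   unfolding vector_add_component vector_scaleR_component real_scaleR_def by linarith+
  have "x \<notin> D" using D[of x] x(2) r0 by auto
  then have "P + T y \<in> \<Omega> - D" using x(1) y by simp
  then have gy: "g (y $ 1, y $ 2) < y $ 3" using U[OF in1] by blast
  have "dist (g (?z $ 1, ?z $ 2)) (g (y $ 1, y $ 2)) <= L * dist (?z $ 1, ?z $ 2) (y $ 1, y $ 2)"
   by (rule lipschitz_onD[OF L]) (use in1 in2 in \<open>auto simp: abs_le_iff\<close>)
  also have "dist (?z $ 1, ?z $ 2) (y $ 1, y $ 2) <= \<bar>t * b $ 1\<bar> + \<bar>t * b $ 2\<bar>"
   by (simp add: dist_prod_def dist_real_def sqrt_sum_squares_le_sum_abs)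
  also have "\<bar>t * b $ 1\<bar> + \<bar>t * b $ 2\<bar> <= t * (2 * \<kappa>)"
   using bc t by (simp add: abs_mult distrib_left[symmetric])
  finally have "dist (g (?z $ 1, ?z $ 2)) (g (y $ 1, y $ 2)) <= L * (t * (2 * \<kappa>))"
   using L0 by (auto intro: mult_left_mono)
  also have "\<dots> = t * (2 * L * \<kappa>)" by simp
  also have "\<dots> < t * (1 - \<kappa>)" using t \<kappa> by (intro mult_strict_left_mono) auto
  also have "\<dots> <= t * b $ 3" using t bc by (intro mult_left_mono) auto
  finally have "g (?z $ 1, ?z $ 2) < ?z $ 3" using gy by (simp add: dist_real_def abs_if split: if_splits)
  then have "P + T ?z \<in> \<Omega> - D" using U[OF in2] by blast
  moreover have "P + T ?z = x + t *R d" using y b by (simp add: linear_add[OF lin] linear_scale[OF lin])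
  ultimately show ?thesis by simp
 qed
 then have "inner_cone \<Omega> P (r\<^sub>0 / 4) (T ?e) \<kappa> (r\<^sub>0 / 8)"
  using \<kappa> r0 nT[of ?e] by (auto simp: inner_cone_def)
 then show ?thesis by blast
qed

subsection \<open>Lipschitz perturbations of the identity\<close>

lemma norm_matrix_vector_mult:
 fixes A :: "real^'n^'m"
 shows "norm (A *v h) <= norm A * norm h"
proof -
 have "(norm (A *v h))\<^sup>2 = (\<Sum>i\<in>UNIV. (A $ i \<bullet> h)\<^sup>2)"
  by (simp only: power2_norm_eq_inner inner_vec_def[of "A *v h" "A *v h"])
    (simp add: matrix_vector_mul_component power2_eq_square)
 also have "\<dots> <= (\<Sum>i\<in>UNIV. (norm (A $ i))\<^sup>2 * (norm h)\<^sup>2)"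
 proof (rule sum_mono)
  fix i
  have "\<bar>A $ i \<bullet> h\<bar>\<^sup>2 <= (norm (A $ i) * norm h)\<^sup>2" by (intro power_mono Cauchy_Schwarz_ineq2) auto
  then show "(A $ i \<bullet> h)\<^sup>2 <= (norm (A $ i))\<^sup>2 * (norm h)\<^sup>2" by (simp add: power_mult_distrib)
 qed
 also have "\<dots> = (norm A * norm h)\<^sup>2"
  by (simp add: power_mult_distrib sum_distrib_right[symmetric] power2_norm_eq_inner inner_vec_def)
 finally show ?thesis by (rule power2_le_imp_le) simp
qed

lemma norm_vector_matrix_mult_le:
 fixes B :: "real^'n^'m"
 assumes "\<And>y. norm (B *v y) <= k * norm y" "k >= 0"
 shows "norm (v v* B) <= norm v * k"
proof (cases "norm (v v* B) = 0")
 case True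
 then show ?thesis using assms(2) by simp
next
 case False
 have "norm (v v* B) * norm (v v* B) = (v v* B) \<bullet> (v v* B)" by (simp add: dot_square_norm power2_eq_square)
 also have "\<dots> = v \<bullet> (B *v (v v* B))" by (rule dot_lmul_matrix)
 also have "\<dots> <= norm v * norm (B *v (v v* B))" by (rule norm_cauchy_schwarz)
 also have "\<dots> <= norm v * (k * norm (v v* B))" by (intro mult_left_mono assms) auto
 finally have "norm (v v* B) * norm (v v* B) <= (norm v * k) * norm (v v* B)" by (simp add: mult.assoc)
 then show ?thesis using False by (simp add: mult_le_cancel_right)
qed

text \<open>The norm of a matrix is here the Frobenius norm, in which a product only costs the
  operator norm of the right factor. The Frobenius norm of an inverse would instead bring in the
  factor sqrt 3 of the identity and spoil the bound 1/2 reached later.\<close>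

lemma norm_matrix_mult_le:
 fixes A :: "real^'m^'k" and B :: "real^'n^'m"
 assumes "\<And>y. norm (B *v y) <= k * norm y" "k >= 0"
 shows "norm (A ** B) <= norm A * k"
proof -
 have row: "(A ** B) $ i = A $ i v* B" for i
  by (simp add: vec_eq_iff matrix_matrix_mult_def vector_matrix_mult_def mult.commute)
 have "(norm (A ** B))\<^sup>2 = (\<Sum>i\<in>UNIV. (norm (A $ i v* B))\<^sup>2)"
  by (simp add: power2_norm_eq_inner inner_vec_def[of "A ** B"] row)
 also have "\<dots> <= (\<Sum>i\<in>UNIV. (norm (A $ i) * k)\<^sup>2)"
  by (intro sum_mono power_mono norm_vector_matrix_mult_le assms) auto
 also have "\<dots> = (norm A * k)\<^sup>2"
  by (simp add: power_mult_distrib sum_distrib_right[symmetric] power2_norm_eq_inner inner_vec_def[of A])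
 finally show ?thesis by (rule power2_le_imp_le) (use assms in auto)
qed

lemma matrix_inv_eq:
 fixes M :: "real^'n^'n"
 assumes "invertible M"
 shows "M ** matrix_inv M = mat 1" "matrix_inv M ** M = mat 1"
proof -
 have "\<exists>N. M ** N = mat 1 \<and> N ** M = mat 1" using assms by (simp add: invertible_def)
 then have "M ** matrix_inv M = mat 1 \<and> matrix_inv M ** M = mat 1" unfolding matrix_inv_def by (rule someI_ex)
 then show "M ** matrix_inv M = mat 1" "matrix_inv M ** M = mat 1" by auto
qed

lemma matrix_inv_unique:
 fixes M N :: "real^'n^'n"
 assumes "N ** M = mat 1"
 shows "matrix_inv M = N"
proof -
 have "invertible M" using assms invertible_left_inverse by blast
 then have "N = N ** (M ** matrix_inv M)" by (simp add: matrix_inv_eq)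
 also have "\<dots> = matrix_inv M" using assms by (simp add: matrix_mul_assoc)
 finally show ?thesis by simp
qed

context
 fixes c :: real and A :: "real^3^3"
 assumes c: "norm A <= c" "c < 1"
begin

lemma perturbed_lower: "(1 - c) * norm h <= norm ((mat 1 + A) *v h)"
proof -
 have "norm (A *v h) <= c * norm h" using norm_matrix_vector_mult[of A h] c(1) by (meson mult_right_mono norm_ge_zero order_trans)
 moreover have "(mat 1 + A) *v h = h + A *v h" by (simp add: matrix_vector_mult_add_rdistrib)
 moreover have "norm h <= norm (h + A *v h) + norm (A *v h)" using norm_triangle_ineq4[of "h + A *v h" "A *v h"] by simp
 ultimately show ?thesis by (simp add: algebra_simps)
qed

lemma perturbed_invertible: "invertible (mat 1 + A)"
proof -
 have "inj ((*v) (mat 1 + A))"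
 proof (rule injI)
  fix x y assume "(mat 1 + A) *v x = (mat 1 + A) *v y"
  then have "(mat 1 + A) *v (x - y) = 0" by (simp add: matrix_vector_mult_diff_distrib)
  then have "(1 - c) * norm (x - y) <= 0" using perturbed_lower[of "x - y"] by simp
  then show "x = y" using c(2) by (simp add: mult_le_0_iff)
 qed
 then show ?thesis using matrix_left_invertible_injective invertible_left_inverse by blast
qed

lemma perturbed_inverse_bound: "norm (matrix_inv (mat 1 + A) *v h) <= inverse (1 - c) * norm h"
proof -
 let ?B = "matrix_inv (mat 1 + A)"
 have "(1 - c) * norm (?B *v h) <= norm ((mat 1 + A) *v (?B *v h))" by (rule perturbed_lower)
 also have "(mat 1 + A) *v (?B *v h) = h"
  using matrix_inv_eq(1)[OF perturbed_invertible] by (simp add: matrix_vector_mul_assoc)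
 finally show ?thesis using c(2) by (simp add: field_simps)
qed

end

text \<open>Resolvent identity: the difference of the inverses B and B' is B (A' - A) B'.\<close>

lemma perturbed_inverse_diff:
 fixes A A' :: "real^3^3"
 assumes c: "norm A <= c" "norm A' <= c" "c < 1"
 shows "norm (matrix_inv (mat 1 + A) *v h - matrix_inv (mat 1 + A') *v h) <= (inverse (1 - c))\<^sup>2 * norm (A - A') * norm h"
proof -
 let ?B = "matrix_inv (mat 1 + A)" and ?B' = "matrix_inv (mat 1 + A')"
 have "?B *v h - ?B' *v h = ?B *v ((A' - A) *v (?B' *v h))"
 proof -
  have e1: "(mat 1 + A') *v (?B' *v h) = h"
   using matrix_inv_eq(1)[OF perturbed_invertible[OF c(2,3)]] by (simp add: matrix_vector_mul_assoc)
  have e2: "?B *v ((mat 1 + A) *v k) = k" for k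
   using matrix_inv_eq(2)[OF perturbed_invertible[OF c(1,3)]] by (simp add: matrix_vector_mul_assoc)
  have "(A' - A) *v (?B' *v h) = (mat 1 + A') *v (?B' *v h) - (mat 1 + A) *v (?B' *v h)"
   by (simp add: matrix_vector_mult_add_rdistrib matrix_vector_mult_diff_rdistrib)
  then have "?B *v ((A' - A) *v (?B' *v h)) = ?B *v h - ?B *v ((mat 1 + A) *v (?B' *v h))"
   by (simp only: e1 matrix_vector_mult_diff_distrib)
  then show ?thesis by (simp only: e2)
 qed
 also have "norm \<dots> <= inverse (1 - c) * norm ((A' - A) *v (?B' *v h))" by (rule perturbed_inverse_bound[OF c(1,3)])
 also have "\<dots> <= inverse (1 - c) * (norm (A' - A) * (inverse (1 - c) * norm h))"
  using c(3) by (intro mult_left_mono order_trans[OF norm_matrix_vector_mult] perturbed_inverse_bound[OF c(2,3)]) auto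
 finally show ?thesis by (simp add: power2_eq_square norm_minus_commute mult_ac)
qed

lemma continuous_on_matrix_component:
 fixes F :: "'a::topological_space => real^3^3"
 assumes "\<And>j. continuous_on S (\<lambda>x. F x *v axis j 1)"
 shows "continuous_on S F"
proof -
 have "F x = (\<chi> i j. (F x *v axis j 1) $ i)" for x
  by (simp add: vec_eq_iff matrix_vector_mul_component inner_axis)
 moreover have "continuous_on S (\<lambda>x. \<chi> i j. (F x *v axis j 1) $ i)"
  by (intro continuous_on_vec_lambda continuous_on_component assms)
 ultimately show ?thesis by simp
qed

lemma continuous_on_perturbed_inverse:
 assumes "c < 1"
 shows "continuous_on {A :: real^3^3. norm A <= c} (\<lambda>A. matrix_inv (mat 1 + A))"
proof (rule continuous_on_matrix_component)
 fix j
 have "((inverse (1 - c))\<^sup>2)-lipschitz_on {A :: real^3^3. norm A <= c} (\<lambda>A. matrix_inv (mat 1 + A) *v axis j 1)"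
  using perturbed_inverse_diff[OF _ _ assms, of _ _ "axis j 1"]
  by (intro lipschitz_onI) (auto simp: dist_norm)
 then show "continuous_on {A :: real^3^3. norm A <= c} (\<lambda>A. matrix_inv (mat 1 + A) *v axis j 1)"
  by (rule lipschitz_on_continuous_on)
qed

lemma continuous_on_det: "continuous_on S f ==> continuous_on S (\<lambda>x. det (f x :: real^3^3))"
 unfolding det_3 by (intro continuous_intros)

lemma det_perturbed_bounded: "\<exists>k\<ge>0. \<forall>A :: real^3^3. norm A <= c --> \<bar>det (mat 1 + A)\<bar> <= k"
proof -
 have "compact ((\<lambda>A :: real^3^3. det (mat 1 + A)) ` cball 0 c)"
  by (intro compact_continuous_image continuous_on_det continuous_intros) auto
 then have "\<exists>b. \<forall>A\<in>cball (0 :: real^3^3) c. \<bar>det (mat 1 + A)\<bar> <= b"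
  using compact_imp_bounded by (fastforce simp: bounded_iff)
 then obtain b where b: "\<forall>A\<in>cball (0 :: real^3^3) c. \<bar>det (mat 1 + A)\<bar> <= b" by (rule exE)
 then show ?thesis by (intro exI[of _ "\<bar>b\<bar>"]) (auto intro: order_trans[OF _ abs_ge_self])
qed

text \<open>Surjectivity is Banach's fixed point theorem for x \<mapsto> y - V x; injectivity and
  the Lipschitz bound of the inverse come from the triangle inequality.\<close>

lemma id_plus_lipschitz:
 fixes V :: "real^3 => real^3"
 assumes L: "\<And>x y. norm (V x - V y) <= c * norm (x - y)" and c: "0 <= c" "c < 1"
 shows "bij (\<lambda>x. x + V x)"
  and "norm (inv (\<lambda>x. x + V x) a - inv (\<lambda>x. x + V x) b) <= inverse (1 - c) * norm (a - b)"
  and "continuous_on UNIV (inv (\<lambda>x. x + V x))" "continuous_on UNIV V"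
proof -
 let ?\<Phi> = "\<lambda>x. x + V x"
 have low: "(1 - c) * norm (x - y) <= norm (?\<Phi> x - ?\<Phi> y)" for x y
 proof -
  have "norm (x - y) <= norm (?\<Phi> x - ?\<Phi> y) + norm (V x - V y)"
   using norm_triangle_ineq4[of "?\<Phi> x - ?\<Phi> y" "V x - V y"] by (simp add: algebra_simps)
  then show ?thesis using L[of x y] by (simp add: algebra_simps)
 qed
 have inj: "inj ?\<Phi>"
 proof (rule injI)
  fix x y assume "?\<Phi> x = ?\<Phi> y"
  then have "(1 - c) * norm (x - y) <= 0" using low[of x y] by simp
  then show "x = y" using c by (simp add: mult_le_0_iff)
 qed
 have surj: "surj ?\<Phi>"
  unfolding surj_def
 proof
  fix y
  have "\<exists>!x. y - V x = x"
   by (rule banach_fix_type[OF c]) (use L in \<open>auto simp: dist_norm norm_minus_commute\<close>)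
  then obtain x where "y - V x = x" by blast
  then have "y = x + V x" by (simp add: algebra_simps)
  then show "\<exists>x. y = x + V x" by blast
 qed
 show bij: "bij ?\<Phi>" using inj surj by (simp add: bij_def)
 have b: "norm (inv ?\<Phi> a - inv ?\<Phi> b) <= inverse (1 - c) * norm (a - b)" for a b
  using low[of "inv ?\<Phi> a" "inv ?\<Phi> b"] surj_f_inv_f[OF surj, of a] surj_f_inv_f[OF surj, of b] c
  by (simp add: field_simps)
 then show "norm (inv ?\<Phi> a - inv ?\<Phi> b) <= inverse (1 - c) * norm (a - b)" .
 have "(inverse (1 - c))-lipschitz_on UNIV (inv ?\<Phi>)" using b c by (intro lipschitz_onI) (auto simp: dist_norm)
 then show "continuous_on UNIV (inv ?\<Phi>)" by (rule lipschitz_on_continuous_on)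
 have "c-lipschitz_on UNIV V" using L c by (intro lipschitz_onI) (auto simp: dist_norm)
 then show "continuous_on UNIV V" by (rule lipschitz_on_continuous_on)
qed

section \<open>Change of variables and chain rule for Lipschitz maps\<close>

lemma C1_change_of_variables:
 fixes \<Phi> :: "real^3 => real^3" and f :: "real^3 => real"
 assumes bij: "bij \<Phi>" and der: "\<And>x. (\<Phi> has_derivative (\<lambda>h. J x *v h)) (at x)"
  and J: "continuous_on UNIV J" and f: "continuous_on UNIV f" "compact K" "\<And>x. x \<notin> K ==> f x = 0"
 shows "(LBINT x. \<bar>det (J x)\<bar> * f (\<Phi> x)) = (LBINT x. f x)"
proof -
 have \<Phi>c: "continuous_on UNIV \<Phi>" using der by (auto intro!: continuous_at_imp_continuous_on has_derivative_continuous)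
 have [measurable]: "f Borel" "\<Phi> Borel" "J Borel"
  using f(1) \<Phi>c J by (auto intro: borel_measurable_continuous_onI)
 have detm [measurable]: "(\<lambda>x. det (J x)) Borel"
  by (intro borel_measurable_continuous_onI continuous_on_det J)
 \<comment> \<open>Real values are wrapped into \<open>real^1\<close>, since the change of variables
   theorem for absolutely integrable functions is phrased for vectors.\<close>
 define F where "F x = (\<chi> i. f x :: real^1)" for x
 define F2 where "F2 x = (\<chi> i. \<bar>det (J x)\<bar> * f (\<Phi> x) :: real^1)" for x
 have [measurable]: "F Borel" "F2 Borel"
 proof -
  have "F = (\<lambda>x. f x *R vec 1)" "F2 = (\<lambda>x. (\<bar>det (J x)\<bar> * f (\<Phi> x)) *R vec 1)"
   by (auto simp: F_def F2_def vec_eq_iff)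
  then show "F Borel" "F2 Borel" by simp_all
 qed
 have fint: "L1 f" by (rule compact_support_integrable[OF f])
 have "L1 (\<lambda>x. f x *R (vec 1 :: real^1))" using fint by simp
 moreover have "(\<lambda>x. f x *R (vec 1 :: real^1)) = F" by (auto simp: F_def vec_eq_iff)
 ultimately have "L1 F" by simp
 then have FL: "F absolutely_integrable_on UNIV"
  by (simp add: set_integrable_def integrable_completion)
 have eqF: "integral UNIV F = (LBINT x. F x)"
  using set_lebesgue_integral_eq_integral(2)[OF FL] by (simp add: set_lebesgue_integral_def integral_completion)
 have F2eq: "F2 = (\<lambda>x. \<bar>det (matrix (\<lambda>h. J x *v h))\<bar> *R F (\<Phi> x))"
  by (auto simp: F2_def F_def vec_eq_iff)
 have "F2 absolutely_integrable_on UNIV \<and> integral UNIV F2 = integral UNIV F"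
  unfolding F2eq
  by (rule has_absolute_integral_change_of_variables[THEN iffD2])
    (use der bij FL in \<open>auto simp: bij_def\<close>)
 then have F2L: "F2 absolutely_integrable_on UNIV" and eq: "integral UNIV F2 = integral UNIV F" by auto
 have F2int: "L1 F2"
  using F2L by (simp add: set_integrable_def integrable_completion)
 have eqF2: "integral UNIV F2 = (LBINT x. F2 x)"
  using set_lebesgue_integral_eq_integral(2)[OF F2L] by (simp add: set_lebesgue_integral_def integral_completion)
 have comp: "(LBINT x. G x) $ 1 = (LBINT x. G x $ 1)" if "L1 G" for G :: "real^3 => real^1"
  using integral_bounded_linear[OF bounded_linear_vec_nth that, of 1] by simp
 have "(LBINT x. F2 x $ 1) = (LBINT x. F x $ 1)"
  using comp[OF F2int] comp[OF \<open>L1 F\<close>] eq eqF eqF2 by simp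
 then show ?thesis by (simp add: F_def F2_def)
qed

text \<open>Split into (fn - f) \<bullet> gn, where gn is bounded and fn - f tends to 0 in L1, and f
  \<bullet> gn, where dominated convergence applies.\<close>

lemma L1_bounded_inner_tendsto:
 fixes f g :: "'a => 'b::euclidean_space"
 assumes f: "integrable M f" and fn: "\<And>n. integrable M (fn n)"
  and lim: "(\<lambda>n. \<integral>\<^sup>+x. ennreal (norm (fn n x - f x)) \<partial>M) ----> 0"
  and gn: "\<And>n. gn n \<in> borel_measurable M" "\<And>n x. norm (gn n x) <= B" and g: "g \<in> borel_measurable M"
  and ae: "AE x in M. (\<lambda>n. gn n x) ----> g x"
 shows "(\<lambda>n. \<integral>x. fn n x \<bullet> gn n x \<partial>M) ----> (\<integral>x. f x \<bullet> g x \<partial>M)"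
proof -
 have [measurable]: "f \<in> borel_measurable M" "fn n \<in> borel_measurable M" "gn n \<in> borel_measurable M" "g \<in> borel_measurable M" for n
  using f fn gn g by auto
 have bd: "integrable M (\<lambda>x. u x \<bullet> gn n x)" if u: "integrable M u" for u n
 proof (rule Bochner_Integration.integrable_bound[of M "\<lambda>x. B *R u x"])
  have [measurable]: "u \<in> borel_measurable M" using u by simp
  show "(\<lambda>x. u x \<bullet> gn n x) \<in> borel_measurable M" by measurable
  have "\<bar>u x \<bullet> gn n x\<bar> <= norm (B *R u x)" for x
  proof -
   have "\<bar>u x \<bullet> gn n x\<bar> <= norm (u x) * norm (gn n x)" by (rule Cauchy_Schwarz_ineq2)
   also have "\<dots> <= norm (u x) * \<bar>B\<bar>" using gn(2)[of n x] by (intro mult_left_mono) auto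
   finally show ?thesis by (simp add: mult.commute)
  qed
  then show "AE x in M. norm (u x \<bullet> gn n x) <= norm (B *R u x)" by simp
 qed (use u in simp)
 have 1: "(\<lambda>n. \<integral>x. f x \<bullet> gn n x \<partial>M) ----> (\<integral>x. f x \<bullet> g x \<partial>M)"
 proof (rule integral_dominated_convergence[where w="\<lambda>x. norm (f x) * \<bar>B\<bar>"])
  show "AE x in M. (\<lambda>n. f x \<bullet> gn n x) ----> f x \<bullet> g x"
   using ae by eventually_elim (intro tendsto_intros)
  show "AE x in M. norm (f x \<bullet> gn n x) <= norm (f x) * \<bar>B\<bar>" for n
  proof (rule AE_I2)
   fix x
   have "\<bar>f x \<bullet> gn n x\<bar> <= norm (f x) * norm (gn n x)" by (rule Cauchy_Schwarz_ineq2)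
   also have "\<dots> <= norm (f x) * \<bar>B\<bar>" using gn(2)[of n x] by (intro mult_left_mono) auto
   finally show "norm (f x \<bullet> gn n x) <= norm (f x) * \<bar>B\<bar>" by simp
  qed
 qed (use f in auto)
 have l: "(\<lambda>n. \<integral>x. norm (fn n x - f x) \<partial>M) ----> 0"
  by (rule nn_integral_tendsto_0_imp[OF _ _ lim]) auto
 have 2: "(\<lambda>n. \<integral>x. (fn n x - f x) \<bullet> gn n x \<partial>M) ----> 0"
 proof (rule Lim_null_comparison)
  show "(\<lambda>n. (\<integral>x. norm (fn n x - f x) \<partial>M) * \<bar>B\<bar>) ----> 0" using tendsto_mult_left_zero[OF l] .
  have "norm (\<integral>x. (fn n x - f x) \<bullet> gn n x \<partial>M) <= (\<integral>x. norm (fn n x - f x) \<partial>M) * \<bar>B\<bar>" for n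
  proof -
   have d: "integrable M (\<lambda>x. fn n x - f x)" using f fn by simp
   have "norm (\<integral>x. (fn n x - f x) \<bullet> gn n x \<partial>M) <= (\<integral>x. norm ((fn n x - f x) \<bullet> gn n x) \<partial>M)" by (rule integral_norm_bound)
   also have "\<dots> <= (\<integral>x. norm (fn n x - f x) * \<bar>B\<bar> \<partial>M)"
   proof (rule integral_mono[OF integrable_norm[OF bd[OF d]]])
    show "integrable M (\<lambda>x. norm (fn n x - f x) * \<bar>B\<bar>)" using d by simp
    fix x
    have "\<bar>(fn n x - f x) \<bullet> gn n x\<bar> <= norm (fn n x - f x) * norm (gn n x)" by (rule Cauchy_Schwarz_ineq2)
    also have "\<dots> <= norm (fn n x - f x) * \<bar>B\<bar>" using gn(2)[of n x] by (intro mult_left_mono) auto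
    finally show "norm ((fn n x - f x) \<bullet> gn n x) <= norm (fn n x - f x) * \<bar>B\<bar>" by simp
   qed
   finally show ?thesis by simp
  qed
  then show "eventually (\<lambda>n. norm (\<integral>x. (fn n x - f x) \<bullet> gn n x \<partial>M) <= (\<integral>x. norm (fn n x - f x) \<partial>M) * \<bar>B\<bar>) sequentially" by simp
 qed
 have "(\<integral>x. fn n x \<bullet> gn n x \<partial>M) = (\<integral>x. (fn n x - f x) \<bullet> gn n x \<partial>M) + (\<integral>x. f x \<bullet> gn n x \<partial>M)" for n
  using bd[OF f, of n] bd[OF fn, of n n] by (simp add: inner_diff_left)
 then show ?thesis using tendsto_add[OF 2 1] by simp
qed

lemma conv_component:
 fixes f :: "real^3 => ('b::euclidean_space)^'n"
 assumes "test_function UNIV \<eta>" "L1 f"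
 shows "conv \<eta> f x $ i = conv \<eta> (\<lambda>y. f y $ i) x"
 using integral_bounded_linear[OF bounded_linear_vec_nth conv_integrable[OF assms, of x], of i] by (simp add: conv_def)

lemma conv_norm_bound:
 fixes f :: "'a::euclidean_space => 'b::euclidean_space"
 assumes \<eta>: "mollifier a r \<eta>" and f: "L1 f" and b: "\<And>x. norm (f x) <= b"
 shows "norm (conv \<eta> f x) <= b"
proof -
 note \<eta>' = mollifier_D[OF \<eta>]
 have [measurable]: "\<eta> Borel" by (rule \<eta>'(6))
 have i: "L1 (\<lambda>y. \<eta> (x - y))"
  using integrable_lborel_affine[of "-1" \<eta> x] \<eta>'(5) by simp
 have "norm (conv \<eta> f x) <= (LBINT y. norm (\<eta> (x - y) *R f y))" unfolding conv_def by (rule integral_norm_bound)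
 also have "\<dots> <= (LBINT y. \<eta> (x - y) * b)"
  using i b \<eta>'(2) by (intro integral_mono integrable_norm conv_integrable \<eta>' f) (auto intro: mult_left_mono)
 also have "\<dots> = b" using integral_lborel_affine[of "-1" \<eta> x] \<eta>'(4) by simp
 finally show ?thesis .
qed

lemma conv_tendsto_at_continuous:
 fixes f :: "'a::euclidean_space => 'b::euclidean_space"
 assumes \<eta>: "mollifying \<eta>" and f: "L1 f" and c: "continuous_on UNIV f"
 shows "(\<lambda>n. conv (\<eta> n) f x) ----> f x"
proof (rule LIMSEQ_I)
 fix e :: real assume e: "e > 0"
 have "isCont f x" using c continuous_on_eq_continuous_at[of UNIV f] by simp
 then obtain d where d: "d > 0" "\<And>y. dist y x < d ==> dist (f y) (f x) < e / 2"
  using e unfolding continuous_at_eps_delta by (meson half_gt_zero)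
 have "eventually (\<lambda>n. norm (conv (\<eta> n) f x - f x) <= e / 2) sequentially"
 proof (rule mollifying_seq[OF \<eta>], rule exI[of _ d], intro conjI allI impI d(1))
  fix a r and \<eta> :: "'a => real" assume m: "mollifier a r \<eta>" and ar: "norm a + r <= d"
  note \<eta>' = mollifier_D[OF m]
  have "norm (conv \<eta> f x - f x) <= (LBINT z. norm (\<eta> z *R (f (x - z) - f x)))"
   unfolding conv_minus_eq(2)[OF m f] by (rule integral_norm_bound)
  also have "\<dots> <= (LBINT z. \<eta> z * (e / 2))"
  proof (rule integral_mono[OF integrable_norm[OF conv_minus_eq(1)[OF m f]]])
   show "L1 (\<lambda>z. \<eta> z * (e / 2))" using \<eta>'(5) by simp
   fix z
   show "norm (\<eta> z *R (f (x - z) - f x)) <= \<eta> z * (e / 2)"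
   proof (cases "\<eta> z = 0")
    case False
    then have "dist a z < r" using \<eta>'(3) by auto
    then have "norm z < d" using ar norm_triangle_sub[of z a] by (auto simp: dist_norm norm_minus_commute)
    then have "dist (f (x - z)) (f x) < e / 2" by (intro d(2)) (simp add: dist_norm)
    then have "norm (f (x - z) - f x) <= e / 2" by (simp add: dist_norm)
    from mult_left_mono[OF this \<eta>'(2)[of z]] show ?thesis using \<eta>'(2)[of z] by simp
   qed simp
  qed
  also have "\<dots> = e / 2" using \<eta>'(4) by simp
  finally show "norm (conv \<eta> f x - f x) <= e / 2" .
 qed
 then obtain N where "\<And>n. n >= N ==> norm (conv (\<eta> n) f x - f x) <= e / 2" by (auto simp: eventually_sequentially)
 then have "norm (conv (\<eta> n) f x - f x) < e" if "n >= N" for n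
  by (rule le_less_trans) (use e that in auto)
 then show "\<exists>N. \<forall>n\<ge>N. norm (conv (\<eta> n) f x - f x) < e" by blast
qed

lemma mollifying_subseq: "mollifying \<eta> ==> strict_mono r ==> mollifying (\<lambda>n. \<eta> (r n))"
proof -
 assume m: "mollifying \<eta>" and r: "strict_mono r"
 obtain a s where as: "\<forall>n. mollifier (a n) (s n) (\<eta> n)" "(\<lambda>n. norm (a n) + s n) ----> 0"
  using m unfolding mollifying_def by (elim exE conjE)
 have "(\<lambda>n. norm (a (r n)) + s (r n)) ----> 0" using LIMSEQ_subseq_LIMSEQ[OF as(2) r] by (simp add: o_def)
 then show "mollifying (\<lambda>n. \<eta> (r n))" unfolding mollifying_def using as(1)
  by (intro exI[of _ "\<lambda>n. a (r n)"] exI[of _ "\<lambda>n. s (r n)"]) simp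
qed

text \<open>V is the continuous representative, and A a representative of its gradient chosen to
  obey the Frobenius bound c at every point; c < 1 makes id + V bi-Lipschitz and \<open>J\<close>
  invertible.\<close>

locale lip_field =
 fixes V :: "real^3 => real^3" and A :: "real^3 => real^3^3" and c :: real
 assumes W: "\<And>i. wgrad (\<lambda>x. V x $ i) (\<lambda>x. A x $ i)"
  and cont: "continuous_on UNIV V"
  and Ac: "\<And>x. norm (A x) <= c" and c: "0 <= c" "c < 1"
begin

definition "\<Phi> x = x + V x"
definition "J x = mat 1 + A x"
definition "\<Theta> = inv \<Phi>"
definition "B x = matrix_inv (J x)"

lemma support: "\<exists>S. bounded S \<and> (\<forall>x. x \<notin> S --> V x = 0 \<and> A x = 0)"
proof -
 have "\<forall>i. \<exists>S. bounded S \<and> (\<forall>x. x \<notin> S --> V x $ i = 0 \<and> A x $ i = 0)" using wgradD(8)[OF W] by blast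
 then obtain S where S: "\<forall>i. bounded (S i) \<and> (\<forall>x. x \<notin> S i --> V x $ i = 0 \<and> A x $ i = 0)" by metis
 have "bounded (\<Union>i\<in>UNIV. S i)" using S by (intro bounded_UN) auto
 moreover have "\<forall>x. x \<notin> (\<Union>i\<in>UNIV. S i) --> V x = 0 \<and> A x = 0" using S by (simp add: vec_eq_iff)
 ultimately show ?thesis by blast
qed

lemma A_measurable: "A Borel"
proof -
 have "(\<lambda>x. A x \<bullet> b) Borel" if b: "b \<in> Basis" for b
 proof -
  obtain i u where b: "b = axis i u" using b by (auto simp: Basis_vec_def)
  have [measurable]: "(\<lambda>x. A x $ i) Borel" by (rule wgradD(6)[OF W])
  show ?thesis unfolding b by (simp add: inner_axis)
 qed
 then show ?thesis by (subst borel_measurable_euclidean_space) blast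
qed

lemma A_integrable: "L1 A"
proof -
 obtain S where S: "bounded S" "\<forall>x. x \<notin> S --> V x = 0 \<and> A x = 0" using support by blast
 then obtain R where R: "\<forall>x\<in>S. norm x <= R" by (auto simp: bounded_iff)
 show ?thesis
 proof (rule Bochner_Integration.integrable_bound[of _ "\<lambda>x. c * indicator (cball 0 R) x :: real"])
  show "L1 (\<lambda>x :: real^3. c * indicator (cball 0 R) x :: real)"
   using emeasure_bounded_finite[OF bounded_cball, of "0 :: real^3" R]
   by (intro integrable_mult_right integrable_real_indicator) auto
  show "AE x in lborel. norm (A x) <= norm (c * indicator (cball 0 R) x :: real)"
  proof (rule AE_I2)
   fix x show "norm (A x) <= norm (c * indicator (cball 0 R) x :: real)"
    using Ac[of x] c S(2) R by (cases "x \<in> S") auto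
  qed
 qed (use A_measurable in simp)
qed

lemma V_integrable: "L1 V"
proof -
 obtain S where S: "bounded S" "\<forall>x. x \<notin> S --> V x = 0 \<and> A x = 0" using support by blast
 have cS: "compact (closure S)" using S(1) by (simp add: compact_closure)
 show ?thesis
 proof (rule compact_support_integrable[OF cont cS])
  show "V x = 0" if "x \<notin> closure S" for x using that S(2) closure_subset[of S] by auto
 qed
qed

text \<open>Determinants and inverses depend nonlinearly on A, so L1 convergence of the mollified
  gradients is not enough; a subsequence converges almost everywhere as well.\<close>

definition "approximating \<eta> \<longleftrightarrow> mollifying \<eta> \<and> (\<forall>n. \<exists>r. mollifier 0 r (\<eta> n)) \<and>
 (AE x in lborel. (\<lambda>n. conv (\<eta> n) A x) ----> A x)"

lemma approximating_exists: "\<exists>\<eta> :: nat => real^3 => real. approximating \<eta>"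
proof -
 obtain \<eta> :: "nat => real^3 => real" where \<eta>: "mollifying \<eta>" "\<forall>n. mollifier 0 (inverse (real (Suc n))) (\<eta> n)"
  using mollifying_exists by blast
 have m: "conv (\<eta> n) A Borel" for n by (rule conv_measurable[OF mollifying_test[OF \<eta>(1)] A_integrable])
 \<comment> \<open>From some index on the L1 distance is at most 1; starting there makes every
   \<open>u n\<close> integrable.\<close>
 have fin: "\<exists>N. \<forall>n\<ge>N. (NN x. ennreal (norm (conv (\<eta> n) A x - A x))) <= ennreal 1"
  using ennreal_tendsto_0D[OF mollifying_L1[OF \<eta>(1) A_integrable], of 1] by (simp add: eventually_sequentially)
 then obtain N where N: "\<forall>n\<ge>N. (NN x. ennreal (norm (conv (\<eta> n) A x - A x))) <= ennreal 1" by blast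
 define u where "u n x = conv (\<eta> (n + N)) A x - A x" for n x
 have um: "u n Borel" for n unfolding u_def using m A_measurable by measurable
 have ui: "L1 (u n)" for n
 proof (rule integrableI_bounded)
  have "(NN x. ennreal (norm (u n x))) <= ennreal 1" using N by (simp add: u_def)
  then show "(NN x. ennreal (norm (u n x))) < \<infinity>" by (rule le_less_trans) simp
 qed (use um in simp)
 have "(\<lambda>n. LBINT x. norm (u n x)) ----> 0"
  using LIMSEQ_ignore_initial_segment[OF mollifying_L1[OF \<eta>(1) A_integrable], of N] um
  unfolding u_def[symmetric] by (intro nn_integral_tendsto_0_imp) auto
 from tendsto_L1_AE_subseq[OF ui this] obtain r where r: "strict_mono r" "AE x in lborel. (\<lambda>n. u (r n) x) ----> 0" by blast
 have sm: "strict_mono (\<lambda>n. r n + N)" using r(1) by (simp add: strict_mono_def)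
 have "approximating (\<lambda>n. \<eta> (r n + N))"
  unfolding approximating_def
 proof (intro conjI)
  show "mollifying (\<lambda>n. \<eta> (r n + N))" by (rule mollifying_subseq[OF \<eta>(1) sm])
  show "\<forall>n. \<exists>s. mollifier 0 s (\<eta> (r n + N))" using \<eta>(2) by blast
  show "AE x in lborel. (\<lambda>n. conv (\<eta> (r n + N)) A x) ----> A x"
   using r(2) by eventually_elim (simp add: u_def Lim_null[symmetric])
 qed
 then show ?thesis by blast
qed

context
 fixes \<eta> :: "real^3 => real" and r :: real
 assumes \<eta>: "mollifier 0 r \<eta>"
begin

lemma mollified_bound: "norm (conv \<eta> A x) <= c"
 by (rule conv_norm_bound[OF \<eta> A_integrable Ac])

lemma mollified_derivative: "(conv \<eta> V has_derivative (\<lambda>h. conv \<eta> A x *v h)) (at x)"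
proof -
 note t = mollifier_D(1)[OF \<eta>]
 have s: "smooth (conv \<eta> V)" by (rule conv_smooth[OF t V_integrable])
 have "dd (conv \<eta> V) x h = conv \<eta> A x *v h" for h
 proof (rule vec_eq_iff[THEN iffD2], rule allI)
  fix i
  have si: "smooth (conv \<eta> (\<lambda>y. V y $ i))" by (rule conv_smooth[OF t wgradD(3)[OF W]])
  have "((\<lambda>x. conv \<eta> V x $ i) has_derivative (\<lambda>h. dd (conv \<eta> V) x h $ i)) (at x)"
   by (rule bounded_linear.has_derivative[OF bounded_linear_vec_nth smooth_has_derivative[OF s]])
  moreover have "(\<lambda>x. conv \<eta> V x $ i) = conv \<eta> (\<lambda>y. V y $ i)" using conv_component[OF t V_integrable] by auto
  ultimately have "(conv \<eta> (\<lambda>y. V y $ i) has_derivative (\<lambda>h. dd (conv \<eta> V) x h $ i)) (at x)" by simp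
  from fun_cong[OF frechet_derivative_at[OF this], of h]
  have "dd (conv \<eta> V) x h $ i = frechet_derivative (conv \<eta> (\<lambda>y. V y $ i)) (at x) h" .
  also have "\<dots> = conv \<eta> (\<lambda>y. A y $ i) x \<bullet> h" by (rule wgrad_conv[OF W t])
  also have "\<dots> = (conv \<eta> A x *v h) $ i"
   by (simp add: matrix_vector_mul_component conv_component[OF t A_integrable])
  finally show "dd (conv \<eta> V) x h $ i = (conv \<eta> A x *v h) $ i" .
 qed
 then have "dd (conv \<eta> V) x = (\<lambda>h. conv \<eta> A x *v h)" by auto
 then show ?thesis using smooth_has_derivative[OF s, of x] by simp
qed

lemma mollified_lipschitz: "norm (conv \<eta> V x - conv \<eta> V y) <= c * norm (x - y)"
proof (rule differentiable_bound[of UNIV "conv \<eta> V" "\<lambda>x h. conv \<eta> A x *v h"])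
 show "onorm (\<lambda>h. conv \<eta> A x *v h) <= c" for x
 proof (rule onorm_bound)
  show "norm (conv \<eta> A x *v h) <= c * norm h" for h
   using norm_matrix_vector_mult[of "conv \<eta> A x" h] mult_right_mono[OF mollified_bound norm_ge_zero[of h], of x] by linarith
 qed (rule c)
qed (use mollified_derivative in auto)

lemma mollified_map:
 shows "((\<lambda>x. x + conv \<eta> V x) has_derivative (\<lambda>h. (mat 1 + conv \<eta> A x) *v h)) (at x)"
  and "bij (\<lambda>x. x + conv \<eta> V x)" and "continuous_on UNIV (inv (\<lambda>x. x + conv \<eta> V x))"
  and "continuous_on UNIV (\<lambda>x. mat 1 + conv \<eta> A x)"
proof -
 have "((\<lambda>x. x + conv \<eta> V x) has_derivative (\<lambda>h. h + conv \<eta> A x *v h)) (at x)"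
  by (intro has_derivative_add has_derivative_ident mollified_derivative)
 then show "((\<lambda>x. x + conv \<eta> V x) has_derivative (\<lambda>h. (mat 1 + conv \<eta> A x) *v h)) (at x)"
  by (simp add: matrix_vector_mult_add_rdistrib)
 show "bij (\<lambda>x. x + conv \<eta> V x)" "continuous_on UNIV (inv (\<lambda>x. x + conv \<eta> V x))"
  using id_plus_lipschitz[OF mollified_lipschitz c] by auto
 show "continuous_on UNIV (\<lambda>x. mat 1 + conv \<eta> A x)"
  by (intro continuous_intros smooth_continuous conv_smooth mollifier_D(1)[OF \<eta>] A_integrable)
qed

lemma mollified_inverse_derivative:
 defines "\<Psi> \<equiv> \<lambda>x. x + conv \<eta> V x"
 shows "(inv \<Psi> has_derivative (\<lambda>h. matrix_inv (mat 1 + conv \<eta> A (inv \<Psi> y)) *v h)) (at y)"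
proof -
 let ?M = "mat 1 + conv \<eta> A (inv \<Psi> y)"
 have inv: "invertible ?M" by (rule perturbed_invertible[OF mollified_bound c(2)])
 show ?thesis
 proof (rule has_derivative_inverse_basic[where f=\<Psi> and f'="\<lambda>h. ?M *v h" and T=UNIV])
  show "(\<Psi> has_derivative (\<lambda>h. ?M *v h)) (at (inv \<Psi> y))" unfolding \<Psi>_def by (rule mollified_map(1))
  show "bounded_linear (\<lambda>h. matrix_inv ?M *v h)" by simp
  show "(\<lambda>h. matrix_inv ?M *v h) \<circ> (\<lambda>h. ?M *v h) = id"
   using matrix_inv_eq(2)[OF inv] by (auto simp: matrix_vector_mul_assoc)
  show "continuous (at y) (inv \<Psi>)" using mollified_map(3) unfolding \<Psi>_def continuous_on_eq_continuous_at[OF open_UNIV] by blast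
  show "\<Psi> (inv \<Psi> z) = z" for z using surj_f_inv_f[OF bij_is_surj[OF mollified_map(2)], of z] by (simp add: \<Psi>_def)
 qed auto
qed

end

text \<open>Convolution with a mollifier averages, so the mollified fields keep the gradient bound c
  and obey the mean value inequality; the estimate passes to the pointwise limit because V is
  continuous.\<close>

lemma V_lipschitz: "norm (V x - V y) <= c * norm (x - y)"
proof -
 obtain \<eta> where \<eta>: "approximating \<eta>" using approximating_exists by blast
 then have m: "mollifying \<eta>" and m': "\<And>n. \<exists>r. mollifier 0 r (\<eta> n)" by (auto simp: approximating_def)
 have "(\<lambda>n. norm (conv (\<eta> n) V x - conv (\<eta> n) V y)) ----> norm (V x - V y)"
  by (intro tendsto_intros conv_tendsto_at_continuous[OF m V_integrable cont])
 then show ?thesis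
  by (rule LIMSEQ_le_const2) (use m' mollified_lipschitz in blast)
qed

lemma \<Phi>_bij: "bij \<Phi>" and \<Theta>_continuous: "continuous_on UNIV \<Theta>"
 and \<Theta>_lipschitz: "norm (\<Theta> a - \<Theta> b) <= inverse (1 - c) * norm (a - b)"
 using id_plus_lipschitz[OF V_lipschitz c] unfolding \<Theta>_def \<Phi>_def[abs_def] by auto

lemma \<Phi>_\<Theta> [simp]: "\<Phi> (\<Theta> y) = y" and \<Theta>_\<Phi> [simp]: "\<Theta> (\<Phi> x) = x"
 using \<Phi>_bij by (auto simp: \<Theta>_def bij_def surj_f_inv_f)

lemma \<Phi>_continuous: "continuous_on UNIV \<Phi>"
 unfolding \<Phi>_def by (intro continuous_intros cont)

lemma B_bound: "norm (B x *v h) <= inverse (1 - c) * norm h"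
 unfolding B_def J_def by (rule perturbed_inverse_bound[OF Ac c(2)])

lemma J_B: "J x ** B x = mat 1" "B x ** J x = mat 1"
 unfolding B_def J_def using matrix_inv_eq[OF perturbed_invertible[OF Ac c(2)]] by auto

lemma V_bounded: "\<exists>b. \<forall>x. norm (V x) <= b"
proof -
 obtain S where S: "bounded S" "\<forall>x. x \<notin> S --> V x = 0 \<and> A x = 0" using support by blast
 have "compact (closure S)" using S(1) by (simp add: compact_closure)
 moreover have "V x = 0" if "x \<notin> closure S" for x using that S(2) closure_subset[of S] by auto
 ultimately obtain b where "\<And>x. norm (V x) <= b" by (rule compact_support_bounded[OF cont]) (assumption, rule that)
 then show ?thesis by auto
qed

lemma borel_measurable_maps [measurable]: "A Borel" "\<Phi> Borel"
  "\<Theta> Borel" "J Borel" "(\<lambda>x. det (J x)) Borel"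
  "B Borel"
proof -
 show "A Borel" by (rule A_measurable)
 show "\<Phi> Borel" "\<Theta> Borel"
  by (auto intro: borel_measurable_continuous_onI \<Phi>_continuous \<Theta>_continuous)
 show J: "J Borel" unfolding J_def[abs_def] using A_measurable by measurable
 have "(\<lambda>M :: real^3^3. det M) Borel"
  by (intro borel_measurable_continuous_onI continuous_on_det continuous_on_id)
 then show "(\<lambda>x. det (J x)) Borel" using J by (rule measurable_compose[rotated])
 have "{M :: real^3^3. norm M <= c} = cball 0 c" by auto
 then have "(\<lambda>M. indicator {M :: real^3^3. norm M <= c} M *R matrix_inv (mat 1 + M)) Borel"
  by (intro borel_measurable_continuous_on_indicator continuous_on_perturbed_inverse c) (simp add: borel_closed)
 from measurable_compose[OF A_measurable this]
 show "B Borel" by (simp add: B_def[abs_def] J_def Ac)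
qed

text \<open>Everything about \<open>\<Phi>\<close>, which is merely Lipschitz, is obtained from the smooth diffeomorphisms
  \<open>x \<mapsto> x + (\<eta>\<^sub>n * V) x\<close>; this avoids Rademacher's theorem.\<close>

lemma mollified_limit:
 fixes f f' :: "real^3 => 'b::euclidean_space" and k :: "real^3 => real" and D :: "nat => real^3 => 'b" and D' :: "real^3 => 'b"
 assumes \<eta>: "approximating \<eta>" and f: "L1 f" and fn: "\<And>n. L1 (fn n)"
  and lim: "(\<lambda>n. NN x. ennreal (norm (fn n x - f x))) ----> 0"
  and k: "continuous_on UNIV k" "\<And>x. \<bar>k x\<bar> <= b"
  and D: "\<And>n. D n Borel" "D' Borel" "\<And>n x. norm (D n x) <= d"
   "\<And>x. (\<lambda>n. conv (\<eta> n) A x) ----> A x ==> (\<lambda>n. D n x) ----> D' x"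
 shows "(\<lambda>n. LBINT x. fn n x \<bullet> ((k (x + conv (\<eta> n) V x) * \<bar>det (mat 1 + conv (\<eta> n) A x)\<bar>) *R D n x))
   ----> (LBINT x. f x \<bullet> ((k (\<Phi> x) * \<bar>det (J x)\<bar>) *R D' x))"
proof -
 have m: "mollifying \<eta>" and m': "\<exists>r. mollifier 0 r (\<eta> n)" and ae: "AE x in lborel. (\<lambda>n. conv (\<eta> n) A x) ----> A x" for n
  using \<eta> by (auto simp: approximating_def)
 obtain K where K: "K >= 0" "\<forall>M :: real^3^3. norm M <= c --> \<bar>det (mat 1 + M)\<bar> <= K" using det_perturbed_bounded by blast
 have ms [measurable]: "conv (\<eta> n) V Borel" "conv (\<eta> n) A Borel"
   "k Borel" "D n Borel" "D' Borel" for n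
  using conv_measurable[OF mollifying_test[OF m] V_integrable] conv_measurable[OF mollifying_test[OF m] A_integrable] k(1) D
  by (auto intro: borel_measurable_continuous_onI)
 have detc: "continuous_on UNIV (\<lambda>M :: real^3^3. det (mat 1 + M))" by (intro continuous_on_det continuous_intros)
 have detm [measurable]: "(\<lambda>x. det (mat 1 + conv (\<eta> n) A x)) Borel" for n
  using measurable_compose[OF ms(2) borel_measurable_continuous_onI[OF detc]] .
 show ?thesis
 proof (rule L1_bounded_inner_tendsto[where B="b * K * d", OF f fn lim])
  fix n x
  obtain r where r: "mollifier 0 r (\<eta> n)" using m' by blast
  have b0: "0 <= b" using k(2)[of 0] by linarith
  have "\<bar>k (x + conv (\<eta> n) V x)\<bar> * \<bar>det (mat 1 + conv (\<eta> n) A x)\<bar> * norm (D n x) <= b * K * d"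
   using k(2) K(2) mollified_bound[OF r, of x] D(3) b0 K(1) by (intro mult_mono) auto
  then show "norm ((k (x + conv (\<eta> n) V x) * \<bar>det (mat 1 + conv (\<eta> n) A x)\<bar>) *R D n x) <= b * K * d" by (simp add: abs_mult)
  show "(\<lambda>x. (k (x + conv (\<eta> n) V x) * \<bar>det (mat 1 + conv (\<eta> n) A x)\<bar>) *R D n x) \<in> borel_measurable lborel" for n
   by measurable
 next
  have "(\<lambda>x. k (\<Phi> x)) Borel" by measurable
  then show "(\<lambda>x. (k (\<Phi> x) * \<bar>det (J x)\<bar>) *R D' x) \<in> borel_measurable lborel" by measurable
  show "AE x in lborel. (\<lambda>n. (k (x + conv (\<eta> n) V x) * \<bar>det (mat 1 + conv (\<eta> n) A x)\<bar>) *R D n x) ----> (k (\<Phi> x) * \<bar>det (J x)\<bar>) *R D' x"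
   using ae
  proof eventually_elim
   case (elim x)
   have "isCont k (x + V x)" using k(1) continuous_on_eq_continuous_at[of UNIV k] by simp
   then have 1: "(\<lambda>n. k (x + conv (\<eta> n) V x)) ----> k (x + V x)"
    by (rule isCont_tendsto_compose) (intro tendsto_intros conv_tendsto_at_continuous[OF m V_integrable cont])
   have "isCont (\<lambda>M :: real^3^3. det (mat 1 + M)) (A x)" using detc continuous_on_eq_continuous_at[of UNIV] by auto
   then have 2: "(\<lambda>n. det (mat 1 + conv (\<eta> n) A x)) ----> det (mat 1 + A x)"
    by (rule isCont_tendsto_compose) (rule elim)
   show ?case unfolding \<Phi>_def J_def by (intro tendsto_intros 1 2 D(4) elim)
  qed
 qed
qed

lemma change_of_variables_continuous:
 fixes f :: "real^3 => real"
 assumes f: "continuous_on UNIV f" "compact K" "\<And>x. x \<notin> K ==> f x = 0"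
 shows "(LBINT x. \<bar>det (J x)\<bar> * f (\<Phi> x)) = (LBINT x. f x)"
  and "L1 (\<lambda>x. \<bar>det (J x)\<bar> * f (\<Phi> x))"
proof -
 obtain \<eta> where \<eta>: "approximating \<eta>" using approximating_exists by blast
 then have m': "\<exists>r. mollifier 0 r (\<eta> n)" for n by (auto simp: approximating_def)
 obtain b where b: "\<And>x. norm (f x) <= b" using compact_support_bounded[OF f] by blast
 obtain v where v: "\<forall>x. norm (V x) <= v" using V_bounded by blast
 obtain R where R: "\<forall>x\<in>K. norm x <= R" using compact_imp_bounded[OF f(2)] by (auto simp: bounded_iff)
 \<comment> \<open>\<open>mollified_limit\<close> needs an integrable factor. All displacements are
   at most v, so every f (x + w) in question vanishes off the ball of radius R + v, and multiplying
   by its indicator changes nothing.\<close>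
 define \<chi>R where "\<chi>R = (indicator (cball (0::real^3) (R + v)) :: real^3 => real)"
 have \<chi>: "L1 \<chi>R" unfolding \<chi>R_def using emeasure_bounded_finite[OF bounded_cball, of "0::real^3" "R + v"]
  by (intro integrable_real_indicator) auto
 have sup: "\<chi>R x * f (x + w) = f (x + w)" if "norm w <= v" for x w
 proof (cases "x + w \<in> K")
  case True
  then have "norm (x + w) <= R" using R by blast
  then have "norm x <= R + v" using that norm_triangle_ineq4[of "x + w" w] by simp
  then show ?thesis by (simp add: \<chi>R_def)
 qed (simp add: f(3))
 have l1: "(\<lambda>n. LBINT x. \<chi>R x \<bullet> ((f (x + conv (\<eta> n) V x) * \<bar>det (mat 1 + conv (\<eta> n) A x)\<bar>) *R (1::real)))
   ----> (LBINT x. \<chi>R x \<bullet> ((f (\<Phi> x) * \<bar>det (J x)\<bar>) *R 1))"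
  by (rule mollified_limit[OF \<eta> \<chi> \<chi> _ f(1), where d=1 and b=b]) (use b in auto)
 have l2: "(LBINT x. \<chi>R x \<bullet> ((f (x + conv (\<eta> n) V x) * \<bar>det (mat 1 + conv (\<eta> n) A x)\<bar>) *R (1::real))) = (LBINT x. f x)" for n
 proof -
  obtain r where r: "mollifier 0 r (\<eta> n)" using m' by blast
  have "norm (conv (\<eta> n) V x) <= v" for x by (rule conv_norm_bound[OF r V_integrable]) (use v in blast)
  then have e: "\<chi>R x \<bullet> ((f (x + conv (\<eta> n) V x) * \<bar>det (mat 1 + conv (\<eta> n) A x)\<bar>) *R (1::real)) = \<bar>det (mat 1 + conv (\<eta> n) A x)\<bar> * f (x + conv (\<eta> n) V x)" for x
   using sup[of "conv (\<eta> n) V x" x] by (auto simp: mult_ac)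
  show ?thesis unfolding e
   by (rule C1_change_of_variables[OF mollified_map(2)[OF r] mollified_map(1)[OF r] mollified_map(4)[OF r] f])
 qed
 have eq: "\<chi>R x \<bullet> ((f (\<Phi> x) * \<bar>det (J x)\<bar>) *R 1) = \<bar>det (J x)\<bar> * f (\<Phi> x)" for x
  using sup[of "V x" x] v by (auto simp: \<Phi>_def mult_ac)
 have "(\<lambda>n::nat. LBINT x. f x) ----> (LBINT x. \<bar>det (J x)\<bar> * f (\<Phi> x))"
  using l1 unfolding l2 eq .
 then show "(LBINT x. \<bar>det (J x)\<bar> * f (\<Phi> x)) = (LBINT x. f x)"
  by (simp add: LIMSEQ_const_iff)
 obtain k where k: "k >= 0" "\<forall>M :: real^3^3. norm M <= c --> \<bar>det (mat 1 + M)\<bar> <= k" using det_perturbed_bounded by blast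
 have [measurable]: "f Borel" using f(1) by (rule borel_measurable_continuous_onI)
 show "L1 (\<lambda>x. \<bar>det (J x)\<bar> * f (\<Phi> x))"
 proof (rule Bochner_Integration.integrable_bound[of _ "\<lambda>x. (k * b) * \<chi>R x"])
  have "\<bar>\<bar>det (J x)\<bar> * f (\<Phi> x)\<bar> <= \<bar>(k * b) * \<chi>R x\<bar>" for x
  proof -
   have b0: "b >= 0" using b[of 0] norm_ge_zero order_trans by blast
   have "\<bar>det (J x)\<bar> * \<bar>f (\<Phi> x)\<bar> <= k * b" using k Ac[of x] b[of "\<Phi> x"] by (intro mult_mono) (auto simp: J_def)
   moreover have "f (\<Phi> x) = 0 \<or> \<chi>R x = 1" using sup[of "V x" x] v by (auto simp: \<Phi>_def \<chi>R_def indicator_def)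
   ultimately show ?thesis using k(1) b0 by (auto simp: abs_mult)
  qed
  then show "AE x in lborel. norm (\<bar>det (J x)\<bar> * f (\<Phi> x)) <= norm ((k * b) * \<chi>R x)" by simp
 qed (use \<chi> in auto)
qed

text \<open>As an identity of measures the change of variables extends from continuous to all Borel
  functions at once. It is checked on boxes, whose indicators are increasing limits of continuous
  functions built from the distance to the complement.\<close>

lemma lborel_eq_distr: "lborel = distr (density lborel (\<lambda>x. ennreal \<bar>det (J x)\<bar>)) borel \<Phi>"
proof (rule lborel_eqI)
 fix l u :: "real^3" assume lu: "\<And>b. b \<in> Basis ==> l \<bullet> b <= u \<bullet> b"
 let ?M = "distr (density lborel (\<lambda>x. ennreal \<bar>det (J x)\<bar>)) borel \<Phi>"
 define f where "f k x = min 1 (real k * infdist x (- box l u))" for k :: nat and x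
 have ne: "- box l u \<noteq> {}" using bounded_box[of l u] not_bounded_UNIV by (metis Compl_UNIV_eq double_compl)
 have fc: "continuous_on UNIV (f k)" for k unfolding f_def by (intro continuous_intros)
 have [measurable]: "f k Borel" for k using fc by (rule borel_measurable_continuous_onI)
 have f0: "f k x >= 0" for k x by (simp add: f_def infdist_nonneg)
 have fz: "f k x = 0" if "x \<notin> cbox l u" for k x
 proof -
  have "x \<in> - box l u" using that box_subset_cbox by blast
  then show ?thesis by (simp add: f_def)
 qed
 have inc: "incseq (\<lambda>k x. ennreal (f k x))"
  unfolding incseq_def le_fun_def f_def by (auto intro!: ennreal_leI min.mono mult_right_mono infdist_nonneg)
 have sup: "(SUP k. ennreal (f k x)) = indicator (box l u) x" for x
 proof (cases "x \<in> box l u")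
  case True
  have cl: "closed (- box l u)" by (simp add: closed_Compl open_box)
  then have "infdist x (- box l u) > 0"
   using True in_closed_iff_infdist_zero[OF cl ne, of x] infdist_nonneg[of x "- box l u"] by (auto simp: less_le)
  then obtain k where "1 <= real k * infdist x (- box l u)" using reals_Archimedean3 less_imp_le by blast
  then have "f k x = 1" by (simp add: f_def)
  then have "1 <= (SUP k. ennreal (f k x))" by (intro SUP_upper2[of k]) auto
  moreover have "(SUP k. ennreal (f k x)) <= 1"
   by (intro SUP_least) (auto simp: f_def ennreal_le_1)
  ultimately show ?thesis using True by simp
 next
  case False
  then have "f k x = 0" for k by (simp add: f_def)
  then show ?thesis using False by simp
 qed
 have eq: "(\<integral>\<^sup>+x. ennreal (f k x) \<partial>?M) = (NN x. ennreal (f k x))" for k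
 proof -
  have cK: "compact (cbox l u)" by simp
  note cv = change_of_variables_continuous[OF fc[of k] cK fz[where k=k]]
  have "(\<integral>\<^sup>+x. ennreal (f k x) \<partial>?M) = (NN x. ennreal \<bar>det (J x)\<bar> * ennreal (f k (\<Phi> x)))"
   by (simp add: nn_integral_distr nn_integral_density)
  also have "\<dots> = (NN x. ennreal (\<bar>det (J x)\<bar> * f k (\<Phi> x)))" using f0 by (simp add: ennreal_mult)
  also have "\<dots> = ennreal (LBINT x. \<bar>det (J x)\<bar> * f k (\<Phi> x))" using f0 by (intro nn_integral_eq_integral cv(2)) auto
  also have "\<dots> = ennreal (LBINT x. f k x)" by (rule arg_cong[OF cv(1)])
  also have "\<dots> = (NN x. ennreal (f k x))"
   using f0 compact_support_integrable[OF fc cK fz] by (intro nn_integral_eq_integral[symmetric]) auto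
  finally show ?thesis .
 qed
 have "emeasure ?M (box l u) = (\<integral>\<^sup>+x. (SUP k. ennreal (f k x)) \<partial>?M)" by (simp add: sup)
 also have "\<dots> = (SUP k. \<integral>\<^sup>+x. ennreal (f k x) \<partial>?M)" by (rule nn_integral_monotone_convergence_SUP[OF inc]) simp
 also have "\<dots> = (SUP k. NN x. ennreal (f k x))" by (simp only: eq)
 also have "\<dots> = (NN x. (SUP k. ennreal (f k x)))" by (rule nn_integral_monotone_convergence_SUP[OF inc, symmetric]) simp
 also have "\<dots> = emeasure lborel (box l u)" by (simp add: sup)
 finally show "emeasure ?M (box l u) = (\<Prod>b\<in>Basis. (u - l) \<bullet> b)" using lu by (simp add: emeasure_lborel_box_eq)
qed simp

lemma change_of_variables:
 fixes f :: "real^3 => 'b::euclidean_space"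
 assumes [measurable]: "f Borel"
 shows "(LBINT y. f y) = (LBINT x. \<bar>det (J x)\<bar> *R f (\<Phi> x))"
  and "L1 f \<longleftrightarrow> L1 (\<lambda>x. \<bar>det (J x)\<bar> *R f (\<Phi> x))"
proof -
 show "(LBINT y. f y) = (LBINT x. \<bar>det (J x)\<bar> *R f (\<Phi> x))"
  by (subst lborel_eq_distr) (simp add: integral_distr integral_density)
 show "L1 f \<longleftrightarrow> L1 (\<lambda>x. \<bar>det (J x)\<bar> *R f (\<Phi> x))"
  by (subst lborel_eq_distr) (simp add: integrable_distr_eq integrable_density)
qed

end

context lip_field
begin

lemma square_integrable_comp_\<Theta>:
 fixes f :: "real^3 => 'b::euclidean_space"
 assumes f: "L2 f"
 shows "L2 (\<lambda>y. f (\<Theta> y))"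
proof -
 have [measurable]: "f Borel" using f by (simp add: square_integrable_def)
 obtain k where k: "k >= 0" "\<forall>M :: real^3^3. norm M <= c --> \<bar>det (mat 1 + M)\<bar> <= k" using det_perturbed_bounded by blast
 have "L1 (\<lambda>x. \<bar>det (J x)\<bar> *R (norm (f x))\<^sup>2)"
 proof (rule integrable_bounded_scaleR[where B=k])
  show "\<bar>\<bar>det (J x)\<bar>\<bar> <= k" for x using k(2) Ac[of x] by (simp add: J_def)
 qed (use f in \<open>auto simp: square_integrable_def\<close>)
 then have "L1 (\<lambda>y. (norm (f (\<Theta> y)))\<^sup>2)"
  using change_of_variables(2)[of "\<lambda>y. (norm (f (\<Theta> y)))\<^sup>2"] by simp
 then show ?thesis by (simp add: square_integrable_def)
qed

text \<open>For the mollified, smooth diffeomorphisms this is the classical chain rule, integrated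
  by parts and pulled back to the x side. There only \<open>\<Phi>\<close> and A appear, whose
  approximations are known to converge. The row vector q is multiplied by \<open>B\<close>, the
  inverse of the Jacobian matrix of \<open>\<Phi>\<close>.\<close>

lemma wgrad_comp_\<Theta>:
 assumes p: "wgrad p q"
 shows "wgrad (\<lambda>y. p (\<Theta> y)) (\<lambda>y. q (\<Theta> y) v* B (\<Theta> y))"
proof -
 note P = wgradD[OF p]
 have [measurable]: "p Borel" "q Borel" using P by auto
 have vm: "(\<lambda>x. u x v* M x) Borel" if [measurable]: "u Borel" "M Borel"
  for u :: "real^3 => real^3" and M :: "real^3 => real^3^3"
 proof -
  have "continuous_on UNIV (\<lambda>(u :: real^3, M :: real^3^3). u v* M)"
   unfolding vector_matrix_mult_def case_prod_unfold by (intro continuous_intros)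
  then have "(\<lambda>(u :: real^3, M :: real^3^3). u v* M) \<in> borel_measurable (borel \<Otimes>\<^sub>M borel)"
   by (simp add: borel_prod borel_measurable_continuous_onI)
  then have "(\<lambda>x. case (u x, M x) of (u, M) => u v* M) Borel"
   by (rule measurable_compose[rotated]) measurable
  then show ?thesis by simp
 qed
 define g where "g x = q x v* B x" for x
 have gm [measurable]: "g Borel" unfolding g_def by (rule vm) measurable
 have g2: "L2 g"
 proof (rule L2_bound[OF P(2), of _ "inverse (1 - c)"])
  show "AE x in lborel. norm (g x) <= inverse (1 - c) * norm (q x)"
  proof (rule AE_I2)
   fix x
   have "norm (g x) <= norm (q x) * inverse (1 - c)" unfolding g_def using c by (intro norm_vector_matrix_mult_le B_bound) auto
   then show "norm (g x) <= inverse (1 - c) * norm (q x)" by (simp only: mult.commute)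
  qed
 qed simp
 have "wgrad_on UNIV (\<lambda>y. p (\<Theta> y)) (\<lambda>y. g (\<Theta> y))"
  unfolding wgrad_on_def
 proof (intro conjI allI impI square_integrable_comp_\<Theta> P(1) g2)
  fix \<phi> :: "real^3 => real" and h :: "real^3" assume \<phi>: "test_function UNIV \<phi>"
  let ?D = "\<lambda>y. dd \<phi> y h"
  have \<phi>': "test_function UNIV ?D" by (rule test_deriv[OF \<phi>])
  note c\<phi> = smooth_continuous[OF test_smooth[OF \<phi>]] and c\<phi>' = smooth_continuous[OF test_smooth[OF \<phi>']]
  have [measurable]: "\<phi> Borel" "?D Borel"
   using c\<phi> c\<phi>' by (auto intro: borel_measurable_continuous_onI)
  obtain b where b: "\<And>x. norm (\<phi> x) <= b" using test_bounded[OF \<phi>] by blast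
  obtain b' where b': "\<And>x. norm (?D x) <= b'" using test_bounded[OF \<phi>'] by blast
  obtain K where K: "compact K" "\<And>x. x \<notin> K ==> \<phi> x = 0" "\<And>x b. x \<notin> K ==> dd \<phi> x b = 0"
   using test_supp_deriv[OF \<phi>] by auto
  obtain \<eta> where \<eta>: "approximating \<eta>" using approximating_exists by blast
  then have m: "mollifying \<eta>" and m': "\<And>n. \<exists>r. mollifier 0 r (\<eta> n)" by (auto simp: approximating_def)
  obtain S where S: "bounded S" "\<forall>x. x \<notin> S --> p x = 0 \<and> q x = 0" using P(8) by blast
  have t: "test_function UNIV (\<eta> n)" for n by (rule mollifying_test[OF m])
  have pn: "L1 (conv (\<eta> n) p)" "L1 (conv (\<eta> n) q)" for n
  proof -
   obtain K' where K': "compact K'" "\<And>x. x \<notin> K' ==> \<eta> n x = 0" using test_supp[OF t] by auto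
   have cK: "compact {x + y | x y. x \<in> closure S \<and> y \<in> K'}"
    using S(1) K'(1) by (intro compact_sums) (auto simp: compact_closure)
   have z: "conv (\<eta> n) f x = 0" if "x \<notin> {x + y | x y. x \<in> closure S \<and> y \<in> K'}" and f: "\<forall>x. x \<notin> S --> f x = 0" for f :: "real^3 => 'z::euclidean_space" and x
   proof (rule ccontr)
    assume "conv (\<eta> n) f x \<noteq> 0"
    then obtain y where y: "\<eta> n (x - y) \<noteq> 0" "f y \<noteq> 0" by (rule conv_support)
    then have "x - y \<in> K'" "y \<in> closure S" using K'(2) f closure_subset[of S] by auto
    then have "x \<in> {x + y | x y. x \<in> closure S \<and> y \<in> K'}" by (intro CollectI exI[of _ y] exI[of _ "x - y"]) auto
    then show False using that(1) by simp
   qed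
   show "L1 (conv (\<eta> n) p)"
    by (rule compact_support_integrable[OF smooth_continuous[OF conv_smooth[OF t P(3)]] cK z]) (use S(2) in auto)
   show "L1 (conv (\<eta> n) q)"
    by (rule compact_support_integrable[OF smooth_continuous[OF conv_smooth[OF t P(4)]] cK z]) (use S(2) in auto)
  qed
  define Bn where "Bn n x = matrix_inv (mat 1 + conv (\<eta> n) A x)" for n x
  have An: "norm (conv (\<eta> n) A x) <= c" for n x using m'[of n] mollified_bound by blast
  have Bnc: "continuous_on UNIV (Bn n)" for n
   unfolding Bn_def
   by (rule continuous_on_compose2[OF continuous_on_perturbed_inverse[OF c(2)] smooth_continuous[OF conv_smooth[OF t A_integrable]]]) (auto simp: An)
  have Bnm [measurable]: "Bn n Borel" for n using Bnc by (rule borel_measurable_continuous_onI)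
  have mvm: "(\<lambda>x. M x *v h) Borel" if [measurable]: "M Borel" for M :: "real^3 => real^3^3"
  proof -
   have "continuous_on UNIV (\<lambda>M :: real^3^3. M *v h)" unfolding matrix_vector_mult_def by (intro continuous_intros)
   then have "(\<lambda>M :: real^3^3. M *v h) Borel" by (rule borel_measurable_continuous_onI)
   then show ?thesis by (rule measurable_compose[rotated]) measurable
  qed
  have lim1: "(\<lambda>n. LBINT x. conv (\<eta> n) p x \<bullet> ((?D (x + conv (\<eta> n) V x) * \<bar>det (mat 1 + conv (\<eta> n) A x)\<bar>) *R (1::real)))
    ----> (LBINT x. p x \<bullet> ((?D (\<Phi> x) * \<bar>det (J x)\<bar>) *R 1))"
   by (rule mollified_limit[OF \<eta> P(3) pn(1) mollifying_L1[OF m P(3)] c\<phi>', where d=1 and b=b']) (use b' in auto)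
  have lim2: "(\<lambda>n. LBINT x. conv (\<eta> n) q x \<bullet> ((\<phi> (x + conv (\<eta> n) V x) * \<bar>det (mat 1 + conv (\<eta> n) A x)\<bar>) *R (Bn n x *v h)))
    ----> (LBINT x. q x \<bullet> ((\<phi> (\<Phi> x) * \<bar>det (J x)\<bar>) *R (B x *v h)))"
  proof (rule mollified_limit[OF \<eta> P(4) pn(2) mollifying_L1[OF m P(4)] c\<phi>, where d="inverse (1 - c) * norm h" and b=b])
   show "\<bar>\<phi> x\<bar> <= b" for x using b[of x] by simp
   show "(\<lambda>x. Bn n x *v h) Borel" for n by (rule mvm) measurable
   show "(\<lambda>x. B x *v h) Borel" by (rule mvm) measurable
   show "norm (Bn n x *v h) <= inverse (1 - c) * norm h" for n x
    unfolding Bn_def by (rule perturbed_inverse_bound[OF An c(2)])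
   fix x assume l: "(\<lambda>n. conv (\<eta> n) A x) ----> A x"
   have "(\<lambda>n. (inverse (1 - c))\<^sup>2 * norm (conv (\<eta> n) A x - A x) * norm h) ----> (inverse (1 - c))\<^sup>2 * norm (A x - A x) * norm h"
    by (intro tendsto_intros l)
   then have "(\<lambda>n. (inverse (1 - c))\<^sup>2 * norm (conv (\<eta> n) A x - A x) * norm h) ----> 0" by simp
   then have "(\<lambda>n. Bn n x *v h - B x *v h) ----> 0"
    by (rule Lim_null_comparison[rotated])
      (auto simp: Bn_def B_def J_def intro!: always_eventually perturbed_inverse_diff An Ac c)
   then show "(\<lambda>n. Bn n x *v h) ----> B x *v h" by (simp add: Lim_null[symmetric])
  qed
  \<comment> \<open>For fixed n the composition with the inverse of \<open>?\<Psi>\<close> is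
    continuously differentiable. The integration by parts takes place in the variable y, and both of
    its sides are then written in x by the same change of variables.\<close>
  have step: "(LBINT x. conv (\<eta> n) p x \<bullet> ((?D (x + conv (\<eta> n) V x) * \<bar>det (mat 1 + conv (\<eta> n) A x)\<bar>) *R (1::real)))
    = - (LBINT x. conv (\<eta> n) q x \<bullet> ((\<phi> (x + conv (\<eta> n) V x) * \<bar>det (mat 1 + conv (\<eta> n) A x)\<bar>) *R (Bn n x *v h)))" for n
  proof -
   obtain r where r: "mollifier 0 r (\<eta> n)" using m' by blast
   let ?\<Psi> = "\<lambda>x. x + conv (\<eta> n) V x"
   let ?T = "inv ?\<Psi>"
   note mm = mollified_map[OF r]
   have TP: "?T (?\<Psi> x) = x" for x using inv_f_f[OF bij_is_inj[OF mm(2)], of x] by simp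
   have cp: "continuous_on UNIV (conv (\<eta> n) p)" "continuous_on UNIV (conv (\<eta> n) q)"
    by (auto intro!: smooth_continuous conv_smooth t P)
   define F where "F y = conv (\<eta> n) p (?T y)" for y
   define F' where "F' y h = conv (\<eta> n) q (?T y) \<bullet> (Bn n (?T y) *v h)" for y h
   have derF: "(F has_derivative F' y) (at y)" for y
   proof -
    have "(F has_derivative (\<lambda>h. frechet_derivative (conv (\<eta> n) p) (at (?T y)) (Bn n (?T y) *v h))) (at y)"
     unfolding F_def Bn_def
     by (rule has_derivative_compose[OF mollified_inverse_derivative[OF r] smooth_has_derivative[OF conv_smooth[OF t P(3)]]])
    moreover have "(\<lambda>h. frechet_derivative (conv (\<eta> n) p) (at (?T y)) (Bn n (?T y) *v h)) = F' y"
     unfolding F'_def wgrad_conv[OF p t] ..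
    ultimately show ?thesis by simp
   qed
   have Fc: "continuous_on UNIV F" unfolding F_def by (rule continuous_on_compose2[OF cp(1) mm(3)]) auto
   have F'c: "continuous_on UNIV (\<lambda>y. F' y h)"
    unfolding F'_def matrix_vector_mult_def
    by (intro continuous_intros continuous_on_vec_lambda continuous_on_component continuous_on_compose2[OF cp(2) mm(3)] continuous_on_compose2[OF Bnc mm(3)]) auto
   have "(LBINT x. conv (\<eta> n) p x \<bullet> ((?D (x + conv (\<eta> n) V x) * \<bar>det (mat 1 + conv (\<eta> n) A x)\<bar>) *R (1::real)))
     = (LBINT x. \<bar>det (mat 1 + conv (\<eta> n) A x)\<bar> * (F (?\<Psi> x) * ?D (?\<Psi> x)))"
    unfolding F_def TP by (simp add: mult_ac)
   also have "\<dots> = (LBINT y. F y * ?D y)"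
    by (rule C1_change_of_variables[OF mm(2,1,4) _ K(1)]) (auto intro!: continuous_on_mult Fc c\<phi>' simp: K(3))
   also have "\<dots> = - (LBINT y. F' y h * \<phi> y)" by (rule integral_by_parts_test(1)[OF derF F'c \<phi>])
   also have "(LBINT y. F' y h * \<phi> y) = (LBINT x. \<bar>det (mat 1 + conv (\<eta> n) A x)\<bar> * (F' (?\<Psi> x) h * \<phi> (?\<Psi> x)))"
    by (rule C1_change_of_variables[OF mm(2,1,4) _ K(1), symmetric]) (auto intro!: continuous_on_mult F'c c\<phi> simp: K(2))
   also have "\<dots> = (LBINT x. conv (\<eta> n) q x \<bullet> ((\<phi> (x + conv (\<eta> n) V x) * \<bar>det (mat 1 + conv (\<eta> n) A x)\<bar>) *R (Bn n x *v h)))"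
    unfolding F'_def TP by (simp add: mult_ac)
   finally show ?thesis .
  qed
  have "(LBINT x. p x \<bullet> ((?D (\<Phi> x) * \<bar>det (J x)\<bar>) *R 1)) = - (LBINT x. q x \<bullet> ((\<phi> (\<Phi> x) * \<bar>det (J x)\<bar>) *R (B x *v h)))"
   using lim1 tendsto_minus[OF lim2] unfolding step by (rule LIMSEQ_unique)
  moreover have "(LBINT y. p (\<Theta> y) * ?D y) = (LBINT x. p x \<bullet> ((?D (\<Phi> x) * \<bar>det (J x)\<bar>) *R 1))"
   by (subst change_of_variables(1)) (auto simp: mult_ac)
  moreover have "(LBINT y. (g (\<Theta> y) \<bullet> h) * \<phi> y) = (LBINT x. q x \<bullet> ((\<phi> (\<Phi> x) * \<bar>det (J x)\<bar>) *R (B x *v h)))"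
  proof (subst change_of_variables(1))
   show "(\<lambda>y. (g (\<Theta> y) \<bullet> h) * \<phi> y) Borel" by measurable
  qed (simp add: mult_ac g_def dot_lmul_matrix)
  ultimately show "(LBINT y. p (\<Theta> y) * ?D y) = - (LBINT y. (g (\<Theta> y) \<bullet> h) * \<phi> y)" by simp
 qed
 moreover have "\<exists>S. bounded S \<and> (\<forall>x. x \<notin> S --> p (\<Theta> x) = 0 \<and> g (\<Theta> x) = 0)"
 proof -
  obtain S where S: "bounded S" "\<forall>x. x \<notin> S --> p x = 0 \<and> q x = 0" using P(8) by blast
  have "compact (closure S)" using S(1) by (simp add: compact_closure)
  then have "bounded (\<Phi> ` closure S)" by (intro compact_imp_bounded compact_continuous_image continuous_on_subset[OF \<Phi>_continuous]) auto
  moreover have "p (\<Theta> x) = 0 \<and> g (\<Theta> x) = 0" if "x \<notin> \<Phi> ` closure S" for x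
  proof -
   have "\<Theta> x \<notin> S" using that closure_subset[of S] by (metis \<Phi>_\<Theta> image_eqI subsetD)
   then show ?thesis using S(2) by (simp add: g_def)
  qed
  ultimately show ?thesis by blast
 qed
 ultimately show ?thesis unfolding wgrad_def g_def by blast
qed

end

lemma wgrad_scale: "wgrad p q ==> wgrad (\<lambda>x. s * p x) (\<lambda>x. s *R q x)"
 unfolding wgrad_def wgrad_on_def
 using L2_scaleR[of lborel p s] L2_scaleR[of lborel q s] by (auto simp: mult.assoc)

lemma wgrad_diff:
 assumes "wgrad p q" "wgrad p' q'"
 shows "wgrad (\<lambda>x. p x - p' x) (\<lambda>x. q x - q' x)"
proof -
 note P = wgradD[OF assms(1)] and P' = wgradD[OF assms(2)]
 obtain S S' where S: "bounded S" "\<forall>x. x \<notin> S --> p x = 0 \<and> q x = 0" and S': "bounded S'" "\<forall>x. x \<notin> S' --> p' x = 0 \<and> q' x = 0"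
  using P(8) P'(8) by blast
 have "wgrad_on UNIV (\<lambda>x. p x - p' x) (\<lambda>x. q x - q' x)"
  unfolding wgrad_on_def
 proof (intro conjI allI impI L2_diff P P')
  fix \<phi> :: "real^3 => real" and h :: "real^3" assume \<phi>: "test_function UNIV \<phi>"
  have i: "L1 (\<lambda>x. f x * dd \<phi> x h)" if "L2 f" for f
   using integrable_inner_L2[OF that test_square_integrable[OF test_deriv[OF \<phi>]]] by simp
  have j: "L1 (\<lambda>x. (f x \<bullet> h) * \<phi> x)" if "L2 f" for f :: "real^3 => real^3"
   using integrable_inner_L2[OF L2_inner_const[OF that] test_square_integrable[OF \<phi>]] by simp
  show "(LBINT x. (p x - p' x) * dd \<phi> x h) = - (LBINT x. ((q x - q' x) \<bullet> h) * \<phi> x)"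
   using i[OF P(1)] i[OF P'(1)] j[OF P(2)] j[OF P'(2)] P(7)[OF \<phi>, of h] P'(7)[OF \<phi>, of h]
   by (simp add: left_diff_distrib inner_diff_left)
 qed
 moreover have "bounded (S \<union> S')" using S S' by simp
 ultimately show ?thesis unfolding wgrad_def using S(2) S'(2) by (intro conjI exI[of _ "S \<union> S'"]) auto
qed

lemma (in lip_field) lip_field_scale:
 assumes "\<bar>s\<bar> <= 1"
 shows "lip_field (\<lambda>x. s *R V x) (\<lambda>x. s *R A x) (\<bar>s\<bar> * c)"
proof
 show "wgrad (\<lambda>x. (s *R V x) $ i) (\<lambda>x. (s *R A x) $ i)" for i using wgrad_scale[OF W[of i], of s] by simp
 show "continuous_on UNIV (\<lambda>x. s *R V x)" by (intro continuous_intros cont)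
 show "norm (s *R A x) <= \<bar>s\<bar> * c" for x using Ac[of x] by (simp add: mult_left_mono)
 show "0 <= \<bar>s\<bar> * c" using c by simp
 have "\<bar>s\<bar> * c <= 1 * c" using assms c by (intro mult_right_mono) auto
 then show "\<bar>s\<bar> * c < 1" using c by simp
qed

lemma matrix_mult_row: "((M :: real^3^3) ** N) $ i = M $ i v* N"
 by (simp add: vec_eq_iff matrix_matrix_mult_def vector_matrix_mult_def mult.commute)

lemma matrix_mult_add_left: "((M :: real^3^3) + N) ** P = M ** P + N ** P"
 by (simp add: vec_eq_iff matrix_matrix_mult_def distrib_right sum.distrib)

lemma (in lip_field) wgrad_V_comp_\<Theta>:
 "wgrad (\<lambda>y. V (\<Theta> y) $ i) (\<lambda>y. (A (\<Theta> y) ** B (\<Theta> y)) $ i)"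
 using wgrad_comp_\<Theta>[OF W[of i]] by (simp add: matrix_mult_row)

lemma (in lip_field) AB_bound: "norm (A x ** B x) <= c * inverse (1 - c)"
proof -
 have "norm (A x ** B x) <= norm (A x) * inverse (1 - c)" using c by (intro norm_matrix_mult_le B_bound) auto
 also have "\<dots> <= c * inverse (1 - c)" using Ac c by (intro mult_right_mono) auto
 finally show ?thesis .
qed

text \<open>The gradient of V o \<Theta> is bounded by c / (1 - c), and c < 1/2 is the condition for
  this to stay below 1.\<close>

lemma (in lip_field) lip_field_comp_inverse:
 assumes "c < 1/2"
 shows "lip_field (\<lambda>y. V (\<Theta> y)) (\<lambda>y. A (\<Theta> y) ** B (\<Theta> y)) (c * inverse (1 - c))"
proof
 show "continuous_on UNIV (\<lambda>y. V (\<Theta> y))" by (rule continuous_on_compose2[OF cont \<Theta>_continuous]) auto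
 show "c * inverse (1 - c) < 1" using c assms by (simp add: field_simps)
qed (use wgrad_V_comp_\<Theta> AB_bound c in auto)

text \<open>The inverse of \<open>x + V x\<close> is \<open>y - V (\<Theta> y)\<close>, again of the form treated above, so that the forward
  composition follows from the composition with the inverse.\<close>

lemma (in lip_field) wgrad_comp_\<Phi>:
 assumes p: "wgrad p q" and c2: "c < 1/2"
 shows "wgrad (\<lambda>x. p (\<Phi> x)) (\<lambda>x. q (\<Phi> x) v* J x)"
proof -
 interpret I: lip_field "\<lambda>y. (-1) *R V (\<Theta> y)" "\<lambda>y. (-1) *R (A (\<Theta> y) ** B (\<Theta> y))" "\<bar>-1\<bar> * (c * inverse (1 - c))"
  by (rule lip_field.lip_field_scale[OF lip_field_comp_inverse[OF c2]]) simp
 have I\<Phi>: "I.\<Phi> = \<Theta>"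
 proof
  fix y
  have "\<Phi> (\<Theta> y) = \<Theta> y + V (\<Theta> y)" by (simp only: \<Phi>_def)
  then have "y = \<Theta> y + V (\<Theta> y)" by simp
  then show "I.\<Phi> y = \<Theta> y" unfolding I.\<Phi>_def by (simp add: algebra_simps)
 qed
 have I\<Theta>: "I.\<Theta> = \<Phi>"
  unfolding I.\<Theta>_def I\<Phi> by (rule inv_equality) auto
 \<comment> \<open>J B = 1 reads B + A B = 1, so the Jacobian matrix 1 - A B of the inverse map is
   B, and its inverse is J again.\<close>
 have IB: "I.B (\<Phi> x) = J x" for x
 proof -
  have "J x ** I.J (\<Phi> x) = J x ** (mat 1 - A x ** B x)" unfolding I.J_def by simp
  also have "mat 1 - A x ** B x = B x"
  proof -
   have "mat 1 = (mat 1 + A x) ** B x" using J_B(1)[of x] by (simp add: J_def)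
   then have "mat 1 = B x + A x ** B x" unfolding matrix_mult_add_left matrix_mul_lid .
   then show ?thesis by simp
  qed
  finally have "J x ** I.J (\<Phi> x) = mat 1" using J_B(1) by simp
  then show ?thesis unfolding I.B_def by (rule matrix_inv_unique)
 qed
 show ?thesis using I.wgrad_comp_\<Theta>[OF p] unfolding I\<Theta> IB .
qed

subsection \<open>Korn inequality\<close>

lemma integral_difference_quotient_test:
 fixes F \<psi> :: "real^3 => real"
 assumes F: "test_function UNIV F" and \<psi>: "test_function UNIV \<psi>" and T: "\<And>n. T n > 0" "T ----> 0"
 shows "(\<lambda>n. LBINT x. F x * ((\<psi> (x + T n *R h) - \<psi> x) / T n)) ----> (LBINT x. F x * dd \<psi> x h)"
proof -
 have c: "continuous_on UNIV \<psi>" by (rule smooth_continuous[OF test_smooth[OF \<psi>]])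
 obtain b where b: "b > 0" "\<And>x y. norm (\<psi> x - \<psi> y) <= b * norm (x - y)" "\<And>x h. norm (dd \<psi> x h) <= b * norm h"
  using test_lipschitz[OF \<psi>] by blast
 have "(\<lambda>n. LBINT x. F x \<bullet> ((\<psi> (x + T n *R h) - \<psi> x) / T n)) ----> (LBINT x. F x \<bullet> dd \<psi> x h)"
 proof (rule L1_bounded_inner_tendsto[where fn="\<lambda>_. F" and B="b * norm h", OF test_integrable[OF F] test_integrable[OF F]])
  show "(\<lambda>x. (\<psi> (x + T n *R h) - \<psi> x) / T n) \<in> borel_measurable lborel" for n
  proof -
   have "continuous_on UNIV (\<lambda>x. (\<psi> (x + T n *R h) - \<psi> x) / T n)"
    by (intro continuous_intros continuous_on_compose2[OF c]) (use T(1)[of n] in auto)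
   then show ?thesis using borel_measurable_continuous_onI by simp
  qed
  show "norm ((\<psi> (x + T n *R h) - \<psi> x) / T n) <= b * norm h" for n x
   using b(2)[of "x + T n *R h" x] T(1)[of n] by (simp add: field_simps)
  show "(\<lambda>x. dd \<psi> x h) \<in> borel_measurable lborel"
   using smooth_measurable[OF smooth_deriv[OF test_smooth[OF \<psi>]]] by simp
  have "filterlim T (at 0) sequentially" using T by (simp add: filterlim_at less_imp_neq[symmetric] less_imp_neq[THEN not_sym])
  then show "AE x in lborel. (\<lambda>n. (\<psi> (x + T n *R h) - \<psi> x) / T n) ----> dd \<psi> x h"
   by (intro AE_I2 filterlim_compose[OF directional_difference_tendsto[OF smooth_has_derivative[OF test_smooth[OF \<psi>]]]])
 qed simp
 then show ?thesis by simp
qed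

text \<open>One derivative is replaced by a difference quotient and moved to the other factor by
  translation invariance; only then is the remaining derivative integrated by parts. Letting t tend
  to 0 expresses the symmetry of second derivatives without forming any.\<close>

lemma integral_mixed_partials:
 fixes \<phi> \<psi> :: "real^3 => real"
 assumes \<phi>: "test_function UNIV \<phi>" and \<psi>: "test_function UNIV \<psi>"
 shows "(LBINT x. dd \<phi> x a * dd \<psi> x b)
    = (LBINT x. dd \<phi> x b * dd \<psi> x a)"
proof -
 let ?T = "\<lambda>n. inverse (real (Suc n))"
 let ?D\<phi> = "\<lambda>x. dd \<phi> x a" and ?D\<psi> = "\<lambda>x. dd \<psi> x a"
 have T: "?T n > 0" for n by simp
 have T0: "?T ----> 0" by (rule LIMSEQ_inverse_real_of_nat)
 have s\<phi>: "smooth \<phi>" by (rule test_smooth[OF \<phi>])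
 have D\<phi>: "test_function UNIV ?D\<phi>" and D\<psi>: "test_function UNIV ?D\<psi>" using \<phi> \<psi> by (auto intro: test_deriv)
 have m: "\<phi> Borel" "\<psi> Borel" "?D\<phi> Borel"
  using \<phi> \<psi> D\<phi> by (auto intro: smooth_measurable test_smooth)
 have shift: "test_function UNIV (\<lambda>x. u (x + v))" if "test_function UNIV u" for u :: "real^3 => real" and v
  using test_shift[OF that, of 1 v] by (simp add: add.commute)
 have i: "L1 (\<lambda>x. u x * v x)" if "test_function UNIV u" "test_function UNIV v" for u v :: "real^3 => real"
  using integrable_inner_L2[OF test_square_integrable[OF that(1)] test_square_integrable[OF that(2)]] by simp
 have key: "(LBINT x. ?D\<phi> x * ((\<psi> (x + t *R b) - \<psi> x) / t)) = - (LBINT x. ?D\<psi> x * ((\<phi> (x + t *R (- b)) - \<phi> x) / t))"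
  if t: "t > 0" for t
 proof -
  have "(LBINT x. ?D\<phi> x * ((\<psi> (x + t *R b) - \<psi> x) / t)) = (LBINT x. ?D\<phi> x * \<psi> (x + t *R b) / t - ?D\<phi> x * \<psi> x / t)"
   by (simp add: diff_divide_distrib right_diff_distrib)
  also have "\<dots> = (LBINT x. ?D\<phi> x * \<psi> (x + t *R b)) / t - (LBINT x. ?D\<phi> x * \<psi> x) / t"
   using i[OF D\<phi> shift[OF \<psi>, of "t *R b"]] i[OF D\<phi> \<psi>] by simp
  also have "(LBINT x. ?D\<phi> x * \<psi> (x + t *R b)) = (LBINT x. ?D\<phi> (x - t *R b) * \<psi> x)"
  proof -
   have mm: "(\<lambda>x. ?D\<phi> (x - t *R b) * \<psi> x) Borel"
    using smooth_measurable[OF test_smooth[OF shift[OF D\<phi>, of "- t *R b"]]] m(2) by simp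
   show ?thesis using integral_lborel_affine[OF _ mm, of 1 "t *R b"] by (simp add: add.commute)
  qed
  also have "(LBINT x. ?D\<phi> (x - t *R b) * \<psi> x) / t - (LBINT x. ?D\<phi> x * \<psi> x) / t
    = (LBINT x. ((?D\<phi> (x + t *R (- b)) - ?D\<phi> x) / t) * \<psi> x)"
   using i[OF shift[OF D\<phi>, of "- t *R b"] \<psi>] i[OF D\<phi> \<psi>] by (simp add: diff_divide_distrib left_diff_distrib)
  also have "\<dots> = - (LBINT x. ((\<phi> (x + t *R (- b)) - \<phi> x) / t) * ?D\<psi> x)"
  proof -
   let ?F = "\<lambda>x. (\<phi> (x + t *R (- b)) - \<phi> x) / t"
   let ?F' = "\<lambda>x h. (dd \<phi> (x + t *R (- b)) h - dd \<phi> x h) / t"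
   have der: "(?F has_derivative ?F' x) (at x)" for x
   proof -
    have "((\<lambda>x. \<phi> (x + t *R (- b))) has_derivative (\<lambda>h. dd \<phi> (x + t *R (- b)) h)) (at x)"
     by (rule has_derivative_compose[OF _ smooth_has_derivative[OF s\<phi>], where f="\<lambda>x. x + t *R (- b)" and f'="\<lambda>h. h"]) (auto intro!: derivative_eq_intros)
    then show ?thesis using smooth_has_derivative[OF s\<phi>, of x] t by (auto intro!: derivative_eq_intros simp: field_simps)
   qed
   have c: "continuous_on UNIV ?D\<phi>" by (rule smooth_continuous[OF test_smooth[OF D\<phi>]])
   have "continuous_on UNIV (\<lambda>x. ?F' x a)"
    using t by (intro continuous_intros continuous_on_compose2[OF c]) auto
   from integral_by_parts_test(1)[OF der this \<psi>] show ?thesis by simp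
  qed
  finally show ?thesis by (simp add: mult.commute)
 qed
 have "(\<lambda>n. LBINT x. ?D\<phi> x * ((\<psi> (x + ?T n *R b) - \<psi> x) / ?T n)) ----> (LBINT x. ?D\<phi> x * dd \<psi> x b)"
  by (rule integral_difference_quotient_test[OF D\<phi> \<psi> T T0])
 moreover have "(\<lambda>n. - (LBINT x. ?D\<psi> x * ((\<phi> (x + ?T n *R (- b)) - \<phi> x) / ?T n))) ----> - (LBINT x. ?D\<psi> x * dd \<phi> x (- b))"
  by (intro tendsto_minus integral_difference_quotient_test[OF D\<psi> \<phi> T T0])
 ultimately have "(LBINT x. ?D\<phi> x * dd \<psi> x b) = - (LBINT x. ?D\<psi> x * dd \<phi> x (- b))"
  unfolding key[OF T] by (rule LIMSEQ_unique)
 moreover have "dd \<phi> x (- b) = - dd \<phi> x b" for x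
  using linear_neg[OF has_derivative_linear[OF smooth_has_derivative[OF s\<phi>]]] .
 ultimately show ?thesis by (simp add: mult.commute)
qed

section \<open>Gradients as annihilators of divergence-free fields\<close>

definition scalar_null :: "(real^3) set => (real^3 => real^3) => bool" where
 "scalar_null \<Omega> g \<longleftrightarrow> L2 g \<and> (\<forall>h. scalar_divfree \<Omega> h --> (LBINT x. h x \<bullet> g x) = 0)"

text \<open>The closure in \<open>L\<^sup>2\<close> of the gradients of test functions, described as a double annihilator.\<close>

definition null_gradient :: "(real^3) set => (real^3 => real^3^3) => bool" where
 "null_gradient \<Omega> G \<longleftrightarrow> L2 G \<and> (\<forall>i. scalar_null \<Omega> (\<lambda>x. G x $ i))"

definition divfree :: "(real^3) set => (real^3 => real^3^3) => bool" where
 "divfree \<Omega> h \<longleftrightarrow> L2 h \<and>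
   (\<forall>\<phi> :: real^3 => real^3. test_function \<Omega> \<phi> --> (LBINT x. h x \<bullet> jacobian \<phi> (at x)) = 0)"

lemma L2_nth:
 fixes G :: "'a => ('b::euclidean_space)^'n"
 assumes "square_integrable M G"
 shows "square_integrable M (\<lambda>x. G x $ i)"
proof (rule L2_bound[OF assms, of _ 1])
 have "(\<lambda>A :: 'b^'n. A $ i) Borel" by (intro borel_measurable_continuous_onI continuous_intros)
 then show "(\<lambda>x. G x $ i) \<in> borel_measurable M" by (rule measurable_compose[OF L2_measurable[OF assms]])
 show "AE x in M. norm (G x $ i) <= 1 * norm (G x)" by (simp add: Finite_Cartesian_Product.norm_nth_le)
qed

lemma integral_row_sum:
 fixes h G :: "'a => real^3^3"
 assumes "square_integrable M h" "square_integrable M G"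
 shows "(\<integral>x. h x \<bullet> G x \<partial>M) = (\<Sum>i\<in>UNIV. \<integral>x. h x $ i \<bullet> G x $ i \<partial>M)"
proof -
 have "(\<integral>x. h x \<bullet> G x \<partial>M) = (\<integral>x. (\<Sum>i\<in>UNIV. h x $ i \<bullet> G x $ i) \<partial>M)" by (simp only: inner_vec_def)
 also have "\<dots> = (\<Sum>i\<in>UNIV. \<integral>x. h x $ i \<bullet> G x $ i \<partial>M)"
  by (intro Bochner_Integration.integral_sum integrable_inner_L2 L2_nth assms)
 finally show ?thesis .
qed

text \<open>Test with \<phi> times the i-th unit vector, whose Jacobian matrix has the gradient of
  \<phi> in row i and zeros elsewhere.\<close>

lemma divfree_row:
 assumes h: "divfree \<Omega> h"
 shows "scalar_divfree \<Omega> (\<lambda>x. h x $ i)"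
 unfolding scalar_divfree_def
proof (intro conjI allI impI)
 show "L2 (\<lambda>x. h x $ i)" using h by (simp add: divfree_def L2_nth)
 fix \<phi> :: "real^3 => real" assume \<phi>: "test_function \<Omega> \<phi>"
 let ?\<psi> = "\<lambda>x. \<phi> x *R (axis i 1 :: real^3)"
 obtain K where K: "compact K" "K \<subseteq> \<Omega>" "\<And>x. x \<notin> K ==> \<phi> x = 0" using test_supp[OF \<phi>] by auto
 have t: "test_function \<Omega> ?\<psi>"
  by (rule test_functionI[OF smooth_bounded_linear[OF bounded_linear_scaleR_left test_smooth[OF \<phi>]] K(1,2)]) (use K(3) in force)
 have "jacobian ?\<psi> (at x) = (\<chi> j. if j = i then grad \<phi> x else 0)" for x
 proof -
  have "(?\<psi> has_derivative (\<lambda>h. dd \<phi> x h *R axis i 1)) (at x)"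
   by (intro has_derivative_scaleR_left smooth_has_derivative[OF test_smooth[OF \<phi>]])
  then show ?thesis
   unfolding jacobian_def matrix_def by (subst frechet_derivative_at[symmetric]) (auto simp: vec_eq_iff grad_def axis_def)
 qed
 then have "h x \<bullet> jacobian ?\<psi> (at x) = h x $ i \<bullet> grad \<phi> x" for x
  by (simp add: inner_vec_def[of "h x"] if_distrib[of "inner _"] cong: if_cong)
 then show "(LBINT x. h x $ i \<bullet> grad \<phi> x) = 0" using h t by (auto simp: divfree_def)
qed

lemma null_gradient_orthogonal:
 assumes G: "null_gradient \<Omega> G" and h: "divfree \<Omega> h"
 shows "(LBINT x. h x \<bullet> G x) = 0"
proof -
 have "(LBINT x. h x \<bullet> G x) = (\<Sum>i\<in>UNIV. LBINT x. h x $ i \<bullet> G x $ i)"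
  using assms by (intro integral_row_sum) (auto simp: divfree_def null_gradient_def)
 also have "\<dots> = 0"
  using G divfree_row[OF h] by (intro sum.neutral) (auto simp: null_gradient_def scalar_null_def)
 finally show ?thesis .
qed

text \<open>Rotating a gradient by a quarter turn in a coordinate plane yields a divergence-free field.
  Applied first to test functions and then to \<open>g\<close> itself, this transfers the symmetry of mixed
  partial derivatives to the closure.\<close>

lemma scalar_null_curl:
 assumes g: "scalar_null \<Omega> g" and g': "scalar_null \<Omega> g'"
 shows "(LBINT x. g x $ a * g' x $ b) = (LBINT x. g x $ b * g' x $ a)"
proof -
 define rot where "rot v = v $ b *R axis a 1 - v $ a *R axis b (1::real)" for v :: "real^3"
 have rot_inner: "rot v \<bullet> w = v $ b * w $ a - v $ a * w $ b" for v w
  by (simp add: rot_def inner_diff_left inner_axis' )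
 have rot_sq: "L2 (\<lambda>x. rot (v x))" if v: "L2 v" for v :: "real^3 => real^3"
  unfolding rot_def
 proof (intro L2_diff)
  have *: "L2 (\<lambda>x. v x $ i *R axis j (1::real) :: real^3)" for i j
  proof (rule L2_bound[OF v, of _ 1])
   have "(\<lambda>x. v x $ i) \<in> borel_measurable lborel" by (intro L2_measurable L2_nth v)
   then show "(\<lambda>x. v x $ i *R axis j (1::real) :: real^3) \<in> borel_measurable lborel" by (intro borel_measurable_scaleR) auto
   show "AE x in lborel. norm (v x $ i *R axis j (1::real) :: real^3) <= 1 * norm (v x)" using component_le_norm_cart by auto
  qed
  show "L2 (\<lambda>x. v x $ b *R axis a (1::real) :: real^3)" "L2 (\<lambda>x. v x $ a *R axis b (1::real) :: real^3)"
   by (rule *)+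
 qed
 have split: "(LBINT x. rot (v x) \<bullet> w x) = (LBINT x. v x $ b * w x $ a) - (LBINT x. v x $ a * w x $ b)"
  if "L2 v" "L2 w" for v w :: "real^3 => real^3"
 proof -
  have "L1 (\<lambda>x. v x $ i * w x $ j)" for i j
   using integrable_inner_L2[OF L2_nth[OF that(1), of i] L2_nth[OF that(2), of j]] by simp
  then show ?thesis unfolding rot_inner by simp
 qed
 have "scalar_divfree \<Omega> (\<lambda>x. rot (grad \<psi> x))" if \<psi>: "test_function \<Omega> \<psi>" for \<psi>
  unfolding scalar_divfree_def
 proof (intro conjI allI impI)
  show "L2 (\<lambda>x. rot (grad \<psi> x))" by (rule rot_sq[OF grad_test_square_integrable[OF \<psi>]])
  fix \<phi> :: "real^3 => real" assume \<phi>: "test_function \<Omega> \<phi>"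
  show "(LBINT x. rot (grad \<psi> x) \<bullet> grad \<phi> x) = 0"
   using integral_mixed_partials[OF test_UNIV[OF \<psi>] test_UNIV[OF \<phi>], of "axis b 1" "axis a 1"]
   by (subst split) (auto intro: grad_test_square_integrable \<psi> \<phi> simp: grad_def)
 qed
 then have *: "(LBINT x. rot (grad \<psi> x) \<bullet> g x) = 0" if "test_function \<Omega> \<psi>" for \<psi>
  using g that by (simp add: scalar_null_def)
 have "scalar_divfree \<Omega> (\<lambda>x. rot (g x))"
  unfolding scalar_divfree_def
 proof (intro conjI allI impI)
  show "L2 (\<lambda>x. rot (g x))" using g by (intro rot_sq) (simp add: scalar_null_def)
  fix \<phi> :: "real^3 => real" assume \<phi>: "test_function \<Omega> \<phi>"
  have "rot (g x) \<bullet> grad \<phi> x = - (rot (grad \<phi> x) \<bullet> g x)" for x by (simp add: rot_inner mult.commute)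
  then show "(LBINT x. rot (g x) \<bullet> grad \<phi> x) = 0" using *[OF \<phi>] by simp
 qed
 then have "(LBINT x. rot (g x) \<bullet> g' x) = 0" using g' by (simp add: scalar_null_def)
 then show ?thesis using split[of g g'] g g' by (simp add: scalar_null_def)
qed

lemma inner_matrix_transpose: "(A :: real^3^3) \<bullet> transpose A = (\<Sum>i\<in>UNIV. \<Sum>j\<in>UNIV. A $ i $ j * A $ j $ i)"
 by (simp add: inner_vec_def transpose_def)

definition sym_part :: "real^3^3 => real^3^3" where
 "sym_part A = (1/2) *R (A + transpose A)"

lemma norm_transpose [simp]: "norm (transpose (A :: real^3^3)) = norm A"
proof -
 have "(norm (transpose A))\<^sup>2 = (norm A)\<^sup>2"
  unfolding power2_norm_eq_inner inner_vec_def transpose_def by simp (rule sum.swap)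
 then show ?thesis by simp
qed

lemma norm_sym_part: "(norm (sym_part A))\<^sup>2 = ((norm A)\<^sup>2 + A \<bullet> transpose A) / 2"
proof -
 have "(norm (sym_part A))\<^sup>2 = (1/4) * ((norm A)\<^sup>2 + (norm (transpose A))\<^sup>2 + 2 * (A \<bullet> transpose A))"
  unfolding sym_part_def power2_norm_eq_inner by (simp add: inner_add_left inner_add_right inner_commute)
 then show ?thesis by simp
qed

lemma norm_sym_part_le: "norm (sym_part A) <= norm A"
 unfolding sym_part_def using norm_triangle_ineq[of A "transpose A"] by simp

text \<open>Exchanging the derivatives in each product G_ij G_ji turns the integral of G \<bullet>
  G^T into that of (tr G)^2, which is nonnegative; |sym G|^2 is half of |G|^2 + G \<bullet> G^T,
  whence the constant 2.\<close>

theorem Korn: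
 assumes G: "null_gradient \<Omega> G"
 shows "(LBINT x. (norm (G x))\<^sup>2) <= 2 * (LBINT x. (norm (sym_part (G x)))\<^sup>2)"
proof -
 have sq: "L2 G" and row: "\<And>i. scalar_null \<Omega> (\<lambda>x. G x $ i)" using G by (auto simp: null_gradient_def)
 have comp: "L2 (\<lambda>x. G x $ i $ j)" for i j by (intro L2_nth sq)
 have int: "L1 (\<lambda>x. G x $ i $ j * G x $ k $ l)" for i j k l
  using integrable_inner_L2[OF comp[of i j] comp[of k l]] by simp
 have "(LBINT x. G x \<bullet> transpose (G x)) = (\<Sum>i\<in>UNIV. \<Sum>j\<in>UNIV. LBINT x. G x $ i $ j * G x $ j $ i)"
  unfolding inner_matrix_transpose using int by simp
 also have "\<dots> = (\<Sum>i\<in>UNIV. \<Sum>j\<in>UNIV. LBINT x. G x $ i $ i * G x $ j $ j)"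
  by (intro sum.cong refl scalar_null_curl[OF row row])
 also have "\<dots> = (LBINT x. (trace (G x))\<^sup>2)"
  unfolding trace_def power2_eq_square sum_product using int by simp
 also have "\<dots> >= 0" by simp
 finally have "0 <= (LBINT x. G x \<bullet> transpose (G x))" .
 moreover have "(LBINT x. (norm (sym_part (G x)))\<^sup>2) = ((LBINT x. (norm (G x))\<^sup>2) + (LBINT x. G x \<bullet> transpose (G x))) / 2"
 proof -
  have "L1 (\<lambda>x. G x \<bullet> transpose (G x))" unfolding inner_matrix_transpose using int by simp
  then show ?thesis unfolding norm_sym_part using sq by (simp add: square_integrable_def)
 qed
 ultimately show ?thesis by simp
qed

subsection \<open>The pulled back energy\<close>

lemma borel_measurable_matrix_mult [measurable (raw)]:
 fixes f g :: "'a => real^3^3"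
 assumes "f \<in> borel_measurable M" "g \<in> borel_measurable M"
 shows "(\<lambda>x. f x ** g x) \<in> borel_measurable M"
proof -
 have "continuous_on UNIV (\<lambda>p :: (real^3^3) \<times> (real^3^3). fst p ** snd p)"
  unfolding matrix_matrix_mult_def by (intro continuous_intros)
 from borel_measurable_continuous_Pair[OF assms this] show ?thesis by simp
qed

lemma borel_measurable_det [measurable (raw)]:
 fixes f :: "'a => real^3^3"
 assumes "f \<in> borel_measurable M"
 shows "(\<lambda>x. det (f x)) \<in> borel_measurable M"
 by (rule measurable_compose[OF assms borel_measurable_continuous_onI]) (intro continuous_on_det continuous_on_id)

lemma borel_measurable_matrix_inv_perturbed:
 fixes f :: "'a => real^3^3"
 assumes f: "f \<in> borel_measurable M" and c: "\<And>x. norm (f x) <= c" "c < 1"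
 shows "(\<lambda>x. matrix_inv (mat 1 + f x)) \<in> borel_measurable M"
proof -
 have "{A :: real^3^3. norm A <= c} = cball 0 c" by auto
 then have "(\<lambda>A. indicator {A :: real^3^3. norm A <= c} A *R matrix_inv (mat 1 + A)) Borel"
  by (intro borel_measurable_continuous_on_indicator continuous_on_perturbed_inverse c) (simp add: borel_closed)
 from measurable_compose[OF f this] show ?thesis by (simp add: c)
qed

section \<open>The elasticity tensor\<close>

lemma linear_elasticity_tensor: "linear (elasticity_tensor lam \<mu>)"
proof (rule linearI)
 show "elasticity_tensor lam \<mu> (A + B) = elasticity_tensor lam \<mu> A + elasticity_tensor lam \<mu> B" for A B
  by (simp add: elasticity_tensor_def vec_eq_iff transpose_def trace_def sum.distrib algebra_simps)
 show "elasticity_tensor lam \<mu> (c *R A) = c *R elasticity_tensor lam \<mu> A" for c A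
  by (simp add: elasticity_tensor_def vec_eq_iff transpose_def trace_def sum_distrib_left[symmetric] algebra_simps)
qed

lemma inner_mat_1: "(mat 1 :: real^3^3) \<bullet> A = trace A"
 by (simp add: inner_vec_def mat_def trace_def sum_3)

lemma inner_transpose: "transpose (A :: real^3^3) \<bullet> transpose B = A \<bullet> B"
 by (simp add: inner_vec_def transpose_def) (rule sum.swap)

lemma elasticity_tensor_symmetric: "elasticity_tensor lam \<mu> A \<bullet> B = elasticity_tensor lam \<mu> B \<bullet> A"
proof -
 have "transpose A \<bullet> B = transpose B \<bullet> A" using inner_transpose[of A "transpose B"] by (simp add: inner_commute)
 then show ?thesis by (simp add: elasticity_tensor_def inner_add_left inner_mat_1 inner_commute[of B A])
qed

text \<open>The quotient assumed nonnegative is the Poisson ratio; its denominator is positive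
  because 3 (lam + \<mu>) = (2 \<mu> + 3 lam) + \<mu> > 0.\<close>

lemma lame_admissible_nonneg:
 assumes "lame_admissible \<alpha> \<gamma> lam \<mu>" "\<alpha> > 0" "\<gamma> > 0"
 shows "lam >= 0"
proof (rule ccontr)
 assume "\<not> lam >= 0"
 then have l: "lam < 0" by simp
 have h: "\<mu> > 0" "2 * \<mu> + 3 * lam > 0" "0 <= lam / (2 * (lam + \<mu>))"
  using assms by (auto simp: lame_admissible_def)
 then have "lam + \<mu> > 0" using l by linarith
 then have "lam / (2 * (lam + \<mu>)) < 0" using l by (simp add: divide_less_0_iff)
 then show False using h by simp
qed

text \<open>The tensor sees only the symmetric part of a gradient; \<open>Korn\<close> recovers the
  rest after integration.\<close>

lemma elasticity_tensor_coercive: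
 assumes "lame_admissible \<alpha> \<gamma> lam \<mu>" "\<alpha> > 0" "\<gamma> > 0"
 shows "elasticity_tensor lam \<mu> A \<bullet> A >= 2 * \<alpha> * (norm (sym_part A))\<^sup>2"
proof -
 have "elasticity_tensor lam \<mu> A \<bullet> A = 2 * \<mu> * (norm (sym_part A))\<^sup>2 + lam * (trace A)\<^sup>2"
 proof -
  have "elasticity_tensor lam \<mu> A \<bullet> A = \<mu> * (A \<bullet> A + transpose A \<bullet> A) + lam * (trace A * trace A)"
   by (simp add: elasticity_tensor_def inner_add_left inner_mat_1)
  then show ?thesis unfolding norm_sym_part unfolding power2_norm_eq_inner by (simp add: inner_commute[of A "transpose A"] power2_eq_square)
 qed
 moreover have "2 * \<alpha> * (norm (sym_part A))\<^sup>2 <= 2 * \<mu> * (norm (sym_part A))\<^sup>2"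
  using assms by (intro mult_right_mono) (auto simp: lame_admissible_def)
 moreover have "lam * (trace A)\<^sup>2 >= 0" using lame_admissible_nonneg[OF assms] by simp
 ultimately show ?thesis by simp
qed

text \<open>Moves a right factor across the inner product. This is where the transposed Jacobian
  matrix in the final formula comes from.\<close>

lemma inner_mult_transpose: "((A :: real^3^3) ** transpose (B :: real^3^3)) \<bullet> Y = A \<bullet> (Y ** B)"
 by (simp add: inner_vec_def matrix_matrix_mult_def transpose_def sum_3 algebra_simps)

text \<open>det (1 + s E) = 1 + s tr E + s^2 m + s^3 det E, where m is the sum of the principal 2 by
  2 minors. Entries of size at most 1/2 give |m| <= 6/4, |det E| <= 6/8 and |tr E| <= 3/2, hence the
  bounds 9/4 and 3/2 + 9/4, both below 4.\<close>

lemma det_expansion: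
 fixes E :: "real^3^3"
 assumes E: "norm E <= 1/2" and s: "\<bar>s\<bar> <= 1"
 shows "\<bar>det (mat 1 + s *R E) - 1 - s * trace E\<bar> <= 4 * s\<^sup>2" and "\<bar>det (mat 1 + s *R E) - 1\<bar> <= 4 * \<bar>s\<bar>"
proof -
 have e: "\<bar>E $ i $ j\<bar> <= 1/2" for i j
  using Finite_Cartesian_Product.norm_nth_le[of E i] component_le_norm_cart[of "E $ i" j] E by simp
 have p: "\<bar>E $ i $ j * E $ k $ l\<bar> <= 1/4" for i j k l
  using mult_mono[OF e[of i j] e[of k l]] by (simp add: abs_mult)
 have t: "\<bar>E $ i $ j * E $ k $ l * E $ m $ n\<bar> <= 1/8" for i j k l m n
  using mult_mono[OF p[of i j k l] e[of m n]] by (simp add: abs_mult)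
 define m where "m = E$1$1 * E$2$2 + E$1$1 * E$3$3 + E$2$2 * E$3$3 - E$1$2 * E$2$1 - E$1$3 * E$3$1 - E$2$3 * E$3$2"
 have m: "\<bar>m\<bar> <= 3/2" unfolding m_def
  using p[of 1 1 2 2] p[of 1 1 3 3] p[of 2 2 3 3] p[of 1 2 2 1] p[of 1 3 3 1] p[of 2 3 3 2] by linarith
 have d: "\<bar>det E\<bar> <= 3/4" unfolding det_3
  using t[of 1 1 2 2 3 3] t[of 1 2 2 3 3 1] t[of 1 3 2 1 3 2] t[of 1 1 2 3 3 2] t[of 1 2 2 1 3 3] t[of 1 3 2 2 3 1] by linarith
 have eq: "det (mat 1 + s *R E) - 1 - s * trace E = s\<^sup>2 * (m + s * det E)"
  unfolding det_3 m_def trace_def sum_3 by (simp add: mat_def power2_eq_square algebra_simps)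
 have "\<bar>s * det E\<bar> <= 1 * (3/4)" unfolding abs_mult using s d by (intro mult_mono) auto
 then have b: "\<bar>m + s * det E\<bar> <= 9/4" using m by linarith
 then show "\<bar>det (mat 1 + s *R E) - 1 - s * trace E\<bar> <= 4 * s\<^sup>2"
  using mult_left_mono[OF b, of "s\<^sup>2"] zero_le_power2[of s] unfolding eq abs_mult abs_power2 by linarith
 have "\<bar>trace E\<bar> <= 3/2" unfolding trace_def sum_3 using e[of 1 1] e[of 2 2] e[of 3 3] by linarith
 then have 1: "\<bar>s * trace E\<bar> <= \<bar>s\<bar> * (3/2)" unfolding abs_mult by (rule mult_left_mono) simp
 have "s\<^sup>2 <= \<bar>s\<bar>" using s by (metis abs_ge_zero mult_left_le power2_abs power2_eq_square)
 then have "\<bar>s\<^sup>2 * (m + s * det E)\<bar> <= \<bar>s\<bar> * (9/4)" unfolding abs_mult using b by (intro mult_mono) auto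
 then show "\<bar>det (mat 1 + s *R E) - 1\<bar> <= 4 * \<bar>s\<bar>" using eq 1 by linarith
qed

lemma matrix_mult_scaleR: "(M :: real^3^3) ** (s *R N) = s *R (M ** N)" "(s *R M) ** N = s *R (M ** N)"
 by (simp_all add: vec_eq_iff matrix_matrix_mult_def sum_distrib_left mult_ac)

lemma matrix_mult_add_right: "(M :: real^3^3) ** (N + P) = M ** N + M ** P"
 by (simp add: vec_eq_iff matrix_matrix_mult_def distrib_left sum.distrib)

lemma matrix_mult_diff_right: "(M :: real^3^3) ** (N - P) = M ** N - M ** P"
 by (simp add: vec_eq_iff matrix_matrix_mult_def right_diff_distrib sum_subtractf)

text \<open>Iterating R = 1 - s E R once leaves the remainder s^2 X E E R. As E has operator norm at
  most 1/2 and R at most 2, multiplication by E R does not increase the norm. The constant 4 matches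
  \<open>det_expansion\<close>, so that one k serves \<open>bilinear_expansion\<close>.\<close>

lemma inverse_expansion:
 fixes E X :: "real^3^3"
 assumes E: "norm E <= 1/2" and s: "\<bar>s\<bar> <= 1"
 defines "R \<equiv> matrix_inv (mat 1 + s *R E)"
 shows "norm (X ** R - X - s *R (- (X ** E))) <= 4 * s\<^sup>2 * norm X" and "norm (X ** R - X) <= 4 * \<bar>s\<bar> * norm X"
proof -
 have sE: "norm (s *R E) <= 1/2" using mult_mono[OF s E] by simp
 have Rb: "norm (R *v y) <= 2 * norm y" for y
  using perturbed_inverse_bound[OF sE, of y] by (simp add: R_def)
 have Eb: "norm (E *v y) <= 1/2 * norm y" for y
  using norm_matrix_vector_mult[of E y] mult_right_mono[OF E, of "norm y"] by simp
 have "(mat 1 + s *R E) ** R = mat 1" using matrix_inv_eq(1)[OF perturbed_invertible[OF sE]] by (simp add: R_def)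
 then have R: "R = mat 1 + (- s) *R (E ** R)"
  unfolding matrix_mult_add_left matrix_mul_lid matrix_mult_scaleR by (simp add: algebra_simps)
 have XR: "Y ** R = Y + (- s) *R (Y ** E ** R)" for Y :: "real^3^3"
 proof -
  have "Y ** R = Y ** (mat 1 + (- s) *R (E ** R))" by (rule arg_cong[OF R])
  also have "\<dots> = Y + (- s) *R (Y ** E ** R)"
   by (simp only: matrix_mult_add_right matrix_mult_scaleR matrix_mul_rid matrix_mul_assoc)
  finally show ?thesis .
 qed
 have n: "norm (Y ** E ** R) <= norm Y" for Y :: "real^3^3"
  using norm_matrix_mult_le[OF Rb, of "Y ** E"] norm_matrix_mult_le[OF Eb, of Y] by simp
 have "X ** R - X = - s *R (X ** E ** R)" using XR[of X] by simp
 then have "norm (X ** R - X) <= \<bar>s\<bar> * norm X" using n[of X] by (simp add: mult_left_mono)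
 also have "\<dots> <= 4 * \<bar>s\<bar> * norm X" by (simp add: mult_right_mono)
 finally show "norm (X ** R - X) <= 4 * \<bar>s\<bar> * norm X" .
 have "X ** R - X - s *R (- (X ** E)) = s\<^sup>2 *R (X ** E ** E ** R)"
  using XR[of X] XR[of "X ** E"] by (simp add: algebra_simps power2_eq_square)
 moreover have "norm (X ** E ** E ** R) <= 4 * norm X"
 proof -
  have "norm (X ** E) <= norm X * (1/2)" by (rule norm_matrix_mult_le[OF Eb]) simp
  then show ?thesis using n[of "X ** E"] norm_ge_zero[of X] by linarith
 qed
 ultimately show "norm (X ** R - X - s *R (- (X ** E))) <= 4 * s\<^sup>2 * norm X"
  by (simp add: mult.commute[of _ "norm X"] mult.left_commute[of 4] mult_left_mono) (metis mult.commute mult.left_commute mult_left_mono zero_le_power2)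
qed

text \<open>First-order expansion of a product of three factors. Each of the five remainder terms
  contains either the second-order remainder of one factor or two first-order increments;
  \<open>M\<close> bounds this sum and that of the first estimate alike.\<close>

lemma bilinear_expansion:
 fixes X Y X' Y' X1 Y1 :: "'a::real_inner"
 assumes C: "linear C" "\<And>U. norm (C U) <= K * norm U" "0 <= K" and k: "0 <= k" and s: "\<bar>s\<bar> <= 1"
  and d: "\<bar>d - 1\<bar> <= k * \<bar>s\<bar>" "\<bar>d - 1 - s * d1\<bar> <= k * s\<^sup>2"
  and X: "norm (X' - X) <= k * \<bar>s\<bar> * norm X" "norm (X' - X - s *R X1) <= k * s\<^sup>2 * norm X"
  and Y: "norm (Y' - Y) <= k * \<bar>s\<bar> * norm Y" "norm (Y' - Y - s *R Y1) <= k * s\<^sup>2 * norm Y"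
 defines "M \<equiv> K * (4 * k + k * (2 + k) * (1 + k) + 2 * k\<^sup>2 * (2 + k))"
 shows "\<bar>d * (C X' \<bullet> Y') - C X \<bullet> Y\<bar> <= M * \<bar>s\<bar> * (norm X * norm Y)"
  and "\<bar>d * (C X' \<bullet> Y') - C X \<bullet> Y - s * (d1 * (C X \<bullet> Y) + C X1 \<bullet> Y + C X \<bullet> Y1)\<bar> <= M * s\<^sup>2 * (norm X * norm Y)"
proof -
 interpret C: linear C by fact
 let ?b = "K * (norm X * norm Y)"
 have b0: "?b >= 0" using C by simp
 have prod: "\<bar>C U \<bullet> W\<bar> <= p * q * ?b" if U: "norm U <= p * norm X" and W: "norm W <= q * norm Y" for U W p q
 proof -
  have "0 <= p * norm X" "0 <= q * norm Y" using norm_ge_zero order_trans U W by blast+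
  have "\<bar>C U \<bullet> W\<bar> <= norm (C U) * norm W" by (rule Cauchy_Schwarz_ineq2)
  also have "\<dots> <= (K * (p * norm X)) * (q * norm Y)"
   using C(2)[of U] mult_left_mono[OF U C(3)] W C(3) \<open>0 <= p * norm X\<close> by (intro mult_mono) auto
  finally show ?thesis by (simp add: mult_ac)
 qed
 have s2: "s\<^sup>2 = \<bar>s\<bar> * \<bar>s\<bar>" by (simp add: power2_eq_square)
 have ks: "k * \<bar>s\<bar> <= k" using mult_left_mono[OF s k] by simp
 have Y'b: "norm Y' <= (1 + k) * norm Y"
 proof -
  have "norm Y' <= norm Y + norm (Y' - Y)" using norm_triangle_ineq[of Y "Y' - Y"] by simp
  also have "norm (Y' - Y) <= k * norm Y" using Y(1) mult_right_mono[OF ks, of "norm Y"] by simp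
  finally show ?thesis by (simp add: algebra_simps)
 qed
 define P where "P = C X' \<bullet> Y' - C X \<bullet> Y"
 have Peq: "P = C (X' - X) \<bullet> Y' + C X \<bullet> (Y' - Y)" unfolding P_def C.diff by (simp add: inner_diff_left inner_diff_right)
 have P: "\<bar>P\<bar> <= (k * (2 + k)) * \<bar>s\<bar> * ?b"
 proof -
  have "\<bar>P\<bar> <= k * \<bar>s\<bar> * (1 + k) * ?b + 1 * (k * \<bar>s\<bar>) * ?b"
   unfolding Peq using prod[OF X(1) Y'b] prod[of X 1 "Y' - Y", OF _ Y(1)] by simp
  then show ?thesis by (simp add: algebra_simps)
 qed
 have B: "\<bar>C X \<bullet> Y\<bar> <= ?b" using prod[of X 1 Y 1] by simp
 have dk: "\<bar>d\<bar> <= 1 + k" using d(1) ks by linarith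
 have "d * (C X' \<bullet> Y') - C X \<bullet> Y = (d - 1) * (C X \<bullet> Y) + d * P" unfolding P_def by (simp add: algebra_simps)
 moreover have "\<bar>(d - 1) * (C X \<bullet> Y)\<bar> <= k * \<bar>s\<bar> * ?b" unfolding abs_mult using d(1) B k by (intro mult_mono) auto
 moreover have "\<bar>d * P\<bar> <= (1 + k) * ((k * (2 + k)) * \<bar>s\<bar> * ?b)" unfolding abs_mult using dk P k by (intro mult_mono) auto
 ultimately have "\<bar>d * (C X' \<bullet> Y') - C X \<bullet> Y\<bar> <= k * \<bar>s\<bar> * ?b + (1 + k) * ((k * (2 + k)) * \<bar>s\<bar> * ?b)" by linarith
 also have "\<dots> = (k + (1 + k) * (k * (2 + k))) * (\<bar>s\<bar> * ?b)" by (simp add: algebra_simps)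
 also have "\<dots> <= (4 * k + k * (2 + k) * (1 + k) + 2 * k\<^sup>2 * (2 + k)) * (\<bar>s\<bar> * ?b)"
  using k b0 by (intro mult_right_mono mult_nonneg_nonneg[OF abs_ge_zero b0]) (simp add: algebra_simps)
 finally show "\<bar>d * (C X' \<bullet> Y') - C X \<bullet> Y\<bar> <= M * \<bar>s\<bar> * (norm X * norm Y)" by (simp add: M_def mult_ac)
 have eq: "d * (C X' \<bullet> Y') - C X \<bullet> Y - s * (d1 * (C X \<bullet> Y) + C X1 \<bullet> Y + C X \<bullet> Y1)
  = (d - 1 - s * d1) * (C X \<bullet> Y) + C (X' - X - s *R X1) \<bullet> Y + C X \<bullet> (Y' - Y - s *R Y1) + C (X' - X) \<bullet> (Y' - Y) + (d - 1) * P"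
  unfolding P_def C.diff C.scaleR by (simp add: inner_diff_left inner_diff_right algebra_simps)
 have 1: "\<bar>(d - 1 - s * d1) * (C X \<bullet> Y)\<bar> <= k * s\<^sup>2 * ?b" unfolding abs_mult using d(2) B k by (intro mult_mono) auto
 have 2: "\<bar>C (X' - X - s *R X1) \<bullet> Y\<bar> <= k * s\<^sup>2 * 1 * ?b" by (rule prod[OF X(2)]) simp
 have 3: "\<bar>C X \<bullet> (Y' - Y - s *R Y1)\<bar> <= 1 * (k * s\<^sup>2) * ?b" by (rule prod[OF _ Y(2)]) simp
 have 4: "\<bar>C (X' - X) \<bullet> (Y' - Y)\<bar> <= k * \<bar>s\<bar> * (k * \<bar>s\<bar>) * ?b" by (rule prod[OF X(1) Y(1)])
 have 5: "\<bar>(d - 1) * P\<bar> <= k * \<bar>s\<bar> * ((k * (2 + k)) * \<bar>s\<bar> * ?b)" unfolding abs_mult using d(1) P k by (intro mult_mono) auto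
 have "\<bar>d * (C X' \<bullet> Y') - C X \<bullet> Y - s * (d1 * (C X \<bullet> Y) + C X1 \<bullet> Y + C X \<bullet> Y1)\<bar>
   <= k * s\<^sup>2 * ?b + k * s\<^sup>2 * 1 * ?b + 1 * (k * s\<^sup>2) * ?b + k * \<bar>s\<bar> * (k * \<bar>s\<bar>) * ?b + k * \<bar>s\<bar> * ((k * (2 + k)) * \<bar>s\<bar> * ?b)"
  unfolding eq by (intro order_trans[OF abs_triangle_ineq] add_mono 1 2 3 4 5)
 also have "\<dots> = (3 * k + k\<^sup>2 + k\<^sup>2 * (2 + k)) * (s\<^sup>2 * ?b)" unfolding s2 by (simp add: power2_eq_square[of k] algebra_simps)
 also have "\<dots> <= (4 * k + k * (2 + k) * (1 + k) + 2 * k\<^sup>2 * (2 + k)) * (s\<^sup>2 * ?b)"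
  using k b0 by (intro mult_right_mono mult_nonneg_nonneg[OF zero_le_power2 b0]) (simp add: algebra_simps power2_eq_square)
 finally show "\<bar>d * (C X' \<bullet> Y') - C X \<bullet> Y - s * (d1 * (C X \<bullet> Y) + C X1 \<bullet> Y + C X \<bullet> Y1)\<bar> <= M * s\<^sup>2 * (norm X * norm Y)"
  by (simp add: M_def mult_ac)
qed

definition L2_norm :: "(real^3 => 'b::euclidean_space) => real" where
 "L2_norm f = sqrt (LBINT x. (norm (f x))\<^sup>2)"

lemma L2_norm_nonneg [simp]: "0 <= L2_norm f" by (simp add: L2_norm_def)

lemma L2_norm_square: "(L2_norm f)\<^sup>2 = (LBINT x. (norm (f x))\<^sup>2)" by (simp add: L2_norm_def)

lemma integral_bilinear_bound:
 fixes G H :: "real^3 => 'b::euclidean_space"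
 assumes G: "L2 G" and H: "L2 H" and f: "f Borel"
  and b: "\<And>x. \<bar>f x\<bar> <= M * (norm (G x) * norm (H x))" and M: "M >= 0"
 shows "L1 f" and "\<bar>LBINT x. f x\<bar> <= M * (L2_norm G * L2_norm H)"
proof -
 have i: "L1 (\<lambda>x. M * (norm (G x) * norm (H x)))" using integrable_norm_mult_L2[OF G H] by simp
 show f': "L1 f"
  by (rule Bochner_Integration.integrable_bound[OF i]) (use f b M in \<open>auto simp: abs_mult\<close>)
 have "\<bar>LBINT x. f x\<bar> <= (LBINT x. \<bar>f x\<bar>)" by (rule integral_abs_bound)
 also have "\<dots> <= (LBINT x. M * (norm (G x) * norm (H x)))" using f' i b by (intro integral_mono) auto
 also have "\<dots> = M * (LBINT x. norm (G x) * norm (H x))" by simp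
 also have "\<dots> <= M * (L2_norm G * L2_norm H)"
  unfolding L2_norm_def using M by (intro mult_left_mono L2_Cauchy_Schwarz_norm G H)
 finally show "\<bar>LBINT x. f x\<bar> <= M * (L2_norm G * L2_norm H)" .
qed

locale pulled_back_energy =
 fixes li mi le me \<alpha> \<gamma> :: real and D :: "(real^3) set" and E :: "real^3 => real^3^3"
 assumes lame: "lame_admissible \<alpha> \<gamma> li mi" "lame_admissible \<alpha> \<gamma> le me" "\<alpha> > 0" "\<gamma> > 0"
  and D: "D \<in> sets borel" and E [measurable]: "E Borel" and Eb: "\<And>x. norm (E x) <= 1/2"
begin

definition "C x = inclusion_tensor li mi le me D x"
definition "R s x = matrix_inv (mat 1 + s *R E x)"
text \<open>The energy density at time t + s in the coordinates of time t: X R is the gradient of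
  the original function if X is that of its pullback, and the determinant is the volume factor. It
  carries no absolute value, being nonnegative for |s| <= 1/4.\<close>

definition "q s x X Y = det (mat 1 + s *R E x) * (C x (X ** R s x) \<bullet> (Y ** R s x))"
text \<open>The integrand of the final formula, with E for the Jacobian matrix of U o
  \<Phi>_t^-1.\<close>

definition "\<beta> x X Y = (C x X ** (trace (E x) *R mat 1 - transpose (E x)) - C x (X ** E x)) \<bullet> Y"
definition "Q s G H = (LBINT x. q s x (G x) (H x))"

lemma C_linear: "linear (C x)"
 unfolding C_def inclusion_tensor_def by (simp add: linear_elasticity_tensor)

lemma C_symmetric: "C x A \<bullet> B = C x B \<bullet> A"
 by (simp add: C_def inclusion_tensor_def elasticity_tensor_symmetric)

lemma C_coercive: "C x A \<bullet> A >= 2 * \<alpha> * (norm (sym_part A))\<^sup>2"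
 using elasticity_tensor_coercive[OF lame(1,3,4)] elasticity_tensor_coercive[OF lame(2,3,4)] by (simp add: C_def inclusion_tensor_def)

lemma C_bound: "\<exists>K\<ge>0. \<forall>x A. norm (C x A) <= K * norm A"
proof -
 obtain K1 where K1: "\<And>A. norm (elasticity_tensor li mi A) <= K1 * norm A" using linear_bounded[OF linear_elasticity_tensor[of li mi]] by blast
 obtain K2 where K2: "\<And>A. norm (elasticity_tensor le me A) <= K2 * norm A" using linear_bounded[OF linear_elasticity_tensor[of le me]] by blast
 have "norm (C x A) <= max 0 (max K1 K2) * norm A" for x A
 proof (cases "x \<in> D")
  case True
  have "norm (C x A) <= K1 * norm A" using K1 True by (simp add: C_def inclusion_tensor_def)
  also have "\<dots> <= max 0 (max K1 K2) * norm A" by (rule mult_right_mono) auto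
  finally show ?thesis .
 next
  case False
  have "norm (C x A) <= K2 * norm A" using K2 False by (simp add: C_def inclusion_tensor_def)
  also have "\<dots> <= max 0 (max K1 K2) * norm A" by (rule mult_right_mono) auto
  finally show ?thesis .
 qed
 then show ?thesis by (intro exI[of _ "max 0 (max K1 K2)"]) auto
qed

lemma C_measurable [measurable (raw)]:
 assumes [measurable]: "G Borel"
 shows "(\<lambda>x. C x (G x)) Borel"
proof -
 have [measurable]: "D \<in> sets borel" by (rule D)
 have m: "elasticity_tensor l m' Borel" for l m'
  by (intro borel_measurable_continuous_onI linear_continuous_on) (simp add: linear_elasticity_tensor linear_conv_bounded_linear[symmetric])
 have [measurable]: "(\<lambda>x. elasticity_tensor l m' (G x)) Borel" for l m'
  by (rule measurable_compose[OF _ m]) measurable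
 have "(\<lambda>x. C x (G x)) = (\<lambda>x. if x \<in> D then elasticity_tensor li mi (G x) else elasticity_tensor le me (G x))"
  by (auto simp: C_def inclusion_tensor_def)
 then show ?thesis by simp
qed

lemma sE:
 assumes "\<bar>s\<bar> <= 1"
 shows "norm (s *R E x) <= 1/2"
 using mult_mono[OF assms Eb[of x]] by simp

lemma R_measurable: "\<bar>s\<bar> <= 1 ==> R s Borel"
 unfolding R_def[abs_def] by (intro borel_measurable_matrix_inv_perturbed[where c="1/2"] sE) auto

lemma q_measurable:
 assumes "\<bar>s\<bar> <= 1" and [measurable]: "G Borel" "H Borel"
 shows "(\<lambda>x. q s x (G x) (H x)) Borel"
proof -
 have [measurable]: "R s Borel" by (rule R_measurable[OF assms(1)])
 show ?thesis unfolding q_def by measurable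
qed

text \<open>This form shows \<beta> as the derivative of q at s = 0: the three summands come from
  the determinant, from X R and from Y R, whose derivatives there are tr E, - X E and - Y E.\<close>

lemma \<beta>_eq: "\<beta> x X Y = trace (E x) * (C x X \<bullet> Y) + C x (- (X ** E x)) \<bullet> Y + C x X \<bullet> (- (Y ** E x))"
proof -
 have "C x X ** (trace (E x) *R mat 1 - transpose (E x)) = trace (E x) *R C x X - C x X ** transpose (E x)"
  by (simp add: matrix_mult_diff_right matrix_mult_scaleR)
 then show ?thesis unfolding \<beta>_def linear_neg[OF C_linear]
  by (simp add: inner_diff_left inner_mult_transpose)
qed

lemma q_0: "q 0 x X Y = C x X \<bullet> Y"
proof -
 have "matrix_inv (mat 1 :: real^3^3) = mat 1" by (rule matrix_inv_unique) simp
 then show ?thesis by (simp add: q_def R_def)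
qed

lemma q_expansion:
 "\<exists>M\<ge>0. (\<forall>s x X Y. \<bar>s\<bar> <= 1 --> \<bar>q s x X Y - q 0 x X Y\<bar> <= M * \<bar>s\<bar> * (norm X * norm Y)
   \<and> \<bar>q s x X Y - q 0 x X Y - s * \<beta> x X Y\<bar> <= M * s\<^sup>2 * (norm X * norm Y))
  \<and> (\<forall>x X Y. \<bar>q 0 x X Y\<bar> <= M * (norm X * norm Y))"
proof -
 obtain K where K: "K >= 0" "\<And>x A. norm (C x A) <= K * norm A" using C_bound by blast
 define M where "M = K * (4 * 4 + 4 * (2 + 4) * (1 + 4) + 2 * 4\<^sup>2 * (2 + 4 :: real))"
 have "M >= 0" "K <= M" unfolding M_def using K(1) by simp_all
 moreover have "\<bar>q s x X Y - q 0 x X Y\<bar> <= M * \<bar>s\<bar> * (norm X * norm Y)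
   \<and> \<bar>q s x X Y - q 0 x X Y - s * \<beta> x X Y\<bar> <= M * s\<^sup>2 * (norm X * norm Y)" if s: "\<bar>s\<bar> <= 1" for s x X Y
  unfolding q_0 unfolding \<beta>_eq q_def R_def M_def
  using bilinear_expansion[where X=X and Y=Y, OF C_linear[of x] K(2)[of x] K(1) _ s det_expansion(2,1)[OF Eb[of x] s] inverse_expansion(2,1)[OF Eb[of x] s] inverse_expansion(2,1)[OF Eb[of x] s]]
  by simp
 moreover have "\<bar>q 0 x X Y\<bar> <= M * (norm X * norm Y)" for x X Y
 proof -
  have "\<bar>q 0 x X Y\<bar> <= norm (C x X) * norm Y" unfolding q_0 by (rule Cauchy_Schwarz_ineq2)
  also have "\<dots> <= (M * norm X) * norm Y" using K(2)[of x X] mult_right_mono[OF \<open>K <= M\<close>, of "norm X"] by (intro mult_right_mono) auto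
  finally show ?thesis by simp
 qed
 ultimately show ?thesis by blast
qed

lemma q_integrable:
 assumes s: "\<bar>s\<bar> <= 1" and G: "L2 G" and H: "L2 H"
 shows "L1 (\<lambda>x. q s x (G x) (H x))"
proof -
 obtain M where M: "M >= 0" "\<And>s x X Y. \<bar>s\<bar> <= 1 ==> \<bar>q s x X Y - q 0 x X Y\<bar> <= M * \<bar>s\<bar> * (norm X * norm Y)"
   "\<And>x X Y. \<bar>q 0 x X Y\<bar> <= M * (norm X * norm Y)" using q_expansion by blast
 have "\<bar>q s x X Y\<bar> <= (2 * M) * (norm X * norm Y)" for x X Y
 proof -
  have "M * \<bar>s\<bar> * (norm X * norm Y) <= M * 1 * (norm X * norm Y)" using s M(1) by (intro mult_right_mono mult_left_mono) auto
  then show ?thesis using M(2)[OF s, of x X Y] M(3)[of x X Y] by (simp add: algebra_simps)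
 qed
 then show ?thesis using G H M(1) s
  by (intro integral_bilinear_bound(1)[OF G H _ _, of _ "2 * M"] q_measurable) (auto simp: square_integrable_def)
qed

lemma q_add_left: "q s x (X + X') Y = q s x X Y + q s x X' Y"
 by (simp add: q_def matrix_mult_add_left linear_add[OF C_linear] inner_add_left distrib_left)

lemma q_add_right: "q s x X (Y + Y') = q s x X Y + q s x X Y'"
 by (simp add: q_def matrix_mult_add_left inner_add_right distrib_left)

lemma Q_add:
 assumes "\<bar>s\<bar> <= 1" "L2 G" "L2 G'" "L2 H"
 shows "Q s (\<lambda>x. G x + G' x) H = Q s G H + Q s G' H" "Q s H (\<lambda>x. G x + G' x) = Q s H G + Q s H G'"
 using assms by (simp_all add: Q_def q_add_left q_add_right q_integrable)

lemma Q_0_symmetric: "Q 0 G H = Q 0 H G"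
 unfolding Q_def q_0 by (subst C_symmetric) simp

text \<open>The factor 2 in the coercivity of the tensor makes up for the constant 2 of
  \<open>Korn\<close>.\<close>

lemma Q_0_coercive:
 assumes Z: "null_gradient \<Omega> Z"
 shows "\<alpha> * (L2_norm Z)\<^sup>2 <= Q 0 Z Z"
proof -
 have sq: "L2 Z" using Z by (simp add: null_gradient_def)
 have ss: "L2 (\<lambda>x. sym_part (Z x))"
 proof (rule L2_bound[OF sq, of _ 1])
  have "continuous_on UNIV sym_part" unfolding sym_part_def[abs_def] transpose_def by (intro continuous_intros)
  from measurable_compose[OF L2_measurable[OF sq] borel_measurable_continuous_onI[OF this]]
  show "(\<lambda>x. sym_part (Z x)) \<in> borel_measurable lborel" .
 qed (simp add: norm_sym_part_le)
 have "\<alpha> * (L2_norm Z)\<^sup>2 <= \<alpha> * (2 * (LBINT x. (norm (sym_part (Z x)))\<^sup>2))"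
  unfolding L2_norm_square using Korn[OF Z] lame(3) by (intro mult_left_mono) auto
 also have "\<dots> = (LBINT x. 2 * \<alpha> * (norm (sym_part (Z x)))\<^sup>2)" by simp
 also have "\<dots> <= Q 0 Z Z" unfolding Q_def
  using ss q_integrable[of 0, OF _ sq sq] C_coercive
  by (intro integral_mono) (auto simp: q_0 square_integrable_def)
 finally show ?thesis .
qed

lemma \<beta>_measurable:
 assumes [measurable]: "G Borel" "H Borel"
 shows "(\<lambda>x. \<beta> x (G x) (H x)) Borel"
proof -
 have [measurable]: "(\<lambda>x. trace (E x)) Borel"
 proof -
  have "continuous_on UNIV (trace :: real^3^3 => real)" unfolding trace_def[abs_def] by (intro continuous_intros)
  from measurable_compose[OF E borel_measurable_continuous_onI[OF this]] show ?thesis .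
 qed
 show ?thesis unfolding \<beta>_eq by measurable
qed

lemma energy_bounds:
 "\<exists>M\<ge>0. \<forall>s G H. \<bar>s\<bar> <= 1 \<and> L2 G \<and> L2 H -->
   \<bar>Q s G H - Q 0 G H\<bar> <= M * \<bar>s\<bar> * (L2_norm G * L2_norm H) \<and>
   \<bar>Q s G H - Q 0 G H - s * (LBINT x. \<beta> x (G x) (H x))\<bar> <= M * s\<^sup>2 * (L2_norm G * L2_norm H)"
proof -
 obtain M where M: "M >= 0" "\<And>s x X Y. \<bar>s\<bar> <= 1 ==> \<bar>q s x X Y - q 0 x X Y\<bar> <= M * \<bar>s\<bar> * (norm X * norm Y)"
   "\<And>s x X Y. \<bar>s\<bar> <= 1 ==> \<bar>q s x X Y - q 0 x X Y - s * \<beta> x X Y\<bar> <= M * s\<^sup>2 * (norm X * norm Y)" using q_expansion by blast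
 have "\<bar>Q s G H - Q 0 G H\<bar> <= M * \<bar>s\<bar> * (L2_norm G * L2_norm H) \<and>
   \<bar>Q s G H - Q 0 G H - s * (LBINT x. \<beta> x (G x) (H x))\<bar> <= M * s\<^sup>2 * (L2_norm G * L2_norm H)"
  if s: "\<bar>s\<bar> <= 1" and G: "L2 G" and H: "L2 H" for s G H
 proof -
  have [measurable]: "G Borel" "H Borel" using G H by (auto simp: square_integrable_def)
  have m [measurable]: "(\<lambda>x. q s x (G x) (H x)) Borel" "(\<lambda>x. q 0 x (G x) (H x)) Borel"
   using s by (auto intro!: q_measurable)
  have [measurable]: "(\<lambda>x. \<beta> x (G x) (H x)) Borel" by (rule \<beta>_measurable) measurable
  have i: "L1 (\<lambda>x. q s x (G x) (H x))" "L1 (\<lambda>x. q 0 x (G x) (H x))"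
   using q_integrable[OF _ G H] s by auto
  let ?f = "\<lambda>x. q s x (G x) (H x) - q 0 x (G x) (H x)"
  have 1: "\<bar>LBINT x. ?f x\<bar> <= M * \<bar>s\<bar> * (L2_norm G * L2_norm H)"
   using M(1,2) s by (intro integral_bilinear_bound(2)[OF G H]) auto
  have m2: "(\<lambda>x. ?f x - s * \<beta> x (G x) (H x)) Borel" by measurable
  have i2: "L1 (\<lambda>x. ?f x - s * \<beta> x (G x) (H x))"
   using M(1,3) s by (intro integral_bilinear_bound(1)[OF G H m2, of "M * s\<^sup>2"]) auto
  have 2: "\<bar>LBINT x. ?f x - s * \<beta> x (G x) (H x)\<bar> <= M * s\<^sup>2 * (L2_norm G * L2_norm H)"
   using M(1,3) s by (intro integral_bilinear_bound(2)[OF G H m2, of "M * s\<^sup>2"]) auto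
  have i3: "L1 (\<lambda>x. s * \<beta> x (G x) (H x))"
   using Bochner_Integration.integrable_diff[OF Bochner_Integration.integrable_diff[OF i] i2] by simp
  have "(LBINT x. ?f x - s * \<beta> x (G x) (H x)) = Q s G H - Q 0 G H - s * (LBINT x. \<beta> x (G x) (H x))"
   unfolding Q_def using i i3 by (simp add: Bochner_Integration.integral_diff)
  then show ?thesis using 1 2 i by (simp add: Q_def)
 qed
 then show ?thesis using M(1) by blast
qed

text \<open>\<open>F s - F 0\<close> equals \<open>Q s (Gs s) H - Q 0 (Gs s) H\<close> because both fields minimise the energy, and coercivity
  makes \<open>Gs s - G\<close> of order \<open>s\<close>; no derivative of \<open>Gs\<close> is needed.\<close>

theorem energy_derivative:
 assumes G: "L2 G" and H: "L2 H"
  and oG: "\<And>Z. null_gradient \<Omega> Z ==> Q 0 G Z = 0" and oH: "\<And>Z. null_gradient \<Omega> Z ==> Q 0 H Z = 0"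
  and \<epsilon>: "\<epsilon> > 0"
  and Gs: "\<And>s. s \<in> S ==> \<bar>s\<bar> <= \<epsilon> ==> null_gradient \<Omega> (\<lambda>x. Gs s x - G x)"
  and Hs: "\<And>s. s \<in> S ==> \<bar>s\<bar> <= \<epsilon> ==> null_gradient \<Omega> (\<lambda>x. Hs s x - H x)"
  and oGs: "\<And>s Z. s \<in> S ==> \<bar>s\<bar> <= \<epsilon> ==> null_gradient \<Omega> Z ==> Q s (Gs s) Z = 0"
  and F: "\<And>s. s \<in> S ==> \<bar>s\<bar> <= \<epsilon> ==> F s = Q s (Gs s) (Hs s)" and F0: "F 0 = Q 0 G H"
 shows "(F has_real_derivative (LBINT x. \<beta> x (G x) (H x))) (at 0 within S)"
proof -
 let ?L = "LBINT x. \<beta> x (G x) (H x)"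
 obtain M where M: "M >= 0" "\<And>s G H. \<bar>s\<bar> <= 1 ==> L2 G ==> L2 H ==>
   \<bar>Q s G H - Q 0 G H\<bar> <= M * \<bar>s\<bar> * (L2_norm G * L2_norm H)"
   "\<And>s G H. \<bar>s\<bar> <= 1 ==> L2 G ==> L2 H ==>
   \<bar>Q s G H - Q 0 G H - s * (LBINT x. \<beta> x (G x) (H x))\<bar> <= M * s\<^sup>2 * (L2_norm G * L2_norm H)"
  using energy_bounds by blast
 \<comment> \<open>\<alpha> / (2 M + 1) makes M |s| at most \<alpha> / 2, so the term quadratic in Z
   is absorbed by coercivity; the 1 prevents division by 0.\<close>
 define e where "e = min \<epsilon> (min 1 (\<alpha> / (2 * M + 1)))"
 have e0: "e > 0" using \<epsilon> lame(3) M(1) by (simp add: e_def)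
 define N where "N = (M + M * (2 * M / \<alpha>)) * (L2_norm G * L2_norm H)"
 have est: "\<bar>F s - F 0 - s * ?L\<bar> <= N * s\<^sup>2" if sS: "s \<in> S" and se: "\<bar>s\<bar> <= e" for s
 proof -
  have s: "\<bar>s\<bar> <= \<epsilon>" "\<bar>s\<bar> <= 1" "\<bar>s\<bar> <= \<alpha> / (2 * M + 1)" using se by (auto simp: e_def)
  have "\<bar>s\<bar> * (2 * M + 1) <= \<alpha>" using s(3) M(1) by (simp add: pos_le_divide_eq)
  then have Ms: "M * \<bar>s\<bar> <= \<alpha> / 2" by (simp add: algebra_simps)
  define Z where "Z = (\<lambda>x. Gs s x - G x)"
  have Z: "null_gradient \<Omega> Z" using Gs[OF sS s(1)] by (simp add: Z_def)
  have sqZ: "L2 Z" using Z by (simp add: null_gradient_def)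
  define W where "W = (\<lambda>x. Hs s x - H x)"
  have W: "null_gradient \<Omega> W" using Hs[OF sS s(1)] by (simp add: W_def)
  have sqW: "L2 W" using W by (simp add: null_gradient_def)
  have GZ: "Gs s = (\<lambda>x. G x + Z x)" and HW: "Hs s = (\<lambda>x. H x + W x)" by (auto simp: Z_def W_def)
  have sqGs: "L2 (Gs s)" unfolding GZ by (rule L2_add[OF G sqZ])
  let ?z = "L2_norm Z"
  have "\<alpha> * ?z\<^sup>2 <= Q 0 Z Z" by (rule Q_0_coercive[OF Z])
  \<comment> \<open>The orthogonality relations \<open>Q 0 G Z = 0\<close> and
    \<open>Q s (Gs s) Z = 0\<close> are inserted as zeros. What remains are differences of Q s and Q
    0, which are of order s.\<close>
  also have "Q 0 Z Z = Q 0 G Z + Q 0 Z Z - (Q s G Z + Q s Z Z)"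
   using oG[OF Z] oGs[OF sS s(1) Z] Q_add(1)[OF s(2) G sqZ sqZ] by (simp add: GZ)
  also have "\<dots> <= M * \<bar>s\<bar> * (L2_norm G * ?z) + M * \<bar>s\<bar> * (?z * ?z)"
   using M(2)[OF s(2) G sqZ] M(2)[OF s(2) sqZ sqZ] by linarith
  also have "M * \<bar>s\<bar> * (?z * ?z) <= \<alpha> / 2 * (?z * ?z)" using Ms by (intro mult_right_mono) auto
  finally have "\<alpha> / 2 * (?z * ?z) <= M * \<bar>s\<bar> * L2_norm G * ?z" by (simp add: power2_eq_square algebra_simps)
  then have "(\<alpha> / 2 * ?z) * ?z <= (M * \<bar>s\<bar> * L2_norm G) * ?z" by (simp add: mult_ac)
  then have "?z = 0 \<or> \<alpha> / 2 * ?z <= M * \<bar>s\<bar> * L2_norm G"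
   using mult_right_le_imp_le L2_norm_nonneg[of Z] by (metis less_eq_real_def)
  then have "\<alpha> / 2 * ?z <= M * \<bar>s\<bar> * L2_norm G" using M(1) by auto
  then have z: "?z <= (2 * M / \<alpha>) * \<bar>s\<bar> * L2_norm G" using lame(3) by (simp add: field_simps)
  \<comment> \<open>\<open>Hs s\<close> may be replaced by H since the difference is a null
    gradient.\<close>
  have "F s = Q s (Gs s) H"
   using F[OF sS s(1)] Q_add(2)[OF s(2) H sqW sqGs] oGs[OF sS s(1) W] by (simp add: HW)
  then have Fs: "F s = Q s G H + Q s Z H" using Q_add(1)[OF s(2) G sqZ H] by (simp add: GZ)
  \<comment> \<open>By symmetry the equation for H annihilates the first-order effect of Z.\<close>
  have QZ: "Q 0 Z H = 0" using oH[OF Z] Q_0_symmetric by simp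
  have "F s - F 0 - s * ?L = (Q s G H - Q 0 G H - s * ?L) + (Q s Z H - Q 0 Z H)" using Fs QZ F0 by simp
  then have "\<bar>F s - F 0 - s * ?L\<bar> <= M * s\<^sup>2 * (L2_norm G * L2_norm H) + M * \<bar>s\<bar> * (?z * L2_norm H)"
   using M(3)[OF s(2) G H] M(2)[OF s(2) sqZ H] by linarith
  also have "M * \<bar>s\<bar> * (?z * L2_norm H) <= M * \<bar>s\<bar> * (((2 * M / \<alpha>) * \<bar>s\<bar> * L2_norm G) * L2_norm H)"
   using z M(1) by (intro mult_left_mono mult_right_mono) auto
  also have "\<dots> = M * (2 * M / \<alpha>) * (L2_norm G * L2_norm H) * s\<^sup>2" using abs_mult_self_eq[of s] by (simp add: power2_eq_square mult_ac)
  finally show ?thesis by (simp add: N_def algebra_simps)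
 qed
 have "((\<lambda>s. (F s - F 0) / (s - 0) - ?L) \<longlongrightarrow> 0) (at 0 within S)"
 proof (rule Lim_null_comparison[where g="\<lambda>s. N * \<bar>s\<bar>"])
  show "\<forall>\<^sub>F s in at 0 within S. norm ((F s - F 0) / (s - 0) - ?L) <= N * \<bar>s\<bar>"
   unfolding eventually_at
  proof (intro exI[of _ e] conjI ballI impI e0)
   fix s assume "s \<in> S" and s: "s \<noteq> 0 \<and> dist s 0 < e"
   then have "\<bar>F s - F 0 - s * ?L\<bar> <= N * s\<^sup>2" by (intro est) auto
   then have "\<bar>F s - F 0 - s * ?L\<bar> / \<bar>s\<bar> <= N * s\<^sup>2 / \<bar>s\<bar>" by (rule divide_right_mono) simp
   moreover have "(F s - F 0) / (s - 0) - ?L = (F s - F 0 - s * ?L) / s" using s by (simp add: diff_divide_distrib)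
   moreover have "N * s\<^sup>2 / \<bar>s\<bar> = N * \<bar>s\<bar>" using s by (simp add: power2_eq_square abs_if)
   ultimately show "norm ((F s - F 0) / (s - 0) - ?L) <= N * \<bar>s\<bar>" by (simp add: abs_divide)
  qed
  have "((\<lambda>s. N * \<bar>s\<bar>) \<longlongrightarrow> N * \<bar>0\<bar>) (at 0 within S)" by (intro tendsto_intros)
  then show "((\<lambda>s. N * \<bar>s\<bar>) \<longlongrightarrow> 0) (at 0 within S)" by simp
 qed
 then show ?thesis unfolding has_field_derivative_iff by (rule Lim_null[THEN iffD2])
qed

end

subsection \<open>Sobolev functions and traces\<close>

lemma borel_measurable_lebesgue_AE:
 fixes f F :: "real^3 => 'b::topological_space"
 assumes F: "F Borel" and ae: "AE x in lborel. F x = f x"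
 shows "f \<in> borel_measurable lebesgue"
proof (rule measurableI)
 fix A :: "'b set" assume A: "A \<in> sets borel"
 have "F -` A \<in> sets borel" using measurable_sets[OF F A] by simp
 then have "F -` A \<in> sets lebesgue" by simp
 moreover have ae': "AE x in lebesgue. x \<in> F -` A \<longleftrightarrow> x \<in> f -` A" unfolding AE_completion_iff using ae by eventually_elim simp
 ultimately have "f -` A \<in> sets lebesgue" by (intro completion.in_sets_AE[OF ae']) simp_all
 then show "f -` A \<inter> space lebesgue \<in> sets lebesgue" by simp
qed simp

lemma borel_representative:
 fixes f :: "real^3 => 'b::euclidean_space"
 assumes f: "f \<in> borel_measurable lebesgue"
 shows "\<exists>F \<in> borel_measurable borel. AE x in lborel. F x = f x"
proof -
 have "\<exists>g. g \<in> borel_measurable lborel \<and> (AE x in lborel. f x \<bullet> b = g x)" for b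
 proof -
  have "(\<lambda>x. f x \<bullet> b) \<in> borel_measurable (completion lborel)" using f by measurable
  from completion_ex_borel_measurable_real[OF this] show ?thesis by auto
 qed
 then have "\<forall>b. \<exists>g. g \<in> borel_measurable lborel \<and> (AE x in lborel. f x \<bullet> b = g x)" by (rule allI)
 from choice[OF this] obtain g where g: "\<And>b. g b \<in> borel_measurable lborel" "\<And>b. AE x in lborel. f x \<bullet> b = g b x" by auto
 have [measurable]: "g b Borel" for b using g(1) by simp
 have "AE x in lborel. \<forall>b\<in>Basis. f x \<bullet> b = g b x" using g(2) by (intro AE_finite_allI) auto
 then have "AE x in lborel. (\<Sum>b\<in>Basis. g b x *R b) = f x"
 proof eventually_elim
  case (elim x)
  then have "(\<Sum>b\<in>Basis. g b x *R b) = (\<Sum>b\<in>Basis. (f x \<bullet> b) *R b)" by (intro sum.cong) auto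
  then show ?case by (simp add: euclidean_representation)
 qed
 moreover have "(\<lambda>x. \<Sum>b\<in>Basis. g b x *R b) Borel" by measurable
 ultimately show ?thesis by (intro bexI)
qed

text \<open>Solutions and their gradients are Lebesgue measurable on \<Omega> only. Borel
  representatives extended by 0 carry them over to \<open>lborel\<close> on the whole space, where
  translation and change of variables are available.\<close>

lemma borel_representative_on:
 fixes f :: "real^3 => 'b::euclidean_space"
 assumes f: "f \<in> borel_measurable (lebesgue_on \<Omega>)" and \<Omega> [measurable]: "\<Omega> \<in> sets borel"
 shows "\<exists>F. F Borel \<and> (\<forall>x. x \<notin> \<Omega> --> F x = 0) \<and> (AE x in lborel. x \<in> \<Omega> --> F x = f x)"
proof -
 have "(\<lambda>x. indicator \<Omega> x *R f x) \<in> borel_measurable lebesgue"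
  using f by (subst (asm) borel_measurable_restrict_space_iff) auto
 then obtain F where F [measurable]: "F Borel" "AE x in lborel. F x = indicator \<Omega> x *R f x"
  using borel_representative by blast
 have "AE x in lborel. x \<in> \<Omega> --> indicator \<Omega> x *R F x = f x" using F(2) by eventually_elim auto
 moreover have "(\<lambda>x. indicator \<Omega> x *R F x) Borel" by measurable
 ultimately show ?thesis by (intro exI[of _ "\<lambda>x. indicator \<Omega> x *R F x"]) auto
qed

lemma lebesgue_on_eq_lborel:
 fixes f F :: "real^3 => 'b::euclidean_space"
 assumes \<Omega>: "\<Omega> \<in> sets borel" and F: "F Borel" "\<And>x. x \<notin> \<Omega> ==> F x = 0"
  and ae: "AE x in lborel. x \<in> \<Omega> --> F x = f x"
 shows "(\<integral>x. f x \<partial>lebesgue_on \<Omega>) = (LBINT x. F x)" and "integrable (lebesgue_on \<Omega>) f \<longleftrightarrow> L1 F"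
  and "f \<in> borel_measurable (lebesgue_on \<Omega>)"
proof -
 have ae': "AE x in lborel. F x = indicator \<Omega> x *R f x" using ae by eventually_elim (use F(2) in \<open>auto simp: indicator_def\<close>)
 then have ae'': "AE x in lebesgue. indicator \<Omega> x *R f x = F x" unfolding AE_completion_iff by eventually_elim simp
 have m: "(\<lambda>x. indicator \<Omega> x *R f x) \<in> borel_measurable lebesgue" by (rule borel_measurable_lebesgue_AE[OF F(1) ae'])
 have mF: "F \<in> borel_measurable lebesgue" using F(1) by (simp add: measurable_completion)
 have s: "\<Omega> \<inter> space lebesgue \<in> sets lebesgue" using \<Omega> by simp
 show "(\<integral>x. f x \<partial>lebesgue_on \<Omega>) = (LBINT x. F x)"
  unfolding integral_restrict_space[OF s] integral_cong_AE[OF m mF ae''] using F(1) by (intro integral_completion) simp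
 show "integrable (lebesgue_on \<Omega>) f \<longleftrightarrow> L1 F"
  unfolding integrable_restrict_space[OF s] integrable_cong_AE[OF m mF ae''] using F(1) by (intro integrable_completion) simp
 show "f \<in> borel_measurable (lebesgue_on \<Omega>)" using m by (subst borel_measurable_restrict_space_iff[OF s])
qed

lemma nn_integral_lebesgue_on:
 "\<Omega> \<in> sets borel ==> (\<integral>\<^sup>+x. f x \<partial>lebesgue_on \<Omega>) = (NN x. f x * indicator \<Omega> x)"
 by (subst nn_integral_restrict_space) (auto simp: nn_integral_completion)

lemma AE_lebesgue_on_iff: "\<Omega> \<in> sets borel ==> (AE x in lebesgue_on \<Omega>. P x) \<longleftrightarrow> (AE x in lborel. x \<in> \<Omega> --> P x)"
 by (subst AE_restrict_space_iff) (auto simp: AE_completion_iff)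

text \<open>The definition grants integrability over compact subsets only, so \<Omega> is exhausted
  by an increasing sequence of these.\<close>

lemma weak_gradient_measurable:
 assumes G: "is_weak_gradient \<Omega> u G" and \<Omega>: "open \<Omega>"
 shows "G \<in> borel_measurable (lebesgue_on \<Omega>)"
proof -
 obtain K where K: "\<And>n. compact (K n)" "\<And>n. K n \<subseteq> \<Omega>" "\<And>n. K n \<subseteq> interior (K (Suc n))" "\<Union>(range K) = \<Omega>"
  using open_Union_compact_subsets[OF \<Omega>] by metis
 have mono: "K n \<subseteq> K (Suc n)" for n using K(3) interior_subset by blast
 have "(\<lambda>x. indicator \<Omega> x *R G x) \<in> borel_measurable lebesgue"
 proof (rule borel_measurable_LIMSEQ_metric)
  fix n
  have "integrable (lebesgue_on (K n)) G" using G K(1,2) by (simp add: is_weak_gradient_def)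
  then show "(\<lambda>x. indicator (K n) x *R G x) \<in> borel_measurable lebesgue"
   using K(1)[of n] by (subst (asm) integrable_restrict_space) (auto simp: borel_compact)
 next
  fix x
  show "(\<lambda>n. indicator (K n) x *R G x) ----> indicator \<Omega> x *R G x"
  proof (cases "x \<in> \<Omega>")
   case True
   then obtain N where N: "x \<in> K N" using K(4) by blast
   have "\<forall>\<^sub>F n in sequentially. indicator (K n) x *R G x = indicator \<Omega> x *R G x"
    using eventually_ge_at_top[of N]
   proof eventually_elim
    case (elim n)
    have "x \<in> K n" using lift_Suc_mono_le[of K, OF mono elim] N by blast
    then show ?case using True by simp
   qed
   then show ?thesis by (rule tendsto_eventually)
  next
   case False
   then have "x \<notin> K n" for n using K(2) by blast
   then show ?thesis using False by simp
  qed
 qed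
 then show ?thesis using \<Omega> by (subst borel_measurable_restrict_space_iff) auto
qed

text \<open>Justifies the choice inside \<open>weak_gradient\<close>: any explicitly known gradient
  may be substituted for it under the integral. Each entry of the difference is orthogonal to all
  test functions.\<close>

lemma weak_gradient_unique:
 assumes G: "is_weak_gradient \<Omega> u G" and G': "is_weak_gradient \<Omega> u G'" and \<Omega>: "open \<Omega>"
 shows "AE x in lborel. x \<in> \<Omega> --> G x = G' x"
proof -
 have \<Omega>b [measurable]: "\<Omega> \<in> sets borel" using \<Omega> by simp
 obtain F where F [measurable]: "F Borel" and F0: "\<And>x. x \<notin> \<Omega> ==> F x = 0" and Fa: "AE x in lborel. x \<in> \<Omega> --> F x = G x"
  using borel_representative_on[OF weak_gradient_measurable[OF G \<Omega>] \<Omega>b] by auto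
 obtain F' where F' [measurable]: "F' Borel" and F0': "\<And>x. x \<notin> \<Omega> ==> F' x = 0" and Fa': "AE x in lborel. x \<in> \<Omega> --> F' x = G' x"
  using borel_representative_on[OF weak_gradient_measurable[OF G' \<Omega>] \<Omega>b] by auto
 have loc: "L1 (\<lambda>x. indicator K x *R L x)"
  if "is_weak_gradient \<Omega> u M" "L Borel" "AE x in lborel. x \<in> \<Omega> --> L x = M x" "compact K" "K \<subseteq> \<Omega>" for L M K
 proof -
  have "integrable (lebesgue_on K) M" using that by (simp add: is_weak_gradient_def)
  moreover have "AE x in lborel. x \<in> K --> indicator K x *R L x = M x"
   using that(3) by eventually_elim (use that(5) in auto)
  moreover have "(\<lambda>x. indicator K x *R L x) Borel" using that(2,4) by (auto intro!: borel_measurable_scaleR borel_measurable_indicator borel_compact)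
  ultimately show ?thesis using that(4) by (subst lebesgue_on_eq_lborel(2)[symmetric, where \<Omega>=K and f=M]) (auto simp: borel_compact)
 qed
 have orth: "(LBINT x. L x $ i $ j * \<phi> x) = - (\<integral>x. u x $ i * dd \<phi> x (axis j 1) \<partial>lebesgue_on \<Omega>)"
  and int: "L1 (\<lambda>x. L x $ i $ j * \<phi> x)"
  if L: "is_weak_gradient \<Omega> u M" "L Borel" "\<And>x. x \<notin> \<Omega> ==> L x = 0" "AE x in lborel. x \<in> \<Omega> --> L x = M x"
   and \<phi>: "test_function \<Omega> \<phi>" for L M i j and \<phi> :: "real^3 => real"
 proof -
  have [measurable]: "\<phi> Borel" by (rule smooth_measurable[OF test_smooth[OF \<phi>]])
  have [measurable]: "(\<lambda>x. L x $ i $ j) Borel"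
  proof -
   have "(\<lambda>A :: real^3^3. A $ i $ j) Borel" by (intro borel_measurable_continuous_onI continuous_intros)
   then show ?thesis by (rule measurable_compose[OF L(2)])
  qed
  obtain K where K: "compact K" "K \<subseteq> \<Omega>" "\<And>x. x \<notin> K ==> \<phi> x = 0" using test_supp[OF \<phi>] by auto
  obtain b where b: "\<And>x. norm (\<phi> x) <= b" using test_bounded[OF \<phi>] by blast
  have "L1 (\<lambda>x. (indicator K x *R L x) $ i $ j)"
   using integrable_bounded_linear[OF bounded_linear_vec_nth[of j] integrable_bounded_linear[OF bounded_linear_vec_nth[of i] loc[OF L(1,2,4) K(1,2)]]] .
  then have "L1 (\<lambda>x. \<phi> x *R (indicator K x *R L x) $ i $ j)"
   using b by (intro integrable_bounded_scaleR[where B=b]) auto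
  moreover have "\<phi> x *R (indicator K x *R L x) $ i $ j = L x $ i $ j * \<phi> x" for x using K(3)[of x] by (cases "x \<in> K") auto
  ultimately show "L1 (\<lambda>x. L x $ i $ j * \<phi> x)" by (simp only:)
  have "(\<integral>x. M x $ i $ j * \<phi> x \<partial>lebesgue_on \<Omega>) = (LBINT x. L x $ i $ j * \<phi> x)"
  proof (rule lebesgue_on_eq_lborel(1)[OF \<Omega>b])
   show "AE x in lborel. x \<in> \<Omega> --> L x $ i $ j * \<phi> x = M x $ i $ j * \<phi> x" using L(4) by eventually_elim auto
  qed (auto simp: L(3))
  then show "(LBINT x. L x $ i $ j * \<phi> x) = - (\<integral>x. u x $ i * dd \<phi> x (axis j 1) \<partial>lebesgue_on \<Omega>)"
   using L(1) \<phi> by (simp add: is_weak_gradient_def)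
 qed
 have comp: "AE x in lborel. x \<in> \<Omega> --> F x $ i $ j - F' x $ i $ j = 0" for i j
 proof (rule null_of_test_orthogonal[OF _ \<Omega>])
  have c: "(\<lambda>A :: real^3^3. A $ i $ j) Borel" by (intro borel_measurable_continuous_onI continuous_intros)
  show "(\<lambda>x. F x $ i $ j - F' x $ i $ j) Borel"
   by (intro borel_measurable_diff measurable_compose[OF F c] measurable_compose[OF F' c])
  show "L1 (\<lambda>x. indicator K x * (F x $ i $ j - F' x $ i $ j))" if K: "compact K" "K \<subseteq> \<Omega>" for K
  proof -
   have "L1 (\<lambda>x. (indicator K x *R F x - indicator K x *R F' x) $ i $ j)"
    by (intro integrable_bounded_linear[OF bounded_linear_vec_nth[of j]] integrable_bounded_linear[OF bounded_linear_vec_nth[of i]]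
      Bochner_Integration.integrable_diff loc[OF G F Fa K] loc[OF G' F' Fa' K])
   then show ?thesis by (simp add: right_diff_distrib)
  qed
  fix \<phi> :: "real^3 => real" assume \<phi>: "test_function \<Omega> \<phi>"
  show "(LBINT x. (F x $ i $ j - F' x $ i $ j) * \<phi> x) = 0"
   using orth[OF G F F0 Fa \<phi>, of i j] orth[OF G' F' F0' Fa' \<phi>, of i j] int[OF G F F0 Fa \<phi>, of i j] int[OF G' F' F0' Fa' \<phi>, of i j]
   by (simp add: left_diff_distrib)
 qed
 have "AE x in lborel. \<forall>i\<in>UNIV. \<forall>j\<in>UNIV. x \<in> \<Omega> --> F x $ i $ j - F' x $ i $ j = 0"
  using comp by (intro AE_finite_allI) auto
 then show ?thesis using Fa Fa' by eventually_elim (auto simp: vec_eq_iff)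
qed

lemma is_weak_gradient_weak_gradient: "is_weak_gradient \<Omega> u G ==> is_weak_gradient \<Omega> u (weak_gradient \<Omega> u)"
 unfolding weak_gradient_def by (rule someI[of "is_weak_gradient \<Omega> u"])

text \<open>The last conjunct restates the weak derivative row by row, the form used for convolution
  and composition; the one before ties G to the gradient selected by
  \<open>weak_gradient\<close>.\<close>

definition H1_rep :: "(real^3) set => (real^3 => real^3) => (real^3 => real^3) => (real^3 => real^3^3) => bool" where
 "H1_rep \<Omega> u p G \<longleftrightarrow> L2 p \<and> L2 G \<and> (\<forall>x. x \<notin> \<Omega> --> p x = 0 \<and> G x = 0) \<and>
   (AE x in lborel. x \<in> \<Omega> --> p x = u x \<and> G x = weak_gradient \<Omega> u x) \<and>
   (\<forall>i. wgrad_on \<Omega> (\<lambda>x. p x $ i) (\<lambda>x. G x $ i))"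

lemma H1_repD:
 assumes "H1_rep \<Omega> u p G"
 shows "L2 p" "L2 G" "x \<notin> \<Omega> ==> p x = 0" "x \<notin> \<Omega> ==> G x = 0"
  "AE x in lborel. x \<in> \<Omega> --> p x = u x" "AE x in lborel. x \<in> \<Omega> --> G x = weak_gradient \<Omega> u x"
  "p Borel" "G Borel" "wgrad_on \<Omega> (\<lambda>x. p x $ i) (\<lambda>x. G x $ i)"
 using assms by (auto simp: H1_rep_def square_integrable_def elim: AE_mp)

lemma L2_lebesgue_on:
 fixes f F :: "real^3 => 'b::euclidean_space"
 assumes f: "square_integrable (lebesgue_on \<Omega>) f" and \<Omega>: "\<Omega> \<in> sets borel" and F: "F Borel" "\<And>x. x \<notin> \<Omega> ==> F x = 0"
  and ae: "AE x in lborel. x \<in> \<Omega> --> F x = f x"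
 shows "L2 F"
proof -
 have "integrable (lebesgue_on \<Omega>) (\<lambda>x. (norm (f x))\<^sup>2)" using f by (simp add: square_integrable_def)
 moreover have "AE x in lborel. x \<in> \<Omega> --> (norm (F x))\<^sup>2 = (norm (f x))\<^sup>2" using ae by eventually_elim auto
 ultimately have "L1 (\<lambda>x. (norm (F x))\<^sup>2)"
  using F by (subst lebesgue_on_eq_lborel(2)[symmetric, OF \<Omega>, where f="\<lambda>x. (norm (f x))\<^sup>2"]) auto
 then show ?thesis using F(1) by (simp add: square_integrable_def)
qed

lemma H1_rep_exists:
 assumes u: "u \<in> H1 \<Omega>" and \<Omega>: "open \<Omega>"
 shows "\<exists>p G. H1_rep \<Omega> u p G"
proof -
 have \<Omega>b [measurable]: "\<Omega> \<in> sets borel" using \<Omega> by simp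
 have su: "square_integrable (lebesgue_on \<Omega>) u" using u by (simp add: H1_def)
 obtain G1 where G1: "is_weak_gradient \<Omega> u G1" and sG1: "square_integrable (lebesgue_on \<Omega>) G1" using u by (auto simp: H1_def)
 note G0 = is_weak_gradient_weak_gradient[OF G1]
 obtain p where p: "p Borel" "\<And>x. x \<notin> \<Omega> ==> p x = 0" "AE x in lborel. x \<in> \<Omega> --> p x = u x"
  using borel_representative_on[OF L2_measurable[OF su] \<Omega>b] by auto
 obtain G where G: "G Borel" "\<And>x. x \<notin> \<Omega> ==> G x = 0" "AE x in lborel. x \<in> \<Omega> --> G x = G1 x"
  using borel_representative_on[OF L2_measurable[OF sG1] \<Omega>b] by auto
 have sp: "L2 p" by (rule L2_lebesgue_on[OF su \<Omega>b p])
 have sG: "L2 G" by (rule L2_lebesgue_on[OF sG1 \<Omega>b G])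
 have "wgrad_on \<Omega> (\<lambda>x. p x $ i) (\<lambda>x. G x $ i)" for i
 proof (rule wgrad_onI_axis[OF L2_nth[OF sp] L2_nth[OF sG]])
  fix \<phi> :: "real^3 => real" and j assume \<phi>: "test_function \<Omega> \<phi>"
  let ?D = "\<lambda>x. dd \<phi> x (axis j 1)"
  have m: "\<phi> Borel" "?D Borel"
   using smooth_measurable[OF test_smooth[OF \<phi>]] smooth_measurable[OF smooth_deriv[OF test_smooth[OF \<phi>]]] .
  have mp: "(\<lambda>x. p x $ i) Borel" "(\<lambda>x. G x $ i $ j) Borel"
   using L2_measurable[OF L2_nth[OF sp]] L2_measurable[OF L2_nth[OF L2_nth[OF sG]]] by simp_all
  have "(\<integral>x. u x $ i * ?D x \<partial>lebesgue_on \<Omega>) = (LBINT x. p x $ i * ?D x)"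
  proof (rule lebesgue_on_eq_lborel(1)[OF \<Omega>b borel_measurable_times[OF mp(1) m(2)]])
   show "AE x in lborel. x \<in> \<Omega> --> p x $ i * ?D x = u x $ i * ?D x" using p(3) by eventually_elim auto
  qed (simp add: p(2))
  moreover have "(\<integral>x. G1 x $ i $ j * \<phi> x \<partial>lebesgue_on \<Omega>) = (LBINT x. G x $ i $ j * \<phi> x)"
  proof (rule lebesgue_on_eq_lborel(1)[OF \<Omega>b borel_measurable_times[OF mp(2) m(1)]])
   show "AE x in lborel. x \<in> \<Omega> --> G x $ i $ j * \<phi> x = G1 x $ i $ j * \<phi> x" using G(3) by eventually_elim auto
  qed (simp add: G(2))
  ultimately show "(LBINT x. p x $ i * ?D x) = - (LBINT x. G x $ i $ j * \<phi> x)"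
   using G1 \<phi> by (simp add: is_weak_gradient_def)
 qed
 moreover have "AE x in lborel. x \<in> \<Omega> --> p x = u x \<and> G x = weak_gradient \<Omega> u x"
  using p(3) G(3) weak_gradient_unique[OF G1 G0 \<Omega>] by eventually_elim auto
 ultimately show ?thesis unfolding H1_rep_def using sp sG p(2) G(2) by blast
qed

lemma nn_integral_limit_two:
 assumes m: "\<And>k. a k \<in> borel_measurable M" "\<And>k. b k \<in> borel_measurable M"
  and l: "(\<lambda>k. \<integral>\<^sup>+x. a k x \<partial>M) ----> 0" "(\<lambda>k. \<integral>\<^sup>+x. b k x \<partial>M) ----> 0"
  and le: "\<And>k x. c k x <= 2 * a k x + 2 * b k x"
 shows "(\<lambda>k. \<integral>\<^sup>+x. c k x \<partial>M) ----> (0 :: ennreal)"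
proof (rule ennreal_tendsto_0I)
 fix e :: real assume e: "e > 0"
 have "\<forall>\<^sub>F k in sequentially. (\<integral>\<^sup>+x. a k x \<partial>M) <= ennreal (e/4)" "\<forall>\<^sub>F k in sequentially. (\<integral>\<^sup>+x. b k x \<partial>M) <= ennreal (e/4)"
  using e by (auto intro!: ennreal_tendsto_0D l)
 then show "\<forall>\<^sub>F k in sequentially. (\<integral>\<^sup>+x. c k x \<partial>M) <= ennreal e"
 proof eventually_elim
  case (elim k)
  have "(\<integral>\<^sup>+x. c k x \<partial>M) <= (\<integral>\<^sup>+x. 2 * a k x + 2 * b k x \<partial>M)" by (intro nn_integral_mono le)
  also have "\<dots> = 2 * (\<integral>\<^sup>+x. a k x \<partial>M) + 2 * (\<integral>\<^sup>+x. b k x \<partial>M)"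
   using m by (subst nn_integral_add) (auto simp: nn_integral_cmult)
  also have "\<dots> <= 2 * ennreal (e/4) + 2 * ennreal (e/4)" by (intro add_mono mult_left_mono elim) auto
  also have "\<dots> = ennreal (2 * (e/4)) + ennreal (2 * (e/4))" using e by (simp only: ennreal_mult'' ennreal_numeral zero_le_numeral)
  also have "\<dots> = ennreal (2 * (e/4) + 2 * (e/4))" using e by (intro ennreal_plus[symmetric]) auto
  finally show ?case by simp
 qed
qed

lemma ennreal_two_le:
 assumes "c <= 2 * a + 2 * b" "0 <= a" "0 <= b"
 shows "ennreal c <= 2 * ennreal a + 2 * ennreal b"
proof -
 have "ennreal c <= ennreal (2 * a + 2 * b)" using assms by (intro ennreal_leI)
 also have "\<dots> = ennreal (2 * a) + ennreal (2 * b)" using assms by (intro ennreal_plus) auto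
 also have "\<dots> = 2 * ennreal a + 2 * ennreal b" using assms by (simp add: ennreal_mult)
 finally show ?thesis .
qed

lemma nth_diff_square:
 fixes X Y :: "('b::euclidean_space)^3"
 shows "(norm ((X - Y) $ i))\<^sup>2 <= 2 * (norm X)\<^sup>2 + 2 * (norm Y)\<^sup>2"
proof -
 have "norm ((X - Y) $ i) <= norm X + norm Y"
  using Finite_Cartesian_Product.norm_nth_le[of "X - Y" i] norm_triangle_ineq4[of X Y] by linarith
 then have "(norm ((X - Y) $ i))\<^sup>2 <= (norm X + norm Y)\<^sup>2" by (rule power_mono) simp
 also have "\<dots> <= 2 * (norm X)\<^sup>2 + 2 * (norm Y)\<^sup>2" using zero_le_power2[of "norm X - norm Y"] by (simp add: power2_eq_square algebra_simps)
 finally show ?thesis .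
qed

lemma two_sum_mono: "A <= 2 * a + 2 * b ==> 0 <= c ==> 0 <= d ==> A <= 2 * (a + c) + 2 * (b + d)"
  and two_sum_mono': "A <= 2 * a + 2 * b ==> 0 <= c ==> 0 <= d ==> A <= 2 * (c + a) + 2 * (d + b)"
 for A :: real
 by simp_all

lemma grad_component:
 fixes \<phi> :: "real^3 => real^3"
 assumes "smooth \<phi>"
 shows "grad (\<lambda>x. \<phi> x $ i) x = jacobian \<phi> (at x) $ i"
proof -
 have "((\<lambda>x. \<phi> x $ i) has_derivative (\<lambda>h. dd \<phi> x h $ i)) (at x)"
  by (rule bounded_linear.has_derivative[OF bounded_linear_vec_nth smooth_has_derivative[OF assms]])
 from frechet_derivative_at[OF this] have e: "dd (\<lambda>x. \<phi> x $ i) x = (\<lambda>h. dd \<phi> x h $ i)" by simp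
 show ?thesis unfolding grad_def jacobian_def matrix_def e by (simp add: vec_eq_iff)
qed

lemma jacobian_continuous:
 fixes \<phi> :: "real^3 => real^3"
 assumes "smooth \<phi>"
 shows "continuous_on UNIV (\<lambda>x. jacobian \<phi> (at x))"
 unfolding jacobian_def matrix_def
 by (intro continuous_on_vec_lambda continuous_on_component smooth_continuous smooth_deriv assms)

lemma has_trace_approximation:
 assumes t: "has_trace \<Omega> u f" and r: "H1_rep \<Omega> u p G" and \<Omega>: "open \<Omega>"
 shows "\<exists>\<phi> :: nat => real^3 => real^3. (\<forall>k. smooth (\<phi> k)) \<and>
   (\<lambda>k. NN x. ennreal ((norm (indicator \<Omega> x *R \<phi> k x - p x))\<^sup>2 + (norm (indicator \<Omega> x *R jacobian (\<phi> k) (at x) - G x))\<^sup>2)) ----> 0 \<and>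
   (\<lambda>k. \<integral>\<^sup>+x. ennreal ((norm (\<phi> k x - f x))\<^sup>2) \<partial>surface_measure \<Omega>) ----> 0"
proof -
 obtain \<phi> where \<phi>: "\<forall>k. smooth (\<phi> k)"
   "(\<lambda>k. \<integral>\<^sup>+x. ennreal ((norm (\<phi> k x - u x))\<^sup>2 + (norm (jacobian (\<phi> k) (at x) - weak_gradient \<Omega> u x))\<^sup>2) \<partial>lebesgue_on \<Omega>) ----> 0"
   "(\<lambda>k. \<integral>\<^sup>+x. ennreal ((norm (\<phi> k x - f x))\<^sup>2) \<partial>surface_measure \<Omega>) ----> 0"
  using t unfolding has_trace_def by (elim conjE exE)
 have \<Omega>b: "\<Omega> \<in> sets borel" using \<Omega> by simp
 have "(\<integral>\<^sup>+x. ennreal ((norm (\<phi> k x - u x))\<^sup>2 + (norm (jacobian (\<phi> k) (at x) - weak_gradient \<Omega> u x))\<^sup>2) \<partial>lebesgue_on \<Omega>)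
   = (NN x. ennreal ((norm (indicator \<Omega> x *R \<phi> k x - p x))\<^sup>2 + (norm (indicator \<Omega> x *R jacobian (\<phi> k) (at x) - G x))\<^sup>2))" for k
  unfolding nn_integral_lebesgue_on[OF \<Omega>b]
 proof (rule nn_integral_cong_AE)
  show "AE x in lborel. ennreal ((norm (\<phi> k x - u x))\<^sup>2 + (norm (jacobian (\<phi> k) (at x) - weak_gradient \<Omega> u x))\<^sup>2) * indicator \<Omega> x
   = ennreal ((norm (indicator \<Omega> x *R \<phi> k x - p x))\<^sup>2 + (norm (indicator \<Omega> x *R jacobian (\<phi> k) (at x) - G x))\<^sup>2)"
   using H1_repD(5,6)[OF r]
  proof eventually_elim
   case (elim x)
   then show ?case using H1_repD(3,4)[OF r, of x] by (cases "x \<in> \<Omega>") auto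
  qed
 qed
 then show ?thesis using \<phi> by auto
qed

text \<open>The difference of the two approximating sequences tends to u - u' in H^1, and its
  boundary values tend to 0 because f cancels. Thus \<open>zero_trace_orthogonal\<close> applies to
  each component.\<close>

lemma trace_difference_null:
 assumes \<Omega>: "open \<Omega>" "bounded \<Omega>" and cone: "\<And>P. P \<in> closure \<Omega> ==> \<exists>\<rho> e \<kappa> \<tau>. inner_cone \<Omega> P \<rho> e \<kappa> \<tau>"
  and u: "has_trace \<Omega> u f" "H1_rep \<Omega> u p G" and u': "has_trace \<Omega> u' f" "H1_rep \<Omega> u' p' G'"
 shows "null_gradient \<Omega> (\<lambda>x. G x - G' x)"
 unfolding null_gradient_def scalar_null_def
proof (intro conjI allI impI)
 note R = H1_repD[OF u(2)] and R' = H1_repD[OF u'(2)]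
 show sG: "L2 (\<lambda>x. G x - G' x)" by (rule L2_diff[OF R(2) R'(2)])
 fix i show sGi: "L2 (\<lambda>x. (G x - G' x) $ i)" by (rule L2_nth[OF sG])
 fix h assume h: "scalar_divfree \<Omega> h"
 obtain \<phi> where \<phi>: "\<And>k. smooth (\<phi> k)"
   "(\<lambda>k. NN x. ennreal ((norm (indicator \<Omega> x *R \<phi> k x - p x))\<^sup>2 + (norm (indicator \<Omega> x *R jacobian (\<phi> k) (at x) - G x))\<^sup>2)) ----> 0"
   "(\<lambda>k. \<integral>\<^sup>+x. ennreal ((norm (\<phi> k x - f x))\<^sup>2) \<partial>surface_measure \<Omega>) ----> 0"
  using has_trace_approximation[OF u \<Omega>(1)] by (elim exE conjE) auto
 obtain \<psi> where \<psi>: "\<And>k. smooth (\<psi> k)"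
   "(\<lambda>k. NN x. ennreal ((norm (indicator \<Omega> x *R \<psi> k x - p' x))\<^sup>2 + (norm (indicator \<Omega> x *R jacobian (\<psi> k) (at x) - G' x))\<^sup>2)) ----> 0"
   "(\<lambda>k. \<integral>\<^sup>+x. ennreal ((norm (\<psi> k x - f x))\<^sup>2) \<partial>surface_measure \<Omega>) ----> 0"
  using has_trace_approximation[OF u' \<Omega>(1)] by (elim exE conjE) auto
 define \<theta> where "\<theta> k x = (\<phi> k x - \<psi> k x) $ i" for k x
 have sd: "smooth (\<lambda>x. \<phi> k x - \<psi> k x)" for k by (intro smooth_diff \<phi>(1) \<psi>(1))
 have grad\<theta>: "grad (\<theta> k) x = (jacobian (\<phi> k) (at x) - jacobian (\<psi> k) (at x)) $ i" for k x
 proof -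
  have "grad (\<lambda>x. \<phi> k x $ i - \<psi> k x $ i) x = grad (\<lambda>x. \<phi> k x $ i) x - grad (\<lambda>x. \<psi> k x $ i) x"
   by (intro grad_diff smooth_bounded_linear[OF bounded_linear_vec_nth] \<phi>(1) \<psi>(1))
  then show ?thesis unfolding \<theta>_def[abs_def] by (simp add: grad_component \<phi>(1) \<psi>(1))
 qed
 have mb: "(\<lambda>x. ennreal ((norm (indicator \<Omega> x *R \<chi>' x - q x))\<^sup>2 + (norm (indicator \<Omega> x *R jacobian \<chi>' (at x) - H x))\<^sup>2)) \<in> borel_measurable lborel"
  if "smooth \<chi>'" and [measurable]: "q Borel" "H Borel"
  for \<chi>' q :: "real^3 => real^3" and H :: "real^3 => real^3^3"
 proof -
  have [measurable]: "\<chi>' Borel" by (rule smooth_measurable[OF that(1)])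
  have [measurable]: "(\<lambda>x. jacobian \<chi>' (at x)) Borel" by (rule borel_measurable_continuous_onI[OF jacobian_continuous[OF that(1)]])
  have [measurable]: "\<Omega> \<in> sets borel" using \<Omega>(1) by simp
  show ?thesis by measurable
 qed
 have ms: "(\<lambda>x. ennreal ((norm (\<chi>' x - f x))\<^sup>2)) \<in> borel_measurable (surface_measure \<Omega>)" if "smooth \<chi>'" for \<chi>' :: "real^3 => real^3"
 proof -
  have "\<chi>' \<in> borel_measurable (restrict_space borel (frontier \<Omega>))" by (rule measurable_restrict_space1[OF smooth_measurable[OF that]])
  then have [measurable]: "\<chi>' \<in> borel_measurable (surface_measure \<Omega>)" by (simp add: measurable_cong_sets[OF sets_surface_measure refl])
  have [measurable]: "f \<in> borel_measurable (surface_measure \<Omega>)" using u(1) by (auto simp: has_trace_def square_integrable_def)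
  show ?thesis by measurable
 qed
 show "(LBINT x. h x \<bullet> (G x - G' x) $ i) = 0"
 proof (rule zero_trace_orthogonal[OF \<Omega> cone _ sGi, where w="\<lambda>x. (p x - p' x) $ i" and \<phi>=\<theta>])
  show "L2 (\<lambda>x. (p x - p' x) $ i)" by (intro L2_nth L2_diff R R')
  show "(p x - p' x) $ i = 0 \<and> (G x - G' x) $ i = 0" if "x \<notin> \<Omega>" for x using R(3,4)[OF that] R'(3,4)[OF that] by simp
  show "smooth (\<theta> k)" for k unfolding \<theta>_def[abs_def] by (rule smooth_bounded_linear[OF bounded_linear_vec_nth sd])
  show "(\<lambda>k. NN x. ennreal ((norm (indicator \<Omega> x * \<theta> k x - (p x - p' x) $ i))\<^sup>2)) ----> 0"
  proof (rule nn_integral_limit_two[OF mb[OF \<phi>(1) R(7,8)] mb[OF \<psi>(1) R'(7,8)] \<phi>(2) \<psi>(2)], rule ennreal_two_le)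
   fix k x
   have e: "indicator \<Omega> x * \<theta> k x - (p x - p' x) $ i = ((indicator \<Omega> x *R \<phi> k x - p x) - (indicator \<Omega> x *R \<psi> k x - p' x)) $ i"
    by (simp add: \<theta>_def algebra_simps)
   show "(norm (indicator \<Omega> x * \<theta> k x - (p x - p' x) $ i))\<^sup>2 <= 2 * ((norm (indicator \<Omega> x *R \<phi> k x - p x))\<^sup>2 + (norm (indicator \<Omega> x *R jacobian (\<phi> k) (at x) - G x))\<^sup>2)
     + 2 * ((norm (indicator \<Omega> x *R \<psi> k x - p' x))\<^sup>2 + (norm (indicator \<Omega> x *R jacobian (\<psi> k) (at x) - G' x))\<^sup>2)"
    unfolding e by (rule two_sum_mono[OF nth_diff_square]) simp_all
  qed auto
  show "(\<lambda>k. NN x. ennreal ((norm (indicator \<Omega> x *R grad (\<theta> k) x - (G x - G' x) $ i))\<^sup>2)) ----> 0"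
  proof (rule nn_integral_limit_two[OF mb[OF \<phi>(1) R(7,8)] mb[OF \<psi>(1) R'(7,8)] \<phi>(2) \<psi>(2)], rule ennreal_two_le)
   fix k x
   have e: "indicator \<Omega> x *R grad (\<theta> k) x - (G x - G' x) $ i = ((indicator \<Omega> x *R jacobian (\<phi> k) (at x) - G x) - (indicator \<Omega> x *R jacobian (\<psi> k) (at x) - G' x)) $ i"
    by (simp add: grad\<theta> algebra_simps)
   show "(norm (indicator \<Omega> x *R grad (\<theta> k) x - (G x - G' x) $ i))\<^sup>2 <= 2 * ((norm (indicator \<Omega> x *R \<phi> k x - p x))\<^sup>2 + (norm (indicator \<Omega> x *R jacobian (\<phi> k) (at x) - G x))\<^sup>2)
     + 2 * ((norm (indicator \<Omega> x *R \<psi> k x - p' x))\<^sup>2 + (norm (indicator \<Omega> x *R jacobian (\<psi> k) (at x) - G' x))\<^sup>2)"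
    unfolding e by (rule two_sum_mono'[OF nth_diff_square]) simp_all
  qed auto
  show "(\<lambda>k. \<integral>\<^sup>+x. ennreal ((\<theta> k x)\<^sup>2) \<partial>surface_measure \<Omega>) ----> 0"
  proof (rule nn_integral_limit_two[OF ms[OF \<phi>(1)] ms[OF \<psi>(1)] \<phi>(3) \<psi>(3)], rule ennreal_two_le)
   fix k x
   have "\<theta> k x = ((\<phi> k x - f x) - (\<psi> k x - f x)) $ i" by (simp add: \<theta>_def)
   then show "(\<theta> k x)\<^sup>2 <= 2 * (norm (\<phi> k x - f x))\<^sup>2 + 2 * (norm (\<psi> k x - f x))\<^sup>2"
    using nth_diff_square[of "\<phi> k x - f x" "\<psi> k x - f x" i] by simp
  qed auto
 qed (use h in auto)
qed

context pulled_back_energy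
begin

lemma energy_form_eq_Q:
 assumes u: "H1_rep \<Omega> u p G" and v: "H1_rep \<Omega> v p' G'" and \<Omega>: "open \<Omega>"
 shows "energy_form \<Omega> (inclusion_tensor li mi le me D) u v = Q 0 G G'"
 unfolding energy_form_def Q_def q_0
proof (rule lebesgue_on_eq_lborel(1))
 note R = H1_repD[OF u] and R' = H1_repD[OF v]
 have [measurable]: "G Borel" "G' Borel" by (rule R R')+
 show "(\<lambda>x. C x (G x) \<bullet> G' x) Borel" by measurable
 show "AE x in lborel. x \<in> \<Omega> --> C x (G x) \<bullet> G' x = inclusion_tensor li mi le me D x (weak_gradient \<Omega> u x) \<bullet> weak_gradient \<Omega> v x"
  using R(6) R'(6) by eventually_elim (auto simp: C_def)
 show "C x (G x) \<bullet> G' x = 0" if "x \<notin> \<Omega>" for x using R'(4)[OF that] by simp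
qed (use \<Omega> in simp)

lemma solution_divfree:
 assumes s: "dirichlet_solution \<Omega> (inclusion_tensor li mi le me D) f u" and u: "H1_rep \<Omega> u p G" and \<Omega>: "open \<Omega>"
 shows "divfree \<Omega> (\<lambda>x. C x (G x))"
proof -
 note R = H1_repD[OF u]
 have [measurable]: "G Borel" by (rule R)
 obtain K where K: "K >= 0" "\<And>x A. norm (C x A) <= K * norm A" using C_bound by blast
 show ?thesis
  unfolding divfree_def
 proof (intro conjI allI impI)
  show "L2 (\<lambda>x. C x (G x))" by (rule L2_bound[OF R(2), of _ K]) (use K in auto)
  fix \<phi> :: "real^3 => real^3" assume \<phi>: "test_function \<Omega> \<phi>"
  have [measurable]: "(\<lambda>x. jacobian \<phi> (at x)) Borel"
   by (rule borel_measurable_continuous_onI[OF jacobian_continuous[OF test_smooth[OF \<phi>]]])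
  have "(\<integral>x. inclusion_tensor li mi le me D x (weak_gradient \<Omega> u x) \<bullet> jacobian \<phi> (at x) \<partial>lebesgue_on \<Omega>) = (LBINT x. C x (G x) \<bullet> jacobian \<phi> (at x))"
  proof (rule lebesgue_on_eq_lborel(1))
   show "(\<lambda>x. C x (G x) \<bullet> jacobian \<phi> (at x)) Borel" by measurable
   show "AE x in lborel. x \<in> \<Omega> --> C x (G x) \<bullet> jacobian \<phi> (at x) = inclusion_tensor li mi le me D x (weak_gradient \<Omega> u x) \<bullet> jacobian \<phi> (at x)"
    using R(6) by eventually_elim (auto simp: C_def)
   show "C x (G x) \<bullet> jacobian \<phi> (at x) = 0" if "x \<notin> \<Omega>" for x using R(4)[OF that] linear_0[OF C_linear] by simp
  qed (use \<Omega> in simp)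
  then show "(LBINT x. C x (G x) \<bullet> jacobian \<phi> (at x)) = 0" using s \<phi> by (simp add: dirichlet_solution_def)
 qed
qed

lemma solution_orthogonal:
 assumes "dirichlet_solution \<Omega> (inclusion_tensor li mi le me D) f u" "H1_rep \<Omega> u p G" "open \<Omega>" and Z: "null_gradient \<Omega> Z"
 shows "Q 0 G Z = 0"
 using null_gradient_orthogonal[OF Z solution_divfree[OF assms(1-3)]] by (simp add: Q_def q_0)

text \<open>The definite description in \<open>DN_pairing\<close> needs a single value. Replacing v
  changes the energy by the pairing of a solution with a null gradient, which is 0; replacing u
  changes it by 0 likewise, by symmetry and because v is a solution.\<close>

lemma energy_form_eq_DN_pairing:
 assumes \<Omega>: "open \<Omega>" "bounded \<Omega>" and cone: "\<And>P. P \<in> closure \<Omega> ==> \<exists>\<rho> e \<kappa> \<tau>. inner_cone \<Omega> P \<rho> e \<kappa> \<tau>"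
  and u: "dirichlet_solution \<Omega> (inclusion_tensor li mi le me D) f u"
  and v: "dirichlet_solution \<Omega> (inclusion_tensor li mi le me D) g v"
 shows "energy_form \<Omega> (inclusion_tensor li mi le me D) u v = DN_pairing \<Omega> (inclusion_tensor li mi le me D) f g"
proof -
 let ?C = "inclusion_tensor li mi le me D"
 obtain p G where G: "H1_rep \<Omega> u p G" using H1_rep_exists[OF _ \<Omega>(1), of u] u by (auto simp: dirichlet_solution_def)
 obtain q H where H: "H1_rep \<Omega> v q H" using H1_rep_exists[OF _ \<Omega>(1), of v] v by (auto simp: dirichlet_solution_def)
 have eq: "energy_form \<Omega> ?C u v = energy_form \<Omega> ?C u' v'"
  if u': "dirichlet_solution \<Omega> ?C f u'" and v': "has_trace \<Omega> v' g" for u' v'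
 proof -
  obtain p' G' where G': "H1_rep \<Omega> u' p' G'" using H1_rep_exists[OF _ \<Omega>(1), of u'] u' by (auto simp: dirichlet_solution_def)
  obtain q' H' where H': "H1_rep \<Omega> v' q' H'" using H1_rep_exists[OF _ \<Omega>(1), of v'] v' by (auto simp: has_trace_def)
  have tr: "has_trace \<Omega> u f" "has_trace \<Omega> u' f" "has_trace \<Omega> v g" using u u' v by (auto simp: dirichlet_solution_def)
  have Z: "null_gradient \<Omega> (\<lambda>x. G' x - G x)" by (rule trace_difference_null[OF \<Omega> cone tr(2) G' tr(1) G])
  have W: "null_gradient \<Omega> (\<lambda>x. H' x - H x)" by (rule trace_difference_null[OF \<Omega> cone v' H' tr(3) H])
  have sZ: "L2 (\<lambda>x. G' x - G x)" "L2 (\<lambda>x. H' x - H x)" using Z W by (auto simp: null_gradient_def)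
  have "Q 0 G' H' = Q 0 G' H + Q 0 G' (\<lambda>x. H' x - H x)"
   using Q_add(2)[of 0, OF _ H1_repD(2)[OF H] sZ(2) H1_repD(2)[OF G']] by simp
  also have "Q 0 G' (\<lambda>x. H' x - H x) = 0" by (rule solution_orthogonal[OF u' G' \<Omega>(1) W])
  also have "Q 0 G' H = Q 0 G H + Q 0 (\<lambda>x. G' x - G x) H"
   using Q_add(1)[of 0, OF _ H1_repD(2)[OF G] sZ(1) H1_repD(2)[OF H]] by simp
  also have "Q 0 (\<lambda>x. G' x - G x) H = 0" using solution_orthogonal[OF v H \<Omega>(1) Z] Q_0_symmetric by simp
  finally show ?thesis using energy_form_eq_Q[OF G H \<Omega>(1)] energy_form_eq_Q[OF G' H' \<Omega>(1)] by simp
 qed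
 have tv: "has_trace \<Omega> v g" using v by (simp add: dirichlet_solution_def)
 show ?thesis
  unfolding DN_pairing_def
 proof (rule the_equality[symmetric])
  show "\<forall>u' v'. dirichlet_solution \<Omega> ?C f u' \<and> has_trace \<Omega> v' g --> energy_form \<Omega> ?C u v = energy_form \<Omega> ?C u' v'" using eq by blast
  fix r assume "\<forall>u' v'. dirichlet_solution \<Omega> ?C f u' \<and> has_trace \<Omega> v' g --> r = energy_form \<Omega> ?C u' v'"
  then show "r = energy_form \<Omega> ?C u v" using u tv by blast
 qed
qed

end

subsection \<open>The derivative\<close>

lemma wgrad_test_function:
 fixes \<phi> :: "real^3 => real"
 assumes \<phi>: "test_function \<Omega> \<phi>"
 shows "wgrad \<phi> (grad \<phi>)"
 unfolding wgrad_def wgrad_on_def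
proof (intro conjI allI impI)
 note s = test_smooth[OF \<phi>]
 show "L2 \<phi>" by (rule test_square_integrable[OF \<phi>])
 show "L2 (grad \<phi>)" by (rule grad_test_square_integrable[OF \<phi>])
 show "(LBINT x. \<phi> x * dd \<psi> x h) = - (LBINT x. (grad \<phi> x \<bullet> h) * \<psi> x)" if "test_function UNIV \<psi>" for \<psi> h
  unfolding grad_smooth_inner[OF s]
  by (rule integral_by_parts_test(1)[OF smooth_has_derivative[OF s] smooth_continuous[OF smooth_deriv[OF s]] that])
 obtain K where K: "compact K" "\<And>x. x \<notin> K ==> \<phi> x = 0" "\<And>x b. x \<notin> K ==> dd \<phi> x b = 0"
  using test_supp_deriv[OF \<phi>] by auto
 then show "\<exists>S. bounded S \<and> (\<forall>x. x \<notin> S --> \<phi> x = 0 \<and> grad \<phi> x = 0)"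
  by (intro exI[of _ K]) (auto simp: grad_def vec_eq_iff compact_imp_bounded)
qed

lemma L2_rows:
 fixes M :: "'a => real^3^3"
 assumes r: "\<And>i. square_integrable N (\<lambda>x. M x $ i)" and m: "M \<in> borel_measurable N"
 shows "square_integrable N M"
proof -
 have "integrable N (\<lambda>x. \<Sum>i\<in>UNIV. (norm (M x $ i))\<^sup>2)"
  using r by (intro Bochner_Integration.integrable_sum) (simp add: square_integrable_def)
 moreover have "(\<Sum>i\<in>UNIV. (norm (M x $ i))\<^sup>2) = (norm (M x))\<^sup>2" for x
  unfolding power2_norm_eq_inner inner_vec_def[of "M x"] ..
 ultimately show ?thesis using m by (simp add: square_integrable_def)
qed

lemma null_gradient_add:
 assumes "null_gradient \<Omega> G" "null_gradient \<Omega> H"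
 shows "null_gradient \<Omega> (\<lambda>x. G x + H x)"
 unfolding null_gradient_def scalar_null_def
proof (intro conjI allI impI)
 show s: "L2 (\<lambda>x. G x + H x)" using assms by (intro L2_add) (auto simp: null_gradient_def)
 show "L2 (\<lambda>x. (G x + H x) $ i)" for i by (rule L2_nth[OF s])
 fix i h assume h: "scalar_divfree \<Omega> h"
 have "L1 (\<lambda>x. h x \<bullet> G x $ i)" "L1 (\<lambda>x. h x \<bullet> H x $ i)"
  using h assms by (auto intro!: integrable_inner_L2 simp: scalar_divfree_def null_gradient_def scalar_null_def)
 then show "(LBINT x. h x \<bullet> (G x + H x) $ i) = 0"
  using h assms by (simp add: inner_add_right null_gradient_def scalar_null_def)
qed

context pulled_back_energy
begin

text \<open>\<open>T G\<close> is the gradient of u o (id + s V). As V is supported in the compact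
  subset K of \<Omega>, the composition changes u only on K, so the difference of the gradients is
  null by the interior argument and traces do not enter.\<close>

lemma pull_back:
 assumes V: "lip_field V E (1/2)" and \<Omega>: "open \<Omega>" and K: "compact K" "K \<subseteq> \<Omega>" and z: "\<And>x. x \<notin> K ==> V x = 0 \<and> E x = 0"
  and s: "\<bar>s\<bar> <= 1/4" and D': "D' \<in> sets borel" "\<And>x. x + s *R V x \<in> D' \<longleftrightarrow> x \<in> D"
  and u: "H1_rep \<Omega> u p G"
 defines "T \<equiv> \<lambda>G x. G (x + s *R V x) ** (mat 1 + s *R E x)"
 shows pull_back_null: "null_gradient \<Omega> (\<lambda>x. T G x - G x)"
  and pull_back_orthogonal: "dirichlet_solution \<Omega> (inclusion_tensor li mi le me D') f u ==> null_gradient \<Omega> Z ==> Q s (T G) Z = 0"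
  and pull_back_energy: "H1_rep \<Omega> v p' H ==> energy_form \<Omega> (inclusion_tensor li mi le me D') u v = Q s (T G) (T H)"
proof -
 have s1: "\<bar>s\<bar> <= 1" using s by simp
 interpret L: lip_field "\<lambda>x. s *R V x" "\<lambda>x. s *R E x" "\<bar>s\<bar> * (1/2)" by (rule lip_field.lip_field_scale[OF V s1])
 interpret P: pulled_back_energy li mi le me \<alpha> \<gamma> D' E by unfold_locales (use lame D' E Eb in auto)
 have \<Phi>: "L.\<Phi> x = x + s *R V x" and J: "L.J x = mat 1 + s *R E x" and RB: "R s x = L.B x" for x
  by (simp_all add: L.\<Phi>_def L.J_def L.B_def R_def)
 have T: "T G x = G (L.\<Phi> x) ** L.J x" for G x by (simp add: T_def \<Phi> J)
 have TR: "T G x ** R s x = G (L.\<Phi> x)" for G x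
  unfolding T RB by (simp add: matrix_mul_assoc[symmetric] L.J_B)
 have CP: "C x = P.C (L.\<Phi> x)" for x unfolding C_def P.C_def \<Phi> by (simp add: inclusion_tensor_def D'(2))
 have off: "L.\<Phi> x = x" "L.J x = mat 1" if "x \<notin> K" for x using z[OF that] by (simp_all add: \<Phi> J)
 \<comment> \<open>A point carried out of A would lie outside K and hence be fixed by the map, so
   injectivity would force it to equal x.\<close>
 have stay: "L.\<Phi> x \<in> A" if "x \<in> A" "K \<subseteq> A" for x A
 proof (rule ccontr)
  assume n: "L.\<Phi> x \<notin> A"
  then have "L.\<Phi> (L.\<Phi> x) = L.\<Phi> x" using that(2) by (intro off) auto
  then have "L.\<Phi> x = x" using L.\<Theta>_\<Phi> by metis
  then show False using n that(1) by simp
 qed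
 \<comment> \<open>The determinant differs from 1 by at most 4 |s| <= 1.\<close>
 have det: "\<bar>det (L.J x)\<bar> = det (mat 1 + s *R E x)" for x
  using det_expansion(2)[OF Eb s1, of x] s unfolding J by linarith
 have detm: "(\<lambda>x. det (mat 1 + s *R E x)) Borel" using L.borel_measurable_maps(5) by (simp add: J)
 have Rm [measurable]: "R s Borel" by (rule R_measurable[OF s1])
 have Jm [measurable]: "L.J Borel" by (rule L.borel_measurable_maps)
 note U = H1_repD[OF u]
 have Gm [measurable]: "G Borel" by (rule U)
 have TGm [measurable]: "T G Borel" unfolding T[abs_def] by measurable
 obtain \<zeta> W where \<zeta>: "test_function \<Omega> (\<zeta> :: real^3 => real)" "open W" "K \<subseteq> W" "\<And>x. x \<in> W ==> \<zeta> x = 1"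
  using cutoff_exists[OF K \<Omega>] by auto
 have row: "\<exists>w. wgrad w (\<lambda>x. (T G x - G x) $ i) \<and> (\<forall>x. x \<notin> K --> w x = 0)" for i
 proof -
  \<comment> \<open>u has a weak gradient in \<Omega> only. The cutoff \<zeta> makes it global, and
    since \<zeta> is 1 near K it is invisible where the map moves points.\<close>
  define P where "P x = \<zeta> x * p x $ i" for x
  define Qf where "Qf x = \<zeta> x *R G x $ i + p x $ i *R grad \<zeta> x" for x
  have W: "wgrad P Qf" unfolding P_def Qf_def by (rule wgrad_on_cutoff[OF U(9) \<zeta>(1)])
  have "wgrad (\<lambda>x. P (L.\<Phi> x)) (\<lambda>x. Qf (L.\<Phi> x) v* L.J x)" by (rule L.wgrad_comp_\<Phi>[OF W]) (use s in linarith)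
  then have D: "wgrad (\<lambda>x. P (L.\<Phi> x) - P x) (\<lambda>x. Qf (L.\<Phi> x) v* L.J x - Qf x)" by (rule wgrad_diff[OF _ W])
  have QK: "Qf x = G x $ i" if "x \<in> K" for x
   using that \<zeta>(3,4) grad_const_on_open[OF \<zeta>(2), of x \<zeta> 1] by (auto simp: Qf_def)
  have "Qf (L.\<Phi> x) v* L.J x - Qf x = (T G x - G x) $ i" for x
  proof (cases "x \<in> K")
   case True
   then show ?thesis using QK[OF True] QK[OF stay[OF True order_refl]] by (simp add: T matrix_mult_row)
  next
   case False
   then show ?thesis by (simp add: T off)
  qed
  then have "wgrad (\<lambda>x. P (L.\<Phi> x) - P x) (\<lambda>x. (T G x - G x) $ i)" using D by simp
  moreover have "\<forall>x. x \<notin> K --> P (L.\<Phi> x) - P x = 0" by (simp add: off)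
  ultimately show ?thesis by (intro exI[of _ "\<lambda>x. P (L.\<Phi> x) - P x"] conjI)
 qed
 have sqd: "L2 (\<lambda>x. T G x - G x)"
 proof (rule L2_rows)
  show "L2 (\<lambda>x. (T G x - G x) $ i)" for i using row[of i] by (auto dest: wgradD(2))
  show "(\<lambda>x. T G x - G x) \<in> borel_measurable lborel" by measurable
 qed
 show null: "null_gradient \<Omega> (\<lambda>x. T G x - G x)"
  unfolding null_gradient_def scalar_null_def
 proof (intro conjI allI impI sqd L2_nth[OF sqd])
  fix i h assume h: "scalar_divfree \<Omega> h"
  obtain w where "wgrad w (\<lambda>x. (T G x - G x) $ i)" "\<And>x. x \<notin> K ==> w x = 0" using row[of i] by auto
  then show "(LBINT x. h x \<bullet> (T G x - G x) $ i) = 0" by (rule divfree_orthogonal_compact[OF h _ \<Omega> K])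
 qed
 have sTG: "L2 (T G)" using L2_add[OF sqd U(2)] by simp
 have Qs: "Q s (T G) Z = (LBINT x. \<bar>det (L.J x)\<bar> * (P.C (L.\<Phi> x) (G (L.\<Phi> x)) \<bullet> (Z x ** R s x)))" for Z
  unfolding Q_def q_def TR CP det ..
 show "energy_form \<Omega> (inclusion_tensor li mi le me D') u v = Q s (T G) (T H)" if v: "H1_rep \<Omega> v p' H"
 proof -
  have [measurable]: "H Borel" by (rule H1_repD(8)[OF v])
  have m: "(\<lambda>y. P.C y (G y) \<bullet> H y) Borel" by measurable
  show ?thesis
   unfolding P.energy_form_eq_Q[OF u v \<Omega>] Qs TR unfolding P.Q_def P.q_0
   using L.change_of_variables(1)[OF m] by simp
 qed
 show "Q s (T G) Z = 0" if sol: "dirichlet_solution \<Omega> (inclusion_tensor li mi le me D') f u" and Z: "null_gradient \<Omega> Z"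
 proof -
  obtain K0 where K0: "K0 >= 0" "\<And>x A. norm (P.C x A) <= K0 * norm A" using P.C_bound by blast
  define h where "h y = P.C y (G y)" for y
  have hm [measurable]: "h Borel" unfolding h_def[abs_def] by measurable
  have sh: "L2 h"
   by (rule L2_bound[OF U(2), of _ K0]) (use K0 hm in \<open>auto simp: h_def\<close>)
  have dh: "divfree \<Omega> h" unfolding h_def[abs_def] by (rule P.solution_divfree[OF sol u \<Omega>])
  \<comment> \<open>The Piola transform of the stress h: pairing k with a gradient amounts to
    pairing h with the transported gradient.\<close>
  define k where "k x = det (mat 1 + s *R E x) *R (h (L.\<Phi> x) ** transpose (R s x))" for x
  have kin: "k x \<bullet> Y = \<bar>det (L.J x)\<bar> * (h (L.\<Phi> x) \<bullet> (Y ** R s x))" for x Y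
   by (simp add: k_def inner_mult_transpose det)
  have Rb: "norm (R s x *v y) <= 2 * norm y" for x y
   using perturbed_inverse_bound[OF sE[OF s1], of x y] by (simp add: R_def)
  have sGP: "L2 (\<lambda>x. G (L.\<Phi> x))"
  proof (rule L2_bound[OF sTG, of _ 2])
   have "norm (T G x ** R s x) <= norm (T G x) * 2" for x by (rule norm_matrix_mult_le[OF Rb]) simp
   then show "AE x in lborel. norm (G (L.\<Phi> x)) <= 2 * norm (T G x)" unfolding TR by (simp add: mult.commute)
   show "(\<lambda>x. G (L.\<Phi> x)) \<in> borel_measurable lborel" using measurable_compose[OF L.borel_measurable_maps(2) Gm] by simp
  qed
  have tm: "(\<lambda>x. transpose (R s x)) Borel"
  proof -
   have "continuous_on UNIV (transpose :: real^3^3 => real^3^3)" unfolding transpose_def[abs_def] by (intro continuous_intros)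
   from measurable_compose[OF Rm borel_measurable_continuous_onI[OF this]] show ?thesis .
  qed
  have sk: "L2 k"
  proof (rule L2_bound[OF sGP, of _ "2 * (K0 * (norm (mat 1 :: real^3^3) * 2))"])
   have "norm (k x) <= 2 * (K0 * (norm (mat 1 :: real^3^3) * 2)) * norm (G (L.\<Phi> x))" for x
   proof -
    have d: "\<bar>det (mat 1 + s *R E x)\<bar> <= 2" using det_expansion(2)[OF Eb s1, of x] s by linarith
    have "norm (R s x) = norm (mat 1 ** R s x)" by simp
    also have "\<dots> <= norm (mat 1 :: real^3^3) * 2" by (rule norm_matrix_mult_le[OF Rb]) simp
    finally have n: "norm (transpose (R s x)) <= norm (mat 1 :: real^3^3) * 2" by simp
    have "norm (h (L.\<Phi> x) ** transpose (R s x)) <= norm (h (L.\<Phi> x)) * (norm (mat 1 :: real^3^3) * 2)"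
     by (rule norm_matrix_mult_le[OF order_trans[OF norm_matrix_vector_mult mult_right_mono[OF n]]]) auto
    also have "\<dots> <= (K0 * norm (G (L.\<Phi> x))) * (norm (mat 1 :: real^3^3) * 2)"
     using K0(2) by (intro mult_right_mono) (auto simp: h_def)
    finally have "norm (k x) <= 2 * ((K0 * norm (G (L.\<Phi> x))) * (norm (mat 1 :: real^3^3) * 2))"
     unfolding k_def norm_scaleR using d by (intro mult_mono) auto
    then show ?thesis by (simp only: mult_ac)
   qed
   then show "AE x in lborel. norm (k x) <= 2 * (K0 * (norm (mat 1 :: real^3^3) * 2)) * norm (G (L.\<Phi> x))" by simp
   have "(\<lambda>x. h (L.\<Phi> x)) Borel" by (rule measurable_compose[OF L.borel_measurable_maps(2) hm])
   then show "k \<in> borel_measurable lborel"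
    unfolding k_def[abs_def] using borel_measurable_scaleR[OF detm borel_measurable_matrix_mult[OF _ tm]] by simp
  qed
  have "divfree \<Omega> k"
   unfolding divfree_def
  proof (intro conjI allI impI sk)
   fix \<phi> :: "real^3 => real^3" assume \<phi>: "test_function \<Omega> \<phi>"
   \<comment> \<open>The gradient of \<phi> o \<Theta>. This function has compact support in
     \<Omega> but is merely Lipschitz, so the equation for h is extended to it by
     \<open>divfree_orthogonal_compact\<close>.\<close>
   define N where "N y = jacobian \<phi> (at (L.\<Theta> y)) ** L.B (L.\<Theta> y)" for y
   obtain K2 where K2: "compact K2" "K2 \<subseteq> \<Omega>" "\<And>x. x \<notin> K2 ==> \<phi> x = 0" using test_supp[OF \<phi>] by auto
   have t: "test_function \<Omega> (\<lambda>x. \<phi> x $ i)" for i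
    by (rule test_functionI[OF smooth_bounded_linear[OF bounded_linear_vec_nth test_smooth[OF \<phi>]] K2(1,2)]) (use K2(3) in force)
   have Nrow: "wgrad (\<lambda>y. \<phi> (L.\<Theta> y) $ i) (\<lambda>y. N y $ i)" for i
    using L.wgrad_comp_\<Theta>[OF wgrad_test_function[OF t[of i]]]
    unfolding N_def matrix_mult_row grad_component[OF test_smooth[OF \<phi>]] .
   have cK: "compact (L.\<Phi> ` K2)" by (intro compact_continuous_image continuous_on_subset[OF L.\<Phi>_continuous] K2) simp
   have sK: "L.\<Phi> ` K2 \<subseteq> \<Omega>" using stay[OF _ K(2)] K2(2) by blast
   have N0: "(LBINT y. h y $ i \<bullet> N y $ i) = 0" for i
   proof (rule divfree_orthogonal_compact[OF divfree_row[OF dh] Nrow \<Omega> cK sK])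
    fix y assume "y \<notin> L.\<Phi> ` K2"
    then have "L.\<Theta> y \<notin> K2" using L.\<Phi>_\<Theta> by (metis image_eqI)
    then show "\<phi> (L.\<Theta> y) $ i = 0" by (simp add: K2(3))
   qed
   have Nm: "N Borel"
    unfolding N_def[abs_def]
    by (intro borel_measurable_matrix_mult measurable_compose[OF L.borel_measurable_maps(3) borel_measurable_continuous_onI[OF jacobian_continuous[OF test_smooth[OF \<phi>]]]]
      measurable_compose[OF L.borel_measurable_maps(3) L.borel_measurable_maps(6)])
   have sN: "L2 N"
   proof (rule L2_rows)
    show "L2 (\<lambda>x. N x $ i)" for i by (rule wgradD(2)[OF Nrow])
   qed (use Nm in simp)
   have m: "(\<lambda>y. h y \<bullet> N y) Borel" using Nm by measurable
   have "(LBINT x. k x \<bullet> jacobian \<phi> (at x)) = (LBINT y. h y \<bullet> N y)"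
    unfolding L.change_of_variables(1)[OF m] kin by (simp add: N_def RB)
   also have "\<dots> = 0" unfolding integral_row_sum[OF sh sN] using N0 by simp
   finally show "(LBINT x. k x \<bullet> jacobian \<phi> (at x)) = 0" .
  qed
  from null_gradient_orthogonal[OF Z this] show ?thesis unfolding Qs kin h_def .
 qed
qed

end

text \<open>V' may differ from V outside \<Omega>, because \<open>inv_into \<Omega>\<close> is
  arbitrary there.\<close>

lemma is_weak_gradient_lip_field:
 assumes L: "lip_field V E c" and \<Omega>: "open \<Omega>" and eq: "\<And>x. x \<in> \<Omega> ==> V' x = V x"
 shows "is_weak_gradient \<Omega> V' E"
 unfolding is_weak_gradient_def
proof (intro conjI allI impI)
 interpret L: lip_field V E c by (rule L)
 have \<Omega>b: "\<Omega> \<in> sets borel" using \<Omega> by simp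
 have Vm: "V Borel" using L.V_integrable by (rule integrable_lborel_measurable)
 fix K :: "(real^3) set" assume K: "compact K \<and> K \<subseteq> \<Omega>"
 then have Kb [measurable]: "K \<in> sets borel" by (simp add: borel_compact)
 have i: "integrable (lebesgue_on K) f" if F: "L1 F" and e: "\<And>x. x \<in> K ==> f x = F x" for f F :: "real^3 => 'z::euclidean_space"
 proof -
  have "L1 (\<lambda>x. indicator K x *R F x)" by (rule integrable_bounded_scaleR[OF F, where B=1]) (auto simp: indicator_def)
  then show ?thesis
   by (subst lebesgue_on_eq_lborel(2)[OF Kb, of "\<lambda>x. indicator K x *R F x"]) (auto simp: e intro: integrable_lborel_measurable)
 qed
 show "integrable (lebesgue_on K) V'" by (rule i[OF L.V_integrable]) (use eq K in auto)
 show "integrable (lebesgue_on K) E" by (rule i[OF L.A_integrable]) simp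
next
 interpret L: lip_field V E c by (rule L)
 have \<Omega>b: "\<Omega> \<in> sets borel" using \<Omega> by simp
 fix \<phi> :: "real^3 => real" and i j assume \<phi>: "test_function \<Omega> \<phi>"
 let ?D = "\<lambda>x. dd \<phi> x (axis j 1)"
 note W = wgradD[OF L.W[of i]]
 have m: "\<phi> Borel" "?D Borel"
  using smooth_measurable[OF test_smooth[OF \<phi>]] smooth_measurable[OF smooth_deriv[OF test_smooth[OF \<phi>]]] .
 have Em: "(\<lambda>x. E x $ i $ j) Borel" using L2_measurable[OF L2_nth[OF W(2), of j]] by simp
 obtain K where K: "K \<subseteq> \<Omega>" "\<And>x. x \<notin> K ==> \<phi> x = 0" "\<And>x b. x \<notin> K ==> dd \<phi> x b = 0"
  using test_supp_deriv[OF \<phi>] by auto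
 have "(\<integral>x. V' x $ i * ?D x \<partial>lebesgue_on \<Omega>) = (LBINT x. V x $ i * ?D x)"
  by (rule lebesgue_on_eq_lborel(1)[OF \<Omega>b borel_measurable_times[OF W(5) m(2)]]) (use K eq in auto)
 moreover have "(\<integral>x. E x $ i $ j * \<phi> x \<partial>lebesgue_on \<Omega>) = (LBINT x. E x $ i $ j * \<phi> x)"
  by (rule lebesgue_on_eq_lborel(1)[OF \<Omega>b borel_measurable_times[OF Em m(1)]]) (use K in auto)
 moreover have "(LBINT x. V x $ i * ?D x) = - (LBINT x. (E x $ i \<bullet> axis j 1) * \<phi> x)" by (rule W(7)[OF test_UNIV[OF \<phi>]])
 ultimately show "(\<integral>x. V' x $ i * ?D x \<partial>lebesgue_on \<Omega>) = - (\<integral>x. E x $ i $ j * \<phi> x \<partial>lebesgue_on \<Omega>)"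
  by (simp add: inner_axis)
qed

text \<open>A Sobolev gradient is determined and bounded almost everywhere only. Setting a Borel
  representative to 0 off S and wherever it violates the bound changes it on a null set: off S it
  vanishes almost everywhere, by testing, as U is 0 there.\<close>

lemma lip_field_of_W1inf:
 assumes U: "U \<in> W1inf UNIV" "continuous_on UNIV U" and S: "compact S" "\<And>x. x \<notin> S ==> U x = 0"
  and b: "AE x in lborel. norm (weak_gradient UNIV U x) <= c" and c: "0 <= c" "c < 1"
 shows "\<exists>A. lip_field U A c \<and> (\<forall>x. x \<notin> S --> A x = 0)"
proof -
 let ?G = "weak_gradient UNIV U"
 obtain G1 where "is_weak_gradient UNIV U G1" using U(1) by (auto simp: W1inf_def)
 then have wg: "is_weak_gradient UNIV U ?G" by (rule is_weak_gradient_weak_gradient)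
 obtain F where F [measurable]: "F Borel" and Fa: "AE x in lborel. F x = ?G x"
  using borel_representative_on[OF weak_gradient_measurable[OF wg open_UNIV]] by auto
 have Sb [measurable]: "S \<in> sets borel" using S(1) by (simp add: borel_compact)
 define A where "A x = (if x \<in> S \<and> norm (F x) <= c then F x else 0)" for x
 have Am [measurable]: "A Borel" unfolding A_def[abs_def] by measurable
 have nA: "norm (A x) <= c" for x using c by (simp add: A_def)
 have A0: "A x = 0" if "x \<notin> S" for x using that by (simp add: A_def)
 have Um: "U Borel" by (rule borel_measurable_continuous_onI[OF U(2)])
 have cm: "(\<lambda>M :: real^3^3. M $ i $ j) Borel" for i j by (intro borel_measurable_continuous_onI continuous_intros)
 have orth: "(LBINT x. U x $ i * dd \<phi> x (axis j 1)) = - (LBINT x. F x $ i $ j * \<phi> x)"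
  if \<phi>: "test_function UNIV \<phi>" for \<phi> :: "real^3 => real" and i j
 proof -
  let ?D = "\<lambda>x. dd \<phi> x (axis j 1)"
  have m: "\<phi> Borel" "?D Borel"
   using smooth_measurable[OF test_smooth[OF \<phi>]] smooth_measurable[OF smooth_deriv[OF test_smooth[OF \<phi>]]] .
  have Ui: "(\<lambda>x. U x $ i) Borel" by (intro borel_measurable_continuous_onI continuous_on_component U(2))
  have "(\<integral>x. U x $ i * ?D x \<partial>lebesgue_on UNIV) = (LBINT x. U x $ i * ?D x)"
   by (rule lebesgue_on_eq_lborel(1)[OF _ borel_measurable_times[OF Ui m(2)]]) auto
  moreover have "(\<integral>x. ?G x $ i $ j * \<phi> x \<partial>lebesgue_on UNIV) = (LBINT x. F x $ i $ j * \<phi> x)"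
  proof (rule lebesgue_on_eq_lborel(1)[OF _ borel_measurable_times[OF measurable_compose[OF F cm] m(1)]])
   show "AE x in lborel. x \<in> UNIV --> F x $ i $ j * \<phi> x = ?G x $ i $ j * \<phi> x" using Fa by eventually_elim simp
  qed auto
  ultimately show ?thesis using wg \<phi> by (simp add: is_weak_gradient_def)
 qed
 have Fb: "AE x in lborel. norm (F x) <= c" using Fa b by eventually_elim simp
 have loc: "L1 (\<lambda>x. indicator K x * F x $ i $ j)" if K: "compact K" for K i j
 proof -
  have [measurable]: "K \<in> sets borel" using K by (simp add: borel_compact)
  have "L1 (\<lambda>x. c * indicator K x :: real)" using emeasure_compact_finite[OF K] by (intro integrable_mult_right) (simp add: K borel_compact)
  then show ?thesis
  proof (rule Bochner_Integration.integrable_bound)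
   have "(\<lambda>x. F x $ i $ j) Borel" by (rule measurable_compose[OF F cm])
   then show "(\<lambda>x. indicator K x * F x $ i $ j) \<in> borel_measurable lborel" by simp
   show "AE x in lborel. norm (indicator K x * F x $ i $ j) <= norm (c * indicator K x)"
    using Fb
   proof eventually_elim
    case (elim x)
    have "\<bar>F x $ i $ j\<bar> <= norm (F x)" using component_le_norm_cart[of "F x $ i" j] Finite_Cartesian_Product.norm_nth_le[of "F x" i] by linarith
    then show ?case using elim by (auto simp: indicator_def)
   qed
  qed
 qed
 have F0: "AE x in lborel. x \<in> - S --> F x = 0"
 proof -
  have "AE x in lborel. x \<in> - S --> F x $ i $ j = 0" for i j
  proof (rule null_of_test_orthogonal)
   show "(\<lambda>x. F x $ i $ j) Borel" by (rule measurable_compose[OF F cm])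
   show "open (- S)" using S(1) by (simp add: compact_imp_closed open_Compl)
   show "L1 (\<lambda>x. indicator K x * F x $ i $ j)" if "compact K" for K by (rule loc[OF that])
   fix \<phi> :: "real^3 => real" assume \<phi>: "test_function (- S) \<phi>"
   obtain K where K: "K \<subseteq> - S" "\<And>x b. x \<notin> K ==> dd \<phi> x b = 0" using test_supp_deriv[OF \<phi>] by auto
   have "U x $ i * dd \<phi> x (axis j 1) = 0" for x using K S(2)[of x] by (cases "x \<in> K") auto
   then have "(LBINT x. U x $ i * dd \<phi> x (axis j 1)) = 0" by (simp only: Bochner_Integration.integral_zero)
   then show "(LBINT x. F x $ i $ j * \<phi> x) = 0" using orth[OF test_UNIV[OF \<phi>], of i j] by linarith
  qed
  then have "AE x in lborel. \<forall>i\<in>UNIV. \<forall>j\<in>UNIV. x \<in> - S --> F x $ i $ j = 0" by (intro AE_finite_allI) auto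
  then show ?thesis by eventually_elim (auto simp: vec_eq_iff)
 qed
 have AF: "AE x in lborel. A x = F x" using F0 Fb by eventually_elim (auto simp: A_def)
 have cS: "L1 (\<lambda>x. d * indicator S x :: real)" for d using emeasure_compact_finite[OF S(1)] by (intro integrable_mult_right) (simp add: S borel_compact)
 have sA: "L2 A"
  unfolding square_integrable_def
 proof
  show "L1 (\<lambda>x. (norm (A x))\<^sup>2)"
  proof (rule Bochner_Integration.integrable_bound[OF cS[of "c\<^sup>2"]])
   have "(norm (A x))\<^sup>2 <= c\<^sup>2 * indicator S x" for x using A0[of x] nA[of x] by (cases "x \<in> S") (auto intro: power_mono)
   then show "AE x in lborel. norm ((norm (A x))\<^sup>2) <= norm (c\<^sup>2 * indicator S x)" by (simp add: abs_mult)
  qed simp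
 qed simp
 have sU: "L2 U"
  unfolding square_integrable_def
 proof
  have "continuous_on UNIV (\<lambda>x. (norm (U x))\<^sup>2)" by (intro continuous_intros U(2))
  then show "L1 (\<lambda>x. (norm (U x))\<^sup>2)" by (rule compact_support_integrable[OF _ S(1)]) (simp add: S(2))
 qed (use Um in simp)
 have W: "wgrad (\<lambda>x. U x $ i) (\<lambda>x. A x $ i)" for i
  unfolding wgrad_def
 proof
  show "wgrad_on UNIV (\<lambda>x. U x $ i) (\<lambda>x. A x $ i)"
  proof (rule wgrad_onI_axis[OF L2_nth[OF sU] L2_nth[OF sA]])
   fix \<phi> :: "real^3 => real" and j assume \<phi>: "test_function UNIV \<phi>"
   have m: "\<phi> Borel" by (rule smooth_measurable[OF test_smooth[OF \<phi>]])
   have "(LBINT x. A x $ i $ j * \<phi> x) = (LBINT x. F x $ i $ j * \<phi> x)"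
   proof (rule integral_cong_AE)
    show "AE x in lborel. A x $ i $ j * \<phi> x = F x $ i $ j * \<phi> x" using AF by eventually_elim simp
   qed (use measurable_compose[OF F cm] measurable_compose[OF Am cm] m in simp_all)
   then show "(LBINT x. U x $ i * dd \<phi> x (axis j 1)) = - (LBINT x. A x $ i $ j * \<phi> x)"
    using orth[OF \<phi>] by simp
  qed
  show "\<exists>S. bounded S \<and> (\<forall>x. x \<notin> S --> U x $ i = 0 \<and> A x $ i = 0)"
   using S A0 by (intro exI[of _ S]) (auto simp: compact_imp_bounded)
 qed
 have "lip_field U A c" using W U(2) nA c by unfold_locales auto
 then show ?thesis using A0 by blast
qed

text \<open>The regularity of the outer boundary is contained in that of \<Omega> - D. Since D is
  closed and lies in \<Omega>, points of the frontier of \<Omega> belong to the frontier of \<Omega>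
  - D, and they are at distance at least \<open>r\<^sub>0\<close> from D.\<close>

lemma inner_cone_class_P:
 assumes P: "class_P \<Omega> r\<^sub>0 M\<^sub>0 \<theta>\<^sub>0 D \<F>" and \<Omega>: "open \<Omega>" and r0: "0 < r\<^sub>0" and M0: "1 <= M\<^sub>0" and p: "P \<in> closure \<Omega>"
 shows "\<exists>\<rho> e \<kappa> \<tau>. inner_cone \<Omega> P \<rho> e \<kappa> \<tau>"
proof (cases "P \<in> \<Omega>")
 case True
 then show ?thesis by (rule inner_cone_interior[OF \<Omega>])
next
 case False
 have D: "closed D" "D \<subseteq> \<Omega>" "setdist D (frontier \<Omega>) >= r\<^sub>0" "lipschitz_portion (\<Omega> - D) (frontier (\<Omega> - D)) r\<^sub>0 M\<^sub>0"
  using P by (auto simp: class_P_def polyhedral_body_def lipschitz_boundary_def)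
 have fr: "P \<in> frontier \<Omega>" using p False \<Omega> by (simp add: frontier_def interior_open)
 have "P \<in> - D \<inter> closure \<Omega>" using False D(2) p by auto
 then have "P \<in> closure (- D \<inter> \<Omega>)" using open_Int_closure_subset[of "- D" \<Omega>] D(1) by (auto simp: open_Compl)
 moreover have "P \<notin> interior (\<Omega> - D)" using False interior_subset by blast
 ultimately have "P \<in> frontier (\<Omega> - D)" by (simp add: frontier_def Diff_eq Int_commute)
 moreover have "r\<^sub>0 <= dist P x" if "x \<in> D" for x
  using setdist_le_dist[OF that fr] D(3) by (simp add: dist_commute)
 ultimately show ?thesis by (rule inner_cone_lipschitz[OF D(4) _ r0 M0])
qed

text \<open>A segment from a point of D to a point outside \<Omega> crosses the frontier, which is
  at distance at least r from D, so it is longer than r / 4.\<close>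

lemma collar_subset_domain:
 fixes D \<Omega> :: "(real^3) set"
 assumes D: "compact D" "D \<noteq> {}" "D \<subseteq> \<Omega>" and d: "setdist D (frontier \<Omega>) >= r" and r: "r > 0"
 shows "compact {x. infdist x D <= r / 4}" "{x. infdist x D <= r / 4} \<subseteq> \<Omega>"
proof -
 have at: "\<exists>y\<in>D. dist x y <= r / 4" if "infdist x D <= r / 4" for x
  using infdist_attains_inf[OF compact_imp_closed[OF D(1)] D(2), of x] that by metis
 show "compact {x. infdist x D <= r / 4}"
 proof (rule compact_eq_bounded_closed[THEN iffD2], rule conjI)
  obtain b where b: "\<And>y. y \<in> D ==> norm y <= b" using compact_imp_bounded[OF D(1)] by (auto simp: bounded_iff)
  have "norm x <= b + r / 4" if near: "infdist x D <= r / 4" for x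
  proof -
   obtain y where y: "y \<in> D" "dist x y <= r / 4" using at[OF near] by blast
   then show ?thesis using b[OF y(1)] norm_triangle_sub[of x y] by (simp add: dist_norm)
  qed
  then show "bounded {x. infdist x D <= r / 4}" by (auto simp: bounded_iff)
  show "closed {x. infdist x D <= r / 4}" by (intro closed_Collect_le continuous_intros)
 qed
 show "{x. infdist x D <= r / 4} \<subseteq> \<Omega>"
 proof (rule subsetI, rule ccontr)
  fix x assume "x \<in> {x. infdist x D <= r / 4}" and x: "x \<notin> \<Omega>"
  then obtain y where y: "y \<in> D" "dist x y <= r / 4" using at by blast
  have "closed_segment y x \<inter> frontier \<Omega> \<noteq> {}"
   using x y(1) D(3) by (intro connected_Int_frontier) auto
  then obtain z where z: "z \<in> closed_segment y x" "z \<in> frontier \<Omega>" by blast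
  have "dist y z <= dist y x" using dist_in_closed_segment[OF z(1)] by (simp add: dist_commute)
  then show False using setdist_le_dist[OF y(1) z(2)] d y(2) r by (simp add: dist_commute)
 qed
qed

text \<open>\<open>d <= r / (3 * K)\<close> gives K d <= r / 3, and the weight r in front of the
  gradient norm cancels.\<close>

lemma Linf_gradient_bound:
 assumes b: "a + ennreal r * Linf_norm UNIV G <= ennreal (K * d)" and d: "d <= r / (3 * K)" and K: "K > 0" and r: "r > 0"
 shows "AE x in lborel. norm (G x) <= 1/3"
proof -
 have Kd: "K * d <= r / 3" using d K by (simp add: field_simps)
 have "AE x in lebesgue_on UNIV. ennreal (norm (G x)) <= Linf_norm UNIV G" unfolding Linf_norm_def by (rule esssup_AE)
 then have "AE x in lborel. x \<in> UNIV --> ennreal (norm (G x)) <= Linf_norm UNIV G" by (subst (asm) AE_lebesgue_on_iff) auto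
 then show ?thesis
 proof eventually_elim
  case (elim x)
  have "ennreal (r * norm (G x)) = ennreal r * ennreal (norm (G x))" using r by (simp add: ennreal_mult)
  also have "\<dots> <= ennreal r * Linf_norm UNIV G" using elim by (intro mult_left_mono) auto
  also have "\<dots> <= a + ennreal r * Linf_norm UNIV G" by simp
  also have "\<dots> <= ennreal (K * d)" by (rule b)
  also have "\<dots> <= ennreal (r / 3)" by (rule ennreal_leI[OF Kd])
  finally have "r * norm (G x) <= r / 3" using r by (subst (asm) ennreal_le_iff) auto
  then show ?case using r by (simp add: field_simps)
 qed
qed

text \<open>The geometry of polyhedra is reduced to what the analysis uses: inner cones, a compact
  inclusion, and a compactly supported Lipschitz field with gradient bound 1/3.\<close>

lemma shape_derivative:
 fixes U :: "real^3 => real^3" and u v :: "real => real^3 => real^3" and D0 \<Omega> :: "(real^3) set"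
 assumes \<Omega>: "open \<Omega>" "bounded \<Omega>" and cone: "\<And>P. P \<in> closure \<Omega> ==> \<exists>\<rho> e \<kappa> \<tau>. inner_cone \<Omega> P \<rho> e \<kappa> \<tau>"
  and D0: "compact D0" and lame: "lame_admissible \<alpha> \<gamma> li mi" "lame_admissible \<alpha> \<gamma> le me" "0 < \<alpha>" "0 < \<gamma>"
  and U: "lip_field U A (1/3)" and S: "compact S" "S \<subseteq> \<Omega>" "\<And>x. x \<notin> S ==> U x = 0 \<and> A x = 0"
  and bij: "\<And>t. t \<in> {0..1} ==> bij_betw (flow_map U t) \<Omega> \<Omega>"
  and u: "\<And>t. t \<in> {0..1} ==> dirichlet_solution \<Omega> (inclusion_tensor li mi le me (flow_map U t ` D0)) f (u t)"
  and v: "\<And>t. t \<in> {0..1} ==> dirichlet_solution \<Omega> (inclusion_tensor li mi le me (flow_map U t ` D0)) g (v t)"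
  and t0: "t\<^sub>0 \<in> {0..1}"
 defines "\<CC> \<equiv> \<lambda>t. inclusion_tensor li mi le me (flow_map U t ` D0)"
 defines "F \<equiv> \<lambda>t. energy_form \<Omega> (\<CC> t) (u t) (v t)"
 defines "Du \<equiv> weak_gradient \<Omega> (u t\<^sub>0)" and "Dv \<equiv> weak_gradient \<Omega> (v t\<^sub>0)"
  and "DV \<equiv> weak_gradient \<Omega> (U \<circ> inv_into \<Omega> (flow_map U t\<^sub>0))"
 shows "F t\<^sub>0 = DN_pairing \<Omega> (\<CC> t\<^sub>0) f g"
  and "(F has_real_derivative
       (\<integral>x. (\<CC> t\<^sub>0 x (Du x) ** (trace (DV x) *R mat 1 - transpose (DV x))
          - \<CC> t\<^sub>0 x (Du x ** DV x)) \<bullet> Dv x \<partial>lebesgue_on \<Omega>)) (at t\<^sub>0 within {0..1})"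
proof -
 interpret U: lip_field U A "1/3" by (rule U)
 have t0': "\<bar>t\<^sub>0\<bar> <= 1" using t0 by auto
 interpret L: lip_field "\<lambda>x. t\<^sub>0 *R U x" "\<lambda>x. t\<^sub>0 *R A x" "\<bar>t\<^sub>0\<bar> * (1/3)" by (rule U.lip_field_scale[OF t0'])
 have \<Phi>: "L.\<Phi> = flow_map U t\<^sub>0" by (simp add: L.\<Phi>_def[abs_def] flow_map_def[abs_def])
 define V where "V y = U (L.\<Theta> y)" for y
 define E where "E y = A (L.\<Theta> y) ** L.B (L.\<Theta> y)" for y
 \<comment> \<open>For times of size at most 1 the inverse Jacobian matrix has operator norm at most
   3/2, hence (1/3)(3/2) = 1/2.\<close>
 have Eb: "norm (E y) <= 1/2" for y
 proof -
  have k: "1 - \<bar>t\<^sub>0\<bar> * (1/3) >= 2/3" using t0' by simp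
  then have i: "inverse (1 - \<bar>t\<^sub>0\<bar> * (1/3)) <= 3/2" "0 <= inverse (1 - \<bar>t\<^sub>0\<bar> * (1/3))"
   using le_imp_inverse_le[OF k] by simp_all
  have "norm (E y) <= norm (A (L.\<Theta> y)) * inverse (1 - \<bar>t\<^sub>0\<bar> * (1/3))" unfolding E_def by (rule norm_matrix_mult_le[OF L.B_bound i(2)])
  also have "\<dots> <= (1/3) * (3/2)" using U.Ac i by (intro mult_mono) auto
  finally show ?thesis by simp
 qed
 have Vlip: "lip_field V E (1/2)"
 proof
  show "wgrad (\<lambda>x. V x $ i) (\<lambda>x. E x $ i)" for i
   using L.wgrad_comp_\<Theta>[OF U.W[of i]] by (simp add: V_def E_def matrix_mult_row)
  show "continuous_on UNIV V" unfolding V_def by (rule continuous_on_compose2[OF U.cont L.\<Theta>_continuous]) auto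
 qed (use Eb in auto)
 define K where "K = L.\<Phi> ` S"
 have cK: "compact K" unfolding K_def by (intro compact_continuous_image continuous_on_subset[OF L.\<Phi>_continuous] S) simp
 have sK: "K \<subseteq> \<Omega>" using bij[OF t0] S(2) unfolding K_def \<Phi> bij_betw_def by blast
 have zK: "V y = 0 \<and> E y = 0" if "y \<notin> K" for y
 proof -
  have "L.\<Theta> y \<notin> S" using that unfolding K_def by (metis L.\<Phi>_\<Theta> image_eqI)
  then show ?thesis using S(3) by (simp add: V_def E_def matrix_matrix_mult_def vec_eq_iff)
 qed
 \<comment> \<open>V composed with the map at time \<open>t\<^sub>0\<close> is U, so moving on for a
   time s is the map id + s V; it carries the inclusion at \<open>t\<^sub>0\<close> onto the one at
   \<open>t\<^sub>0 + s\<close>.\<close>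
 have shift: "y + s *R V y \<in> flow_map U (t\<^sub>0 + s) ` D0 \<longleftrightarrow> y \<in> flow_map U t\<^sub>0 ` D0" if s: "\<bar>s\<bar> <= 1" for s y
 proof -
  interpret P: lip_field "\<lambda>x. s *R V x" "\<lambda>x. s *R E x" "\<bar>s\<bar> * (1/2)" by (rule lip_field.lip_field_scale[OF Vlip s])
  have comp: "flow_map U (t\<^sub>0 + s) x = P.\<Phi> (flow_map U t\<^sub>0 x)" for x
  proof -
   have "V (flow_map U t\<^sub>0 x) = U x" unfolding V_def \<Phi>[symmetric] by simp
   then show ?thesis by (simp add: P.\<Phi>_def flow_map_def algebra_simps)
  qed
  have "P.\<Phi> y \<in> flow_map U (t\<^sub>0 + s) ` D0 \<longleftrightarrow> P.\<Phi> y \<in> P.\<Phi> ` (flow_map U t\<^sub>0 ` D0)" by (simp add: comp image_image)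
  also have "\<dots> \<longleftrightarrow> y \<in> flow_map U t\<^sub>0 ` D0" using bij_is_inj[OF P.\<Phi>_bij] by (rule inj_image_mem_iff)
  finally show ?thesis by (simp add: P.\<Phi>_def)
 qed
 have Db: "flow_map U t ` D0 \<in> sets borel" for t
 proof -
  have "compact (flow_map U t ` D0)" unfolding flow_map_def
   by (intro compact_continuous_image D0 continuous_intros continuous_on_subset[OF U.cont]) simp
  then show ?thesis by (rule borel_compact)
 qed
 have Em: "E Borel" by (rule lip_field.A_measurable[OF Vlip])
 interpret E: pulled_back_energy li mi le me \<alpha> \<gamma> "flow_map U t\<^sub>0 ` D0" E by unfold_locales (use lame Db Em Eb in auto)
 have CC: "\<CC> t\<^sub>0 = inclusion_tensor li mi le me (flow_map U t\<^sub>0 ` D0)" by (simp add: \<CC>_def)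
 show "F t\<^sub>0 = DN_pairing \<Omega> (\<CC> t\<^sub>0) f g"
  unfolding F_def CC by (rule E.energy_form_eq_DN_pairing[OF \<Omega> cone u[OF t0] v[OF t0]])
 have ex: "\<exists>p G. H1_rep \<Omega> w p G" if "dirichlet_solution \<Omega> C' f' w" for C' f' w
  using H1_rep_exists[OF _ \<Omega>(1), of w] that by (simp add: dirichlet_solution_def)
 have "\<forall>t. \<exists>G. t \<in> {0..1} --> (\<exists>p. H1_rep \<Omega> (u t) p G)" using ex[OF u] by blast
 from choice[OF this] obtain G where G: "\<And>t. t \<in> {0..1} ==> \<exists>p. H1_rep \<Omega> (u t) p (G t)" by auto
 have "\<forall>t. \<exists>G. t \<in> {0..1} --> (\<exists>p. H1_rep \<Omega> (v t) p G)" using ex[OF v] by blast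
 from choice[OF this] obtain H where H: "\<And>t. t \<in> {0..1} ==> \<exists>p. H1_rep \<Omega> (v t) p (H t)" by auto
 obtain p0 where p0: "H1_rep \<Omega> (u t\<^sub>0) p0 (G t\<^sub>0)" using G[OF t0] by auto
 obtain q0 where q0: "H1_rep \<Omega> (v t\<^sub>0) q0 (H t\<^sub>0)" using H[OF t0] by auto
 define T where "T s M x = M (x + s *R V x) ** (mat 1 + s *R E x)" for s and M :: "real^3 => real^3^3" and x
 have tr: "has_trace \<Omega> (u t) f" "has_trace \<Omega> (v t) g" if "t \<in> {0..1}" for t
  using u[OF that] v[OF that] by (simp_all add: dirichlet_solution_def)
 \<comment> \<open>Derivatives are taken within the shifted interval, which makes those at the end
   points one-sided.\<close>
 let ?S = "(\<lambda>t. t - t\<^sub>0) ` {0..1}"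
 have St: "t\<^sub>0 + s \<in> {0..1}" if "s \<in> ?S" for s using that by auto
 have null: "null_gradient \<Omega> (\<lambda>x. T s M x - M0 x)"
  if s: "\<bar>s\<bar> <= 1/4" and M: "H1_rep \<Omega> w p M" "H1_rep \<Omega> w0 p' M0" and t: "has_trace \<Omega> w k" "has_trace \<Omega> w0 k" for s M M0 w w0 p p' k
 proof -
  have "\<bar>s\<bar> <= 1" using s by simp
  note sh = shift[OF this]
  have "null_gradient \<Omega> (\<lambda>x. T s M x - M x)"
   unfolding T_def by (rule E.pull_back_null[OF Vlip \<Omega>(1) cK sK zK s Db sh M(1)])
  from null_gradient_add[OF this trace_difference_null[OF \<Omega> cone t(1) M(1) t(2) M(2)]]
  show ?thesis by simp
 qed
 have "((\<lambda>s. F (t\<^sub>0 + s)) has_real_derivative (LBINT x. E.\<beta> x (G t\<^sub>0 x) (H t\<^sub>0 x))) (at 0 within ?S)"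
 proof (rule E.energy_derivative[where \<Omega>=\<Omega> and \<epsilon>="1/4" and Gs="\<lambda>s. T s (G (t\<^sub>0 + s))" and Hs="\<lambda>s. T s (H (t\<^sub>0 + s))"])
  show "L2 (G t\<^sub>0)" "L2 (H t\<^sub>0)" by (rule H1_repD(2)[OF p0] H1_repD(2)[OF q0])+
  show "E.Q 0 (G t\<^sub>0) Z = 0" if "null_gradient \<Omega> Z" for Z by (rule E.solution_orthogonal[OF u[OF t0] p0 \<Omega>(1) that])
  show "E.Q 0 (H t\<^sub>0) Z = 0" if "null_gradient \<Omega> Z" for Z by (rule E.solution_orthogonal[OF v[OF t0] q0 \<Omega>(1) that])
  show "F (t\<^sub>0 + 0) = E.Q 0 (G t\<^sub>0) (H t\<^sub>0)" unfolding F_def using E.energy_form_eq_Q[OF p0 q0 \<Omega>(1)] by (simp add: CC)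
  fix s assume sS: "s \<in> ?S" and s: "\<bar>s\<bar> <= 1/4"
  note t = St[OF sS]
  have s1: "\<bar>s\<bar> <= 1" using s by simp
  obtain p where p: "H1_rep \<Omega> (u (t\<^sub>0 + s)) p (G (t\<^sub>0 + s))" using G[OF t] by auto
  obtain q where q: "H1_rep \<Omega> (v (t\<^sub>0 + s)) q (H (t\<^sub>0 + s))" using H[OF t] by auto
  show "null_gradient \<Omega> (\<lambda>x. T s (G (t\<^sub>0 + s)) x - G t\<^sub>0 x)" by (rule null[OF s p p0 tr(1)[OF t] tr(1)[OF t0]])
  show "null_gradient \<Omega> (\<lambda>x. T s (H (t\<^sub>0 + s)) x - H t\<^sub>0 x)" by (rule null[OF s q q0 tr(2)[OF t] tr(2)[OF t0]])
  show "E.Q s (T s (G (t\<^sub>0 + s))) Z = 0" if Z: "null_gradient \<Omega> Z" for Z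
   unfolding T_def by (rule E.pull_back_orthogonal[OF Vlip \<Omega>(1) cK sK zK s Db shift[OF s1] p u[OF t] Z])
  show "F (t\<^sub>0 + s) = E.Q s (T s (G (t\<^sub>0 + s))) (T s (H (t\<^sub>0 + s)))"
   unfolding T_def F_def \<CC>_def by (rule E.pull_back_energy[OF Vlip \<Omega>(1) cK sK zK s Db shift[OF s1] p q])
 qed simp
 then have d: "((\<lambda>s. F (t\<^sub>0 + s)) has_real_derivative (LBINT x. E.\<beta> x (G t\<^sub>0 x) (H t\<^sub>0 x))) (at (t\<^sub>0 - t\<^sub>0) within ?S)" by simp
 have d1: "((\<lambda>t. t - t\<^sub>0) has_real_derivative 1) (at t\<^sub>0 within {0..1})" by (auto intro!: derivative_eq_intros)
 from DERIV_image_chain[OF d d1]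
 have F': "(F has_real_derivative (LBINT x. E.\<beta> x (G t\<^sub>0 x) (H t\<^sub>0 x))) (at t\<^sub>0 within {0..1})" by (simp add: o_def)
 \<comment> \<open>The map is a bijection of \<Omega>, so on \<Omega> the inverse relative to
   \<Omega> agrees with the global one.\<close>
 have inv: "(U \<circ> inv_into \<Omega> (flow_map U t\<^sub>0)) y = V y" if y: "y \<in> \<Omega>" for y
 proof -
  have b: "inj_on (flow_map U t\<^sub>0) \<Omega>" "flow_map U t\<^sub>0 ` \<Omega> = \<Omega>" using bij[OF t0] by (auto simp: bij_betw_def)
  obtain x where x: "x \<in> \<Omega>" "y = flow_map U t\<^sub>0 x" using y b(2) by blast
  then show ?thesis using b(1) by (simp add: V_def \<Phi>[symmetric])
 qed
 have wgV: "is_weak_gradient \<Omega> (U \<circ> inv_into \<Omega> (flow_map U t\<^sub>0)) E" by (rule is_weak_gradient_lip_field[OF Vlip \<Omega>(1) inv])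
 have DVE: "AE x in lborel. x \<in> \<Omega> --> E x = DV x"
  unfolding DV_def by (rule weak_gradient_unique[OF wgV is_weak_gradient_weak_gradient[OF wgV] \<Omega>(1)])
 have "(\<integral>x. (\<CC> t\<^sub>0 x (Du x) ** (trace (DV x) *R mat 1 - transpose (DV x)) - \<CC> t\<^sub>0 x (Du x ** DV x)) \<bullet> Dv x \<partial>lebesgue_on \<Omega>)
   = (LBINT x. E.\<beta> x (G t\<^sub>0 x) (H t\<^sub>0 x))"
 proof (rule lebesgue_on_eq_lborel(1))
  show "\<Omega> \<in> sets borel" using \<Omega>(1) by simp
  show "(\<lambda>x. E.\<beta> x (G t\<^sub>0 x) (H t\<^sub>0 x)) Borel"
   by (rule E.\<beta>_measurable[OF H1_repD(8)[OF p0] H1_repD(8)[OF q0]])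
  show "E.\<beta> x (G t\<^sub>0 x) (H t\<^sub>0 x) = 0" if "x \<notin> \<Omega>" for x using H1_repD(4)[OF q0 that] by (simp add: E.\<beta>_def)
  show "AE x in lborel. x \<in> \<Omega> --> E.\<beta> x (G t\<^sub>0 x) (H t\<^sub>0 x)
    = (\<CC> t\<^sub>0 x (Du x) ** (trace (DV x) *R mat 1 - transpose (DV x)) - \<CC> t\<^sub>0 x (Du x ** DV x)) \<bullet> Dv x"
   using DVE H1_repD(6)[OF p0] H1_repD(6)[OF q0] by eventually_elim (auto simp: E.\<beta>_def E.C_def CC Du_def Dv_def)
 qed
 then show "(F has_real_derivative
       (\<integral>x. (\<CC> t\<^sub>0 x (Du x) ** (trace (DV x) *R mat 1 - transpose (DV x))
          - \<CC> t\<^sub>0 x (Du x ** DV x)) \<bullet> Dv x \<partial>lebesgue_on \<Omega>)) (at t\<^sub>0 within {0..1})"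
  using F' by simp
qed

theorem proposition6p9:
  shows "\<exists>\<delta> :: real \<Rightarrow> real \<Rightarrow> real \<Rightarrow> real.
    (\<forall>M\<^sub>0\<ge>1. \<forall>M\<^sub>1>1. \<forall>\<theta>\<^sub>0\<in>{0<..<pi/2}. 0 < \<delta> M\<^sub>0 M\<^sub>1 \<theta>\<^sub>0) \<and>
    (\<forall>(Ct :: real \<Rightarrow> real \<Rightarrow> real) r\<^sub>0 M\<^sub>0 M\<^sub>1 \<theta>\<^sub>0 \<alpha>\<^sub>0 \<gamma>\<^sub>0 \<eta>\<^sub>0 lam_i mu_i lam_e mu_e \<Omega> \<Sigma> D\<^sub>0 D\<^sub>1 \<F>\<^sub>0 \<F>\<^sub>1 N V\<^sub>0 V\<^sub>1 U f g
        (u :: real \<Rightarrow> real^3 \<Rightarrow> real^3) (v :: real \<Rightarrow> real^3 \<Rightarrow> real^3).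
      let \<Phi> = flow_map U;
          \<CC> = (\<lambda>t. inclusion_tensor lam_i mu_i lam_e mu_e (\<Phi> t ` D\<^sub>0));
          F = (\<lambda>t. energy_form \<Omega> (\<CC> t) (u t) (v t))
      in
      0 < r\<^sub>0 \<and> 1 \<le> M\<^sub>0 \<and> 1 < M\<^sub>1 \<and> 0 < \<theta>\<^sub>0 \<and> \<theta>\<^sub>0 < pi/2 \<and> 0 < Ct \<theta>\<^sub>0 M\<^sub>1 \<and>
      domain_setting \<Omega> \<Sigma> r\<^sub>0 M\<^sub>1 \<and>
      0 < \<alpha>\<^sub>0 \<and> 0 < \<gamma>\<^sub>0 \<and> 0 < \<eta>\<^sub>0 \<and>
      lame_admissible \<alpha>\<^sub>0 \<gamma>\<^sub>0 lam_i mu_i \<and> lame_admissible \<alpha>\<^sub>0 \<gamma>\<^sub>0 lam_e mu_e \<and>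
      (lam_i - lam_e)\<^sup>2 + (mu_i - mu_e)\<^sup>2 \<ge> \<eta>\<^sub>0 \<and>
      class_P \<Omega> r\<^sub>0 M\<^sub>0 \<theta>\<^sub>0 D\<^sub>0 \<F>\<^sub>0 \<and> class_P \<Omega> r\<^sub>0 M\<^sub>0 \<theta>\<^sub>0 D\<^sub>1 \<F>\<^sub>1 \<and>
      hausdorff_dist (frontier D\<^sub>0) (frontier D\<^sub>1) \<le> \<delta> M\<^sub>0 M\<^sub>1 \<theta>\<^sub>0 * r\<^sub>0 \<and>
      bij_betw V\<^sub>0 {..<N} (poly_vertices \<F>\<^sub>0) \<and> bij_betw V\<^sub>1 {..<N} (poly_vertices \<F>\<^sub>1) \<and>
      deformation_field \<Omega> r\<^sub>0 (Ct \<theta>\<^sub>0 M\<^sub>1) D\<^sub>0 D\<^sub>1 N V\<^sub>0 V\<^sub>1 U \<and>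
      f \<in> H_half_co \<Omega> \<Sigma> \<and> g \<in> H_half_co \<Omega> \<Sigma> \<and>
      (\<forall>t\<in>{0..1}. dirichlet_solution \<Omega> (\<CC> t) f (u t) \<and> dirichlet_solution \<Omega> (\<CC> t) g (v t))
      \<longrightarrow>
      (\<forall>t\<in>{0..1}. F t = DN_pairing \<Omega> (\<CC> t) f g) \<and>
      (\<forall>t\<^sub>0\<in>{0..1}.
        let Du = weak_gradient \<Omega> (u t\<^sub>0);
            Dv = weak_gradient \<Omega> (v t\<^sub>0);
            DV = weak_gradient \<Omega> (U \<circ> inv_into \<Omega> (\<Phi> t\<^sub>0))
        in (F has_real_derivative
             (\<integral>x. (\<CC> t\<^sub>0 x (Du x) ** (trace (DV x) *\<^sub>R mat 1 - transpose (DV x))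
                    - \<CC> t\<^sub>0 x (Du x ** DV x)) \<bullet> Dv x \<partial>lebesgue_on \<Omega>))
           (at t\<^sub>0 within {0..1})))"
proof (intro exI[of _ "\<lambda>_ _ _. 1"] conjI allI impI, goal_cases)
  case 1
  show ?case by simp
next
  case (2 Ct r\<^sub>0 M\<^sub>0 M\<^sub>1 \<theta>\<^sub>0 \<alpha>\<^sub>0 \<gamma>\<^sub>0 \<eta>\<^sub>0 lam_i mu_i lam_e mu_e \<Omega> \<Sigma> D\<^sub>0 D\<^sub>1 \<F>\<^sub>0 \<F>\<^sub>1 N V\<^sub>0 V\<^sub>1 U f g u v)
  show ?case
    unfolding Let_def
  proof (intro impI, elim conjE, goal_cases)
    case 1
    note r0 = \<open>0 < r\<^sub>0\<close> and dom = \<open>domain_setting \<Omega> \<Sigma> r\<^sub>0 M\<^sub>1\<close> and P = \<open>class_P \<Omega> r\<^sub>0 M\<^sub>0 \<theta>\<^sub>0 D\<^sub>0 \<F>\<^sub>0\<close>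
      and Ct = \<open>0 < Ct \<theta>\<^sub>0 M\<^sub>1\<close> and M0 = \<open>1 \<le> M\<^sub>0\<close>
      and def = \<open>deformation_field \<Omega> r\<^sub>0 (Ct \<theta>\<^sub>0 M\<^sub>1) D\<^sub>0 D\<^sub>1 N V\<^sub>0 V\<^sub>1 U\<close>
      and lame = \<open>lame_admissible \<alpha>\<^sub>0 \<gamma>\<^sub>0 lam_i mu_i\<close> \<open>lame_admissible \<alpha>\<^sub>0 \<gamma>\<^sub>0 lam_e mu_e\<close> \<open>0 < \<alpha>\<^sub>0\<close> \<open>0 < \<gamma>\<^sub>0\<close>
      and sol = \<open>\<forall>t\<in>{0..1}. dirichlet_solution \<Omega> (inclusion_tensor lam_i mu_i lam_e mu_e (flow_map U t ` D\<^sub>0)) f (u t) \<and>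
        dirichlet_solution \<Omega> (inclusion_tensor lam_i mu_i lam_e mu_e (flow_map U t ` D\<^sub>0)) g (v t)\<close>
    have \<Omega>: "open \<Omega>" "bounded \<Omega>" using dom by (auto simp: domain_setting_def)
    have D0: "D\<^sub>0 homeomorphic (cball 0 1 :: (real^3) set)" "D\<^sub>0 \<subseteq> \<Omega>" "setdist D\<^sub>0 (frontier \<Omega>) \<ge> r\<^sub>0"
      using P by (auto simp: class_P_def polyhedral_body_def)
    have cD: "compact D\<^sub>0" using homeomorphic_compactness[OF D0(1)] by simp
    have neD: "D\<^sub>0 \<noteq> {}" using homeomorphic_empty(1)[of "cball 0 1 :: (real^3) set"] D0(1) by auto
    let ?dH = "hausdorff_dist (frontier D\<^sub>0) (frontier D\<^sub>1)"
    have U: "U \<in> W1inf UNIV" "continuous_on UNIV U" "closure {x. U x \<noteq> 0} \<subseteq> {x. infdist x D\<^sub>0 \<le> r\<^sub>0 / 4}"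
      "Linf_norm UNIV U + ennreal r\<^sub>0 * Linf_norm UNIV (weak_gradient UNIV U) \<le> ennreal (Ct \<theta>\<^sub>0 M\<^sub>1 * ?dH)"
      "?dH \<le> r\<^sub>0 / (3 * Ct \<theta>\<^sub>0 M\<^sub>1)" "\<And>t. t \<in> {0..1} \<Longrightarrow> bij_betw (flow_map U t) \<Omega> \<Omega>"
      using def by (simp_all add: deformation_field_def Let_def)
    \<comment> \<open>The closed collar of width \<open>r\<^sub>0 / 4\<close> around the inclusion
      contains the support of U and serves as the compact set S.\<close>
    note S = collar_subset_domain[OF cD neD D0(2,3) r0]
    have z: "U x = 0" if "x \<notin> {x. infdist x D\<^sub>0 \<le> r\<^sub>0 / 4}" for x
      using that U(3) closure_subset[of "{x. U x \<noteq> 0}"] by blast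
    obtain A where A: "lip_field U A (1/3)" "\<forall>x. x \<notin> {x. infdist x D\<^sub>0 \<le> r\<^sub>0 / 4} \<longrightarrow> A x = 0"
      using lip_field_of_W1inf[OF U(1,2) S(1) z Linf_gradient_bound[OF U(4,5) Ct r0]] by auto
    have zA: "U x = 0 \<and> A x = 0" if "x \<notin> {x. infdist x D\<^sub>0 \<le> r\<^sub>0 / 4}" for x using that z A(2) by blast
    note main = shape_derivative[OF \<Omega> inner_cone_class_P[OF P \<Omega>(1) r0 M0] cD lame A(1) S zA U(6)
        sol[THEN bspec, THEN conjunct1] sol[THEN bspec, THEN conjunct2]]
    show ?case by (intro conjI ballI main)
  qed
qed

end
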